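(* Let $\mathcal G$ be a (not necessarily Hausdorff) étale groupoid with locally compact Hausdorff unit space $X=\mathcal G^{(0)}$, equipped with a Fell line bundle $\mathcal L$. If $\mathcal G$ is topologically free, the left regular representation $$\Lambda:C^*(\mathcal G,\mathcal L)\to C^*_{\mathrm{red}}(\mathcal G,\mathcal L)$$ factors through the respective gray ideals $\Gamma\trianglelefteq C^*(\mathcal G,\mathcal L)$ and $\Gamma_{\mathrm{red}}\trianglelefteq C^*_{\mathrm{red}}(\mathcal G,\mathcal L)$, leading up to an isomorphism $$C^*_{\mathrm{ess}}(\mathcal G,\mathcal L)=\frac{C^*(\mathcal G,\mathcal L)}{\Gamma}\ \simeq\ \frac{C^*_{\mathrm{red}}(\mathcal G,\mathcal L)}{\Gamma_{\mathrm{red}}}.$$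
   Context: An étale groupoid is a topological groupoid $\mathcal G$ (not necessarily Hausdorff) whose unit space $X$ is locally compact Hausdorff and whose range map $r:\mathcal G\to X$ (hence also the source map $s$) is a local homeomorphism. $\mathcal G(x)=\{\gamma:s(\gamma)=r(\gamma)=x\}$; $\mathcal G$ is topologically free if $\{x\in X:\mathcal G(x)=\{x\}\}$ is dense in $X$. An open bisection is an open $U\subseteq\mathcal G$ on which $r$ and $s$ are injective. A Fell line bundle over $\mathcal G$ is a topological space $\mathcal L=\bigsqcup_{\gamma}\mathcal L_\gamma$ of one-dimensional complex Banach spaces, restricting to a continuous Banach bundle on every open bisection, with a continuous, bilinear, associative, submultiplicative multiplication $\mathcal L_{\gamma_1}\times\mathcal L_{\gamma_2}\to\mathcal L_{\gamma_1\gamma_2}$ (for composable pairs) and a continuous conjugate-linear, involutive, antimultiplicative adjoint $\mathcal L_\gamma\to\mathcal L_{\gamma^{-1}}$ with $\|\xi^*\xi\|=\|\xi\|^2$ and $\xi^*\xi\ge0$; for $x\in X$, $\mathcal L_x\cong\mathbb C$ canonically. For an open bisection $U$, $\mathscr C_c(U,\mathcal L)$ is the set of sections obtained by extending by zero the continuous compactly supported sections over $U$; $\mathscr C_c(\mathcal G,\mathcal L)$ is their linear span, a $*$-algebra with $(f*g)(\gamma)=\sum_{\gamma_1\gamma_2=\gamma}f(\gamma_1)g(\gamma_2)$, $f^*(\gamma)=f(\gamma^{-1})^*$. $C^*(\mathcal G,\mathcal L)$ is its completion in the largest C*-norm; $C^*_{\mathrm{red}}(\mathcal G,\mathcal L)$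 its completion in $\|f\|_{\mathrm{red}}=\sup_{x\in X}\|\pi_x(f)\|$, where $\pi_x$ acts on the square-summable sections of $\mathcal L$ over $s^{-1}(x)$ by $(\pi_x(f)\xi)(\gamma)=\sum_{\gamma_1\gamma_2=\gamma}f(\gamma_1)\xi(\gamma_2)$. Both contain $C_0(X)$ as the closure of $C_c(X)$. $\Lambda$ is the $*$-homomorphism extending the identity of $\mathscr C_c(\mathcal G,\mathcal L)$. For $B$ either completion, $x\in X$ is free if the evaluation state of $C_0(X)$ at $x$ has a unique extension to a state $\psi_x$ of $B$; the gray ideal of $B$ is $\{b\in B:\psi_x(b^*b)=0\text{ for all free }x\}$, a closed two-sided ideal. $C^*_{\mathrm{ess}}(\mathcal G,\mathcal L)$ is by definition $C^*(\mathcal G,\mathcal L)/\Gamma$. *)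

theory Defs
  imports "HOL-Analysis.Analysis" "HOL-Algebra.FiniteProduct"
begin

section \<open>Etale groupoids\<close>

text \<open>The arrows are the points of \<open>arrow_top\<close> and the units are the arrows fixed by the source
  map, so that the unit space is a subspace of the arrow space. The values of the structure maps
  outside their natural domains are irrelevant.\<close>

record 'g groupoid =
  arrow_top :: "'g topology"
  src :: "'g \<Rightarrow> 'g"
  rng :: "'g \<Rightarrow> 'g"
  gcomp :: "'g \<Rightarrow> 'g \<Rightarrow> 'g"
  ginv :: "'g \<Rightarrow> 'g"

definition arrows :: "'g groupoid \<Rightarrow> 'g set" where
  "arrows G = topspace (arrow_top G)"

definition units :: "'g groupoid \<Rightarrow> 'g set" where
  "units G = {x \<in> arrows G. src G x = x}"

definition unit_top :: "'g groupoid \<Rightarrow> 'g topology" where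
  "unit_top G = subtopology (arrow_top G) (units G)"

definition composable :: "'g groupoid \<Rightarrow> ('g \<times> 'g) set" where
  "composable G = {(\<alpha>, \<beta>). \<alpha> \<in> arrows G \<and> \<beta> \<in> arrows G \<and> src G \<alpha> = rng G \<beta>}"

definition local_homeomorphism :: "'a topology \<Rightarrow> 'b topology \<Rightarrow> ('a \<Rightarrow> 'b) \<Rightarrow> bool" where
  "local_homeomorphism S T f \<longleftrightarrow>
     (\<forall>a \<in> topspace S. \<exists>U. openin S U \<and> a \<in> U \<and> openin T (f ` U) \<and>
        homeomorphic_map (subtopology S U) (subtopology T (f ` U)) f)"

locale etale_groupoid =
  fixes G :: "'g groupoid"
  assumes src_unit: "\<gamma> \<in> arrows G \<Longrightarrow> src G \<gamma> \<in> units G"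
    and rng_unit: "\<gamma> \<in> arrows G \<Longrightarrow> rng G \<gamma> \<in> units G"
    and rng_of_unit: "x \<in> units G \<Longrightarrow> rng G x = x"
    and comp_closed: "(\<alpha>, \<beta>) \<in> composable G \<Longrightarrow> gcomp G \<alpha> \<beta> \<in> arrows G"
    and src_comp: "(\<alpha>, \<beta>) \<in> composable G \<Longrightarrow> src G (gcomp G \<alpha> \<beta>) = src G \<beta>"
    and rng_comp: "(\<alpha>, \<beta>) \<in> composable G \<Longrightarrow> rng G (gcomp G \<alpha> \<beta>) = rng G \<alpha>"
    and comp_assoc: "\<lbrakk>(\<alpha>, \<beta>) \<in> composable G; (\<beta>, \<gamma>) \<in> composable G\<rbrakk> \<Longrightarrow>
          gcomp G (gcomp G \<alpha> \<beta>) \<gamma> = gcomp G \<alpha> (gcomp G \<beta> \<gamma>)"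
    and comp_src: "\<gamma> \<in> arrows G \<Longrightarrow> gcomp G \<gamma> (src G \<gamma>) = \<gamma>"
    and comp_rng: "\<gamma> \<in> arrows G \<Longrightarrow> gcomp G (rng G \<gamma>) \<gamma> = \<gamma>"
    and inv_closed: "\<gamma> \<in> arrows G \<Longrightarrow> ginv G \<gamma> \<in> arrows G"
    and src_inv: "\<gamma> \<in> arrows G \<Longrightarrow> src G (ginv G \<gamma>) = rng G \<gamma>"
    and rng_inv: "\<gamma> \<in> arrows G \<Longrightarrow> rng G (ginv G \<gamma>) = src G \<gamma>"
    and inv_comp: "\<gamma> \<in> arrows G \<Longrightarrow> gcomp G (ginv G \<gamma>) \<gamma> = src G \<gamma>"
    and comp_inv: "\<gamma> \<in> arrows G \<Longrightarrow> gcomp G \<gamma> (ginv G \<gamma>) = rng G \<gamma>"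
    and continuous_comp:
          "continuous_map
             (subtopology (prod_topology (arrow_top G) (arrow_top G)) (composable G))
             (arrow_top G) (\<lambda>(\<alpha>, \<beta>). gcomp G \<alpha> \<beta>)"
    and continuous_inv: "continuous_map (arrow_top G) (arrow_top G) (ginv G)"
    and locally_compact_units: "locally_compact_space (unit_top G)"
    and Hausdorff_units: "Hausdorff_space (unit_top G)"
    and etale: "local_homeomorphism (arrow_top G) (unit_top G) (rng G)"

definition isotropy :: "'g groupoid \<Rightarrow> 'g \<Rightarrow> 'g set" where
  "isotropy G x = {\<gamma> \<in> arrows G. src G \<gamma> = x \<and> rng G \<gamma> = x}"

definition topologically_free :: "'g groupoid \<Rightarrow> bool" where
  "topologically_free G \<longleftrightarrow>
     (unit_top G) closure_of {x \<in> units G. isotropy G x = {x}} = units G"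

definition open_bisection :: "'g groupoid \<Rightarrow> 'g set \<Rightarrow> bool" where
  "open_bisection G U \<longleftrightarrow>
     openin (arrow_top G) U \<and> inj_on (rng G) U \<and> inj_on (src G) U"


section \<open>Fell line bundles\<close>

text \<open>A bundle of vector spaces is given by its total space together with partially defined
  operations: \<open>badd\<close> is only meaningful on pairs in a common fibre, \<open>bmult\<close> on pairs over
  composable arrows.\<close>

record ('g, 'l) vector_bundle =
  total_top :: "'l topology"
  proj :: "'l \<Rightarrow> 'g"
  badd :: "'l \<Rightarrow> 'l \<Rightarrow> 'l"
  bzero :: "'g \<Rightarrow> 'l"
  bscale :: "complex \<Rightarrow> 'l \<Rightarrow> 'l"
  bnorm :: "'l \<Rightarrow> real"
  bmult :: "'l \<Rightarrow> 'l \<Rightarrow> 'l"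
  bstar :: "'l \<Rightarrow> 'l"

definition fibre :: "('g, 'l) vector_bundle \<Rightarrow> 'g \<Rightarrow> 'l set" where
  "fibre L \<gamma> = {\<xi> \<in> topspace (total_top L). proj L \<xi> = \<gamma>}"

text \<open>The additive group of a fibre, in the multiplicative notation of HOL-Algebra; thus
  \<^const>\<open>finprod\<close> over it is a finite sum in the fibre.\<close>

definition fibre_group :: "('g, 'l) vector_bundle \<Rightarrow> 'g \<Rightarrow> 'l monoid" where
  "fibre_group L \<gamma> = \<lparr>carrier = fibre L \<gamma>, mult = badd L, one = bzero L \<gamma>\<rparr>"

text \<open>Completeness of the norm is automatic in dimension one.\<close>

definition one_dimensional_banach_fibre :: "('g, 'l) vector_bundle \<Rightarrow> 'g \<Rightarrow> bool" where
  "one_dimensional_banach_fibre L \<gamma> \<longleftrightarrow>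
     comm_group (fibre_group L \<gamma>) \<and>
     (\<forall>c. \<forall>\<xi>\<in>fibre L \<gamma>. bscale L c \<xi> \<in> fibre L \<gamma>) \<and>
     (\<forall>\<xi>\<in>fibre L \<gamma>. bscale L 1 \<xi> = \<xi>) \<and>
     (\<forall>c d. \<forall>\<xi>\<in>fibre L \<gamma>. bscale L c (bscale L d \<xi>) = bscale L (c * d) \<xi>) \<and>
     (\<forall>c d. \<forall>\<xi>\<in>fibre L \<gamma>. bscale L (c + d) \<xi> = badd L (bscale L c \<xi>) (bscale L d \<xi>)) \<and>
     (\<forall>c. \<forall>\<xi>\<in>fibre L \<gamma>. \<forall>\<eta>\<in>fibre L \<gamma>.
        bscale L c (badd L \<xi> \<eta>) = badd L (bscale L c \<xi>) (bscale L c \<eta>)) \<and>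
     (\<exists>e\<in>fibre L \<gamma>. e \<noteq> bzero L \<gamma> \<and> (\<forall>\<xi>\<in>fibre L \<gamma>. \<exists>c. \<xi> = bscale L c e)) \<and>
     (\<forall>\<xi>\<in>fibre L \<gamma>. 0 \<le> bnorm L \<xi> \<and> (bnorm L \<xi> = 0 \<longleftrightarrow> \<xi> = bzero L \<gamma>)) \<and>
     (\<forall>c. \<forall>\<xi>\<in>fibre L \<gamma>. bnorm L (bscale L c \<xi>) = cmod c * bnorm L \<xi>) \<and>
     (\<forall>\<xi>\<in>fibre L \<gamma>. \<forall>\<eta>\<in>fibre L \<gamma>. bnorm L (badd L \<xi> \<eta>) \<le> bnorm L \<xi> + bnorm L \<eta>)"

text \<open>The axioms of Fell for the restriction of the bundle to \<open>U\<close>. The last one says that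
  \<open>\<xi>\<^sub>i \<rightarrow> 0\<^sub>\<gamma>\<close> whenever \<open>proj \<xi>\<^sub>i \<rightarrow> \<gamma>\<close> and \<open>\<parallel>\<xi>\<^sub>i\<parallel> \<rightarrow> 0\<close>.\<close>

definition continuous_banach_bundle_on ::
    "'g topology \<Rightarrow> ('g, 'l) vector_bundle \<Rightarrow> 'g set \<Rightarrow> bool" where
  "continuous_banach_bundle_on T L U \<longleftrightarrow>
     (let E = subtopology (total_top L) {\<xi>. proj L \<xi> \<in> U}; B = subtopology T U in
       continuous_map E B (proj L) \<and>
       open_map E B (proj L) \<and>
       continuous_map E euclideanreal (bnorm L) \<and>
       continuous_map (subtopology (prod_topology E E) {(\<xi>, \<eta>). proj L \<xi> = proj L \<eta>}) E
         (\<lambda>(\<xi>, \<eta>). badd L \<xi> \<eta>) \<and>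
       (\<forall>c. continuous_map E E (bscale L c)) \<and>
       (\<forall>\<gamma>\<in>topspace B. \<forall>W. openin E W \<and> bzero L \<gamma> \<in> W \<longrightarrow>
          (\<exists>V \<epsilon>. openin B V \<and> \<gamma> \<in> V \<and> \<epsilon> > 0 \<and>
             {\<xi> \<in> topspace E. proj L \<xi> \<in> V \<and> bnorm L \<xi> < \<epsilon>} \<subseteq> W)))"

definition bundle_composable :: "'g groupoid \<Rightarrow> ('g, 'l) vector_bundle \<Rightarrow> ('l \<times> 'l) set" where
  "bundle_composable G L =
     {(\<xi>, \<eta>). \<xi> \<in> topspace (total_top L) \<and> \<eta> \<in> topspace (total_top L) \<and>
        (proj L \<xi>, proj L \<eta>) \<in> composable G}"

text \<open>In \<open>star_positive\<close>, positivity of \<open>\<xi>\<^sup>*\<xi>\<close> is meant in the C*-algebra which is the fibre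
  over the source unit; its positive elements are those of the form \<open>\<eta>\<^sup>*\<eta>\<close> with \<open>\<eta>\<close> in that
  same fibre.\<close>

locale fell_line_bundle = etale_groupoid G
  for G :: "'g groupoid" +
  fixes L :: "('g, 'l) vector_bundle"
  assumes proj_arrow: "\<xi> \<in> topspace (total_top L) \<Longrightarrow> proj L \<xi> \<in> arrows G"
    and one_dimensional: "\<gamma> \<in> arrows G \<Longrightarrow> one_dimensional_banach_fibre L \<gamma>"
    and banach_bundle:
          "open_bisection G U \<Longrightarrow> continuous_banach_bundle_on (arrow_top G) L U"
    and mult_fibre:
          "\<lbrakk>(\<alpha>, \<beta>) \<in> composable G; \<xi> \<in> fibre L \<alpha>; \<eta> \<in> fibre L \<beta>\<rbrakk> \<Longrightarrow>
             bmult L \<xi> \<eta> \<in> fibre L (gcomp G \<alpha> \<beta>)"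
    and mult_add_left:
          "\<lbrakk>(\<alpha>, \<beta>) \<in> composable G; \<xi> \<in> fibre L \<alpha>; \<xi>' \<in> fibre L \<alpha>; \<eta> \<in> fibre L \<beta>\<rbrakk> \<Longrightarrow>
             bmult L (badd L \<xi> \<xi>') \<eta> = badd L (bmult L \<xi> \<eta>) (bmult L \<xi>' \<eta>)"
    and mult_add_right:
          "\<lbrakk>(\<alpha>, \<beta>) \<in> composable G; \<xi> \<in> fibre L \<alpha>; \<eta> \<in> fibre L \<beta>; \<eta>' \<in> fibre L \<beta>\<rbrakk> \<Longrightarrow>
             bmult L \<xi> (badd L \<eta> \<eta>') = badd L (bmult L \<xi> \<eta>) (bmult L \<xi> \<eta>')"
    and mult_scale_left:
          "(\<xi>, \<eta>) \<in> bundle_composable G L \<Longrightarrow>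
             bmult L (bscale L c \<xi>) \<eta> = bscale L c (bmult L \<xi> \<eta>)"
    and mult_scale_right:
          "(\<xi>, \<eta>) \<in> bundle_composable G L \<Longrightarrow>
             bmult L \<xi> (bscale L c \<eta>) = bscale L c (bmult L \<xi> \<eta>)"
    and mult_assoc:
          "\<lbrakk>(\<xi>, \<eta>) \<in> bundle_composable G L; (\<eta>, \<zeta>) \<in> bundle_composable G L\<rbrakk> \<Longrightarrow>
             bmult L (bmult L \<xi> \<eta>) \<zeta> = bmult L \<xi> (bmult L \<eta> \<zeta>)"
    and norm_mult:
          "(\<xi>, \<eta>) \<in> bundle_composable G L \<Longrightarrow> bnorm L (bmult L \<xi> \<eta>) \<le> bnorm L \<xi> * bnorm L \<eta>"
    and continuous_mult:
          "continuous_map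
             (subtopology (prod_topology (total_top L) (total_top L)) (bundle_composable G L))
             (total_top L) (\<lambda>(\<xi>, \<eta>). bmult L \<xi> \<eta>)"
    and star_fibre:
          "\<lbrakk>\<gamma> \<in> arrows G; \<xi> \<in> fibre L \<gamma>\<rbrakk> \<Longrightarrow> bstar L \<xi> \<in> fibre L (ginv G \<gamma>)"
    and star_add:
          "\<lbrakk>\<gamma> \<in> arrows G; \<xi> \<in> fibre L \<gamma>; \<eta> \<in> fibre L \<gamma>\<rbrakk> \<Longrightarrow>
             bstar L (badd L \<xi> \<eta>) = badd L (bstar L \<xi>) (bstar L \<eta>)"
    and star_scale:
          "\<xi> \<in> topspace (total_top L) \<Longrightarrow> bstar L (bscale L c \<xi>) = bscale L (cnj c) (bstar L \<xi>)"
    and star_star: "\<xi> \<in> topspace (total_top L) \<Longrightarrow> bstar L (bstar L \<xi>) = \<xi>"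
    and star_mult:
          "(\<xi>, \<eta>) \<in> bundle_composable G L \<Longrightarrow>
             bstar L (bmult L \<xi> \<eta>) = bmult L (bstar L \<eta>) (bstar L \<xi>)"
    and continuous_star: "continuous_map (total_top L) (total_top L) (bstar L)"
    and norm_star_mult:
          "\<xi> \<in> topspace (total_top L) \<Longrightarrow> bnorm L (bmult L (bstar L \<xi>) \<xi>) = (bnorm L \<xi>)\<^sup>2"
    and star_positive:
          "\<xi> \<in> topspace (total_top L) \<Longrightarrow>
             \<exists>\<eta>\<in>fibre L (src G (proj L \<xi>)). bmult L (bstar L \<xi>) \<xi> = bmult L (bstar L \<eta>) \<eta>"

text \<open>The canonical identification of the fibre over a unit \<open>x\<close> with the complex numbers:
  \<open>fibre_one L x\<close> is the unit of this one-dimensional C*-algebra.\<close>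

definition fibre_one :: "('g, 'l) vector_bundle \<Rightarrow> 'g \<Rightarrow> 'l" where
  "fibre_one L x =
     (THE e. e \<in> fibre L x \<and> (\<forall>\<xi>\<in>fibre L x. bmult L e \<xi> = \<xi> \<and> bmult L \<xi> e = \<xi>))"

definition fibre_value :: "('g, 'l) vector_bundle \<Rightarrow> 'g \<Rightarrow> 'l \<Rightarrow> complex" where
  "fibre_value L x \<xi> = (THE c. \<xi> = bscale L c (fibre_one L x))"


section \<open>Normed *-algebras, completions and quotients\<close>

record 'a star_algebra = "'a partial_object" +
  sa_zero :: 'a
  sa_add :: "'a \<Rightarrow> 'a \<Rightarrow> 'a"
  sa_scale :: "complex \<Rightarrow> 'a \<Rightarrow> 'a"
  sa_mult :: "'a \<Rightarrow> 'a \<Rightarrow> 'a"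
  sa_star :: "'a \<Rightarrow> 'a"

record 'a normed_star_algebra = "'a star_algebra" +
  sa_norm :: "'a \<Rightarrow> real"

definition sa_diff :: "('a, 'm) star_algebra_scheme \<Rightarrow> 'a \<Rightarrow> 'a \<Rightarrow> 'a" where
  "sa_diff A a b = sa_add A a (sa_scale A (-1) b)"

definition cstar_norm :: "('a, 'm) star_algebra_scheme \<Rightarrow> ('a \<Rightarrow> real) \<Rightarrow> bool" where
  "cstar_norm A N \<longleftrightarrow>
     (\<forall>a\<in>carrier A. 0 \<le> N a \<and> (N a = 0 \<longleftrightarrow> a = sa_zero A)) \<and>
     (\<forall>a\<in>carrier A. \<forall>b\<in>carrier A. N (sa_add A a b) \<le> N a + N b) \<and>
     (\<forall>c. \<forall>a\<in>carrier A. N (sa_scale A c a) = cmod c * N a) \<and>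
     (\<forall>a\<in>carrier A. \<forall>b\<in>carrier A. N (sa_mult A a b) \<le> N a * N b) \<and>
     (\<forall>a\<in>carrier A. N (sa_mult A (sa_star A a) a) = (N a)\<^sup>2)"

definition star_hom ::
    "('a, 'm) star_algebra_scheme \<Rightarrow> ('b, 'n) star_algebra_scheme \<Rightarrow> ('a \<Rightarrow> 'b) \<Rightarrow> bool" where
  "star_hom A B h \<longleftrightarrow>
     h \<in> carrier A \<rightarrow> carrier B \<and>
     (\<forall>a\<in>carrier A. \<forall>b\<in>carrier A. h (sa_add A a b) = sa_add B (h a) (h b)) \<and>
     (\<forall>c. \<forall>a\<in>carrier A. h (sa_scale A c a) = sa_scale B c (h a)) \<and>
     (\<forall>a\<in>carrier A. \<forall>b\<in>carrier A. h (sa_mult A a b) = sa_mult B (h a) (h b)) \<and>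
     (\<forall>a\<in>carrier A. h (sa_star A a) = sa_star B (h a))"

text \<open>The usual notion of isomorphism of C*-algebras; isometry is then automatic.\<close>

definition star_iso ::
    "('a, 'm) star_algebra_scheme \<Rightarrow> ('b, 'n) star_algebra_scheme \<Rightarrow> ('a \<Rightarrow> 'b) \<Rightarrow> bool" where
  "star_iso A B h \<longleftrightarrow> star_hom A B h \<and> bij_betw h (carrier A) (carrier B)"

definition closed_two_sided_ideal :: "'a normed_star_algebra \<Rightarrow> 'a set \<Rightarrow> bool" where
  "closed_two_sided_ideal A I \<longleftrightarrow>
     I \<subseteq> carrier A \<and> sa_zero A \<in> I \<and>
     (\<forall>a\<in>I. \<forall>b\<in>I. sa_add A a b \<in> I) \<and>
     (\<forall>c. \<forall>a\<in>I. sa_scale A c a \<in> I) \<and>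
     (\<forall>a\<in>I. \<forall>b\<in>carrier A. sa_mult A a b \<in> I \<and> sa_mult A b a \<in> I) \<and>
     (\<forall>u. \<forall>b\<in>carrier A. (\<forall>n. u n \<in> I) \<and> (\<lambda>n. sa_norm A (sa_diff A (u n) b)) \<longlonglongrightarrow> 0 \<longrightarrow> b \<in> I)"

definition sa_coset :: "('a, 'm) star_algebra_scheme \<Rightarrow> 'a set \<Rightarrow> 'a \<Rightarrow> 'a set" where
  "sa_coset A I a = {sa_add A a b |b. b \<in> I}"

definition rep :: "'a set \<Rightarrow> 'a" where
  "rep S = (SOME a. a \<in> S)"

text \<open>The quotient by a two-sided *-ideal, with the quotient (semi)norm; the operations are
  those of arbitrary representatives.\<close>

definition quotient_algebra ::
    "'a normed_star_algebra \<Rightarrow> 'a set \<Rightarrow> 'a set normed_star_algebra" where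
  "quotient_algebra A I =
     \<lparr>carrier = sa_coset A I ` carrier A,
      sa_zero = sa_coset A I (sa_zero A),
      sa_add = (\<lambda>S T. sa_coset A I (sa_add A (rep S) (rep T))),
      sa_scale = (\<lambda>c S. sa_coset A I (sa_scale A c (rep S))),
      sa_mult = (\<lambda>S T. sa_coset A I (sa_mult A (rep S) (rep T))),
      sa_star = (\<lambda>S. sa_coset A I (sa_star A (rep S))),
      sa_norm = (\<lambda>S. INF a\<in>S. sa_norm A a)\<rparr>"

text \<open>The completion of a *-algebra in a norm \<open>N\<close> is the algebra of \<open>N\<close>-Cauchy sequences, with
  the seminorm \<open>lim N (u n)\<close>, modulo the \<open>N\<close>-null sequences.\<close>

definition cauchy_algebra ::
    "'a star_algebra \<Rightarrow> ('a \<Rightarrow> real) \<Rightarrow> (nat \<Rightarrow> 'a) normed_star_algebra" where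
  "cauchy_algebra A N =
     \<lparr>carrier = {u. (\<forall>n. u n \<in> carrier A) \<and>
        (\<forall>\<epsilon>>0. \<exists>M. \<forall>m\<ge>M. \<forall>n\<ge>M. N (sa_diff A (u m) (u n)) < \<epsilon>)},
      sa_zero = (\<lambda>n. sa_zero A),
      sa_add = (\<lambda>u v n. sa_add A (u n) (v n)),
      sa_scale = (\<lambda>c u n. sa_scale A c (u n)),
      sa_mult = (\<lambda>u v n. sa_mult A (u n) (v n)),
      sa_star = (\<lambda>u n. sa_star A (u n)),
      sa_norm = (\<lambda>u. lim (\<lambda>n. N (u n)))\<rparr>"

definition null_sequences :: "'a star_algebra \<Rightarrow> ('a \<Rightarrow> real) \<Rightarrow> (nat \<Rightarrow> 'a) set" where
  "null_sequences A N = {u. (\<forall>n. u n \<in> carrier A) \<and> (\<lambda>n. N (u n)) \<longlonglongrightarrow> 0}"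

definition completion ::
    "'a star_algebra \<Rightarrow> ('a \<Rightarrow> real) \<Rightarrow> (nat \<Rightarrow> 'a) set normed_star_algebra" where
  "completion A N = quotient_algebra (cauchy_algebra A N) (null_sequences A N)"

definition completion_class ::
    "'a star_algebra \<Rightarrow> ('a \<Rightarrow> real) \<Rightarrow> (nat \<Rightarrow> 'a) \<Rightarrow> (nat \<Rightarrow> 'a) set" where
  "completion_class A N u = sa_coset (cauchy_algebra A N) (null_sequences A N) u"

definition completion_embed ::
    "'a star_algebra \<Rightarrow> ('a \<Rightarrow> real) \<Rightarrow> 'a \<Rightarrow> (nat \<Rightarrow> 'a) set" where
  "completion_embed A N a = completion_class A N (\<lambda>n. a)"

text \<open>States are made extensional so that two states are equal iff they agree on the algebra.\<close>

definition state :: "'a normed_star_algebra \<Rightarrow> ('a \<Rightarrow> complex) \<Rightarrow> bool" where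
  "state B \<psi> \<longleftrightarrow>
     \<psi> \<in> extensional (carrier B) \<and>
     (\<forall>a\<in>carrier B. \<forall>b\<in>carrier B. \<psi> (sa_add B a b) = \<psi> a + \<psi> b) \<and>
     (\<forall>c. \<forall>a\<in>carrier B. \<psi> (sa_scale B c a) = c * \<psi> a) \<and>
     (\<forall>b\<in>carrier B. \<psi> (sa_mult B (sa_star B b) b) \<in> \<real>\<^sub>\<ge>\<^sub>0) \<and>
     bdd_above {cmod (\<psi> b) |b. b \<in> carrier B \<and> sa_norm B b \<le> 1} \<and>
     Sup {cmod (\<psi> b) |b. b \<in> carrier B \<and> sa_norm B b \<le> 1} = 1"


section \<open>The *-algebra of compactly supported sections and its norms\<close>

text \<open>Sections are defined on all arrows and extensional there. As an open bisection is
  Hausdorff, the support of a section over \<open>U\<close> is compact iff the section vanishes outside some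
  compact subset of \<open>U\<close>. No continuity is required outside \<open>U\<close>.\<close>

definition Cc_on :: "'g groupoid \<Rightarrow> ('g, 'l) vector_bundle \<Rightarrow> 'g set \<Rightarrow> ('g \<Rightarrow> 'l) set" where
  "Cc_on G L U =
     {f. f \<in> extensional (arrows G) \<and> (\<forall>\<gamma>\<in>arrows G. f \<gamma> \<in> fibre L \<gamma>) \<and>
        continuous_map (subtopology (arrow_top G) U) (total_top L) f \<and>
        (\<exists>K. compactin (arrow_top G) K \<and> K \<subseteq> U \<and>
           (\<forall>\<gamma>\<in>arrows G - K. f \<gamma> = bzero L \<gamma>))}"

text \<open>The linear span of all \<open>Cc_on G L U\<close>.\<close>

inductive_set Cc :: "'g groupoid \<Rightarrow> ('g, 'l) vector_bundle \<Rightarrow> ('g \<Rightarrow> 'l) set"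
  for G :: "'g groupoid" and L :: "('g, 'l) vector_bundle" where
  base: "\<lbrakk>open_bisection G U; f \<in> Cc_on G L U\<rbrakk> \<Longrightarrow> f \<in> Cc G L"
| zero: "(\<lambda>\<gamma>\<in>arrows G. bzero L \<gamma>) \<in> Cc G L"
| add: "\<lbrakk>f \<in> Cc G L; g \<in> Cc G L\<rbrakk> \<Longrightarrow> (\<lambda>\<gamma>\<in>arrows G. badd L (f \<gamma>) (g \<gamma>)) \<in> Cc G L"
| scale: "f \<in> Cc G L \<Longrightarrow> (\<lambda>\<gamma>\<in>arrows G. bscale L c (f \<gamma>)) \<in> Cc G L"

text \<open>The value at \<open>\<gamma>\<close> of the convolution product. For the arguments used below only finitely many
  factorizations of \<open>\<gamma>\<close> contribute a nonzero term.\<close>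

definition convolution ::
    "'g groupoid \<Rightarrow> ('g, 'l) vector_bundle \<Rightarrow> ('g \<Rightarrow> 'l) \<Rightarrow> ('g \<Rightarrow> 'l) \<Rightarrow> 'g \<Rightarrow> 'l" where
  "convolution G L f g \<gamma> =
     finprod (fibre_group L \<gamma>) (\<lambda>(\<alpha>, \<beta>). bmult L (f \<alpha>) (g \<beta>))
       {(\<alpha>, \<beta>). (\<alpha>, \<beta>) \<in> composable G \<and> gcomp G \<alpha> \<beta> = \<gamma> \<and> bmult L (f \<alpha>) (g \<beta>) \<noteq> bzero L \<gamma>}"

definition section_algebra :: "'g groupoid \<Rightarrow> ('g, 'l) vector_bundle \<Rightarrow> ('g \<Rightarrow> 'l) star_algebra" where
  "section_algebra G L =
     \<lparr>carrier = Cc G L,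
      sa_zero = (\<lambda>\<gamma>\<in>arrows G. bzero L \<gamma>),
      sa_add = (\<lambda>f g. \<lambda>\<gamma>\<in>arrows G. badd L (f \<gamma>) (g \<gamma>)),
      sa_scale = (\<lambda>c f. \<lambda>\<gamma>\<in>arrows G. bscale L c (f \<gamma>)),
      sa_mult = (\<lambda>f g. \<lambda>\<gamma>\<in>arrows G. convolution G L f g \<gamma>),
      sa_star = (\<lambda>f. \<lambda>\<gamma>\<in>arrows G. bstar L (f (ginv G \<gamma>)))\<rparr>"

text \<open>The largest C*-norm, as the pointwise supremum of all C*-norms.\<close>

definition full_norm :: "'g groupoid \<Rightarrow> ('g, 'l) vector_bundle \<Rightarrow> ('g \<Rightarrow> 'l) \<Rightarrow> real" where
  "full_norm G L f = Sup {N f |N. cstar_norm (section_algebra G L) N}"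

definition source_fibre :: "'g groupoid \<Rightarrow> 'g \<Rightarrow> 'g set" where
  "source_fibre G x = {\<gamma> \<in> arrows G. src G \<gamma> = x}"

definition l2_sections :: "'g groupoid \<Rightarrow> ('g, 'l) vector_bundle \<Rightarrow> 'g \<Rightarrow> ('g \<Rightarrow> 'l) set" where
  "l2_sections G L x =
     {\<xi>. \<xi> \<in> extensional (source_fibre G x) \<and> (\<forall>\<gamma>\<in>source_fibre G x. \<xi> \<gamma> \<in> fibre L \<gamma>) \<and>
        (\<lambda>\<gamma>. (bnorm L (\<xi> \<gamma>))\<^sup>2) summable_on source_fibre G x}"

definition l2_norm :: "'g groupoid \<Rightarrow> ('g, 'l) vector_bundle \<Rightarrow> 'g \<Rightarrow> ('g \<Rightarrow> 'l) \<Rightarrow> real" where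
  "l2_norm G L x \<xi> = sqrt (\<Sum>\<^sub>\<infinity>\<gamma>\<in>source_fibre G x. (bnorm L (\<xi> \<gamma>))\<^sup>2)"

definition regular_rep ::
    "'g groupoid \<Rightarrow> ('g, 'l) vector_bundle \<Rightarrow> 'g \<Rightarrow> ('g \<Rightarrow> 'l) \<Rightarrow> ('g \<Rightarrow> 'l) \<Rightarrow> ('g \<Rightarrow> 'l)" where
  "regular_rep G L x f \<xi> = (\<lambda>\<gamma>\<in>source_fibre G x. convolution G L f \<xi> \<gamma>)"

definition regular_rep_norm ::
    "'g groupoid \<Rightarrow> ('g, 'l) vector_bundle \<Rightarrow> 'g \<Rightarrow> ('g \<Rightarrow> 'l) \<Rightarrow> real" where
  "regular_rep_norm G L x f =
     Sup {l2_norm G L x (regular_rep G L x f \<xi>) |\<xi>. \<xi> \<in> l2_sections G L x \<and> l2_norm G L x \<xi> \<le> 1}"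

text \<open>Inserting \<open>0\<close> only matters for the empty groupoid, where the supremum is over the empty
  set.\<close>

definition red_norm :: "'g groupoid \<Rightarrow> ('g, 'l) vector_bundle \<Rightarrow> ('g \<Rightarrow> 'l) \<Rightarrow> real" where
  "red_norm G L f = Sup (insert 0 ((\<lambda>x. regular_rep_norm G L x f) ` units G))"

definition groupoid_cstar ::
    "'g groupoid \<Rightarrow> ('g, 'l) vector_bundle \<Rightarrow> (nat \<Rightarrow> 'g \<Rightarrow> 'l) set normed_star_algebra" where
  "groupoid_cstar G L = completion (section_algebra G L) (full_norm G L)"

definition groupoid_cstar_red ::
    "'g groupoid \<Rightarrow> ('g, 'l) vector_bundle \<Rightarrow> (nat \<Rightarrow> 'g \<Rightarrow> 'l) set normed_star_algebra" where
  "groupoid_cstar_red G L = completion (section_algebra G L) (red_norm G L)"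

text \<open>The extension by continuity of the identity of \<open>Cc G L\<close>: as \<open>red_norm \<le> full_norm\<close>, a Cauchy
  sequence for the full norm is one for the reduced norm.\<close>

definition left_regular ::
    "'g groupoid \<Rightarrow> ('g, 'l) vector_bundle \<Rightarrow> (nat \<Rightarrow> 'g \<Rightarrow> 'l) set \<Rightarrow> (nat \<Rightarrow> 'g \<Rightarrow> 'l) set" where
  "left_regular G L b = completion_class (section_algebra G L) (red_norm G L) (rep b)"


section \<open>Free points and gray ideals\<close>

text \<open>Here and below \<open>N\<close> is either \<open>full_norm G L\<close> or \<open>red_norm G L\<close>. The space \<open>units G\<close> is itself an
  open bisection and \<open>Cc_on G L (units G)\<close> is \<open>C\<^sub>c(X)\<close>, by the identification of each fibre over a
  unit with the complex numbers. The classes of Cauchy sequences in it form the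
  closure \<open>C\<^sub>0(X)\<close> of \<open>C\<^sub>c(X)\<close>, on which evaluation at \<open>x\<close> is computed as a limit.\<close>

definition extends_evaluation ::
    "'g groupoid \<Rightarrow> ('g, 'l) vector_bundle \<Rightarrow> (('g \<Rightarrow> 'l) \<Rightarrow> real) \<Rightarrow> 'g \<Rightarrow>
      ((nat \<Rightarrow> 'g \<Rightarrow> 'l) set \<Rightarrow> complex) \<Rightarrow> bool" where
  "extends_evaluation G L N x \<psi> \<longleftrightarrow>
     (\<forall>u\<in>carrier (cauchy_algebra (section_algebra G L) N).
        (\<forall>n. u n \<in> Cc_on G L (units G)) \<longrightarrow>
        (\<lambda>n. fibre_value L x (u n x)) \<longlonglongrightarrow> \<psi> (completion_class (section_algebra G L) N u))"

definition evaluation_extension ::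
    "'g groupoid \<Rightarrow> ('g, 'l) vector_bundle \<Rightarrow> (('g \<Rightarrow> 'l) \<Rightarrow> real) \<Rightarrow> 'g \<Rightarrow>
      ((nat \<Rightarrow> 'g \<Rightarrow> 'l) set \<Rightarrow> complex) \<Rightarrow> bool" where
  "evaluation_extension G L N x \<psi> \<longleftrightarrow>
     state (completion (section_algebra G L) N) \<psi> \<and> extends_evaluation G L N x \<psi>"

definition free_point ::
    "'g groupoid \<Rightarrow> ('g, 'l) vector_bundle \<Rightarrow> (('g \<Rightarrow> 'l) \<Rightarrow> real) \<Rightarrow> 'g \<Rightarrow> bool" where
  "free_point G L N x \<longleftrightarrow> x \<in> units G \<and> (\<exists>!\<psi>. evaluation_extension G L N x \<psi>)"

definition free_state ::
    "'g groupoid \<Rightarrow> ('g, 'l) vector_bundle \<Rightarrow> (('g \<Rightarrow> 'l) \<Rightarrow> real) \<Rightarrow> 'g \<Rightarrow>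
      (nat \<Rightarrow> 'g \<Rightarrow> 'l) set \<Rightarrow> complex" where
  "free_state G L N x = (THE \<psi>. evaluation_extension G L N x \<psi>)"

definition gray_ideal ::
    "'g groupoid \<Rightarrow> ('g, 'l) vector_bundle \<Rightarrow> (('g \<Rightarrow> 'l) \<Rightarrow> real) \<Rightarrow> (nat \<Rightarrow> 'g \<Rightarrow> 'l) set set" where
  "gray_ideal G L N =
     (let B = completion (section_algebra G L) N in
       {b \<in> carrier B. \<forall>x. free_point G L N x \<longrightarrow>
          free_state G L N x (sa_mult B (sa_star B b) b) = 0})"

definition full_gray_ideal ::
    "'g groupoid \<Rightarrow> ('g, 'l) vector_bundle \<Rightarrow> (nat \<Rightarrow> 'g \<Rightarrow> 'l) set set" where
  "full_gray_ideal G L = gray_ideal G L (full_norm G L)"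

definition red_gray_ideal ::
    "'g groupoid \<Rightarrow> ('g, 'l) vector_bundle \<Rightarrow> (nat \<Rightarrow> 'g \<Rightarrow> 'l) set set" where
  "red_gray_ideal G L = gray_ideal G L (red_norm G L)"

definition groupoid_cstar_ess ::
    "'g groupoid \<Rightarrow> ('g, 'l) vector_bundle \<Rightarrow> (nat \<Rightarrow> 'g \<Rightarrow> 'l) set set normed_star_algebra" where
  "groupoid_cstar_ess G L = quotient_algebra (groupoid_cstar G L) (full_gray_ideal G L)"

end

theory Submission
  imports Defs
begin

text \<open>
  Call the isotropy at a unit \<open>x\<close> invisible if every section in \<open>Cc G L\<close> vanishes on the isotropy
  group at \<open>x\<close>, except possibly at \<open>x\<close> itself. The theorem holds because the free points of both
  completions are exactly the units with invisible isotropy, and the states \<open>\<psi>\<^sub>x\<close> are given on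
  sections by the same formula, \<open>\<psi>\<^sub>x(f) = f(x)\<close>. Since \<open>(f\<^sup>*f)(x)\<close> is the sum of \<open>\<parallel>f(\<gamma>)\<parallel>\<^sup>2\<close> over
  the arrows \<open>\<gamma>\<close> with source \<open>x\<close>, the class of a Cauchy sequence \<open>u\<close> belongs to the gray ideal, in
  either completion, iff these sums tend to \<open>0\<close> along \<open>u\<close> for every such \<open>x\<close> (\<open>gray_iff\<close>). Thus
  \<open>\<Gamma>\<close> is the preimage of \<open>\<Gamma>\<^sub>r\<^sub>e\<^sub>d\<close> under the regular representation \<open>\<Lambda>\<close>, and as \<open>\<Lambda>\<close> is onto, the
  quotients are isomorphic (\<open>quotient_isomorphism\<close>).

  Uniqueness of the extension at a unit with invisible isotropy (\<open>free_unique\<close>): a state extending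
  the evaluation at \<open>x\<close> cannot distinguish \<open>f\<close> from \<open>\<phi> f \<phi>\<close>, where \<open>\<phi>\<close> is a bump function with
  \<open>\<phi>(x) = 1\<close>. If the support of \<open>\<phi>\<close> is small, then \<open>\<phi> f \<phi>\<close> is either a function on the unit
  space or of small norm (\<open>small_return\<close>). Conversely, an arrow \<open>\<gamma>\<close> in the isotropy group at which some
  section does not vanish gives rise to different vector states of the regular representation that
  all extend the evaluation at \<open>x\<close> (\<open>twist_functional\<close>).

  The gray ideal is a left ideal since the seminorms in \<open>gray_iff\<close> come from representations. It is a
  right ideal since right multiplication by a section over a bisection moves the seminorm at the
  source of an arrow to the one at its range, and invisibility of the isotropy passes along arrows on
  which some section does not vanish (\<open>invisible_isotropy_transport\<close>). It is closed under the adjoint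
  since it contains \<open>b b\<^sup>*\<close> together with \<open>b\<close> (\<open>gray_star\<close>).

  That \<open>\<Lambda>\<close> is onto is an instance of the fact that homomorphisms of C*-algebras have closed range. It
  is proved here for two C*-norms on one *-algebra (\<open>cauchy_lift\<close>): for selfadjoint \<open>h\<close> the element
  \<open>(1 + \<i>h/n)\<^sup>n - 1\<close> is, for large \<open>n\<close>, nearly a unitary minus one, hence of norm at most \<open>3\<close> however
  large the norm of \<open>h\<close> is; but it is close to \<open>\<i>h\<close> in the smaller norm if \<open>h\<close> is small there.

  The algebra is done in coordinates: after the choice of a unit vector in each fibre, sections become
  complex functions and their product a convolution twisted by a cocycle of modulus one. The choice is
  not continuous, but topology only enters through the closure of \<open>Cc G L\<close> under the operations, the
  existence of bump functions, and the continuity of the unit section over the unit space.\<close>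

section \<open>Star algebras and their quotients\<close>

locale star_alg =
  fixes A :: "('a, 'm) star_algebra_scheme" (structure)
  assumes zero_closed [simp, intro]: "sa_zero A \<in> carrier A"
    and add_closed [simp, intro]: "\<lbrakk>a \<in> carrier A; b \<in> carrier A\<rbrakk> \<Longrightarrow> sa_add A a b \<in> carrier A"
    and scale_closed [simp, intro]: "a \<in> carrier A \<Longrightarrow> sa_scale A s a \<in> carrier A"
    and mult_closed [simp, intro]: "\<lbrakk>a \<in> carrier A; b \<in> carrier A\<rbrakk> \<Longrightarrow> sa_mult A a b \<in> carrier A"
    and star_closed [simp, intro]: "a \<in> carrier A \<Longrightarrow> sa_star A a \<in> carrier A"
    and add_commute: "\<lbrakk>a \<in> carrier A; b \<in> carrier A\<rbrakk> \<Longrightarrow> sa_add A a b = sa_add A b a"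
    and add_assoc: "\<lbrakk>a \<in> carrier A; b \<in> carrier A; c \<in> carrier A\<rbrakk> \<Longrightarrow>
          sa_add A (sa_add A a b) c = sa_add A a (sa_add A b c)"
    and add_zero: "a \<in> carrier A \<Longrightarrow> sa_add A a (sa_zero A) = a"
    and scale_one: "a \<in> carrier A \<Longrightarrow> sa_scale A 1 a = a"
    and scale_0: "a \<in> carrier A \<Longrightarrow> sa_scale A 0 a = sa_zero A"
    and scale_scale: "a \<in> carrier A \<Longrightarrow> sa_scale A s (sa_scale A t a) = sa_scale A (s * t) a"
    and scale_add_left: "a \<in> carrier A \<Longrightarrow>
          sa_scale A (s + t) a = sa_add A (sa_scale A s a) (sa_scale A t a)"
    and scale_add_right: "\<lbrakk>a \<in> carrier A; b \<in> carrier A\<rbrakk> \<Longrightarrow>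
          sa_scale A s (sa_add A a b) = sa_add A (sa_scale A s a) (sa_scale A s b)"
    and mult_assoc: "\<lbrakk>a \<in> carrier A; b \<in> carrier A; c \<in> carrier A\<rbrakk> \<Longrightarrow>
          sa_mult A (sa_mult A a b) c = sa_mult A a (sa_mult A b c)"
    and distrib_left: "\<lbrakk>a \<in> carrier A; b \<in> carrier A; c \<in> carrier A\<rbrakk> \<Longrightarrow>
          sa_mult A a (sa_add A b c) = sa_add A (sa_mult A a b) (sa_mult A a c)"
    and distrib_right: "\<lbrakk>a \<in> carrier A; b \<in> carrier A; c \<in> carrier A\<rbrakk> \<Longrightarrow>
          sa_mult A (sa_add A a b) c = sa_add A (sa_mult A a c) (sa_mult A b c)"
    and mult_scale_left: "\<lbrakk>a \<in> carrier A; b \<in> carrier A\<rbrakk> \<Longrightarrow>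
          sa_mult A (sa_scale A s a) b = sa_scale A s (sa_mult A a b)"
    and mult_scale_right: "\<lbrakk>a \<in> carrier A; b \<in> carrier A\<rbrakk> \<Longrightarrow>
          sa_mult A a (sa_scale A s b) = sa_scale A s (sa_mult A a b)"
    and star_add: "\<lbrakk>a \<in> carrier A; b \<in> carrier A\<rbrakk> \<Longrightarrow>
          sa_star A (sa_add A a b) = sa_add A (sa_star A a) (sa_star A b)"
    and star_scale: "a \<in> carrier A \<Longrightarrow> sa_star A (sa_scale A s a) = sa_scale A (cnj s) (sa_star A a)"
    and star_mult: "\<lbrakk>a \<in> carrier A; b \<in> carrier A\<rbrakk> \<Longrightarrow>
          sa_star A (sa_mult A a b) = sa_mult A (sa_star A b) (sa_star A a)"
    and star_star: "a \<in> carrier A \<Longrightarrow> sa_star A (sa_star A a) = a"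
begin

abbreviation plus_A (infixl "\<boxplus>" 65) where "a \<boxplus> b \<equiv> sa_add A a b"
abbreviation diff_A (infixl "\<boxminus>" 65) where "a \<boxminus> b \<equiv> sa_diff A a b"
abbreviation mult_A (infixl "\<boxtimes>" 70) where "a \<boxtimes> b \<equiv> sa_mult A a b"
abbreviation scale_A (infixr "\<odot>" 75) where "c \<odot> a \<equiv> sa_scale A c a"
abbreviation zero_A ("\<zero>\<zero>") where "\<zero>\<zero> \<equiv> sa_zero A"
abbreviation star_A ("_\<^sup>\<star>" [200] 200) where "a\<^sup>\<star> \<equiv> sa_star A a"

lemma add_left_commute:
  "\<lbrakk>a \<in> carrier A; b \<in> carrier A; c \<in> carrier A\<rbrakk> \<Longrightarrow> a \<boxplus> (b \<boxplus> c) = b \<boxplus> (a \<boxplus> c)"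
  by (metis add_assoc add_commute)

lemmas add_ac = add_assoc add_commute add_left_commute

lemma zero_add: "a \<in> carrier A \<Longrightarrow> \<zero>\<zero> \<boxplus> a = a"
  using add_commute add_zero zero_closed by metis

lemma scale_zero: "c \<odot> \<zero>\<zero> = \<zero>\<zero>"
  by (metis scale_0 scale_scale mult_zero_right zero_closed)

lemma diff_closed [simp, intro]: "\<lbrakk>a \<in> carrier A; b \<in> carrier A\<rbrakk> \<Longrightarrow> a \<boxminus> b \<in> carrier A"
  by (simp add: sa_diff_def)

lemma diff_self: "a \<in> carrier A \<Longrightarrow> a \<boxminus> a = \<zero>\<zero>"
  using scale_add_left[of a 1 "-1"] by (simp add: sa_diff_def scale_one scale_0)

lemma scale_minus_add: "a \<in> carrier A \<Longrightarrow> (-1) \<odot> a \<boxplus> a = \<zero>\<zero>"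
  using diff_self[of a] add_commute[of a "(-1) \<odot> a"] by (simp add: sa_diff_def)

lemma add_diff_cancel: "\<lbrakk>a \<in> carrier A; b \<in> carrier A\<rbrakk> \<Longrightarrow> a \<boxplus> (b \<boxminus> a) = b"
  using add_left_commute[of a b "(-1) \<odot> a"] diff_self[of a]
  by (simp add: sa_diff_def add_zero)

lemma add_diff_cancel_left: "\<lbrakk>a \<in> carrier A; b \<in> carrier A\<rbrakk> \<Longrightarrow> (a \<boxplus> b) \<boxminus> a = b"
proof -
  assume ab: "a \<in> carrier A" "b \<in> carrier A"
  have "(a \<boxplus> b) \<boxminus> a = b \<boxplus> (a \<boxplus> (-1) \<odot> a)"
    using ab by (simp add: sa_diff_def add_ac)
  thus ?thesis using ab diff_self[of a] by (simp add: sa_diff_def add_zero)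
qed

lemma diff_add_add:
  "\<lbrakk>a \<in> carrier A; b \<in> carrier A; c \<in> carrier A; d \<in> carrier A\<rbrakk> \<Longrightarrow>
     (a \<boxplus> b) \<boxminus> (c \<boxplus> d) = (a \<boxminus> c) \<boxplus> (b \<boxminus> d)"
  by (simp add: sa_diff_def scale_add_right add_ac)

lemma diff_scale:
  "\<lbrakk>a \<in> carrier A; b \<in> carrier A\<rbrakk> \<Longrightarrow> (s \<odot> a) \<boxminus> (s \<odot> b) = s \<odot> (a \<boxminus> b)"
  by (simp add: sa_diff_def scale_add_right scale_scale)

lemma diff_swap:
  "\<lbrakk>a \<in> carrier A; b \<in> carrier A\<rbrakk> \<Longrightarrow> b \<boxminus> a = (-1) \<odot> (a \<boxminus> b)"
  by (simp add: sa_diff_def scale_add_right scale_scale scale_one add_commute)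

lemma diff_trans:
  assumes "a \<in> carrier A" "b \<in> carrier A" "c \<in> carrier A"
  shows "a \<boxminus> c = (a \<boxminus> b) \<boxplus> (b \<boxminus> c)"
proof -
  have "(a \<boxminus> b) \<boxplus> (b \<boxminus> c) = a \<boxplus> (((-1) \<odot> b \<boxplus> b) \<boxplus> (-1) \<odot> c)"
    using assms by (simp add: sa_diff_def add_assoc)
  thus ?thesis using assms by (simp add: scale_minus_add zero_add) (simp add: sa_diff_def)
qed

lemma diff_star:
  "\<lbrakk>a \<in> carrier A; b \<in> carrier A\<rbrakk> \<Longrightarrow> a\<^sup>\<star> \<boxminus> b\<^sup>\<star> = (a \<boxminus> b)\<^sup>\<star>"
  by (simp add: sa_diff_def star_add star_scale)

lemma mult_diff_left:
  "\<lbrakk>a \<in> carrier A; b \<in> carrier A; c \<in> carrier A\<rbrakk> \<Longrightarrow> (a \<boxminus> b) \<boxtimes> c = (a \<boxtimes> c) \<boxminus> (b \<boxtimes> c)"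
  by (simp add: sa_diff_def distrib_right mult_scale_left)

lemma mult_diff_right:
  "\<lbrakk>a \<in> carrier A; b \<in> carrier A; c \<in> carrier A\<rbrakk> \<Longrightarrow> c \<boxtimes> (a \<boxminus> b) = (c \<boxtimes> a) \<boxminus> (c \<boxtimes> b)"
  by (simp add: sa_diff_def distrib_left mult_scale_right)

lemma diff_mult:
  "\<lbrakk>a \<in> carrier A; b \<in> carrier A; c \<in> carrier A; d \<in> carrier A\<rbrakk> \<Longrightarrow>
     (a \<boxtimes> b) \<boxminus> (c \<boxtimes> d) = ((a \<boxminus> c) \<boxtimes> b) \<boxplus> (c \<boxtimes> (b \<boxminus> d))"
  using diff_trans[of "a \<boxtimes> b" "c \<boxtimes> b" "c \<boxtimes> d"] by (simp add: mult_diff_left mult_diff_right)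

lemma mult_zero_left: "a \<in> carrier A \<Longrightarrow> \<zero>\<zero> \<boxtimes> a = \<zero>\<zero>"
  by (metis mult_scale_left scale_0 mult_closed zero_closed)

lemma mult_zero_right: "a \<in> carrier A \<Longrightarrow> a \<boxtimes> \<zero>\<zero> = \<zero>\<zero>"
  by (metis mult_scale_right scale_0 mult_closed zero_closed)

lemma star_zero: "\<zero>\<zero>\<^sup>\<star> = \<zero>\<zero>"
  by (metis star_scale scale_0 complex_cnj_zero star_closed zero_closed)

end

text \<open>For closed ideals of C*-algebras, closure under the adjoint is automatic. It is part of the definition
  because the ideals are used before anything is known to be a C*-algebra, in particular the null sequences inside
  the Cauchy sequences.\<close>

locale star_ideal = star_alg A for A :: "'a normed_star_algebra" +
  fixes I :: "'a set"
  assumes ideal_sub: "I \<subseteq> carrier A"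
    and ideal_zero: "sa_zero A \<in> I"
    and ideal_add: "\<lbrakk>a \<in> I; b \<in> I\<rbrakk> \<Longrightarrow> sa_add A a b \<in> I"
    and ideal_scale: "a \<in> I \<Longrightarrow> sa_scale A c a \<in> I"
    and ideal_mult_left: "\<lbrakk>a \<in> I; b \<in> carrier A\<rbrakk> \<Longrightarrow> sa_mult A b a \<in> I"
    and ideal_mult_right: "\<lbrakk>a \<in> I; b \<in> carrier A\<rbrakk> \<Longrightarrow> sa_mult A a b \<in> I"
    and ideal_star: "a \<in> I \<Longrightarrow> sa_star A a \<in> I"
begin

abbreviation "coset \<equiv> sa_coset A I"
abbreviation "Q \<equiv> quotient_algebra A I"

lemma ideal_carrier: "a \<in> I \<Longrightarrow> a \<in> carrier A"
  using ideal_sub by blast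

lemma mem_coset: "a \<in> carrier A \<Longrightarrow> b \<in> coset a \<longleftrightarrow> b \<in> carrier A \<and> b \<boxminus> a \<in> I"
proof
  assume a: "a \<in> carrier A" and "b \<in> coset a"
  then obtain i where "i \<in> I" "b = a \<boxplus> i" by (auto simp: sa_coset_def)
  thus "b \<in> carrier A \<and> b \<boxminus> a \<in> I"
    using a ideal_carrier by (simp add: add_diff_cancel_left)
next
  assume a: "a \<in> carrier A" and b: "b \<in> carrier A \<and> b \<boxminus> a \<in> I"
  hence "b = a \<boxplus> (b \<boxminus> a)" by (simp add: add_diff_cancel)
  thus "b \<in> coset a" using b by (auto simp: sa_coset_def)
qed

lemma self_mem_coset: "a \<in> carrier A \<Longrightarrow> a \<in> coset a"
  by (simp add: mem_coset diff_self ideal_zero)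

lemma coset_eq_iff:
  assumes a: "a \<in> carrier A" and b: "b \<in> carrier A"
  shows "coset a = coset b \<longleftrightarrow> a \<boxminus> b \<in> I"
proof
  assume "coset a = coset b"
  hence "a \<in> coset b" using self_mem_coset[OF a] by simp
  thus "a \<boxminus> b \<in> I" using mem_coset[OF b] by simp
next
  assume ab: "a \<boxminus> b \<in> I"
  hence ba: "b \<boxminus> a \<in> I" using diff_swap[OF a b] ideal_scale by simp
  have "c \<boxminus> a \<in> I \<longleftrightarrow> c \<boxminus> b \<in> I" if c: "c \<in> carrier A" for c
    using diff_trans[OF c a b] diff_trans[OF c b a] ab ba ideal_add by metis
  thus "coset a = coset b" using mem_coset[OF a] mem_coset[OF b] by blast
qed

lemma rep_coset:
  assumes a: "a \<in> carrier A"
  shows "rep (coset a) \<in> carrier A" "rep (coset a) \<boxminus> a \<in> I" "coset (rep (coset a)) = coset a"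
proof -
  have "rep (coset a) \<in> coset a"
    unfolding rep_def using self_mem_coset[OF a] by (rule someI)
  thus "rep (coset a) \<in> carrier A" "rep (coset a) \<boxminus> a \<in> I" using mem_coset[OF a] by auto
  thus "coset (rep (coset a)) = coset a" using coset_eq_iff a by blast
qed

lemma carrier_quotient: "carrier Q = coset ` carrier A"
  by (simp add: quotient_algebra_def)

lemma coset_closed [simp, intro]: "a \<in> carrier A \<Longrightarrow> coset a \<in> carrier Q"
  by (simp add: carrier_quotient)

lemma quotient_zero: "sa_zero Q = coset \<zero>\<zero>"
  by (simp add: quotient_algebra_def)

lemma quotient_add:
  assumes "a \<in> carrier A" "b \<in> carrier A"
  shows "sa_add Q (coset a) (coset b) = coset (a \<boxplus> b)"
  using rep_coset(1,2)[OF assms(1)] rep_coset(1,2)[OF assms(2)] assms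
  by (simp add: quotient_algebra_def coset_eq_iff diff_add_add ideal_add)

lemma quotient_scale:
  assumes "a \<in> carrier A"
  shows "sa_scale Q c (coset a) = coset (c \<odot> a)"
  using rep_coset(1,2)[OF assms(1)] assms
  by (simp add: quotient_algebra_def coset_eq_iff diff_scale ideal_scale)

lemma quotient_mult:
  assumes "a \<in> carrier A" "b \<in> carrier A"
  shows "sa_mult Q (coset a) (coset b) = coset (a \<boxtimes> b)"
  using rep_coset(1,2)[OF assms(1)] rep_coset(1,2)[OF assms(2)] assms
  by (simp add: quotient_algebra_def coset_eq_iff diff_mult ideal_add ideal_mult_left
      ideal_mult_right)

lemma quotient_star:
  assumes "a \<in> carrier A"
  shows "sa_star Q (coset a) = coset (a\<^sup>\<star>)"
  using rep_coset(1,2)[OF assms(1)] assms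
  by (simp add: quotient_algebra_def coset_eq_iff diff_star ideal_star)

lemmas quotient_ops = quotient_zero quotient_add quotient_scale quotient_mult quotient_star

lemma quotient_star_alg: "star_alg Q"
proof -
  have *: "\<exists>a\<in>carrier A. S = coset a" if "S \<in> carrier Q" for S
    using that by (auto simp: carrier_quotient)
  show ?thesis
  proof
    show "sa_zero Q \<in> carrier Q" by (simp add: quotient_zero)
  qed (auto dest!: * simp: quotient_ops add_zero scale_one scale_0 scale_scale scale_add_left
      scale_add_right mult_assoc distrib_left distrib_right mult_scale_left mult_scale_right
      star_add star_scale star_mult star_star add_ac)
qed

lemma quotient_diff:
  "\<lbrakk>a \<in> carrier A; b \<in> carrier A\<rbrakk> \<Longrightarrow> sa_diff Q (coset a) (coset b) = coset (a \<boxminus> b)"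
  by (simp add: sa_diff_def quotient_add quotient_scale)

end

lemma quotient_isomorphism:
  assumes "star_ideal A I" "star_ideal B J" and h: "star_hom A B h"
    and onto: "\<And>b. b \<in> carrier B \<Longrightarrow> \<exists>a\<in>carrier A. h a = b"
    and pre: "\<And>a. a \<in> carrier A \<Longrightarrow> a \<in> I \<longleftrightarrow> h a \<in> J"
  shows "\<exists>\<Phi>. star_iso (quotient_algebra A I) (quotient_algebra B J) \<Phi> \<and>
           (\<forall>a\<in>carrier A. \<Phi> (sa_coset A I a) = sa_coset B J (h a))"
proof -
  interpret I: star_ideal A I by fact
  interpret J: star_ideal B J by fact
  have hc [simp]: "h a \<in> carrier B" if "a \<in> carrier A" for a using h that by (auto simp: star_hom_def)
  have hop: "h (sa_add A a b) = sa_add B (h a) (h b)" "h (sa_scale A c a) = sa_scale B c (h a)"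
    "h (sa_mult A a b) = sa_mult B (h a) (h b)" "h (sa_star A a) = sa_star B (h a)"
    if "a \<in> carrier A" "b \<in> carrier A" for a b c using h that by (auto simp: star_hom_def)
  have eq: "I.coset a = I.coset b \<longleftrightarrow> J.coset (h a) = J.coset (h b)"
    if "a \<in> carrier A" "b \<in> carrier A" for a b
    using that pre[of "sa_diff A a b"] by (simp add: I.coset_eq_iff J.coset_eq_iff sa_diff_def hop)
  define \<Phi> where "\<Phi> = (\<lambda>S. J.coset (h (rep S)))"
  have \<Phi>: "\<Phi> (I.coset a) = J.coset (h a)" if "a \<in> carrier A" for a
    using eq[OF I.rep_coset(1)[OF that] that] I.rep_coset(3)[OF that] by (simp add: \<Phi>_def)
  have cI: "\<exists>a\<in>carrier A. S = I.coset a" if "S \<in> carrier I.Q" for S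
    using that by (auto simp: I.carrier_quotient)
  have "star_hom I.Q J.Q \<Phi>"
    unfolding star_hom_def
    by (auto dest!: cI simp: I.quotient_ops J.quotient_ops \<Phi> hop)
  moreover have "bij_betw \<Phi> (carrier I.Q) (carrier J.Q)"
  proof (rule bij_betwI')
    show "\<Phi> S = \<Phi> T \<longleftrightarrow> S = T" if "S \<in> carrier I.Q" "T \<in> carrier I.Q" for S T
      using cI[OF that(1)] cI[OF that(2)] \<Phi> eq by metis
    show "\<Phi> S \<in> carrier J.Q" if "S \<in> carrier I.Q" for S
      using cI[OF that] \<Phi> by auto
    show "\<exists>S\<in>carrier I.Q. T = \<Phi> S" if "T \<in> carrier J.Q" for T
    proof -
      obtain b where b: "b \<in> carrier B" "T = J.coset b" using \<open>T \<in> carrier J.Q\<close> by (auto simp: J.carrier_quotient)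
      obtain a where "a \<in> carrier A" "h a = b" using onto[OF b(1)] by blast
      thus ?thesis using b \<Phi> by (metis I.coset_closed)
    qed
  qed
  ultimately show ?thesis using \<Phi> by (auto simp: star_iso_def)
qed

section \<open>Completions\<close>

locale pre_cstar = star_alg A for A :: "'a star_algebra" +
  fixes N :: "'a \<Rightarrow> real"
  assumes cstar: "cstar_norm A N"
begin

lemma N_nonneg: "a \<in> carrier A \<Longrightarrow> 0 \<le> N a"
  and N_eq_0: "a \<in> carrier A \<Longrightarrow> N a = 0 \<longleftrightarrow> a = \<zero>\<zero>"
  and N_add: "\<lbrakk>a \<in> carrier A; b \<in> carrier A\<rbrakk> \<Longrightarrow> N (a \<boxplus> b) \<le> N a + N b"
  and N_scale: "a \<in> carrier A \<Longrightarrow> N (s \<odot> a) = cmod s * N a"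
  and N_mult: "\<lbrakk>a \<in> carrier A; b \<in> carrier A\<rbrakk> \<Longrightarrow> N (a \<boxtimes> b) \<le> N a * N b"
  and N_star_mult: "a \<in> carrier A \<Longrightarrow> N (a\<^sup>\<star> \<boxtimes> a) = (N a)\<^sup>2"
  using cstar by (auto simp: cstar_norm_def)

lemma N_zero: "N \<zero>\<zero> = 0"
  using N_eq_0[of "\<zero>\<zero>"] by simp

lemma N_star: "a \<in> carrier A \<Longrightarrow> N (a\<^sup>\<star>) = N a"
proof -
  have le: "N a \<le> N (a\<^sup>\<star>)" if a: "a \<in> carrier A" for a
  proof (cases "N a = 0")
    case False
    hence "N a > 0" using N_nonneg[OF a] by simp
    moreover have "N a * N a \<le> N (a\<^sup>\<star>) * N a"
      using N_star_mult[OF a] N_mult[of "a\<^sup>\<star>" a] a by (simp add: power2_eq_square)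
    ultimately show ?thesis by simp
  qed (use N_nonneg a in auto)
  show "N (a\<^sup>\<star>) = N a" if a: "a \<in> carrier A"
    using le[OF a] le[of "a\<^sup>\<star>"] a by (simp add: star_star)
qed

lemma N_diff_commute: "\<lbrakk>a \<in> carrier A; b \<in> carrier A\<rbrakk> \<Longrightarrow> N (a \<boxminus> b) = N (b \<boxminus> a)"
  using N_scale[of "a \<boxminus> b" "-1"] diff_swap[of a b] by simp

lemma N_diff_le: "\<lbrakk>a \<in> carrier A; b \<in> carrier A\<rbrakk> \<Longrightarrow> N (a \<boxminus> b) \<le> N a + N b"
  using N_add[of a "(-1) \<odot> b"] N_scale[of b "-1"] by (simp add: sa_diff_def)

lemma N_diff_triangle:
  "\<lbrakk>a \<in> carrier A; b \<in> carrier A; c \<in> carrier A\<rbrakk> \<Longrightarrow> N (a \<boxminus> c) \<le> N (a \<boxminus> b) + N (b \<boxminus> c)"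
  using N_add[of "a \<boxminus> b" "b \<boxminus> c"] diff_trans[of a b c] by simp

lemma N_abs_diff: "\<lbrakk>a \<in> carrier A; b \<in> carrier A\<rbrakk> \<Longrightarrow> \<bar>N a - N b\<bar> \<le> N (a \<boxminus> b)"
  using N_add[of b "a \<boxminus> b"] N_add[of a "b \<boxminus> a"] N_diff_commute[of a b]
  by (simp add: add_diff_cancel)

abbreviation "K \<equiv> cauchy_algebra A N"
abbreviation "Z \<equiv> null_sequences A N"
abbreviation "B \<equiv> completion A N"
abbreviation "cls \<equiv> completion_class A N"
abbreviation "emb \<equiv> completion_embed A N"

lemma cauchy_iff:
  "u \<in> carrier K \<longleftrightarrow> (\<forall>n. u n \<in> carrier A) \<and>
     (\<forall>\<epsilon>>0. \<exists>M. \<forall>m\<ge>M. \<forall>n\<ge>M. N (u m \<boxminus> u n) < \<epsilon>)"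
  by (simp add: cauchy_algebra_def)

lemma cauchy_term [simp]: "u \<in> carrier K \<Longrightarrow> u n \<in> carrier A"
  by (simp add: cauchy_iff)

text \<open>Every algebraic operation on Cauchy sequences has this form: the increments of the result are
  bounded by those of the arguments.\<close>

lemma cauchyI_small:
  assumes "\<And>n. w n \<in> carrier A" and u: "u \<in> carrier K" and v: "v \<in> carrier K"
    and le: "\<And>m n. N (w m \<boxminus> w n) \<le> C * N (u m \<boxminus> u n) + D * N (v m \<boxminus> v n)"
    and C: "C > 0" and D: "D > 0"
  shows "w \<in> carrier K"
  unfolding cauchy_iff
proof (intro conjI allI impI)
  fix \<epsilon> :: real assume e: "\<epsilon> > 0"
  obtain M1 where M1: "\<forall>m\<ge>M1. \<forall>n\<ge>M1. N (u m \<boxminus> u n) < \<epsilon> / (2 * C)"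
    using u e C unfolding cauchy_iff by (meson divide_pos_pos mult_pos_pos zero_less_numeral)
  obtain M2 where M2: "\<forall>m\<ge>M2. \<forall>n\<ge>M2. N (v m \<boxminus> v n) < \<epsilon> / (2 * D)"
    using v e D unfolding cauchy_iff by (meson divide_pos_pos mult_pos_pos zero_less_numeral)
  have "N (w m \<boxminus> w n) < \<epsilon>" if "m \<ge> max M1 M2" "n \<ge> max M1 M2" for m n
  proof -
    have "C * N (u m \<boxminus> u n) < \<epsilon> / 2" "D * N (v m \<boxminus> v n) < \<epsilon> / 2"
      using M1 M2 that C D by (auto simp: field_simps)
    thus ?thesis using le[of m n] by linarith
  qed
  thus "\<exists>M. \<forall>m\<ge>M. \<forall>n\<ge>M. N (w m \<boxminus> w n) < \<epsilon>" by blast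
qed (use assms in auto)

lemma cauchy_const: "a \<in> carrier A \<Longrightarrow> (\<lambda>n. a) \<in> carrier K"
  by (simp add: cauchy_iff diff_self N_zero)

lemma cauchy_norm_convergent: "u \<in> carrier K \<Longrightarrow> convergent (\<lambda>n. N (u n))"
proof -
  assume u: "u \<in> carrier K"
  have "Cauchy (\<lambda>n. N (u n))"
  proof (rule metric_CauchyI)
    fix e :: real assume "e > 0"
    then obtain M where "\<forall>m\<ge>M. \<forall>n\<ge>M. N (u m \<boxminus> u n) < e" using u by (auto simp: cauchy_iff)
    hence "\<forall>m\<ge>M. \<forall>n\<ge>M. dist (N (u m)) (N (u n)) < e"
      using N_abs_diff u unfolding dist_real_def by (meson cauchy_term order_le_less_trans)
    thus "\<exists>M. \<forall>m\<ge>M. \<forall>n\<ge>M. dist (N (u m)) (N (u n)) < e" by blast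
  qed
  thus ?thesis by (simp add: Cauchy_convergent_iff)
qed

lemma cauchy_bounded: "u \<in> carrier K \<Longrightarrow> \<exists>C>0. \<forall>n. N (u n) \<le> C"
proof -
  assume u: "u \<in> carrier K"
  have "Bseq (\<lambda>n. N (u n))" by (rule convergent_imp_Bseq[OF cauchy_norm_convergent[OF u]])
  then obtain C where "C > 0" "\<forall>n. norm (N (u n)) \<le> C" by (auto simp: Bseq_def)
  thus ?thesis by (metis abs_le_D1 real_norm_def)
qed

lemma cauchy_mult:
  assumes u: "u \<in> carrier K" and v: "v \<in> carrier K"
  shows "(\<lambda>n. u n \<boxtimes> v n) \<in> carrier K"
proof -
  obtain C where C: "C > 0" "\<And>n. N (u n) \<le> C" using cauchy_bounded[OF u] by blast
  obtain D where D: "D > 0" "\<And>n. N (v n) \<le> D" using cauchy_bounded[OF v] by blast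
  show ?thesis
  proof (rule cauchyI_small[OF _ u v _ D(1) C(1)])
    fix m n
    have "N (u m \<boxtimes> v m \<boxminus> u n \<boxtimes> v n) \<le>
        N ((u m \<boxminus> u n) \<boxtimes> v m) + N (u n \<boxtimes> (v m \<boxminus> v n))"
      using u v by (simp add: diff_mult N_add)
    also have "\<dots> \<le> N (u m \<boxminus> u n) * N (v m) + N (u n) * N (v m \<boxminus> v n)"
      using u v by (intro add_mono N_mult) auto
    also have "\<dots> \<le> N (u m \<boxminus> u n) * D + C * N (v m \<boxminus> v n)"
      using u v C D by (intro add_mono mult_mono order_refl N_nonneg) (auto intro: N_nonneg less_imp_le)
    finally show "N (u m \<boxtimes> v m \<boxminus> u n \<boxtimes> v n) \<le> D * N (u m \<boxminus> u n) + C * N (v m \<boxminus> v n)"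
      by (simp add: mult.commute)
  qed (use u v in auto)
qed

lemma K_ops:
  "sa_zero K = (\<lambda>n. \<zero>\<zero>)" "sa_add K u v = (\<lambda>n. u n \<boxplus> v n)" "sa_scale K s u = (\<lambda>n. s \<odot> u n)"
  "sa_mult K u v = (\<lambda>n. u n \<boxtimes> v n)" "sa_star K u = (\<lambda>n. (u n)\<^sup>\<star>)"
  "sa_diff K u v = (\<lambda>n. u n \<boxminus> v n)"
  unfolding cauchy_algebra_def sa_diff_def by simp_all

lemma K_norm: "sa_norm K u = lim (\<lambda>n. N (u n))"
  unfolding cauchy_algebra_def by simp

lemma cauchy_star_alg: "star_alg K"
proof
  show "sa_zero K \<in> carrier K" by (simp add: K_ops cauchy_const)
  show "sa_add K u v \<in> carrier K" if "u \<in> carrier K" "v \<in> carrier K" for u v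
    by (rule cauchyI_small[OF _ that, of _ 1 1])
       (use that in \<open>auto simp: K_ops diff_add_add intro: N_add\<close>)
  show "sa_scale K s u \<in> carrier K" if "u \<in> carrier K" for s u
  proof (rule cauchyI_small[OF _ that that, of _ "cmod s + 1" 1])
    fix m n
    have "0 \<le> N (u m \<boxminus> u n)" using that by (intro N_nonneg) auto
    thus "N (sa_scale K s u m \<boxminus> sa_scale K s u n) \<le>
        (cmod s + 1) * N (u m \<boxminus> u n) + 1 * N (u m \<boxminus> u n)"
      using that by (simp add: K_ops diff_scale N_scale ring_distribs)
    show "0 < cmod s + 1" using norm_ge_zero[of s] by linarith
  qed (use that in \<open>auto simp: K_ops\<close>)
  show "sa_mult K u v \<in> carrier K" if "u \<in> carrier K" "v \<in> carrier K" for u v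
    using cauchy_mult[OF that] by (simp add: K_ops)
  show "sa_star K u \<in> carrier K" if "u \<in> carrier K" for u
    by (rule cauchyI_small[OF _ that that, of _ 1 1])
       (use that in \<open>auto simp: K_ops diff_star N_star N_nonneg\<close>)
qed (auto simp: K_ops fun_eq_iff add_zero scale_one scale_0 scale_scale scale_add_left
      scale_add_right mult_assoc distrib_left distrib_right mult_scale_left mult_scale_right
      star_add star_scale star_mult star_star add_ac)

lemma null_iff: "u \<in> Z \<longleftrightarrow> (\<forall>n. u n \<in> carrier A) \<and> (\<lambda>n. N (u n)) \<longlonglongrightarrow> 0"
  by (simp add: null_sequences_def)

lemma nullI_small:
  assumes "\<And>n. w n \<in> carrier A" "\<And>n. N (w n) \<le> g n" "g \<longlonglongrightarrow> 0"
  shows "w \<in> Z"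
  using assms unfolding null_iff
  by (auto intro!: tendsto_sandwich[OF _ _ tendsto_const assms(3)] simp: N_nonneg)

lemma null_cauchy: "u \<in> Z \<Longrightarrow> u \<in> carrier K"
  unfolding cauchy_iff
proof (intro conjI allI impI)
  fix \<epsilon> :: real assume u: "u \<in> Z" and e: "\<epsilon> > 0"
  hence "(\<lambda>n. N (u n)) \<longlonglongrightarrow> 0" by (simp add: null_iff)
  then obtain M where "\<forall>n\<ge>M. norm (N (u n) - 0) < \<epsilon> / 2" using e by (meson LIMSEQ_D half_gt_zero)
  hence M: "N (u n) < \<epsilon> / 2" if "n \<ge> M" for n using that by (auto simp: abs_less_iff)
  have "N (u m \<boxminus> u n) < \<epsilon>" if "m \<ge> M" "n \<ge> M" for m n
    using N_diff_le[of "u m" "u n"] M[OF that(1)] M[OF that(2)] u by (auto simp: null_iff)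
  thus "\<exists>M. \<forall>m\<ge>M. \<forall>n\<ge>M. N (u m \<boxminus> u n) < \<epsilon>" by blast
qed (auto simp: null_iff)

lemma null_ideal: "star_ideal K Z"
proof -
  interpret K: star_alg K by (rule cauchy_star_alg)
  show ?thesis
  proof
    show "Z \<subseteq> carrier K" using null_cauchy by blast
    show "sa_zero K \<in> Z" by (simp add: null_iff K_ops N_zero)
    show "sa_add K u v \<in> Z" if "u \<in> Z" "v \<in> Z" for u v
      by (rule nullI_small[where g="\<lambda>n. N (u n) + N (v n)"])
         (use that in \<open>auto simp: K_ops null_iff intro: N_add tendsto_add_zero\<close>)
    show "sa_scale K s u \<in> Z" if "u \<in> Z" for s u
      by (rule nullI_small[where g="\<lambda>n. cmod s * N (u n)"])
         (use that in \<open>auto simp: K_ops null_iff N_scale intro: tendsto_mult_right_zero\<close>)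
    show "sa_mult K v u \<in> Z" if u: "u \<in> Z" and v: "v \<in> carrier K" for u v
    proof -
      obtain C where C: "C > 0" "\<And>n. N (v n) \<le> C" using cauchy_bounded[OF v] by blast
      show ?thesis
      proof (rule nullI_small[where g="\<lambda>n. C * N (u n)"])
        show "N (sa_mult K v u n) \<le> C * N (u n)" for n
          using N_mult[of "v n" "u n"] C u v
          by (auto simp: K_ops null_iff intro!: N_nonneg order_trans[OF N_mult mult_right_mono])
      qed (use u v in \<open>auto simp: K_ops null_iff intro: tendsto_mult_right_zero\<close>)
    qed
    show "sa_mult K u v \<in> Z" if u: "u \<in> Z" and v: "v \<in> carrier K" for u v
    proof -
      obtain C where C: "C > 0" "\<And>n. N (v n) \<le> C" using cauchy_bounded[OF v] by blast
      show ?thesis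
      proof (rule nullI_small[where g="\<lambda>n. N (u n) * C"])
        show "N (sa_mult K u v n) \<le> N (u n) * C" for n
          using N_mult[of "u n" "v n"] C u v
          by (auto simp: K_ops null_iff intro!: N_nonneg order_trans[OF N_mult mult_left_mono])
      qed (use u v in \<open>auto simp: K_ops null_iff intro: tendsto_mult_left_zero\<close>)
    qed
    show "sa_star K u \<in> Z" if "u \<in> Z" for u
      using that by (auto simp: K_ops null_iff N_star)
  qed
qed

sublocale K: star_ideal K Z
  by (rule null_ideal)

lemma cls_coset: "cls = K.coset" and B_quotient: "B = K.Q"
  by (auto simp: completion_class_def completion_def)

sublocale B: star_alg B
  unfolding B_quotient by (rule K.quotient_star_alg)

lemma cls_closed [simp, intro]: "u \<in> carrier K \<Longrightarrow> cls u \<in> carrier B"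
  by (simp add: cls_coset B_quotient)

lemma carrier_cases:
  assumes "b \<in> carrier B"
  obtains u where "u \<in> carrier K" "b = cls u"
  using assms by (auto simp: cls_coset B_quotient K.carrier_quotient)

lemma cls_eq_iff:
  "\<lbrakk>u \<in> carrier K; v \<in> carrier K\<rbrakk> \<Longrightarrow> cls u = cls v \<longleftrightarrow> (\<lambda>n. N (u n \<boxminus> v n)) \<longlonglongrightarrow> 0"
  by (simp add: cls_coset K.coset_eq_iff K_ops null_iff)

lemma rep_cls:
  assumes "u \<in> carrier K"
  shows "rep (cls u) \<in> carrier K" "cls (rep (cls u)) = cls u"
  using K.rep_coset[OF assms] by (auto simp: cls_coset)

lemma B_ops:
  "sa_zero B = cls (\<lambda>n. \<zero>\<zero>)"
  "\<lbrakk>u \<in> carrier K; v \<in> carrier K\<rbrakk> \<Longrightarrow> sa_add B (cls u) (cls v) = cls (\<lambda>n. u n \<boxplus> v n)"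
  "u \<in> carrier K \<Longrightarrow> sa_scale B s (cls u) = cls (\<lambda>n. s \<odot> u n)"
  "\<lbrakk>u \<in> carrier K; v \<in> carrier K\<rbrakk> \<Longrightarrow> sa_mult B (cls u) (cls v) = cls (\<lambda>n. u n \<boxtimes> v n)"
  "u \<in> carrier K \<Longrightarrow> sa_star B (cls u) = cls (\<lambda>n. (u n)\<^sup>\<star>)"
  "\<lbrakk>u \<in> carrier K; v \<in> carrier K\<rbrakk> \<Longrightarrow> sa_diff B (cls u) (cls v) = cls (\<lambda>n. u n \<boxminus> v n)"
  using K.quotient_ops K.quotient_diff by (simp_all add: cls_coset B_quotient K_ops)

lemma K_closed:
  "(\<lambda>n. \<zero>\<zero>) \<in> carrier K"
  "\<lbrakk>u \<in> carrier K; v \<in> carrier K\<rbrakk> \<Longrightarrow> (\<lambda>n. u n \<boxplus> v n) \<in> carrier K"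
  "u \<in> carrier K \<Longrightarrow> (\<lambda>n. s \<odot> u n) \<in> carrier K"
  "\<lbrakk>u \<in> carrier K; v \<in> carrier K\<rbrakk> \<Longrightarrow> (\<lambda>n. u n \<boxtimes> v n) \<in> carrier K"
  "u \<in> carrier K \<Longrightarrow> (\<lambda>n. (u n)\<^sup>\<star>) \<in> carrier K"
  "\<lbrakk>u \<in> carrier K; v \<in> carrier K\<rbrakk> \<Longrightarrow> (\<lambda>n. u n \<boxminus> v n) \<in> carrier K"
  using K.zero_closed K.add_closed K.scale_closed K.mult_closed K.star_closed K.diff_closed
  by (simp_all add: K_ops)

lemma emb_closed [simp, intro]: "a \<in> carrier A \<Longrightarrow> emb a \<in> carrier B"
  by (simp add: completion_embed_def cauchy_const)

text \<open>The quotient norm is an infimum over a class on which the seminorm of the Cauchy algebra is constant.\<close>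

lemma B_norm: "u \<in> carrier K \<Longrightarrow> (\<lambda>n. N (u n)) \<longlonglongrightarrow> sa_norm B (cls u)"
proof -
  assume u: "u \<in> carrier K"
  define l where "l = lim (\<lambda>n. N (u n))"
  have l: "(\<lambda>n. N (u n)) \<longlonglongrightarrow> l"
    unfolding l_def using cauchy_norm_convergent[OF u] by (simp add: convergent_LIMSEQ_iff)
  have "sa_norm K v = l" if "v \<in> cls u" for v
  proof -
    have v: "v \<in> carrier K" and null: "(\<lambda>n. N (v n \<boxminus> u n)) \<longlonglongrightarrow> 0"
      using that K.mem_coset[OF u] by (auto simp: cls_coset K_ops null_iff)
    have "norm (N (v n) - N (u n)) \<le> norm (N (v n \<boxminus> u n)) * 1" for n
      using N_abs_diff[of "v n" "u n"] cauchy_term[OF u] cauchy_term[OF v] by simp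
    hence "(\<lambda>n. N (v n) - N (u n)) \<longlonglongrightarrow> 0"
      by (rule tendsto_0_le[OF null always_eventually[OF allI]])
    from tendsto_add[OF this l] have "(\<lambda>n. N (v n)) \<longlonglongrightarrow> l" by simp
    thus ?thesis unfolding K_norm by (rule limI)
  qed
  moreover have "u \<in> cls u" using K.self_mem_coset[OF u] by (simp add: cls_coset)
  ultimately have "sa_norm K ` cls u = {l}" by auto
  hence "sa_norm B (cls u) = l" unfolding completion_def by (subst quotient_algebra_def) simp
  thus ?thesis using l by simp
qed

lemma B_norm_nonneg: "b \<in> carrier B \<Longrightarrow> 0 \<le> sa_norm B b"
  by (metis B_norm LIMSEQ_le_const N_nonneg carrier_cases cauchy_term)

lemma B_norm_emb: "a \<in> carrier A \<Longrightarrow> sa_norm B (emb a) = N a"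
  using B_norm[OF cauchy_const] LIMSEQ_unique tendsto_const unfolding completion_embed_def by blast

lemma B_norm_scale: "b \<in> carrier B \<Longrightarrow> sa_norm B (sa_scale B s b) = cmod s * sa_norm B b"
proof (erule carrier_cases)
  fix u assume u: "u \<in> carrier K" and b: "b = cls u"
  have "(\<lambda>n. N (s \<odot> u n)) \<longlonglongrightarrow> sa_norm B (sa_scale B s b)"
    using B_norm[OF K_closed(3)[OF u]] u b by (simp add: B_ops)
  moreover have "(\<lambda>n. N (s \<odot> u n)) \<longlonglongrightarrow> cmod s * sa_norm B b"
    using tendsto_mult_left[OF B_norm[OF u]] u b by (simp add: N_scale)
  ultimately show ?thesis by (rule LIMSEQ_unique)
qed

text \<open>The quantitative form of density: the terms of a Cauchy sequence converge to its class.\<close>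

lemma emb_dense:
  assumes u: "u \<in> carrier K"
  shows "(\<lambda>n. sa_norm B (sa_diff B (cls u) (emb (u n)))) \<longlonglongrightarrow> 0"
proof (rule LIMSEQ_I)
  fix r :: real assume "r > 0"
  then obtain M where M: "\<forall>m\<ge>M. \<forall>n\<ge>M. N (u m \<boxminus> u n) < r / 2"
    using u unfolding cauchy_iff by (meson half_gt_zero)
  have "norm (sa_norm B (sa_diff B (cls u) (emb (u n))) - 0) < r" if n: "n \<ge> M" for n
  proof -
    have un: "(\<lambda>m. u n) \<in> carrier K" using u by (simp add: cauchy_const)
    have "(\<lambda>m. N (u m \<boxminus> u n)) \<longlonglongrightarrow> sa_norm B (sa_diff B (cls u) (emb (u n)))"
      using B_norm[OF K_closed(6)[OF u un]] u un by (simp add: B_ops completion_embed_def)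
    hence "sa_norm B (sa_diff B (cls u) (emb (u n))) \<le> r / 2"
      by (rule LIMSEQ_le_const2) (use M n in \<open>auto intro!: exI[of _ M] less_imp_le\<close>)
    moreover have "0 \<le> sa_norm B (sa_diff B (cls u) (emb (u n)))"
      using u by (auto intro!: B_norm_nonneg)
    ultimately show ?thesis using \<open>r > 0\<close> by auto
  qed
  thus "\<exists>no. \<forall>n\<ge>no. norm (sa_norm B (sa_diff B (cls u) (emb (u n))) - 0) < r" by blast
qed

section \<open>States of a completion\<close>

lemma state_bound:
  assumes \<psi>: "state B \<psi>" and b: "b \<in> carrier B"
  shows "cmod (\<psi> b) \<le> sa_norm B b"
proof -
  have le1: "cmod (\<psi> c) \<le> 1" if "c \<in> carrier B" "sa_norm B c \<le> 1" for c
    using \<psi> cSup_upper[of "cmod (\<psi> c)" "{cmod (\<psi> b) |b. b \<in> carrier B \<and> sa_norm B b \<le> 1}"] that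
    by (auto simp: state_def)
  have sc: "\<psi> (sa_scale B t b) = t * \<psi> b" for t
    using \<psi> b by (simp add: state_def)
  show ?thesis
  \<comment> \<open>Dividing by \<open>\<parallel>b\<parallel> + e\<close> rather than by \<open>\<parallel>b\<parallel>\<close> also covers elements of norm zero.\<close>
  proof (rule field_le_epsilon)
    fix e :: real assume e: "e > 0"
    define t where "t = complex_of_real (1 / (sa_norm B b + e))"
    have pos: "sa_norm B b + e > 0" using B_norm_nonneg[OF b] e by simp
    have "sa_norm B (sa_scale B t b) = sa_norm B b / (sa_norm B b + e)"
      using pos by (simp add: t_def B_norm_scale[OF b] norm_divide del: of_real_add of_real_divide)
    hence "sa_norm B (sa_scale B t b) \<le> 1" using pos e by simp
    hence "cmod (t * \<psi> b) \<le> 1" using le1 b sc by (metis B.scale_closed)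
    thus "cmod (\<psi> b) \<le> sa_norm B b + e"
      using pos by (simp add: t_def norm_mult norm_divide field_simps del: of_real_add of_real_divide)
  qed
qed

text \<open>States of the completion are handled through their restrictions to the dense subalgebra, which
  are functionals of the following kind. Extension by continuity inverts the restriction.\<close>

definition pos_functional :: "('a \<Rightarrow> complex) \<Rightarrow> bool" where
  "pos_functional \<tau> \<longleftrightarrow>
     (\<forall>a\<in>carrier A. \<forall>b\<in>carrier A. \<tau> (a \<boxplus> b) = \<tau> a + \<tau> b) \<and>
     (\<forall>s. \<forall>a\<in>carrier A. \<tau> (s \<odot> a) = s * \<tau> a) \<and>
     (\<forall>a\<in>carrier A. \<tau> (a\<^sup>\<star> \<boxtimes> a) \<in> \<real>\<^sub>\<ge>\<^sub>0) \<and>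
     (\<forall>a\<in>carrier A. cmod (\<tau> a) \<le> N a)"

definition extend_functional :: "('a \<Rightarrow> complex) \<Rightarrow> (nat \<Rightarrow> 'a) set \<Rightarrow> complex" where
  "extend_functional \<tau> = (\<lambda>b\<in>carrier B. lim (\<lambda>n. \<tau> (rep b n)))"

lemma pos_functional_diff:
  assumes "pos_functional \<tau>" "a \<in> carrier A" "b \<in> carrier A"
  shows "\<tau> (a \<boxminus> b) = \<tau> a - \<tau> b"
  using assms by (simp add: pos_functional_def sa_diff_def)

lemma extend_functional_lim:
  assumes \<tau>: "pos_functional \<tau>" and u: "u \<in> carrier K"
  shows "(\<lambda>n. \<tau> (u n)) \<longlonglongrightarrow> extend_functional \<tau> (cls u)"
proof -
  have d: "cmod (\<tau> a - \<tau> b) \<le> N (a \<boxminus> b)" if "a \<in> carrier A" "b \<in> carrier A" for a b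
    using pos_functional_diff[OF \<tau> that] \<tau> that unfolding pos_functional_def
    by (metis diff_closed)
  have "Cauchy (\<lambda>n. \<tau> (u n))"
  proof (rule metric_CauchyI)
    fix e :: real assume "e > 0"
    then obtain M where "\<forall>m\<ge>M. \<forall>n\<ge>M. N (u m \<boxminus> u n) < e" using u by (auto simp: cauchy_iff)
    hence "\<forall>m\<ge>M. \<forall>n\<ge>M. dist (\<tau> (u m)) (\<tau> (u n)) < e"
      using d u unfolding dist_norm by (meson cauchy_term order_le_less_trans)
    thus "\<exists>M. \<forall>m\<ge>M. \<forall>n\<ge>M. dist (\<tau> (u m)) (\<tau> (u n)) < e" by blast
  qed
  then obtain l where l: "(\<lambda>n. \<tau> (u n)) \<longlonglongrightarrow> l" by (auto simp: Cauchy_convergent_iff convergent_def)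
  define v where "v = rep (cls u)"
  have v: "v \<in> carrier K" "cls v = cls u" using rep_cls[OF u] by (auto simp: v_def)
  hence null: "(\<lambda>n. N (v n \<boxminus> u n)) \<longlonglongrightarrow> 0" using cls_eq_iff u by blast
  have "norm (\<tau> (v n) - \<tau> (u n)) \<le> norm (N (v n \<boxminus> u n)) * 1" for n
    using d[of "v n" "u n"] cauchy_term[OF u] cauchy_term[OF v(1)] by simp
  hence "(\<lambda>n. \<tau> (v n) - \<tau> (u n)) \<longlonglongrightarrow> 0"
    by (rule tendsto_0_le[OF null always_eventually[OF allI]])
  from tendsto_add[OF this l] have "(\<lambda>n. \<tau> (v n)) \<longlonglongrightarrow> l" by simp
  hence "extend_functional \<tau> (cls u) = l" using u by (auto simp: extend_functional_def v_def limI)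
  thus ?thesis using l by simp
qed

lemma extend_functional_emb:
  "\<lbrakk>pos_functional \<tau>; a \<in> carrier A\<rbrakk> \<Longrightarrow> extend_functional \<tau> (emb a) = \<tau> a"
  using extend_functional_lim[OF _ cauchy_const] LIMSEQ_unique tendsto_const
  unfolding completion_embed_def by blast

text \<open>The element \<open>e\<close> shows that the norm of the extension is one and not smaller.\<close>

lemma extend_functional_state:
  assumes \<tau>: "pos_functional \<tau>" and e: "e \<in> carrier A" "N e \<le> 1" "\<tau> e = 1"
  shows "state B (extend_functional \<tau>)"
proof -
  note lim = extend_functional_lim[OF \<tau>]
  have bd: "cmod (extend_functional \<tau> b) \<le> sa_norm B b" if b: "b \<in> carrier B" for b
  proof -
    obtain u where u: "u \<in> carrier K" "b = cls u" using carrier_cases[OF b] .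
    show ?thesis unfolding u(2)
      by (rule LIMSEQ_le[OF tendsto_norm[OF lim[OF u(1)]] B_norm[OF u(1)]])
         (use \<tau> u in \<open>auto simp: pos_functional_def\<close>)
  qed
  let ?S = "{cmod (extend_functional \<tau> b) |b. b \<in> carrier B \<and> sa_norm B b \<le> 1}"
  have one: "1 \<in> ?S"
    using extend_functional_emb[OF \<tau> e(1)] B_norm_emb[OF e(1)] e
    by (auto intro!: exI[of _ "emb e"])
  have le1: "\<And>y. y \<in> ?S \<Longrightarrow> y \<le> 1" using bd by (auto intro: order_trans)
  have S: "bdd_above ?S" "Sup ?S = 1"
    by (rule bdd_aboveI[of _ 1], erule le1) (rule cSup_eq_maximum[OF one], erule le1)
  show ?thesis
    unfolding state_def
  proof (intro conjI ballI allI S)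
    show "extend_functional \<tau> \<in> extensional (carrier B)" by (simp add: extend_functional_def)
    fix a assume "a \<in> carrier B"
    then obtain u where u: "u \<in> carrier K" "a = cls u" by (rule carrier_cases)
    show "extend_functional \<tau> (sa_scale B s a) = s * extend_functional \<tau> a" for s
    proof (rule LIMSEQ_unique)
      show "(\<lambda>n. \<tau> (s \<odot> u n)) \<longlonglongrightarrow> extend_functional \<tau> (sa_scale B s a)"
        using lim[OF K_closed(3)[OF u(1)]] u by (simp add: B_ops)
      show "(\<lambda>n. \<tau> (s \<odot> u n)) \<longlonglongrightarrow> s * extend_functional \<tau> a"
        using tendsto_mult_left[OF lim[OF u(1)]] u \<tau> by (simp add: pos_functional_def)
    qed
    have lim2: "(\<lambda>n. \<tau> ((u n)\<^sup>\<star> \<boxtimes> u n)) \<longlonglongrightarrow> extend_functional \<tau> (sa_mult B (sa_star B a) a)"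
      using lim[OF K_closed(4)[OF K_closed(5)[OF u(1)] u(1)]] u K_closed(5)[OF u(1)]
      by (simp add: B_ops)
    have "\<tau> ((u n)\<^sup>\<star> \<boxtimes> u n) \<in> \<real>\<^sub>\<ge>\<^sub>0" for n using u \<tau> by (simp add: pos_functional_def)
    thus "extend_functional \<tau> (sa_mult B (sa_star B a) a) \<in> \<real>\<^sub>\<ge>\<^sub>0"
      by (rule closed_sequentially[OF closed_nonneg_Reals_complex _ lim2])
    fix b assume "b \<in> carrier B"
    then obtain v where v: "v \<in> carrier K" "b = cls v" by (rule carrier_cases)
    show "extend_functional \<tau> (sa_add B a b) = extend_functional \<tau> a + extend_functional \<tau> b"
    proof (rule LIMSEQ_unique)
      show "(\<lambda>n. \<tau> (u n \<boxplus> v n)) \<longlonglongrightarrow> extend_functional \<tau> (sa_add B a b)"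
        using lim[OF K_closed(2)[OF u(1) v(1)]] u v by (simp add: B_ops)
      show "(\<lambda>n. \<tau> (u n \<boxplus> v n)) \<longlonglongrightarrow> extend_functional \<tau> a + extend_functional \<tau> b"
        using tendsto_add[OF lim[OF u(1)] lim[OF v(1)]] u v \<tau> by (simp add: pos_functional_def)
    qed
  qed
qed

lemma emb_hom:
  "\<lbrakk>a \<in> carrier A; b \<in> carrier A\<rbrakk> \<Longrightarrow> emb (a \<boxplus> b) = sa_add B (emb a) (emb b)"
  "a \<in> carrier A \<Longrightarrow> emb (s \<odot> a) = sa_scale B s (emb a)"
  "\<lbrakk>a \<in> carrier A; b \<in> carrier A\<rbrakk> \<Longrightarrow> emb (a \<boxtimes> b) = sa_mult B (emb a) (emb b)"
  "a \<in> carrier A \<Longrightarrow> emb (a\<^sup>\<star>) = sa_star B (emb a)"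
  by (simp_all add: completion_embed_def B_ops cauchy_const)

lemma state_restricts:
  assumes \<psi>: "state B \<psi>"
  shows "pos_functional (\<lambda>a. \<psi> (emb a))"
  unfolding pos_functional_def
proof (intro conjI ballI allI)
  show "cmod (\<psi> (emb a)) \<le> N a" if "a \<in> carrier A" for a
    using state_bound[OF \<psi>, of "emb a"] B_norm_emb[OF that] that by simp
qed (use \<psi> in \<open>auto simp: state_def emb_hom\<close>)

lemma state_eq_extend:
  assumes \<psi>: "state B \<psi>" and eq: "\<And>a. a \<in> carrier A \<Longrightarrow> \<psi> (emb a) = \<tau> a"
  shows "\<psi> = extend_functional \<tau>"
proof (rule extensionalityI)
  show "\<psi> \<in> extensional (carrier B)" using \<psi> by (simp add: state_def)
  show "extend_functional \<tau> \<in> extensional (carrier B)" by (simp add: extend_functional_def)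
  have \<tau>: "pos_functional \<tau>"
    using state_restricts[OF \<psi>] eq by (simp add: pos_functional_def)
  fix b assume b: "b \<in> carrier B"
  then obtain u where u: "u \<in> carrier K" "b = cls u" by (rule carrier_cases)
  have "\<psi> b - \<psi> (emb (u n)) = \<psi> (sa_diff B b (emb (u n)))" for n
    using \<psi> b u by (simp add: state_def sa_diff_def)
  hence "norm (\<psi> b - \<psi> (emb (u n))) \<le> norm (sa_norm B (sa_diff B b (emb (u n)))) * 1" for n
    using state_bound[OF \<psi>, of "sa_diff B b (emb (u n))"] b u by simp
  hence "(\<lambda>n. \<psi> b - \<psi> (emb (u n))) \<longlonglongrightarrow> 0"
    using u(2) by (auto intro!: tendsto_0_le[where K=1, OF emb_dense[OF u(1)] always_eventually[OF allI]])
  from tendsto_diff[OF tendsto_const[of "\<psi> b"] this] have "(\<lambda>n. \<tau> (u n)) \<longlonglongrightarrow> \<psi> b" using u eq by simp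
  thus "\<psi> b = extend_functional \<tau> b"
    using extend_functional_lim[OF \<tau> u(1)] u(2) LIMSEQ_unique by blast
qed

text \<open>The degenerate case of the Cauchy-Schwarz inequality: positivity of \<open>\<tau>((a + s b)\<^sup>*(a + s b))\<close> for
  all scalars \<open>s\<close> leaves no room for a term that is linear in \<open>s\<close>.\<close>

lemma pos_functional_cauchy_schwarz:
  assumes \<tau>: "pos_functional \<tau>" and a: "a \<in> carrier A" and b: "b \<in> carrier A"
    and z: "\<tau> (b\<^sup>\<star> \<boxtimes> b) = 0"
  shows "\<tau> (b\<^sup>\<star> \<boxtimes> a) = 0" "\<tau> (a\<^sup>\<star> \<boxtimes> b) = 0"
proof -
  define p where "p = \<tau> (a\<^sup>\<star> \<boxtimes> a)"
  define q where "q = \<tau> (a\<^sup>\<star> \<boxtimes> b)"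
  define r where "r = \<tau> (b\<^sup>\<star> \<boxtimes> a)"
  have "p + s * q + cnj s * r \<in> \<real>\<^sub>\<ge>\<^sub>0" for s
  proof -
    have "\<tau> ((a \<boxplus> s \<odot> b)\<^sup>\<star> \<boxtimes> (a \<boxplus> s \<odot> b)) = p + s * q + cnj s * r + cnj s * s * \<tau> (b\<^sup>\<star> \<boxtimes> b)"
      using a b \<tau> unfolding pos_functional_def
      by (simp add: star_add star_scale distrib_left distrib_right mult_scale_left mult_scale_right
          scale_scale p_def q_def r_def algebra_simps)
    moreover have "\<tau> ((a \<boxplus> s \<odot> b)\<^sup>\<star> \<boxtimes> (a \<boxplus> s \<odot> b)) \<in> \<real>\<^sub>\<ge>\<^sub>0"
      using a b \<tau> unfolding pos_functional_def by simp
    ultimately show ?thesis using z by simp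
  qed
  note pos = this
  have *: "Im (p + s * q + cnj s * r) = 0" "Re (p + s * q + cnj s * r) \<ge> 0" for s
    using pos[of s] by (auto simp: complex_nonneg_Reals_iff)
  have p: "Im p = 0" using *(1)[of 0] by simp
  have r: "r = cnj q"
    using *(1)[of 1] *(1)[of \<i>] p by (auto simp: complex_eq_iff)
  have "q = 0"
  proof (rule ccontr)
    assume "q \<noteq> 0"
    hence n: "(cmod q)\<^sup>2 > 0" by simp
    define t where "t = - (Re p + 1) / (cmod q)\<^sup>2"
    define s where "s = complex_of_real t * cnj q"
    have "s * q = complex_of_real (t * (cmod q)\<^sup>2)"
      using complex_norm_square[of q] by (simp add: s_def mult.assoc mult.commute[of "cnj q"])
    also have "t * (cmod q)\<^sup>2 = - (Re p + 1)" using n by (simp add: t_def)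
    finally have "Re (s * q) = - (Re p + 1)" by simp
    moreover have "cnj s * r = cnj (s * q)" using r by simp
    hence "Re (cnj s * r) = Re (s * q)" by (simp only: cnj.sel)
    ultimately have "Re (p + s * q + cnj s * r) = - Re p - 2" by simp
    moreover have "Re p \<ge> 0" using *(2)[of 0] by simp
    ultimately show False using *(2)[of s] by linarith
  qed
  thus "\<tau> (b\<^sup>\<star> \<boxtimes> a) = 0" "\<tau> (a\<^sup>\<star> \<boxtimes> b) = 0" using r by (auto simp: q_def r_def)
qed

end

section \<open>Comparison of two C*-norms\<close>

context star_alg
begin

text \<open>This is \<open>(1 + a) ^ k - 1\<close>, written without a unit. For \<open>a = \<i>h/k\<close> it approximates
  \<open>exp(\<i>h) - 1\<close>.\<close>

primrec shifted_power :: "'a \<Rightarrow> nat \<Rightarrow> 'a" where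
  "shifted_power a 0 = \<zero>\<zero>"
| "shifted_power a (Suc k) = shifted_power a k \<boxplus> (a \<boxplus> shifted_power a k \<boxtimes> a)"

lemma shifted_power_closed [simp, intro]: "a \<in> carrier A \<Longrightarrow> shifted_power a k \<in> carrier A"
  by (induction k) auto

text \<open>The defect \<open>(1 + v)\<^sup>* (1 + v) - 1\<close> from unitarity.\<close>

definition defect :: "'a \<Rightarrow> 'a" where
  "defect v = v\<^sup>\<star> \<boxtimes> v \<boxplus> (v \<boxplus> v\<^sup>\<star>)"

lemma defect_closed [simp, intro]: "v \<in> carrier A \<Longrightarrow> defect v \<in> carrier A"
  by (simp add: defect_def)

text \<open>This is the expansion of \<open>(1 + a)\<^sup>*(1 + d)(1 + a) - 1\<close> with \<open>d\<close> the defect of \<open>v\<close>.\<close>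

lemma defect_step:
  assumes v: "v \<in> carrier A" and a: "a \<in> carrier A"
  shows "defect (v \<boxplus> (a \<boxplus> v \<boxtimes> a)) =
    (a\<^sup>\<star> \<boxplus> a) \<boxplus> (a\<^sup>\<star> \<boxtimes> a \<boxplus> (defect v \<boxplus> (a\<^sup>\<star> \<boxtimes> defect v \<boxplus> (defect v \<boxtimes> a \<boxplus> a\<^sup>\<star> \<boxtimes> (defect v \<boxtimes> a)))))"
  using v a by (simp add: defect_def star_add star_mult distrib_left distrib_right mult_assoc add_ac)

end

locale two_cstar_norms = star_alg A + full: pre_cstar A N + red: pre_cstar A R
  for A :: "'a star_algebra" and N R :: "'a \<Rightarrow> real" +
  assumes R_le_N: "a \<in> carrier A \<Longrightarrow> R a \<le> N a"
begin

text \<open>As \<open>a\<close> is skew, \<open>(1 + a)\<^sup>*(1 + a) = 1 + a\<^sup>*a\<close>; a step therefore adds only the quadratic term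
  \<open>\<parallel>a\<parallel>\<^sup>2\<close> and multiplies the old defect by at most \<open>(1 + \<parallel>a\<parallel>)\<^sup>2\<close>. For \<open>\<parallel>a\<parallel>\<close> of order \<open>1/k\<close> the bound
  is of order \<open>1/k\<close>.\<close>

lemma defect_bound:
  assumes a: "a \<in> carrier A" and skew: "a\<^sup>\<star> = (-1) \<odot> a"
  shows "N (defect (shifted_power a k)) \<le> real k * (N a)\<^sup>2 * (1 + N a) ^ (2 * k)"
proof (induction k)
  case 0
  show ?case by (simp add: defect_def star_zero mult_zero_left zero_add full.N_zero)
next
  case (Suc k)
  define v where "v = shifted_power a k"
  define d where "d = defect v"
  define t where "t = N a"
  have v: "v \<in> carrier A" and d: "d \<in> carrier A" using a by (auto simp: v_def d_def)
  have t: "t \<ge> 0" using a by (simp add: t_def full.N_nonneg)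
  have Nd: "0 \<le> N d" using d by (rule full.N_nonneg)
  have Nas: "N (a\<^sup>\<star>) = t" using a by (simp add: t_def full.N_star)
  have "a\<^sup>\<star> \<boxplus> a = \<zero>\<zero>" using a skew by (simp add: scale_minus_add)
  hence "defect (shifted_power a (Suc k)) =
      a\<^sup>\<star> \<boxtimes> a \<boxplus> (d \<boxplus> (a\<^sup>\<star> \<boxtimes> d \<boxplus> (d \<boxtimes> a \<boxplus> a\<^sup>\<star> \<boxtimes> (d \<boxtimes> a))))"
    using defect_step[OF v a] a d by (simp add: zero_add flip: v_def d_def)
  also have "N \<dots> \<le> N (a\<^sup>\<star> \<boxtimes> a) + (N d + (N (a\<^sup>\<star> \<boxtimes> d) + (N (d \<boxtimes> a) + N (a\<^sup>\<star> \<boxtimes> (d \<boxtimes> a)))))"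
    using a d by (intro order_trans[OF full.N_add] add_left_mono) auto
  also have "\<dots> \<le> t\<^sup>2 + (N d + (t * N d + (N d * t + t * (N d * t))))"
  proof (intro add_mono order_refl)
    show "N (a\<^sup>\<star> \<boxtimes> a) \<le> t\<^sup>2" using full.N_star_mult[OF a] by (simp add: t_def)
    show "N (a\<^sup>\<star> \<boxtimes> d) \<le> t * N d" using full.N_mult[of "a\<^sup>\<star>" d] a d Nas by simp
    show da: "N (d \<boxtimes> a) \<le> N d * t" using full.N_mult[of d a] a d by (simp add: t_def)
    show "N (a\<^sup>\<star> \<boxtimes> (d \<boxtimes> a)) \<le> t * (N d * t)"
      using full.N_mult[of "a\<^sup>\<star>" "d \<boxtimes> a"] a d Nas mult_left_mono[OF da t] by simp
  qed
  also have "\<dots> = t\<^sup>2 + (1 + t)\<^sup>2 * N d" by (simp add: power2_eq_square algebra_simps)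
  also have "\<dots> \<le> t\<^sup>2 * (1 + t) ^ (2 * Suc k) + (1 + t)\<^sup>2 * (real k * t\<^sup>2 * (1 + t) ^ (2 * k))"
    using Suc.IH t one_le_power[of "1 + t" "2 * Suc k"] unfolding d_def v_def t_def
    by (intro add_mono mult_left_mono) (auto simp: mult_le_cancel_left1)
  also have "\<dots> = real (Suc k) * t\<^sup>2 * (1 + t) ^ (2 * Suc k)"
    by (simp add: power2_eq_square algebra_simps)
  finally show ?case unfolding t_def .
qed

text \<open>The binomial expansion is majorized by the one of \<open>(1 + \<parallel>a\<parallel>)\<^sup>k\<close>.\<close>

lemma shifted_power_linear:
  assumes a: "a \<in> carrier A"
  shows "R (shifted_power a k) \<le> (1 + R a) ^ k - 1"
    and "R (shifted_power a k \<boxminus> of_nat k \<odot> a) \<le> (1 + R a) ^ k - 1 - real k * R a"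
proof (induction k)
  case 0
  show "R (shifted_power a 0) \<le> (1 + R a) ^ 0 - 1" by (simp add: red.N_zero)
  show "R (shifted_power a 0 \<boxminus> of_nat 0 \<odot> a) \<le> (1 + R a) ^ 0 - 1 - real 0 * R a"
    using a by (simp add: scale_0 diff_self red.N_zero)
next
  case (Suc k)
  define v where "v = shifted_power a k"
  have v: "v \<in> carrier A" using a by (simp add: v_def)
  have r: "R a \<ge> 0" using a by (rule red.N_nonneg)
  have va: "R (v \<boxtimes> a) \<le> ((1 + R a) ^ k - 1) * R a"
    using red.N_mult[OF v a] mult_right_mono[OF Suc(1) r] by (simp add: v_def)
  have "R (v \<boxplus> (a \<boxplus> v \<boxtimes> a)) \<le> R v + (R a + R (v \<boxtimes> a))"
    using a v by (intro order_trans[OF red.N_add] add_left_mono) auto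
  also have "\<dots> \<le> ((1 + R a) ^ k - 1) + (R a + ((1 + R a) ^ k - 1) * R a)"
    using Suc(1) va by (simp add: v_def)
  finally show "R (shifted_power a (Suc k)) \<le> (1 + R a) ^ Suc k - 1"
    by (simp add: v_def algebra_simps)
  have "(v \<boxplus> (a \<boxplus> v \<boxtimes> a)) \<boxminus> of_nat (Suc k) \<odot> a =
      (v \<boxplus> (a \<boxplus> v \<boxtimes> a)) \<boxminus> (of_nat k \<odot> a \<boxplus> (a \<boxplus> \<zero>\<zero>))"
    using a by (simp add: scale_add_left scale_one add_zero add.commute[of 1] add_commute)
  also have "\<dots> = (v \<boxminus> of_nat k \<odot> a) \<boxplus> v \<boxtimes> a"
    using a v by (simp add: diff_add_add diff_self zero_add) (simp add: sa_diff_def scale_zero add_zero)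
  finally have "R ((v \<boxplus> (a \<boxplus> v \<boxtimes> a)) \<boxminus> of_nat (Suc k) \<odot> a) \<le> R (v \<boxminus> of_nat k \<odot> a) + R (v \<boxtimes> a)"
    using a v red.N_add[of "v \<boxminus> of_nat k \<odot> a" "v \<boxtimes> a"] by simp
  also have "\<dots> \<le> ((1 + R a) ^ k - 1 - real k * R a) + ((1 + R a) ^ k - 1) * R a"
    using Suc(2) va unfolding v_def by linarith
  finally show "R (shifted_power a (Suc k) \<boxminus> of_nat (Suc k) \<odot> a)
      \<le> (1 + R a) ^ Suc k - 1 - real (Suc k) * R a"
    by (simp add: v_def algebra_simps)
qed

lemma power_le_exp: "0 \<le> x \<Longrightarrow> n > 0 \<Longrightarrow> (1 + x / real n) ^ n \<le> exp x"
  using exp_ge_one_plus_x_over_n_power_n[of n x] by (simp add: order_trans[of "- real n" 0])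

text \<open>A truncation: the norm \<open>N h\<close> may be arbitrarily large, but \<open>b\<close> is bounded by a constant and agrees
  with \<open>h\<close> to second order in the smaller norm. In the limit \<open>b\<close> is \<open>(exp(\<i>h) - 1)/\<i>\<close>. The bound holds since
  \<open>v = exp(\<i>h) - 1\<close> satisfies \<open>v\<^sup>*v = - (v + v\<^sup>*)\<close>, whence \<open>\<parallel>v\<parallel>\<^sup>2 \<le> 2 \<parallel>v\<parallel>\<close>; a defect of norm at most
  \<open>3\<close> still gives \<open>\<parallel>v\<parallel> \<le> 3\<close>.\<close>

lemma approx_selfadjoint:
  assumes h: "h \<in> carrier A" "h\<^sup>\<star> = h" and r: "R h \<le> r" "r \<le> 1"
  shows "\<exists>b\<in>carrier A. N b \<le> 3 \<and> R (h \<boxminus> b) \<le> r\<^sup>2"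
proof -
  define M where "M = N h"
  have M: "M \<ge> 0" using h by (simp add: M_def full.N_nonneg)
  have r0: "0 \<le> R h" using h by (simp add: red.N_nonneg)
  obtain n where n: "real n > M\<^sup>2 * exp (2 * M) + 1" using reals_Archimedean2 by blast
  moreover have "M\<^sup>2 * exp (2 * M) + 1 > 0" by (simp add: add_nonneg_pos)
  ultimately have n0: "n > 0" "real n > 0" by (auto intro!: Nat.gr0I)
  define a where "a = (\<i> / of_nat n) \<odot> h"
  define v where "v = shifted_power a n"
  have a: "a \<in> carrier A" and v: "v \<in> carrier A" using h by (auto simp: a_def v_def)
  have skew: "a\<^sup>\<star> = (-1) \<odot> a" using h by (simp add: a_def star_scale scale_scale)
  have Na: "N a = M / real n" using h by (simp add: a_def full.N_scale M_def norm_divide)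
  have Ra: "R a = R h / real n" using h by (simp add: a_def red.N_scale norm_divide)
  have "N (defect v) \<le> real n * (M / real n)\<^sup>2 * ((1 + M / real n) ^ n)\<^sup>2"
    using defect_bound[OF a skew, of n] by (simp add: v_def Na power_mult mult.commute[of 2])
  also have "\<dots> \<le> real n * (M / real n)\<^sup>2 * (exp M)\<^sup>2"
    using M n0 by (intro mult_left_mono power_mono power_le_exp) auto
  also have "\<dots> = M\<^sup>2 * exp (2 * M) / real n"
    using n0 by (simp add: power2_eq_square exp_add[symmetric])
  also have "\<dots> \<le> 3" using n n0 by (simp add: divide_le_eq)
  finally have d: "N (defect v) \<le> 3" .
  have Nv: "N v \<le> 3"
  proof (rule ccontr)
    assume "\<not> N v \<le> 3"
    have "v\<^sup>\<star> \<boxtimes> v = defect v \<boxminus> (v \<boxplus> v\<^sup>\<star>)"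
      using v add_diff_cancel_left[of "v \<boxplus> v\<^sup>\<star>" "v\<^sup>\<star> \<boxtimes> v"] add_commute[of "v \<boxplus> v\<^sup>\<star>" "v\<^sup>\<star> \<boxtimes> v"]
      by (simp add: defect_def)
    hence "(N v)\<^sup>2 \<le> N (defect v) + N (v \<boxplus> v\<^sup>\<star>)"
      using v full.N_star_mult[OF v] full.N_diff_le[of "defect v" "v \<boxplus> v\<^sup>\<star>"] by simp
    also have "\<dots> \<le> 3 + (N v + N v)"
      using d v full.N_add[of v "v\<^sup>\<star>"] by (simp add: full.N_star)
    finally have "N v * N v \<le> 3 + 2 * N v" by (simp add: power2_eq_square)
    moreover have "N v * N v > 3 * N v" using \<open>\<not> N v \<le> 3\<close> by simp
    ultimately show False using \<open>\<not> N v \<le> 3\<close> by linarith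
  qed
  define b where "b = (-\<i>) \<odot> v"
  have "of_nat n \<odot> a = \<i> \<odot> h" using n0 h by (simp add: a_def scale_scale)
  hence "h \<boxminus> b = (-\<i>) \<odot> (of_nat n \<odot> a \<boxminus> v)"
    using h v diff_scale[of "\<i> \<odot> h" v "-\<i>"] by (simp add: b_def scale_scale scale_one)
  hence "R (h \<boxminus> b) = R (v \<boxminus> of_nat n \<odot> a)"
    using a v by (simp add: red.N_scale red.N_diff_commute)
  also have "\<dots> \<le> (1 + R h / real n) ^ n - 1 - R h"
    using shifted_power_linear(2)[OF a, of n] n0 by (simp add: v_def Ra)
  also have "\<dots> \<le> exp (R h) - 1 - R h" using power_le_exp[OF r0 n0(1)] by simp
  also have "\<dots> \<le> (R h)\<^sup>2" using exp_bound[of "R h"] r r0 by simp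
  also have "\<dots> \<le> r\<^sup>2" using r r0 by (simp add: power_mono)
  finally have "R (h \<boxminus> b) \<le> r\<^sup>2" .
  moreover have "N b \<le> 3" using v Nv by (simp add: b_def full.N_scale)
  ultimately show ?thesis using v by (auto simp: b_def)
qed

text \<open>The real and the imaginary part of \<open>a / (4 c)\<close> have reduced norm at most \<open>1/4\<close>, so that the second
  order errors add up to \<open>2/16\<close>, which is half of \<open>1/4\<close>.\<close>

lemma approx_half:
  assumes a: "a \<in> carrier A" and c: "R a \<le> c" "c > 0"
  shows "\<exists>b\<in>carrier A. N b \<le> 24 * c \<and> R (a \<boxminus> b) \<le> c / 2"
proof -
  define s :: complex where "s = of_real (1 / (8 * c))"
  have s: "cmod s = 1 / (8 * c)" using c by (simp add: s_def norm_divide norm_mult)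
  define x where "x = s \<odot> (a \<boxplus> a\<^sup>\<star>)"
  define y where "y = (-\<i> * s) \<odot> (a \<boxminus> a\<^sup>\<star>)"
  have xy: "x \<in> carrier A" "y \<in> carrier A" using a by (auto simp: x_def y_def)
  have "x\<^sup>\<star> = x" using a by (simp add: x_def s_def star_scale star_add star_star add_commute)
  moreover have "R x \<le> 1 / 4"
  proof -
    have "R x \<le> cmod s * (R a + R a)"
      using a red.N_add[of a "a\<^sup>\<star>"] by (simp add: x_def red.N_scale red.N_star mult_left_mono)
    also have "\<dots> \<le> 1 / (8 * c) * (c + c)" unfolding s using c by (intro mult_left_mono) auto
    finally show ?thesis using c by simp
  qed
  ultimately obtain bx where bx: "bx \<in> carrier A" "N bx \<le> 3" "R (x \<boxminus> bx) \<le> (1 / 4)\<^sup>2"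
    using approx_selfadjoint[OF xy(1)] by (metis divide_le_eq_1 one_le_numeral order_less_le zero_less_numeral)
  have "y\<^sup>\<star> = y" using a diff_swap[of a "a\<^sup>\<star>"]
    by (simp add: y_def s_def star_scale star_star scale_scale flip: diff_star)
  moreover have "R y \<le> 1 / 4"
  proof -
    have "R y \<le> cmod s * (R a + R a)"
      using a red.N_diff_le[of a "a\<^sup>\<star>"]
      by (simp add: y_def red.N_scale red.N_star mult_left_mono norm_mult)
    also have "\<dots> \<le> 1 / (8 * c) * (c + c)" unfolding s using c by (intro mult_left_mono) auto
    finally show ?thesis using c by simp
  qed
  ultimately obtain bz where bz: "bz \<in> carrier A" "N bz \<le> 3" "R (y \<boxminus> bz) \<le> (1 / 4)\<^sup>2"
    using approx_selfadjoint[OF xy(2)] by (metis divide_le_eq_1 one_le_numeral order_less_le zero_less_numeral)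
  have "x \<boxplus> \<i> \<odot> y = s \<odot> ((a \<boxplus> a\<^sup>\<star>) \<boxplus> (a \<boxminus> a\<^sup>\<star>))"
    using a by (simp add: x_def y_def scale_scale scale_add_right mult.assoc[symmetric])
  also have "(a \<boxplus> a\<^sup>\<star>) \<boxplus> (a \<boxminus> a\<^sup>\<star>) = a \<boxplus> (a\<^sup>\<star> \<boxplus> (a \<boxminus> a\<^sup>\<star>))"
    using a by (simp add: add_assoc)
  also have "\<dots> = 2 \<odot> a" using a scale_add_left[of a 1 1] by (simp add: add_diff_cancel scale_one)
  finally have sum: "x \<boxplus> \<i> \<odot> y = (2 * s) \<odot> a" using a by (simp add: scale_scale mult.commute)
  define b where "b = of_real (4 * c) \<odot> (bx \<boxplus> \<i> \<odot> bz)"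
  have b: "b \<in> carrier A" using bx bz by (simp add: b_def)
  have a_eq: "a = of_real (4 * c) \<odot> (x \<boxplus> \<i> \<odot> y)"
    unfolding sum using a c by (simp add: scale_scale s_def scale_one)
  have diff_eq: "a \<boxminus> b = of_real (4 * c) \<odot> ((x \<boxminus> bx) \<boxplus> \<i> \<odot> (y \<boxminus> bz))"
    using bx bz xy unfolding b_def by (subst a_eq) (simp add: diff_scale diff_add_add)
  have "R ((x \<boxminus> bx) \<boxplus> \<i> \<odot> (y \<boxminus> bz)) \<le> (1/4)\<^sup>2 + (1/4)\<^sup>2"
    using bx bz xy red.N_add[of "x \<boxminus> bx" "\<i> \<odot> (y \<boxminus> bz)"] by (simp add: red.N_scale)
  hence "R (a \<boxminus> b) \<le> 4 * c * ((1/4)\<^sup>2 + (1/4)\<^sup>2)"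
    using bx bz xy c unfolding diff_eq by (simp add: red.N_scale mult_left_mono norm_mult)
  hence "R (a \<boxminus> b) \<le> c / 2" by (simp add: power2_eq_square)
  moreover have "N (bx \<boxplus> \<i> \<odot> bz) \<le> 3 + 3"
    using bx bz full.N_add[of bx "\<i> \<odot> bz"] by (simp add: full.N_scale)
  hence "N b \<le> 4 * c * (3 + 3)"
    using bx bz c unfolding b_def by (simp add: full.N_scale mult_left_mono norm_mult)
  ultimately show ?thesis using b by auto
qed

text \<open>The geometric series obtained by applying the previous lemma to the successive errors.\<close>

lemma approx_bounded:
  assumes a: "a \<in> carrier A" and c: "R a \<le> c" "c > 0" and e: "e > 0"
  shows "\<exists>b\<in>carrier A. N b \<le> 48 * c \<and> R (a \<boxminus> b) < e"
proof -
  have *: "\<exists>b\<in>carrier A. N b \<le> 48 * c * (1 - (1/2)^k) \<and> R (a \<boxminus> b) \<le> c * (1/2)^k" for k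
  proof (induction k)
    case 0
    show ?case using a c by (intro bexI[of _ "\<zero>\<zero>"]) (auto simp: full.N_zero sa_diff_def scale_zero add_zero)
  next
    case (Suc k)
    then obtain b where b: "b \<in> carrier A" "N b \<le> 48 * c * (1 - (1/2)^k)" "R (a \<boxminus> b) \<le> c * (1/2)^k"
      by blast
    obtain d where d: "d \<in> carrier A" "N d \<le> 24 * (c * (1/2)^k)" "R ((a \<boxminus> b) \<boxminus> d) \<le> c * (1/2)^k / 2"
      using approx_half[OF _ b(3)] a b c by auto
    have "a \<boxminus> (b \<boxplus> d) = (a \<boxminus> b) \<boxminus> d"
      using a b d by (simp add: sa_diff_def scale_add_right add_assoc)
    moreover have "N (b \<boxplus> d) \<le> 48 * c * (1 - (1/2)^k) + 24 * (c * (1/2)^k)"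
      using full.N_add[OF b(1) d(1)] b d by linarith
    ultimately show ?case using b d
      by (intro bexI[of _ "b \<boxplus> d"]) (auto simp: algebra_simps)
  qed
  obtain k where "(1/2)^k < e / c" using real_arch_pow_inv[of "e / c" "1/2"] e c by auto
  hence "c * (1/2)^k < e" using c by (simp add: field_simps)
  moreover obtain b where "b \<in> carrier A" "N b \<le> 48 * c * (1 - (1/2)^k)" "R (a \<boxminus> b) \<le> c * (1/2)^k"
    using * by blast
  moreover have "48 * c * (1 - (1/2)^k) \<le> 48 * c" using c by simp
  ultimately show ?thesis by force
qed

text \<open>Every element of the completion in the smaller norm comes from the completion in the larger norm.
  A rapidly convergent subsequence is replaced by a sequence whose increments are small in both norms.\<close>

lemma cauchy_lift:
  assumes u: "u \<in> carrier red.K"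
  shows "\<exists>v\<in>carrier full.K. (\<lambda>n. R (u n \<boxminus> v n)) \<longlonglongrightarrow> 0"
proof -
  have uc: "u n \<in> carrier A" for n using u by (rule red.cauchy_term)
  have "\<forall>k. \<exists>M. \<forall>m\<ge>M. \<forall>n\<ge>M. R (u m \<boxminus> u n) < (1/2)^k"
    using u by (simp add: red.cauchy_iff)
  then obtain s where s: "\<And>k m n. m \<ge> s k \<Longrightarrow> n \<ge> s k \<Longrightarrow> R (u m \<boxminus> u n) < (1/2)^k" by metis
  \<comment> \<open>A subsequence beyond all the thresholds \<open>s i\<close> with \<open>i \<le> k\<close>.\<close>
  define S where "S k = k + (\<Sum>i\<le>k. s i)" for k
  have Ss: "s k \<le> S k" for k unfolding S_def by (simp add: member_le_sum trans_le_add2)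
  have Smono: "S k \<le> S (Suc k)" and Sk: "k \<le> S k" for k unfolding S_def by simp_all
  \<comment> \<open>The constant is \<open>96 = 48 * 2\<close>: the element to be corrected has reduced norm at most \<open>2 (1/2)\<^sup>k\<close>.\<close>
  have "\<exists>v. \<forall>k. (v k \<in> carrier A \<and> R (u (S k) \<boxminus> v k) \<le> (1/2)^k) \<and> N (v (Suc k) \<boxminus> v k) \<le> 96 * (1/2)^k"
  proof (rule dependent_nat_choice[of "\<lambda>k a. a \<in> carrier A \<and> R (u (S k) \<boxminus> a) \<le> (1/2)^k"
        "\<lambda>k a b. N (b \<boxminus> a) \<le> 96 * (1/2)^k"], goal_cases)
    case 1
    show ?case using uc by (intro exI[of _ "u (S 0)"]) (simp add: diff_self red.N_zero)
  next
    case (2 x k)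
    define a where "a = u (S (Suc k)) \<boxminus> x"
    have x: "x \<in> carrier A" "a \<in> carrier A" using 2 uc by (auto simp: a_def)
    have "R a \<le> R (u (S (Suc k)) \<boxminus> u (S k)) + R (u (S k) \<boxminus> x)"
      unfolding a_def using x uc by (intro red.N_diff_triangle) auto
    also have "R (u (S (Suc k)) \<boxminus> u (S k)) \<le> (1/2)^k"
      using s[of k "S (Suc k)" "S k"] Ss[of k] Smono[of k] by simp
    finally have "R a \<le> 2 * (1/2)^k" using 2 by linarith
    then obtain b where b: "b \<in> carrier A" "N b \<le> 48 * (2 * (1/2)^k)" "R (a \<boxminus> b) < (1/2)^Suc k"
      using approx_bounded[OF x(2), of "2 * (1/2)^k" "(1/2)^Suc k"] by auto
    have "u (S (Suc k)) \<boxminus> (x \<boxplus> b) = a \<boxminus> b"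
      unfolding a_def using x uc b by (simp add: sa_diff_def scale_add_right add_assoc)
    thus ?case using x b
      by (intro exI[of _ "x \<boxplus> b"]) (auto simp: add_diff_cancel_left)
  qed
  then obtain v where v: "\<And>k. v k \<in> carrier A" "\<And>k. R (u (S k) \<boxminus> v k) \<le> (1/2)^k"
    "\<And>k. N (v (Suc k) \<boxminus> v k) \<le> 96 * (1/2)^k" by blast
  have incr: "N (v (k + j) \<boxminus> v k) \<le> 192 * (1/2)^k * (1 - (1/2)^j)" for k j
  proof (induction j)
    case 0
    show ?case using v by (simp add: diff_self full.N_zero)
  next
    case (Suc j)
    have "N (v (k + Suc j) \<boxminus> v k) \<le> N (v (Suc (k + j)) \<boxminus> v (k + j)) + N (v (k + j) \<boxminus> v k)"
      using full.N_diff_triangle[OF v(1) v(1) v(1)] by simp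
    also have "\<dots> \<le> 96 * (1/2)^(k + j) + 192 * (1/2)^k * (1 - (1/2)^j)"
      using v(3)[of "k + j"] Suc by linarith
    also have "\<dots> = 192 * (1/2)^k * (1 - (1/2)^Suc j)" by (simp add: power_add algebra_simps)
    finally show ?case .
  qed
  have bound: "N (v m \<boxminus> v k) \<le> 192 * (1/2)^k" if "m \<ge> k" for m k
  proof -
    have "192 * (1/2)^k * (1 - (1/2)^(m - k)) \<le> 192 * (1/2)^k * (1::real)"
      by (intro mult_left_mono) auto
    thus ?thesis using incr[of k "m - k"] that by (auto intro: order_trans)
  qed
  have "v \<in> carrier full.K"
    unfolding full.cauchy_iff
  proof (intro conjI allI impI)
    fix \<epsilon> :: real assume "\<epsilon> > 0"
    then obtain k where k: "(1/2)^k < \<epsilon> / 384" using real_arch_pow_inv[of "\<epsilon> / 384" "1/2"] by auto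
    have "N (v m \<boxminus> v n) < \<epsilon>" if "m \<ge> k" "n \<ge> k" for m n
      using full.N_diff_triangle[OF v(1)[of m] v(1)[of k] v(1)[of n]] bound[OF that(1)] bound[OF that(2)]
        full.N_diff_commute[OF v(1)[of n] v(1)[of k]] k by linarith
    thus "\<exists>M. \<forall>m\<ge>M. \<forall>n\<ge>M. N (v m \<boxminus> v n) < \<epsilon>" by blast
  qed (rule v)
  moreover have "(\<lambda>n. R (u n \<boxminus> v n)) \<longlonglongrightarrow> 0"
  proof (rule LIMSEQ_I)
    fix e :: real assume "e > 0"
    then obtain k where k: "(1/2)^k < e / 2" using real_arch_pow_inv[of "e / 2" "1/2"] by auto
    have "norm (R (u n \<boxminus> v n) - 0) < e" if n: "n \<ge> max k (s k)" for n
    proof -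
      have "(1/2)^n \<le> (1/2::real)^k" using n by (intro power_decreasing) auto
      moreover have "R (u n \<boxminus> u (S n)) < (1/2)^k" using s[of k n "S n"] n Sk[of n] by auto
      moreover have "R (u n \<boxminus> v n) \<le> R (u n \<boxminus> u (S n)) + R (u (S n) \<boxminus> v n)"
        using uc v by (intro red.N_diff_triangle) auto
      moreover have "0 \<le> R (u n \<boxminus> v n)" using uc v by (intro red.N_nonneg) auto
      ultimately show ?thesis
        unfolding diff_0_right real_norm_def using v(2)[of n] k by linarith
    qed
    thus "\<exists>no. \<forall>n\<ge>no. norm (R (u n \<boxminus> v n) - 0) < e" by blast
  qed
  ultimately show ?thesis by blast
qed

lemma full_cauchy_red: "u \<in> carrier full.K \<Longrightarrow> u \<in> carrier red.K"
  unfolding full.cauchy_iff red.cauchy_iff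
  by (meson R_le_N diff_closed order_le_less_trans)

definition regular :: "(nat \<Rightarrow> 'a) set \<Rightarrow> (nat \<Rightarrow> 'a) set" where
  "regular b = red.cls (rep b)"

text \<open>Since \<open>R \<le> N\<close>, the result does not depend on the representative.\<close>

lemma regular_cls:
  assumes u: "u \<in> carrier full.K"
  shows "regular (full.cls u) = red.cls u"
proof -
  define w where "w = rep (full.cls u)"
  have w: "w \<in> carrier full.K" "full.cls w = full.cls u" using full.rep_cls[OF u] by (auto simp: w_def)
  hence lim: "(\<lambda>n. N (w n \<boxminus> u n)) \<longlonglongrightarrow> 0" using full.cls_eq_iff u by blast
  have "norm (R (w n \<boxminus> u n)) \<le> norm (N (w n \<boxminus> u n)) * 1" for n
    using R_le_N[of "w n \<boxminus> u n"] red.N_nonneg[of "w n \<boxminus> u n"] full.cauchy_term[OF u] full.cauchy_term[OF w(1)]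
    by simp
  hence "(\<lambda>n. R (w n \<boxminus> u n)) \<longlonglongrightarrow> 0"
    by (intro tendsto_0_le[OF lim always_eventually[OF allI]])
  thus ?thesis
    using red.cls_eq_iff[OF full_cauchy_red[OF w(1)] full_cauchy_red[OF u]] by (simp add: regular_def w_def)
qed

lemma regular_emb: "a \<in> carrier A \<Longrightarrow> regular (full.emb a) = red.emb a"
  by (simp add: completion_embed_def regular_cls full.cauchy_const)

lemma regular_hom: "star_hom full.B red.B regular"
  unfolding star_hom_def
  by (auto elim!: full.carrier_cases
      simp: full.B_ops red.B_ops regular_cls full_cauchy_red full.K_closed)

lemma regular_onto: "b \<in> carrier red.B \<Longrightarrow> \<exists>a\<in>carrier full.B. regular a = b"
proof -
  assume "b \<in> carrier red.B"
  then obtain u where u: "u \<in> carrier red.K" "b = red.cls u" by (rule red.carrier_cases)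
  obtain v where v: "v \<in> carrier full.K" "(\<lambda>n. R (u n \<boxminus> v n)) \<longlonglongrightarrow> 0" using cauchy_lift[OF u(1)] by blast
  hence "regular (full.cls v) = b"
    using u red.cls_eq_iff[OF u(1) full_cauchy_red[OF v(1)]] by (simp add: regular_cls)
  thus ?thesis using v by blast
qed

end

section \<open>Arrows\<close>

context etale_groupoid
begin

lemma units_arrows: "x \<in> units G \<Longrightarrow> x \<in> arrows G"
  and src_of_unit: "x \<in> units G \<Longrightarrow> src G x = x"
  by (auto simp: units_def)

lemma arrow_closed [simp]:
  "\<gamma> \<in> arrows G \<Longrightarrow> src G \<gamma> \<in> arrows G" "\<gamma> \<in> arrows G \<Longrightarrow> rng G \<gamma> \<in> arrows G"
  "\<gamma> \<in> arrows G \<Longrightarrow> ginv G \<gamma> \<in> arrows G"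
  "\<lbrakk>\<alpha> \<in> arrows G; \<beta> \<in> arrows G; src G \<alpha> = rng G \<beta>\<rbrakk> \<Longrightarrow> gcomp G \<alpha> \<beta> \<in> arrows G"
  using src_unit rng_unit units_arrows inv_closed comp_closed by (auto simp: composable_def)

lemma src_rng [simp]:
  "\<gamma> \<in> arrows G \<Longrightarrow> src G (src G \<gamma>) = src G \<gamma>" "\<gamma> \<in> arrows G \<Longrightarrow> rng G (src G \<gamma>) = src G \<gamma>"
  "\<gamma> \<in> arrows G \<Longrightarrow> src G (rng G \<gamma>) = rng G \<gamma>" "\<gamma> \<in> arrows G \<Longrightarrow> rng G (rng G \<gamma>) = rng G \<gamma>"
  "\<gamma> \<in> arrows G \<Longrightarrow> src G (ginv G \<gamma>) = rng G \<gamma>" "\<gamma> \<in> arrows G \<Longrightarrow> rng G (ginv G \<gamma>) = src G \<gamma>"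
  "\<lbrakk>\<alpha> \<in> arrows G; \<beta> \<in> arrows G; src G \<alpha> = rng G \<beta>\<rbrakk> \<Longrightarrow> src G (gcomp G \<alpha> \<beta>) = src G \<beta>"
  "\<lbrakk>\<alpha> \<in> arrows G; \<beta> \<in> arrows G; src G \<alpha> = rng G \<beta>\<rbrakk> \<Longrightarrow> rng G (gcomp G \<alpha> \<beta>) = rng G \<alpha>"
  using src_unit rng_unit rng_of_unit src_of_unit src_inv rng_inv src_comp rng_comp
  by (auto simp: composable_def)

lemma gcomp_assoc:
  "\<lbrakk>\<alpha> \<in> arrows G; \<beta> \<in> arrows G; \<gamma> \<in> arrows G; src G \<alpha> = rng G \<beta>; src G \<beta> = rng G \<gamma>\<rbrakk> \<Longrightarrow>
     gcomp G (gcomp G \<alpha> \<beta>) \<gamma> = gcomp G \<alpha> (gcomp G \<beta> \<gamma>)"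
  using comp_assoc by (simp add: composable_def)

lemma gcomp_unit [simp]:
  "\<lbrakk>\<gamma> \<in> arrows G; x = src G \<gamma>\<rbrakk> \<Longrightarrow> gcomp G \<gamma> x = \<gamma>"
  "\<lbrakk>\<gamma> \<in> arrows G; x = rng G \<gamma>\<rbrakk> \<Longrightarrow> gcomp G x \<gamma> = \<gamma>"
  using comp_src comp_rng by auto

lemma inv_gcomp_cancel [simp]:
  "\<lbrakk>\<alpha> \<in> arrows G; \<beta> \<in> arrows G; src G \<alpha> = rng G \<beta>\<rbrakk> \<Longrightarrow> gcomp G (ginv G \<alpha>) (gcomp G \<alpha> \<beta>) = \<beta>"
  using gcomp_assoc[of "ginv G \<alpha>" \<alpha> \<beta>] inv_comp[of \<alpha>] by simp

lemma gcomp_inv_cancel [simp]: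
  "\<lbrakk>\<alpha> \<in> arrows G; \<gamma> \<in> arrows G; rng G \<alpha> = rng G \<gamma>\<rbrakk> \<Longrightarrow> gcomp G \<alpha> (gcomp G (ginv G \<alpha>) \<gamma>) = \<gamma>"
  using gcomp_assoc[of \<alpha> "ginv G \<alpha>" \<gamma>] comp_inv[of \<alpha>] by simp

lemma inv_unit: "x \<in> units G \<Longrightarrow> ginv G x = x"
  using inv_comp[of x] comp_src[of "ginv G x"] units_arrows src_of_unit rng_of_unit
  by (metis src_inv inv_closed)

lemma inverse_unique:
  assumes "\<alpha> \<in> arrows G" "\<beta> \<in> arrows G" "src G \<alpha> = rng G \<beta>" "gcomp G \<alpha> \<beta> = rng G \<alpha>"
  shows "\<beta> = ginv G \<alpha>"
  using inv_gcomp_cancel[OF assms(1-3)] assms by (simp add: src_inv)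

lemma inv_inv [simp]: "\<gamma> \<in> arrows G \<Longrightarrow> ginv G (ginv G \<gamma>) = \<gamma>"
  using inverse_unique[of "ginv G \<gamma>" \<gamma>] inv_comp by simp

lemma inv_gcomp:
  assumes "\<alpha> \<in> arrows G" "\<beta> \<in> arrows G" "src G \<alpha> = rng G \<beta>"
  shows "ginv G (gcomp G \<alpha> \<beta>) = gcomp G (ginv G \<beta>) (ginv G \<alpha>)"
proof -
  have "gcomp G (gcomp G \<alpha> \<beta>) (gcomp G (ginv G \<beta>) (ginv G \<alpha>)) = rng G \<alpha>"
    using assms by (simp add: gcomp_assoc comp_inv)
  thus ?thesis using inverse_unique[of "gcomp G \<alpha> \<beta>" "gcomp G (ginv G \<beta>) (ginv G \<alpha>)"] assms by simp
qed

end

section \<open>Coordinates in the fibres\<close>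

context fell_line_bundle
begin

lemma fibre_arrow: "\<xi> \<in> fibre L \<gamma> \<Longrightarrow> \<gamma> \<in> arrows G"
  using proj_arrow by (auto simp: fibre_def)

lemma fibre_top: "\<xi> \<in> fibre L \<gamma> \<Longrightarrow> \<xi> \<in> topspace (total_top L)" "\<xi> \<in> fibre L \<gamma> \<Longrightarrow> proj L \<xi> = \<gamma>"
  by (auto simp: fibre_def)

lemma bundle_composableI:
  "\<lbrakk>\<xi> \<in> fibre L \<alpha>; \<eta> \<in> fibre L \<beta>; src G \<alpha> = rng G \<beta>\<rbrakk> \<Longrightarrow> (\<xi>, \<eta>) \<in> bundle_composable G L"
  using fibre_arrow by (auto simp: bundle_composable_def composable_def fibre_top)

lemma fibre_props:
  assumes "\<gamma> \<in> arrows G"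
  shows fibre_comm_group: "comm_group (fibre_group L \<gamma>)"
    and bscale_closed: "\<xi> \<in> fibre L \<gamma> \<Longrightarrow> bscale L c \<xi> \<in> fibre L \<gamma>"
    and bscale_one: "\<xi> \<in> fibre L \<gamma> \<Longrightarrow> bscale L 1 \<xi> = \<xi>"
    and bscale_bscale: "\<xi> \<in> fibre L \<gamma> \<Longrightarrow> bscale L c (bscale L d \<xi>) = bscale L (c * d) \<xi>"
    and bscale_add_left: "\<xi> \<in> fibre L \<gamma> \<Longrightarrow> bscale L (c + d) \<xi> = badd L (bscale L c \<xi>) (bscale L d \<xi>)"
    and fibre_generator: "\<exists>e\<in>fibre L \<gamma>. e \<noteq> bzero L \<gamma> \<and> (\<forall>\<xi>\<in>fibre L \<gamma>. \<exists>c. \<xi> = bscale L c e)"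
    and bnorm_nonneg: "\<xi> \<in> fibre L \<gamma> \<Longrightarrow> 0 \<le> bnorm L \<xi>"
    and bnorm_eq_0: "\<xi> \<in> fibre L \<gamma> \<Longrightarrow> bnorm L \<xi> = 0 \<longleftrightarrow> \<xi> = bzero L \<gamma>"
    and bnorm_bscale: "\<xi> \<in> fibre L \<gamma> \<Longrightarrow> bnorm L (bscale L c \<xi>) = cmod c * bnorm L \<xi>"
  using one_dimensional[OF assms] unfolding one_dimensional_banach_fibre_def by blast+

lemma badd_closed: "\<lbrakk>\<xi> \<in> fibre L \<gamma>; \<eta> \<in> fibre L \<gamma>\<rbrakk> \<Longrightarrow> badd L \<xi> \<eta> \<in> fibre L \<gamma>"
  using comm_groupE(1)[OF fibre_comm_group[OF fibre_arrow]] by (auto simp: fibre_group_def)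

lemma bzero_closed: "\<gamma> \<in> arrows G \<Longrightarrow> bzero L \<gamma> \<in> fibre L \<gamma>"
  using comm_groupE(2)[OF fibre_comm_group] by (auto simp: fibre_group_def)

lemma badd_zero: "\<xi> \<in> fibre L \<gamma> \<Longrightarrow> badd L (bzero L \<gamma>) \<xi> = \<xi>"
  using comm_groupE(5)[OF fibre_comm_group[OF fibre_arrow]] by (auto simp: fibre_group_def)

lemma bscale_0: "\<xi> \<in> fibre L \<gamma> \<Longrightarrow> bscale L 0 \<xi> = bzero L \<gamma>"
  using bnorm_bscale[of \<gamma> \<xi> 0] bscale_closed[of \<gamma> \<xi> 0] bnorm_eq_0[of \<gamma> "bscale L 0 \<xi>"] fibre_arrow by auto

lemma bnorm_bzero: "\<gamma> \<in> arrows G \<Longrightarrow> bnorm L (bzero L \<gamma>) = 0"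
  using bnorm_eq_0 bzero_closed by blast

lemma bscale_inject:
  assumes "\<xi> \<in> fibre L \<gamma>" "\<xi> \<noteq> bzero L \<gamma>" "bscale L c \<xi> = bscale L d \<xi>"
  shows "c = d"
proof -
  have \<gamma>: "\<gamma> \<in> arrows G" using fibre_arrow assms by blast
  have "bscale L (c - d) \<xi> = badd L (bscale L c \<xi>) (bscale L (- d) \<xi>)"
    using bscale_add_left[OF \<gamma> assms(1), of c "- d"] by simp
  also have "\<dots> = bscale L (d + - d) \<xi>" using bscale_add_left[OF \<gamma> assms(1), of d "- d"] assms(3) by simp
  finally have "bscale L (c - d) \<xi> = bzero L \<gamma>" using bscale_0 assms(1) by simp
  hence "cmod (c - d) * bnorm L \<xi> = 0" using bnorm_bscale[OF \<gamma> assms(1)] bnorm_bzero[OF \<gamma>] by metis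
  thus ?thesis using assms(2) bnorm_eq_0[OF \<gamma> assms(1)] by auto
qed

lemma generated:
  assumes "e \<in> fibre L \<gamma>" "e \<noteq> bzero L \<gamma>" "\<xi> \<in> fibre L \<gamma>"
  shows "\<exists>c. \<xi> = bscale L c e"
proof -
  have \<gamma>: "\<gamma> \<in> arrows G" using fibre_arrow assms by blast
  obtain g where g: "g \<in> fibre L \<gamma>" "g \<noteq> bzero L \<gamma>" "\<And>\<zeta>. \<zeta> \<in> fibre L \<gamma> \<Longrightarrow> \<exists>c. \<zeta> = bscale L c g"
    using fibre_generator[OF \<gamma>] by blast
  obtain c d where c: "e = bscale L c g" and d: "\<xi> = bscale L d g" using g assms by metis
  have "c \<noteq> 0" using c assms(2) bscale_0[OF g(1)] by auto
  hence "\<xi> = bscale L (d / c) e" using c d bscale_bscale[OF \<gamma> g(1)] by simp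
  thus ?thesis by blast
qed

lemma bmult_closed:
  "\<lbrakk>\<xi> \<in> fibre L \<alpha>; \<eta> \<in> fibre L \<beta>; src G \<alpha> = rng G \<beta>\<rbrakk> \<Longrightarrow> bmult L \<xi> \<eta> \<in> fibre L (gcomp G \<alpha> \<beta>)"
  using mult_fibre fibre_arrow by (simp add: composable_def)

lemma bmult_scale:
  assumes "\<xi> \<in> fibre L \<alpha>" "\<eta> \<in> fibre L \<beta>" "src G \<alpha> = rng G \<beta>"
  shows "bmult L (bscale L c \<xi>) (bscale L d \<eta>) = bscale L (c * d) (bmult L \<xi> \<eta>)"
proof -
  have a: "\<alpha> \<in> arrows G" "\<beta> \<in> arrows G" using assms fibre_arrow by auto
  have "bmult L (bscale L c \<xi>) (bscale L d \<eta>) = bscale L c (bscale L d (bmult L \<xi> \<eta>))"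
    using assms a bundle_composableI bscale_closed mult_scale_left mult_scale_right by metis
  thus ?thesis using bscale_bscale[OF _ bmult_closed[OF assms]] a assms by simp
qed

text \<open>In a one-dimensional algebra spanned by \<open>g\<close>, the product \<open>g g\<close> is a multiple \<open>k g\<close> of \<open>g\<close>. The
  C*-identity forces \<open>k \<noteq> 0\<close>, and \<open>g / k\<close> is the unit.\<close>

lemma fibre_one_exists:
  assumes x: "x \<in> units G"
  shows "\<exists>e. e \<in> fibre L x \<and> bnorm L e = 1 \<and> bstar L e = e \<and>
    (\<forall>\<xi>\<in>fibre L x. bmult L e \<xi> = \<xi> \<and> bmult L \<xi> e = \<xi>)"
proof -
  note xa = units_arrows[OF x] and xs = src_of_unit[OF x] and xr = rng_of_unit[OF x]
  have xx: "gcomp G x x = x" using xa xs by simp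
  have xi: "ginv G x = x" using inv_unit[OF x] .
  obtain g where g: "g \<in> fibre L x" "g \<noteq> bzero L x" using fibre_generator[OF xa] by blast
  note gen = generated[OF g]
  have mc: "bmult L \<xi> \<eta> \<in> fibre L x" if "\<xi> \<in> fibre L x" "\<eta> \<in> fibre L x" for \<xi> \<eta>
    using bmult_closed[OF that] xs xr xx by simp
  have st: "bstar L \<xi> \<in> fibre L x" if "\<xi> \<in> fibre L x" for \<xi> using star_fibre[OF xa that] xi by simp
  have ms: "bmult L (bscale L c g) (bscale L d g) = bscale L (c * d) (bmult L g g)" for c d
    using bmult_scale[OF g(1) g(1)] xs xr by simp
  obtain d where d: "bstar L g = bscale L d g" using gen[OF st[OF g(1)]] by blast
  obtain k where k: "bmult L g g = bscale L k g" using gen[OF mc[OF g(1) g(1)]] by blast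
  have "bmult L (bstar L g) g = bscale L (d * k) g"
    using ms[of d 1] d k bscale_one[OF xa g(1)] bscale_bscale[OF xa g(1)] by simp
  hence "(bnorm L g)\<^sup>2 = cmod (d * k) * bnorm L g"
    using norm_star_mult[OF fibre_top(1)[OF g(1)]] bnorm_bscale[OF xa g(1)] by simp
  moreover have ng: "bnorm L g \<noteq> 0" using bnorm_eq_0[OF xa g(1)] g(2) by blast
  ultimately have "k \<noteq> 0" by auto
  define e where "e = bscale L (1 / k) g"
  have e: "e \<in> fibre L x" using bscale_closed[OF xa g(1)] by (simp add: e_def)
  have id: "bmult L e \<xi> = \<xi> \<and> bmult L \<xi> e = \<xi>" if \<xi>: "\<xi> \<in> fibre L x" for \<xi>
  proof -
    obtain c where c: "\<xi> = bscale L c g" using gen[OF \<xi>] by blast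
    show ?thesis unfolding e_def c ms k using \<open>k \<noteq> 0\<close> by (simp add: bscale_bscale[OF xa g(1)])
  qed
  have comp: "(\<xi>, \<eta>) \<in> bundle_composable G L" if "\<xi> \<in> fibre L x" "\<eta> \<in> fibre L x" for \<xi> \<eta>
    using bundle_composableI[OF that] xs xr by simp
  have "bstar L e = bmult L e (bstar L e)" using id st[OF e] by simp
  also have "\<dots> = bstar L (bmult L e (bstar L e))"
    using star_mult[OF comp[OF e st[OF e]]] star_star[OF fibre_top(1)[OF e]] by simp
  also have "\<dots> = e" using id st[OF e] star_star[OF fibre_top(1)[OF e]] by simp
  finally have se: "bstar L e = e" .
  have "(bnorm L e)\<^sup>2 = bnorm L e"
    using norm_star_mult[OF fibre_top(1)[OF e]] se id[OF e] by simp
  moreover have "bnorm L e \<noteq> 0" using bnorm_bscale[OF xa g(1), of "1 / k"] ng \<open>k \<noteq> 0\<close> by (simp add: e_def)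
  ultimately have "bnorm L e = 1" by (simp add: power2_eq_square)
  thus ?thesis using e se id by blast
qed

lemma fibre_one:
  assumes x: "x \<in> units G"
  shows "fibre_one L x \<in> fibre L x" "bnorm L (fibre_one L x) = 1" "bstar L (fibre_one L x) = fibre_one L x"
    and "\<xi> \<in> fibre L x \<Longrightarrow> bmult L (fibre_one L x) \<xi> = \<xi>"
    and "\<xi> \<in> fibre L x \<Longrightarrow> bmult L \<xi> (fibre_one L x) = \<xi>"
proof -
  obtain e where e: "e \<in> fibre L x" "bnorm L e = 1" "bstar L e = e"
    "\<And>\<xi>. \<xi> \<in> fibre L x \<Longrightarrow> bmult L e \<xi> = \<xi> \<and> bmult L \<xi> e = \<xi>"
    using fibre_one_exists[OF x] by blast
  have "fibre_one L x = e"
    unfolding fibre_one_def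
  proof (rule the_equality)
    show "e' = e" if "e' \<in> fibre L x \<and> (\<forall>\<xi>\<in>fibre L x. bmult L e' \<xi> = \<xi> \<and> bmult L \<xi> e' = \<xi>)" for e'
      using that e by metis
  qed (use e in auto)
  thus "fibre_one L x \<in> fibre L x" "bnorm L (fibre_one L x) = 1" "bstar L (fibre_one L x) = fibre_one L x"
    "\<xi> \<in> fibre L x \<Longrightarrow> bmult L (fibre_one L x) \<xi> = \<xi>"
    "\<xi> \<in> fibre L x \<Longrightarrow> bmult L \<xi> (fibre_one L x) = \<xi>"
    using e by auto
qed

text \<open>A unit vector in each fibre, chosen without any continuity. Over a unit it is the unit of the fibre,
  so that coordinates agree there with \<^const>\<open>fibre_value\<close>.\<close>

definition unit_vec :: "'g \<Rightarrow> 'l" where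
  "unit_vec \<gamma> = (if \<gamma> \<in> units G then fibre_one L \<gamma> else SOME e. e \<in> fibre L \<gamma> \<and> bnorm L e = 1)"

lemma unit_vec:
  assumes "\<gamma> \<in> arrows G"
  shows unit_vec_closed: "unit_vec \<gamma> \<in> fibre L \<gamma>" and bnorm_unit_vec: "bnorm L (unit_vec \<gamma>) = 1"
    and unit_vec_nonzero: "unit_vec \<gamma> \<noteq> bzero L \<gamma>"
proof -
  have "unit_vec \<gamma> \<in> fibre L \<gamma> \<and> bnorm L (unit_vec \<gamma>) = 1"
  proof (cases "\<gamma> \<in> units G")
    case True
    thus ?thesis using fibre_one by (simp add: unit_vec_def)
  next
    case False
    obtain g where g: "g \<in> fibre L \<gamma>" "g \<noteq> bzero L \<gamma>" using fibre_generator[OF assms] by blast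
    hence n: "bnorm L g > 0" using bnorm_nonneg[OF assms g(1)] bnorm_eq_0[OF assms g(1)] by auto
    have "\<exists>e. e \<in> fibre L \<gamma> \<and> bnorm L e = 1"
      using n bscale_closed[OF assms g(1)] bnorm_bscale[OF assms g(1), of "of_real (1 / bnorm L g)"]
      by (intro exI[of _ "bscale L (of_real (1 / bnorm L g)) g"]) (simp add: norm_divide)
    from someI_ex[OF this] False show ?thesis by (simp add: unit_vec_def)
  qed
  thus "unit_vec \<gamma> \<in> fibre L \<gamma>" "bnorm L (unit_vec \<gamma>) = 1" "unit_vec \<gamma> \<noteq> bzero L \<gamma>"
    using bnorm_bzero[OF assms] by auto
qed

definition coord :: "'g \<Rightarrow> 'l \<Rightarrow> complex" where
  "coord \<gamma> \<xi> = (THE c. \<xi> = bscale L c (unit_vec \<gamma>))"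

lemma coord_bscale: "\<gamma> \<in> arrows G \<Longrightarrow> coord \<gamma> (bscale L c (unit_vec \<gamma>)) = c"
  unfolding coord_def using bscale_inject[OF unit_vec_closed unit_vec_nonzero] by blast

lemma bscale_coord: "\<xi> \<in> fibre L \<gamma> \<Longrightarrow> bscale L (coord \<gamma> \<xi>) (unit_vec \<gamma>) = \<xi>"
  using generated[OF unit_vec_closed unit_vec_nonzero, of \<gamma> \<xi>] coord_bscale[of \<gamma>] fibre_arrow[of \<xi> \<gamma>] by auto

lemma coord_eqI: "\<lbrakk>\<xi> \<in> fibre L \<gamma>; \<eta> \<in> fibre L \<gamma>; coord \<gamma> \<xi> = coord \<gamma> \<eta>\<rbrakk> \<Longrightarrow> \<xi> = \<eta>"
  by (metis bscale_coord)

lemma coord_unit_vec: "\<gamma> \<in> arrows G \<Longrightarrow> coord \<gamma> (unit_vec \<gamma>) = 1"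
  using coord_bscale[of \<gamma> 1] bscale_one unit_vec_closed by simp

lemma coord_zero: "\<gamma> \<in> arrows G \<Longrightarrow> coord \<gamma> (bzero L \<gamma>) = 0"
  using coord_bscale[of \<gamma> 0] bscale_0[OF unit_vec_closed] by simp

lemma coord_eq_0: "\<xi> \<in> fibre L \<gamma> \<Longrightarrow> coord \<gamma> \<xi> = 0 \<longleftrightarrow> \<xi> = bzero L \<gamma>"
  using coord_eqI[OF _ bzero_closed] coord_zero fibre_arrow by metis

lemma coord_scale: "\<xi> \<in> fibre L \<gamma> \<Longrightarrow> coord \<gamma> (bscale L c \<xi>) = c * coord \<gamma> \<xi>"
  using bscale_bscale[OF _ unit_vec_closed] coord_bscale bscale_coord fibre_arrow by metis

lemma coord_add: "\<lbrakk>\<xi> \<in> fibre L \<gamma>; \<eta> \<in> fibre L \<gamma>\<rbrakk> \<Longrightarrow> coord \<gamma> (badd L \<xi> \<eta>) = coord \<gamma> \<xi> + coord \<gamma> \<eta>"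
  using bscale_add_left[OF _ unit_vec_closed] coord_bscale bscale_coord fibre_arrow by metis

lemma bnorm_coord: "\<xi> \<in> fibre L \<gamma> \<Longrightarrow> bnorm L \<xi> = cmod (coord \<gamma> \<xi>)"
  using bnorm_bscale[OF _ unit_vec_closed] bnorm_unit_vec bscale_coord fibre_arrow by (metis mult_1_right)

lemma coord_finprod:
  assumes \<gamma>: "\<gamma> \<in> arrows G" and "finite I" "\<And>i. i \<in> I \<Longrightarrow> h i \<in> fibre L \<gamma>"
  shows "finprod (fibre_group L \<gamma>) h I \<in> fibre L \<gamma> \<and>
    coord \<gamma> (finprod (fibre_group L \<gamma>) h I) = (\<Sum>i\<in>I. coord \<gamma> (h i))"
  using assms(2,3)
proof (induction I)
  case empty
  show ?case using \<gamma> coord_zero bzero_closed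
    by (simp add: finprod_def fibre_group_def)
next
  case (insert i I)
  interpret F: comm_group "fibre_group L \<gamma>" by (rule fibre_comm_group[OF \<gamma>])
  have "finprod (fibre_group L \<gamma>) h (insert i I) = badd L (h i) (finprod (fibre_group L \<gamma>) h I)"
    using insert by (subst F.finprod_insert) (auto simp: fibre_group_def)
  thus ?case using insert badd_closed coord_add by simp
qed

definition cocycle :: "'g \<Rightarrow> 'g \<Rightarrow> complex" where
  "cocycle \<alpha> \<beta> = coord (gcomp G \<alpha> \<beta>) (bmult L (unit_vec \<alpha>) (unit_vec \<beta>))"

definition costar :: "'g \<Rightarrow> complex" where
  "costar \<gamma> = coord (ginv G \<gamma>) (bstar L (unit_vec \<gamma>))"

lemma coord_mult:
  assumes "\<xi> \<in> fibre L \<alpha>" "\<eta> \<in> fibre L \<beta>" "src G \<alpha> = rng G \<beta>"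
  shows "coord (gcomp G \<alpha> \<beta>) (bmult L \<xi> \<eta>) = cocycle \<alpha> \<beta> * coord \<alpha> \<xi> * coord \<beta> \<eta>"
proof -
  have a: "\<alpha> \<in> arrows G" "\<beta> \<in> arrows G" using assms fibre_arrow by auto
  note u = unit_vec_closed[OF a(1)] unit_vec_closed[OF a(2)]
  have "bmult L \<xi> \<eta> = bscale L (coord \<alpha> \<xi> * coord \<beta> \<eta>) (bmult L (unit_vec \<alpha>) (unit_vec \<beta>))"
    using bmult_scale[OF u assms(3), of "coord \<alpha> \<xi>" "coord \<beta> \<eta>"] bscale_coord assms by simp
  thus ?thesis using coord_scale[OF bmult_closed[OF u assms(3)]] by (simp add: cocycle_def)
qed

lemma coord_star:
  assumes "\<xi> \<in> fibre L \<gamma>"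
  shows "coord (ginv G \<gamma>) (bstar L \<xi>) = costar \<gamma> * cnj (coord \<gamma> \<xi>)"
proof -
  have a: "\<gamma> \<in> arrows G" using assms fibre_arrow by auto
  have "bstar L \<xi> = bscale L (cnj (coord \<gamma> \<xi>)) (bstar L (unit_vec \<gamma>))"
    using star_scale[OF fibre_top(1)[OF unit_vec_closed[OF a]], of "coord \<gamma> \<xi>"] bscale_coord[OF assms] by simp
  thus ?thesis using coord_scale[OF star_fibre[OF a unit_vec_closed[OF a]]] by (simp add: costar_def)
qed

lemma bstar_closed: "\<xi> \<in> fibre L \<gamma> \<Longrightarrow> bstar L \<xi> \<in> fibre L (ginv G \<gamma>)"
  using star_fibre fibre_arrow by blast

lemma unit_vec_unit: "x \<in> units G \<Longrightarrow> unit_vec x = fibre_one L x"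
  by (simp add: unit_vec_def)

lemma fibre_value_coord: "\<lbrakk>x \<in> units G; \<xi> \<in> fibre L x\<rbrakk> \<Longrightarrow> fibre_value L x \<xi> = coord x \<xi>"
  by (simp add: fibre_value_def coord_def unit_vec_unit)

lemma cocycle_assoc:
  assumes "\<alpha> \<in> arrows G" "\<beta> \<in> arrows G" "\<gamma> \<in> arrows G" "src G \<alpha> = rng G \<beta>" "src G \<beta> = rng G \<gamma>"
  shows "cocycle \<alpha> \<beta> * cocycle (gcomp G \<alpha> \<beta>) \<gamma> = cocycle \<alpha> (gcomp G \<beta> \<gamma>) * cocycle \<beta> \<gamma>"
proof -
  note u = assms(1-3)[THEN unit_vec_closed]
  have "bmult L (bmult L (unit_vec \<alpha>) (unit_vec \<beta>)) (unit_vec \<gamma>) =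
        bmult L (unit_vec \<alpha>) (bmult L (unit_vec \<beta>) (unit_vec \<gamma>))"
    using mult_assoc bundle_composableI u assms by blast
  moreover have "coord (gcomp G (gcomp G \<alpha> \<beta>) \<gamma>) (bmult L (bmult L (unit_vec \<alpha>) (unit_vec \<beta>)) (unit_vec \<gamma>))
      = cocycle (gcomp G \<alpha> \<beta>) \<gamma> * cocycle \<alpha> \<beta>"
    using coord_mult[OF bmult_closed[OF u(1,2) assms(4)] u(3)] assms
    by (simp add: coord_unit_vec flip: cocycle_def)
  moreover have "coord (gcomp G \<alpha> (gcomp G \<beta> \<gamma>)) (bmult L (unit_vec \<alpha>) (bmult L (unit_vec \<beta>) (unit_vec \<gamma>)))
      = cocycle \<alpha> (gcomp G \<beta> \<gamma>) * cocycle \<beta> \<gamma>"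
    using coord_mult[OF u(1) bmult_closed[OF u(2,3) assms(5)]] assms
    by (simp add: coord_unit_vec flip: cocycle_def)
  ultimately show ?thesis using assms by (simp add: gcomp_assoc mult.commute)
qed

text \<open>Positivity of \<open>\<xi>\<^sup>*\<xi>\<close> excludes the other scalars of modulus one.\<close>

lemma star_mult_unit_vec:
  assumes "\<gamma> \<in> arrows G"
  shows "bmult L (bstar L (unit_vec \<gamma>)) (unit_vec \<gamma>) = fibre_one L (src G \<gamma>)"
proof -
  note u = unit_vec_closed[OF assms] and ut = fibre_top[OF unit_vec_closed[OF assms]]
  have x: "src G \<gamma> \<in> units G" using src_unit[OF assms] .
  note xa = units_arrows[OF x]
  obtain \<eta> where \<eta>: "\<eta> \<in> fibre L (src G \<gamma>)"
    "bmult L (bstar L (unit_vec \<gamma>)) (unit_vec \<gamma>) = bmult L (bstar L \<eta>) \<eta>"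
    using star_positive[OF ut(1)] ut(2) by auto
  define c where "c = coord (src G \<gamma>) \<eta>"
  have \<eta>c: "\<eta> = bscale L c (fibre_one L (src G \<gamma>))"
    using bscale_coord[OF \<eta>(1)] unit_vec_unit[OF x] by (simp add: c_def)
  have "bmult L (bstar L \<eta>) \<eta> = bmult L (bscale L (cnj c) (fibre_one L (src G \<gamma>))) (bscale L c (fibre_one L (src G \<gamma>)))"
    unfolding \<eta>c using star_scale[OF fibre_top(1)[OF fibre_one(1)[OF x]]] fibre_one(3)[OF x] by simp
  also have "\<dots> = bscale L (cnj c * c) (fibre_one L (src G \<gamma>))"
    using bmult_scale[OF fibre_one(1)[OF x] fibre_one(1)[OF x]] assms fibre_one(4)[OF x fibre_one(1)[OF x]] by simp
  finally have eq: "bmult L (bstar L (unit_vec \<gamma>)) (unit_vec \<gamma>) = bscale L (cnj c * c) (fibre_one L (src G \<gamma>))"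
    using \<eta> by simp
  have "1 = cmod (cnj c * c)"
    using norm_star_mult[OF ut(1)] bnorm_unit_vec[OF assms] bnorm_bscale[OF xa fibre_one(1)[OF x]]
      fibre_one(2)[OF x] eq by simp
  hence "(cmod c)\<^sup>2 = 1" by (simp add: Real_Vector_Spaces.norm_mult power2_eq_square)
  hence "cnj c * c = 1" using complex_norm_square[of c] by (simp add: mult.commute)
  thus ?thesis using eq bscale_one[OF xa fibre_one(1)[OF x]] by simp
qed

lemma cocycle_star: "\<gamma> \<in> arrows G \<Longrightarrow> cocycle (ginv G \<gamma>) \<gamma> * costar \<gamma> = 1"
proof -
  assume \<gamma>: "\<gamma> \<in> arrows G"
  note u = unit_vec_closed[OF \<gamma>]
  have "coord (gcomp G (ginv G \<gamma>) \<gamma>) (bmult L (bstar L (unit_vec \<gamma>)) (unit_vec \<gamma>))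
      = cocycle (ginv G \<gamma>) \<gamma> * costar \<gamma>"
    using coord_mult[OF bstar_closed[OF u] u] \<gamma> by (simp add: coord_unit_vec costar_def)
  thus ?thesis
    using star_mult_unit_vec[OF \<gamma>] \<gamma> coord_unit_vec[of "src G \<gamma>"] unit_vec_unit[OF src_unit[OF \<gamma>]]
    by (simp add: inv_comp)
qed

lemma costar_inv: "\<gamma> \<in> arrows G \<Longrightarrow> costar (ginv G \<gamma>) * cnj (costar \<gamma>) = 1"
proof -
  assume \<gamma>: "\<gamma> \<in> arrows G"
  note u = unit_vec_closed[OF \<gamma>]
  have "coord (ginv G (ginv G \<gamma>)) (bstar L (bstar L (unit_vec \<gamma>))) = costar (ginv G \<gamma>) * cnj (costar \<gamma>)"
    using coord_star[OF bstar_closed[OF u]] by (simp add: costar_def)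
  thus ?thesis using \<gamma> star_star[OF fibre_top(1)[OF u]] coord_unit_vec by simp
qed

lemma costar_mult:
  assumes "\<alpha> \<in> arrows G" "\<beta> \<in> arrows G" "src G \<alpha> = rng G \<beta>"
  shows "costar (gcomp G \<alpha> \<beta>) * cnj (cocycle \<alpha> \<beta>) = cocycle (ginv G \<beta>) (ginv G \<alpha>) * costar \<beta> * costar \<alpha>"
proof -
  note u = assms(1,2)[THEN unit_vec_closed]
  have "coord (ginv G (gcomp G \<alpha> \<beta>)) (bstar L (bmult L (unit_vec \<alpha>) (unit_vec \<beta>))) =
      costar (gcomp G \<alpha> \<beta>) * cnj (cocycle \<alpha> \<beta>)"
    using coord_star[OF bmult_closed[OF u assms(3)]] by (simp add: cocycle_def)
  moreover have "bstar L (bmult L (unit_vec \<alpha>) (unit_vec \<beta>)) = bmult L (bstar L (unit_vec \<beta>)) (bstar L (unit_vec \<alpha>))"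
    using star_mult bundle_composableI u assms by blast
  moreover have "coord (gcomp G (ginv G \<beta>) (ginv G \<alpha>)) (bmult L (bstar L (unit_vec \<beta>)) (bstar L (unit_vec \<alpha>))) =
     cocycle (ginv G \<beta>) (ginv G \<alpha>) * costar \<beta> * costar \<alpha>"
    using coord_mult[OF bstar_closed[OF u(2)] bstar_closed[OF u(1)]] assms by (simp add: costar_def)
  ultimately show ?thesis using assms by (simp add: inv_gcomp)
qed

lemma cmod_cocycle_le: 
  assumes "\<alpha> \<in> arrows G" "\<beta> \<in> arrows G" "src G \<alpha> = rng G \<beta>"
  shows "cmod (cocycle \<alpha> \<beta>) \<le> 1"
proof -
  note u = assms(1,2)[THEN unit_vec_closed]
  show ?thesis
    using norm_mult[OF bundle_composableI[OF u assms(3)]] bnorm_coord[OF bmult_closed[OF u assms(3)]]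
      bnorm_unit_vec assms by (simp add: cocycle_def)
qed

text \<open>The cocycle has modulus at most one because the norm of the bundle is submultiplicative; the two
  identities \<open>cocycle_star\<close> and \<open>costar_inv\<close> turn this into equality.\<close>

lemma cmod_costar: "\<gamma> \<in> arrows G \<Longrightarrow> cmod (costar \<gamma>) = 1"
proof -
  assume \<gamma>: "\<gamma> \<in> arrows G"
  have ge: "cmod (costar \<gamma>) \<ge> 1" if "\<gamma> \<in> arrows G" for \<gamma>
  proof -
    have "cmod (cocycle (ginv G \<gamma>) \<gamma>) * cmod (costar \<gamma>) = 1"
      using cocycle_star[OF that] by (metis Real_Vector_Spaces.norm_mult norm_one)
    moreover have "cmod (cocycle (ginv G \<gamma>) \<gamma>) \<le> 1" using that by (intro cmod_cocycle_le) auto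
    ultimately show ?thesis by (metis mult_left_le_one_le norm_ge_zero)
  qed
  have "cmod (costar (ginv G \<gamma>)) * cmod (costar \<gamma>) = 1"
    using costar_inv[OF \<gamma>] by (metis Real_Vector_Spaces.norm_mult norm_one complex_mod_cnj)
  thus ?thesis using ge[OF \<gamma>] ge[of "ginv G \<gamma>"] \<gamma> by (smt (verit) arrow_closed(3) mult_le_cancel_right1)
qed

text \<open>Cancel \<open>\<gamma>\<close> from the left in the cocycle identity for the triple of the inverse of \<open>\<gamma>\<close>, \<open>\<gamma>\<close> and
  its source. Hence the units of the fibres act as identities on the fibres over all arrows.\<close>

lemma cocycle_unit_right [simp]: "\<gamma> \<in> arrows G \<Longrightarrow> cocycle \<gamma> (src G \<gamma>) = 1"
proof -
  assume \<gamma>: "\<gamma> \<in> arrows G"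
  have "cocycle (src G \<gamma>) (src G \<gamma>) = 1"
    using src_unit[OF \<gamma>] fibre_one(1,4) coord_unit_vec[of "src G \<gamma>"] \<gamma>
    by (simp add: cocycle_def unit_vec_unit)
  hence "cocycle (ginv G \<gamma>) \<gamma> = cocycle (ginv G \<gamma>) \<gamma> * cocycle \<gamma> (src G \<gamma>)"
    using cocycle_assoc[of "ginv G \<gamma>" \<gamma> "src G \<gamma>"] \<gamma> by (simp add: inv_comp)
  moreover have "cocycle (ginv G \<gamma>) \<gamma> \<noteq> 0" using cocycle_star[OF \<gamma>] by auto
  ultimately show ?thesis by simp
qed

lemma costar_unit [simp]: "x \<in> units G \<Longrightarrow> costar x = 1"
  using fibre_one(3) coord_unit_vec[of x] by (simp add: costar_def unit_vec_unit inv_unit units_arrows)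

lemma cocycle_unit_left [simp]: "\<gamma> \<in> arrows G \<Longrightarrow> cocycle (rng G \<gamma>) \<gamma> = 1"
proof -
  assume \<gamma>: "\<gamma> \<in> arrows G"
  have "costar \<gamma> * cnj (cocycle (rng G \<gamma>) \<gamma>) = cocycle (ginv G \<gamma>) (rng G \<gamma>) * costar \<gamma>"
    using costar_mult[of "rng G \<gamma>" \<gamma>] \<gamma> by (simp add: inv_unit rng_unit)
  moreover have "cocycle (ginv G \<gamma>) (rng G \<gamma>) = 1" using cocycle_unit_right[of "ginv G \<gamma>"] \<gamma> by simp
  moreover have "costar \<gamma> \<noteq> 0" using cocycle_star[OF \<gamma>] by auto
  ultimately have "cnj (cocycle (rng G \<gamma>) \<gamma>) = 1" by simp
  thus ?thesis by (metis complex_cnj_cnj complex_cnj_one)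
qed

lemma cmod_cocycle:
  assumes "\<alpha> \<in> arrows G" "\<beta> \<in> arrows G" "src G \<alpha> = rng G \<beta>"
  shows "cmod (cocycle \<alpha> \<beta>) = 1"
proof -
  have *: "cmod (cocycle (ginv G \<alpha>) \<alpha>) = 1"
    using cocycle_star[OF assms(1)] cmod_costar[OF assms(1)] by (metis Real_Vector_Spaces.norm_mult norm_one mult_1_right)
  have "cocycle (ginv G \<alpha>) \<alpha> = cocycle (ginv G \<alpha>) (gcomp G \<alpha> \<beta>) * cocycle \<alpha> \<beta>"
    using cocycle_assoc[of "ginv G \<alpha>" \<alpha> \<beta>] assms by (simp add: inv_comp)
  hence "cmod (cocycle (ginv G \<alpha>) (gcomp G \<alpha> \<beta>)) * cmod (cocycle \<alpha> \<beta>) = 1"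
    using * by (metis Real_Vector_Spaces.norm_mult)
  moreover have "cmod (cocycle (ginv G \<alpha>) (gcomp G \<alpha> \<beta>)) \<le> 1"
    using assms by (intro cmod_cocycle_le) auto
  ultimately have "cmod (cocycle \<alpha> \<beta>) \<ge> 1" by (metis mult_left_le_one_le norm_ge_zero)
  thus ?thesis using cmod_cocycle_le[OF assms] by simp
qed

end

section \<open>The twisted convolution algebra of fibrewise finite functions\<close>

lemma sum_reindex_support:
  assumes fin: "finite S" "finite T"
    and S: "\<And>a. a \<in> S - S' \<Longrightarrow> i (j a) = a" "\<And>a. a \<in> S - S' \<Longrightarrow> j a \<in> T - T'"
    and T: "\<And>b. b \<in> T - T' \<Longrightarrow> j (i b) = b" "\<And>b. b \<in> T - T' \<Longrightarrow> i b \<in> S - S'"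
    and "\<And>a. a \<in> S' \<Longrightarrow> g a = 0" "\<And>b. b \<in> T' \<Longrightarrow> h b = 0"
    and eq: "\<And>a. a \<in> S - S' \<Longrightarrow> h (j a) = g a"
  shows "sum g S = (sum h T :: complex)"
proof -
  have "sum g S = sum g (S - S')" using assms by (intro sum.mono_neutral_right) auto
  also have "\<dots> = sum h (T - T')" by (rule sum.reindex_bij_witness[of _ i j]) (use S T eq in auto)
  also have "\<dots> = sum h T" using assms by (intro sum.mono_neutral_left) auto
  finally show ?thesis .
qed

context fell_line_bundle
begin

definition rsupp :: "('g \<Rightarrow> complex) \<Rightarrow> 'g \<Rightarrow> 'g set" where
  "rsupp F x = {\<alpha> \<in> arrows G. rng G \<alpha> = x \<and> F \<alpha> \<noteq> 0}"

definition ssupp :: "('g \<Rightarrow> complex) \<Rightarrow> 'g \<Rightarrow> 'g set" where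
  "ssupp F x = {\<alpha> \<in> arrows G. src G \<alpha> = x \<and> F \<alpha> \<noteq> 0}"

text \<open>These functions form a *-algebra under twisted convolution, which contains the coordinates of the
  sections in \<open>Cc G L\<close> as well as the finitely supported vectors of the regular representations. So a
  regular representation is a left multiplication inside this algebra.\<close>

definition fibre_finite :: "('g \<Rightarrow> complex) set" where
  "fibre_finite = {F. (\<forall>\<gamma>. \<gamma> \<notin> arrows G \<longrightarrow> F \<gamma> = 0) \<and> (\<forall>x. finite (rsupp F x)) \<and> (\<forall>x. finite (ssupp F x))}"

text \<open>The sum extends over the support of the first factor only, so that the second one may be an
  arbitrary vector of the Hilbert space of a regular representation.\<close>

definition tconv :: "('g \<Rightarrow> complex) \<Rightarrow> ('g \<Rightarrow> complex) \<Rightarrow> 'g \<Rightarrow> complex" where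
  "tconv F H \<gamma> = (if \<gamma> \<in> arrows G then
     \<Sum>\<alpha>\<in>rsupp F (rng G \<gamma>). cocycle \<alpha> (gcomp G (ginv G \<alpha>) \<gamma>) * F \<alpha> * H (gcomp G (ginv G \<alpha>) \<gamma>) else 0)"

definition tstar :: "('g \<Rightarrow> complex) \<Rightarrow> 'g \<Rightarrow> complex" where
  "tstar F \<gamma> = (if \<gamma> \<in> arrows G then costar (ginv G \<gamma>) * cnj (F (ginv G \<gamma>)) else 0)"

lemma fibre_finiteD:
  "F \<in> fibre_finite \<Longrightarrow> \<gamma> \<notin> arrows G \<Longrightarrow> F \<gamma> = 0"
  "F \<in> fibre_finite \<Longrightarrow> finite (rsupp F x)"
  "F \<in> fibre_finite \<Longrightarrow> finite (ssupp F x)"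
  by (auto simp: fibre_finite_def)

lemma tconv_superset:
  assumes "\<gamma> \<in> arrows G" "finite P" "rsupp F (rng G \<gamma>) \<subseteq> P" "\<And>\<alpha>. \<alpha> \<in> P \<Longrightarrow> \<alpha> \<in> arrows G \<and> rng G \<alpha> = rng G \<gamma>"
  shows "tconv F H \<gamma> = (\<Sum>\<alpha>\<in>P. cocycle \<alpha> (gcomp G (ginv G \<alpha>) \<gamma>) * F \<alpha> * H (gcomp G (ginv G \<alpha>) \<gamma>))"
  unfolding tconv_def using assms by (auto simp: rsupp_def intro!: sum.mono_neutral_left)

lemma tconv_nonzero:
  assumes "tconv F H \<gamma> \<noteq> 0"
  shows "\<gamma> \<in> arrows G \<and> (\<exists>\<alpha>\<in>arrows G. rng G \<alpha> = rng G \<gamma> \<and> F \<alpha> \<noteq> 0 \<and> H (gcomp G (ginv G \<alpha>) \<gamma>) \<noteq> 0)"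
proof -
  have "\<exists>\<alpha>\<in>rsupp F (rng G \<gamma>). H (gcomp G (ginv G \<alpha>) \<gamma>) \<noteq> 0"
  proof (rule ccontr)
    assume "\<not> ?thesis"
    hence "tconv F H \<gamma> = 0" unfolding tconv_def by (auto intro!: sum.neutral)
    thus False using assms by simp
  qed
  thus ?thesis using assms by (auto simp: rsupp_def tconv_def split: if_splits)
qed

lemma tconv_support:
  "rsupp (tconv F H) x \<subseteq> (\<Union>\<alpha>\<in>rsupp F x. gcomp G \<alpha> ` rsupp H (src G \<alpha>))"
  "ssupp (tconv F H) x \<subseteq> (\<Union>\<beta>\<in>ssupp H x. (\<lambda>\<alpha>. gcomp G \<alpha> \<beta>) ` ssupp F (rng G \<beta>))"
proof -
  have *: "\<exists>\<alpha> \<beta>. \<gamma> = gcomp G \<alpha> \<beta> \<and> \<alpha> \<in> rsupp F (rng G \<gamma>) \<and> \<beta> \<in> rsupp H (src G \<alpha>) \<and>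
      \<beta> \<in> ssupp H (src G \<gamma>) \<and> \<alpha> \<in> ssupp F (rng G \<beta>)" if nz: "tconv F H \<gamma> \<noteq> 0" for \<gamma>
  proof -
    obtain \<alpha> where \<gamma>: "\<gamma> \<in> arrows G" and \<alpha>: "\<alpha> \<in> arrows G" "rng G \<alpha> = rng G \<gamma>" "F \<alpha> \<noteq> 0"
      "H (gcomp G (ginv G \<alpha>) \<gamma>) \<noteq> 0" using tconv_nonzero[OF nz] by blast
    show ?thesis
      by (rule exI[of _ \<alpha>], rule exI[of _ "gcomp G (ginv G \<alpha>) \<gamma>"])
         (use \<gamma> \<alpha> in \<open>simp add: rsupp_def ssupp_def\<close>)
  qed
  show "rsupp (tconv F H) x \<subseteq> (\<Union>\<alpha>\<in>rsupp F x. gcomp G \<alpha> ` rsupp H (src G \<alpha>))"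
    using * by (fastforce simp: rsupp_def[of "tconv F H"])
  show "ssupp (tconv F H) x \<subseteq> (\<Union>\<beta>\<in>ssupp H x. (\<lambda>\<alpha>. gcomp G \<alpha> \<beta>) ` ssupp F (rng G \<beta>))"
    using * by (fastforce simp: ssupp_def[of "tconv F H"])
qed

lemma tconv_closed [intro]: "\<lbrakk>F \<in> fibre_finite; H \<in> fibre_finite\<rbrakk> \<Longrightarrow> tconv F H \<in> fibre_finite"
proof -
  assume F: "F \<in> fibre_finite" and H: "H \<in> fibre_finite"
  have "finite (rsupp (tconv F H) x)" for x
    by (rule finite_subset[OF tconv_support(1)]) (use fibre_finiteD F H in auto)
  moreover have "finite (ssupp (tconv F H) x)" for x
    by (rule finite_subset[OF tconv_support(2)]) (use fibre_finiteD F H in auto)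
  ultimately show ?thesis by (simp add: fibre_finite_def tconv_def)
qed

text \<open>Both sides are sums over pairs \<open>(\<alpha>, \<beta>)\<close>, the left one being indexed by \<open>\<alpha>\<close> and the product
  \<open>\<delta> = \<alpha>\<beta>\<close>; the terms agree by the cocycle identity.\<close>

lemma tconv_assoc:
  assumes F: "F \<in> fibre_finite" and K: "K \<in> fibre_finite"
  shows "tconv (tconv F K) H = tconv F (tconv K H)"
proof
  fix \<gamma>
  show "tconv (tconv F K) H \<gamma> = tconv F (tconv K H) \<gamma>"
  proof (cases "\<gamma> \<in> arrows G")
    case True
    define x where "x = rng G \<gamma>"
    define P where "P = rsupp F x"
    define D where "D = (\<Union>\<alpha>\<in>P. gcomp G \<alpha> ` rsupp K (src G \<alpha>))"
    let ?m = "\<lambda>\<alpha> \<beta>. gcomp G (ginv G \<alpha>) \<beta>"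
    have fin: "finite P" "finite D" using fibre_finiteD F K by (auto simp: P_def D_def)
    have P: "\<alpha> \<in> arrows G" "rng G \<alpha> = x" if "\<alpha> \<in> P" for \<alpha> using that by (auto simp: P_def rsupp_def)
    have D: "\<delta> \<in> arrows G" "rng G \<delta> = x" if "\<delta> \<in> D" for \<delta>
      using that P by (auto simp: D_def rsupp_def)
    have "tconv (tconv F K) H \<gamma> = (\<Sum>\<delta>\<in>D. cocycle \<delta> (?m \<delta> \<gamma>) * tconv F K \<delta> * H (?m \<delta> \<gamma>))"
    proof (rule tconv_superset[OF True fin(2)])
      show "rsupp (tconv F K) (rng G \<gamma>) \<subseteq> D" using tconv_support(1)[of F K x] by (simp only: D_def P_def x_def)
      show "\<delta> \<in> arrows G \<and> rng G \<delta> = rng G \<gamma>" if "\<delta> \<in> D" for \<delta> using D[OF that] by (simp add: x_def)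
    qed
    also have "\<dots> = (\<Sum>\<delta>\<in>D. \<Sum>\<alpha>\<in>P. cocycle \<delta> (?m \<delta> \<gamma>) * (cocycle \<alpha> (?m \<alpha> \<delta>) * F \<alpha> * K (?m \<alpha> \<delta>)) * H (?m \<delta> \<gamma>))"
      using D by (intro sum.cong refl) (simp add: tconv_def sum_distrib_left sum_distrib_right P_def)
    also have "\<dots> = (\<Sum>\<alpha>\<in>P. \<Sum>\<delta>\<in>D. cocycle \<delta> (?m \<delta> \<gamma>) * (cocycle \<alpha> (?m \<alpha> \<delta>) * F \<alpha> * K (?m \<alpha> \<delta>)) * H (?m \<delta> \<gamma>))"
      by (rule sum.swap)
    also have "\<dots> = (\<Sum>\<alpha>\<in>P. \<Sum>\<beta>\<in>rsupp K (src G \<alpha>).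
        cocycle \<alpha> (?m \<alpha> \<gamma>) * F \<alpha> * (cocycle \<beta> (?m \<beta> (?m \<alpha> \<gamma>)) * K \<beta> * H (?m \<beta> (?m \<alpha> \<gamma>))))"
    proof (rule sum.cong[OF refl])
      fix \<alpha> assume \<alpha>: "\<alpha> \<in> P"
      note a = P[OF \<alpha>]
      show "(\<Sum>\<delta>\<in>D. cocycle \<delta> (?m \<delta> \<gamma>) * (cocycle \<alpha> (?m \<alpha> \<delta>) * F \<alpha> * K (?m \<alpha> \<delta>)) * H (?m \<delta> \<gamma>)) =
        (\<Sum>\<beta>\<in>rsupp K (src G \<alpha>). cocycle \<alpha> (?m \<alpha> \<gamma>) * F \<alpha> * (cocycle \<beta> (?m \<beta> (?m \<alpha> \<gamma>)) * K \<beta> * H (?m \<beta> (?m \<alpha> \<gamma>))))"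
      proof (rule sum_reindex_support[where S'="{\<delta>\<in>D. K (?m \<alpha> \<delta>) = 0}" and T'="{}"
            and i="gcomp G \<alpha>" and j="?m \<alpha>"])
        fix \<delta> assume d: "\<delta> \<in> D - {\<delta> \<in> D. K (?m \<alpha> \<delta>) = 0}"
        note d' = D[of \<delta>]
        show "gcomp G \<alpha> (?m \<alpha> \<delta>) = \<delta>" using d d' a by simp
        show "?m \<alpha> \<delta> \<in> rsupp K (src G \<alpha>) - {}" using d d' a by (simp add: rsupp_def)
        define \<beta> where "\<beta> = ?m \<alpha> \<delta>"
        have \<beta>: "\<beta> \<in> arrows G" "rng G \<beta> = src G \<alpha>" "\<delta> = gcomp G \<alpha> \<beta>" using d d' a by (auto simp: \<beta>_def)
        have mm: "?m \<delta> \<gamma> = ?m \<beta> (?m \<alpha> \<gamma>)"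
          using \<beta> a True by (simp add: inv_gcomp gcomp_assoc x_def)
        have gm: "gcomp G \<beta> (?m \<delta> \<gamma>) = ?m \<alpha> \<gamma>" unfolding mm using \<beta>(1,2) a True by (simp add: x_def)
        have c: "?m \<delta> \<gamma> \<in> arrows G" "src G \<beta> = rng G (?m \<delta> \<gamma>)"
          unfolding mm using \<beta>(1,2) a True by (simp_all add: x_def)
        have "cocycle \<alpha> \<beta> * cocycle \<delta> (?m \<delta> \<gamma>) = cocycle \<alpha> (?m \<alpha> \<gamma>) * cocycle \<beta> (?m \<delta> \<gamma>)"
          using cocycle_assoc[OF a(1) \<beta>(1) c(1) \<beta>(2)[symmetric] c(2)]
          unfolding gm \<beta>(3)[symmetric] .
        thus "cocycle \<alpha> (?m \<alpha> \<gamma>) * F \<alpha> * (cocycle (?m \<alpha> \<delta>) (?m (?m \<alpha> \<delta>) (?m \<alpha> \<gamma>)) * K (?m \<alpha> \<delta>) * H (?m (?m \<alpha> \<delta>) (?m \<alpha> \<gamma>))) =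
          cocycle \<delta> (?m \<delta> \<gamma>) * (cocycle \<alpha> (?m \<alpha> \<delta>) * F \<alpha> * K (?m \<alpha> \<delta>)) * H (?m \<delta> \<gamma>)"
          unfolding \<beta>_def[symmetric] mm[symmetric] by (simp add: mult_ac) 
      next
        fix \<beta> assume b: "\<beta> \<in> rsupp K (src G \<alpha>) - {}"
        show "?m \<alpha> (gcomp G \<alpha> \<beta>) = \<beta>" using b a by (simp add: rsupp_def)
        show "gcomp G \<alpha> \<beta> \<in> D - {\<delta> \<in> D. K (?m \<alpha> \<delta>) = 0}"
          using b a \<alpha> by (auto simp: D_def rsupp_def)
      qed (use fin fibre_finiteD(2)[OF K] in auto)
    qed
    also have "\<dots> = (\<Sum>\<alpha>\<in>P. cocycle \<alpha> (?m \<alpha> \<gamma>) * F \<alpha> * tconv K H (?m \<alpha> \<gamma>))"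
      using P True by (intro sum.cong refl) (simp add: tconv_def sum_distrib_left x_def)
    also have "\<dots> = tconv F (tconv K H) \<gamma>" using True by (simp add: tconv_def P_def x_def)
    finally show ?thesis .
  qed (simp add: tconv_def)
qed

lemma fibre_finite_add [intro]:
  assumes "F \<in> fibre_finite" "H \<in> fibre_finite" shows "(\<lambda>\<gamma>. F \<gamma> + H \<gamma>) \<in> fibre_finite"
proof -
  have "rsupp (\<lambda>\<gamma>. F \<gamma> + H \<gamma>) x \<subseteq> rsupp F x \<union> rsupp H x" "ssupp (\<lambda>\<gamma>. F \<gamma> + H \<gamma>) x \<subseteq> ssupp F x \<union> ssupp H x"
    for x by (auto simp: rsupp_def ssupp_def)
  thus ?thesis using assms unfolding fibre_finite_def mem_Collect_eq
    by (metis add_0 finite_UnI finite_subset)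
qed

lemma fibre_finite_subset:
  assumes "F \<in> fibre_finite" "\<And>\<gamma>. F \<gamma> = 0 \<Longrightarrow> H \<gamma> = 0" shows "H \<in> fibre_finite"
proof -
  have "rsupp H x \<subseteq> rsupp F x" "ssupp H x \<subseteq> ssupp F x" for x using assms(2) by (auto simp: rsupp_def ssupp_def)
  thus ?thesis using assms unfolding fibre_finite_def mem_Collect_eq by (metis finite_subset)
qed

lemma fibre_finite_scale [intro]: "F \<in> fibre_finite \<Longrightarrow> (\<lambda>\<gamma>. c * F \<gamma>) \<in> fibre_finite"
  by (rule fibre_finite_subset) auto

lemma tconv_add_right: "tconv F (\<lambda>\<gamma>. H \<gamma> + K \<gamma>) = (\<lambda>\<gamma>. tconv F H \<gamma> + tconv F K \<gamma>)"
  by (auto simp: tconv_def fun_eq_iff algebra_simps sum.distrib)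

lemma tconv_scale_right: "tconv F (\<lambda>\<gamma>. c * H \<gamma>) = (\<lambda>\<gamma>. c * tconv F H \<gamma>)"
  by (auto simp: tconv_def fun_eq_iff algebra_simps sum_distrib_left)

lemma tconv_scale_left: "tconv (\<lambda>\<gamma>. c * F \<gamma>) H = (\<lambda>\<gamma>. c * tconv F H \<gamma>)"
proof (cases "c = 0")
  case False
  hence "rsupp (\<lambda>\<gamma>. c * F \<gamma>) x = rsupp F x" for x by (simp add: rsupp_def)
  thus ?thesis by (auto simp: tconv_def fun_eq_iff algebra_simps sum_distrib_left)
qed (auto simp: tconv_def rsupp_def fun_eq_iff)

lemma tconv_add_left:
  assumes F: "F \<in> fibre_finite" and K: "K \<in> fibre_finite"
  shows "tconv (\<lambda>\<gamma>. F \<gamma> + K \<gamma>) H = (\<lambda>\<gamma>. tconv F H \<gamma> + tconv K H \<gamma>)"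
proof
  fix \<gamma>
  show "tconv (\<lambda>\<gamma>. F \<gamma> + K \<gamma>) H \<gamma> = tconv F H \<gamma> + tconv K H \<gamma>"
  proof (cases "\<gamma> \<in> arrows G")
    case True
    let ?P = "rsupp F (rng G \<gamma>) \<union> rsupp K (rng G \<gamma>)"
    have P: "finite ?P" "\<And>\<alpha>. \<alpha> \<in> ?P \<Longrightarrow> \<alpha> \<in> arrows G \<and> rng G \<alpha> = rng G \<gamma>"
      using fibre_finiteD F K by (auto simp: rsupp_def)
    let ?t = "\<lambda>F \<alpha>. cocycle \<alpha> (gcomp G (ginv G \<alpha>) \<gamma>) * F \<alpha> * H (gcomp G (ginv G \<alpha>) \<gamma>)"
    have "tconv (\<lambda>\<gamma>. F \<gamma> + K \<gamma>) H \<gamma> = (\<Sum>\<alpha>\<in>?P. ?t (\<lambda>\<gamma>. F \<gamma> + K \<gamma>) \<alpha>)"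
      by (rule tconv_superset[OF True P(1) _ P(2)]) (auto simp: rsupp_def)
    moreover have "tconv F H \<gamma> = (\<Sum>\<alpha>\<in>?P. ?t F \<alpha>)" "tconv K H \<gamma> = (\<Sum>\<alpha>\<in>?P. ?t K \<alpha>)"
      by (rule tconv_superset[OF True P(1) _ P(2)]; auto)+
    ultimately show ?thesis by (simp add: algebra_simps sum.distrib)
  qed (simp add: tconv_def)
qed

lemma rsupp_tstar: "rsupp (tstar F) x \<subseteq> ginv G ` ssupp F x"
proof
  fix \<gamma> assume "\<gamma> \<in> rsupp (tstar F) x"
  hence "ginv G \<gamma> \<in> ssupp F x" "\<gamma> = ginv G (ginv G \<gamma>)" by (auto simp: rsupp_def ssupp_def tstar_def)
  thus "\<gamma> \<in> ginv G ` ssupp F x" by blast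
qed

lemma ssupp_tstar: "ssupp (tstar F) x \<subseteq> ginv G ` rsupp F x"
proof
  fix \<gamma> assume "\<gamma> \<in> ssupp (tstar F) x"
  hence "ginv G \<gamma> \<in> rsupp F x" "\<gamma> = ginv G (ginv G \<gamma>)" by (auto simp: rsupp_def ssupp_def tstar_def)
  thus "\<gamma> \<in> ginv G ` rsupp F x" by blast
qed

lemma tstar_closed [intro]: "F \<in> fibre_finite \<Longrightarrow> tstar F \<in> fibre_finite"
  using finite_subset[OF rsupp_tstar finite_imageI] finite_subset[OF ssupp_tstar finite_imageI]
  unfolding fibre_finite_def mem_Collect_eq by (metis tstar_def)

lemma tstar_tstar: "F \<in> fibre_finite \<Longrightarrow> tstar (tstar F) = F"
proof
  fix \<gamma> assume F: "F \<in> fibre_finite"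
  show "tstar (tstar F) \<gamma> = F \<gamma>"
  proof (cases "\<gamma> \<in> arrows G")
    case True
    have "costar (ginv G \<gamma>) * cnj (costar \<gamma>) = 1" by (rule costar_inv[OF True])
    thus ?thesis using True by (simp add: tstar_def mult.assoc[symmetric])
  qed (use F in \<open>auto simp: tstar_def fibre_finite_def\<close>)
qed

lemma tstar_add: "tstar (\<lambda>\<gamma>. F \<gamma> + H \<gamma>) = (\<lambda>\<gamma>. tstar F \<gamma> + tstar H \<gamma>)"
  by (auto simp: tstar_def fun_eq_iff algebra_simps)

lemma tstar_scale: "tstar (\<lambda>\<gamma>. c * F \<gamma>) = (\<lambda>\<gamma>. cnj c * tstar F \<gamma>)"
  by (auto simp: tstar_def fun_eq_iff algebra_simps)

lemma tstar_eq_0: "\<gamma> \<in> arrows G \<Longrightarrow> tstar F \<gamma> = 0 \<longleftrightarrow> F (ginv G \<gamma>) = 0"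
  using cmod_costar[of "ginv G \<gamma>"] by (auto simp: tstar_def)

lemma tstar_tconv:
  assumes F: "F \<in> fibre_finite" and H: "H \<in> fibre_finite"
  shows "tstar (tconv F H) = tconv (tstar H) (tstar F)"
proof
  fix \<gamma>
  show "tstar (tconv F H) \<gamma> = tconv (tstar H) (tstar F) \<gamma>"
  proof (cases "\<gamma> \<in> arrows G")
    case True
    let ?m = "\<lambda>\<alpha> \<beta>. gcomp G (ginv G \<alpha>) \<beta>"
    let ?i = "\<lambda>\<beta>. ?m \<gamma> \<beta>"
    have "tstar (tconv F H) \<gamma> = (\<Sum>\<alpha>\<in>rsupp F (src G \<gamma>). costar (ginv G \<gamma>) *
        cnj (cocycle \<alpha> (?m \<alpha> (ginv G \<gamma>)) * F \<alpha> * H (?m \<alpha> (ginv G \<gamma>))))"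
      using True by (simp add: tstar_def tconv_def sum_distrib_left)
    also have "\<dots> = (\<Sum>\<beta>\<in>rsupp (tstar H) (rng G \<gamma>). cocycle \<beta> (?m \<beta> \<gamma>) * tstar H \<beta> * tstar F (?m \<beta> \<gamma>))"
    proof (rule sum_reindex_support[where i="?i" and j="gcomp G \<gamma>"
        and S'="{\<alpha>\<in>rsupp F (src G \<gamma>). H (?m \<alpha> (ginv G \<gamma>)) = 0}"
        and T'="{\<beta>\<in>rsupp (tstar H) (rng G \<gamma>). F (?i \<beta>) = 0}"])
      fix \<alpha> assume a: "\<alpha> \<in> rsupp F (src G \<gamma>) - {\<alpha> \<in> rsupp F (src G \<gamma>). H (?m \<alpha> (ginv G \<gamma>)) = 0}"
      hence \<alpha>: "\<alpha> \<in> arrows G" "rng G \<alpha> = src G \<gamma>" by (auto simp: rsupp_def)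
      show *: "?i (gcomp G \<gamma> \<alpha>) = \<alpha>" using \<alpha> True by simp
      have inv: "ginv G (gcomp G \<gamma> \<alpha>) = ?m \<alpha> (ginv G \<gamma>)" using \<alpha> True by (simp add: inv_gcomp)
      show "gcomp G \<gamma> \<alpha> \<in> rsupp (tstar H) (rng G \<gamma>) - {\<beta> \<in> rsupp (tstar H) (rng G \<gamma>). F (?i \<beta>) = 0}"
        using a \<alpha> True * by (auto simp: rsupp_def tstar_eq_0 inv)
      have m: "?m (gcomp G \<gamma> \<alpha>) \<gamma> = ginv G \<alpha>"
        using \<alpha> True by (simp add: inv_gcomp gcomp_assoc inv_comp)
      define \<beta> where "\<beta> = ?m \<alpha> (ginv G \<gamma>)"
      have "gcomp G \<alpha> \<beta> = ginv G \<gamma>" "ginv G \<beta> = gcomp G \<gamma> \<alpha>"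
        using \<alpha> True by (auto simp: \<beta>_def inv_gcomp)
      hence "costar (ginv G \<gamma>) * cnj (cocycle \<alpha> \<beta>) = cocycle (gcomp G \<gamma> \<alpha>) (ginv G \<alpha>) * costar \<beta> * costar \<alpha>"
        using costar_mult[of \<alpha> \<beta>] \<alpha> True by (simp add: \<beta>_def)
      thus "cocycle (gcomp G \<gamma> \<alpha>) (?m (gcomp G \<gamma> \<alpha>) \<gamma>) * tstar H (gcomp G \<gamma> \<alpha>) * tstar F (?m (gcomp G \<gamma> \<alpha>) \<gamma>) =
         costar (ginv G \<gamma>) * cnj (cocycle \<alpha> (?m \<alpha> (ginv G \<gamma>)) * F \<alpha> * H (?m \<alpha> (ginv G \<gamma>)))"
        unfolding m using \<alpha> True by (simp add: tstar_def inv \<beta>_def[symmetric] mult_ac)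
    next
      fix \<beta> assume b: "\<beta> \<in> rsupp (tstar H) (rng G \<gamma>) - {\<beta> \<in> rsupp (tstar H) (rng G \<gamma>). F (?i \<beta>) = 0}"
      hence \<beta>: "\<beta> \<in> arrows G" "rng G \<beta> = rng G \<gamma>" by (auto simp: rsupp_def)
      show "gcomp G \<gamma> (?i \<beta>) = \<beta>" using \<beta> True by simp
      have "?m (?i \<beta>) (ginv G \<gamma>) = ginv G \<beta>"
        using \<beta> True by (simp add: inv_gcomp gcomp_assoc comp_inv)
      thus "?i \<beta> \<in> rsupp F (src G \<gamma>) - {\<alpha> \<in> rsupp F (src G \<gamma>). H (?m \<alpha> (ginv G \<gamma>)) = 0}"
        using b \<beta> True by (auto simp: rsupp_def tstar_eq_0)
    next
      fix \<beta> assume b: "\<beta> \<in> {\<beta> \<in> rsupp (tstar H) (rng G \<gamma>). F (?i \<beta>) = 0}"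
      hence "ginv G (?m \<beta> \<gamma>) = ?i \<beta>" using True by (auto simp: rsupp_def inv_gcomp)
      thus "cocycle \<beta> (?m \<beta> \<gamma>) * tstar H \<beta> * tstar F (?m \<beta> \<gamma>) = 0"
        using b True by (simp add: tstar_def)
    qed (use fibre_finiteD F tstar_closed[OF H] in auto)
    also have "\<dots> = tconv (tstar H) (tstar F) \<gamma>" using True by (simp add: tconv_def)
    finally show ?thesis .
  qed (simp add: tstar_def tconv_def)
qed

text \<open>The scalar product of the Hilbert space on which the regular representation at \<open>x\<close> acts.\<close>

definition inner :: "'g \<Rightarrow> ('g \<Rightarrow> complex) \<Rightarrow> ('g \<Rightarrow> complex) \<Rightarrow> complex" where
  "inner x F H = (\<Sum>\<gamma>\<in>ssupp F x. F \<gamma> * cnj (H \<gamma>))"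

definition qnorm :: "'g \<Rightarrow> ('g \<Rightarrow> complex) \<Rightarrow> real" where
  "qnorm x F = L2_set (\<lambda>\<gamma>. cmod (F \<gamma>)) (ssupp F x)"

lemma inner_superset:
  "\<lbrakk>finite P; ssupp F x \<subseteq> P; \<And>\<gamma>. \<gamma> \<in> P \<Longrightarrow> \<gamma> \<in> arrows G \<and> src G \<gamma> = x\<rbrakk> \<Longrightarrow>
     inner x F H = (\<Sum>\<gamma>\<in>P. F \<gamma> * cnj (H \<gamma>))"
  unfolding inner_def by (auto simp: ssupp_def intro!: sum.mono_neutral_left)

lemma qnorm_superset:
  "\<lbrakk>finite P; ssupp F x \<subseteq> P; \<And>\<gamma>. \<gamma> \<in> P \<Longrightarrow> \<gamma> \<in> arrows G \<and> src G \<gamma> = x\<rbrakk> \<Longrightarrow>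
     qnorm x F = L2_set (\<lambda>\<gamma>. cmod (F \<gamma>)) P"
  unfolding qnorm_def L2_set_def by (auto simp: ssupp_def intro!: sum.mono_neutral_left)

lemma qnorm_cong:
  "(\<And>\<gamma>. \<gamma> \<in> arrows G \<Longrightarrow> src G \<gamma> = x \<Longrightarrow> cmod (F \<gamma>) = cmod (H \<gamma>)) \<Longrightarrow> qnorm x F = qnorm x H"
proof -
  assume *: "\<And>\<gamma>. \<gamma> \<in> arrows G \<Longrightarrow> src G \<gamma> = x \<Longrightarrow> cmod (F \<gamma>) = cmod (H \<gamma>)"
  hence "ssupp F x = ssupp H x" unfolding ssupp_def by (metis norm_eq_zero)
  thus ?thesis unfolding qnorm_def using * by (auto simp: ssupp_def intro!: L2_set_cong)
qed

lemma qnorm_nonneg [simp]: "0 \<le> qnorm x F"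
  by (simp add: qnorm_def)

lemma qnorm_scale: "qnorm x (\<lambda>\<gamma>. c * F \<gamma>) = cmod c * qnorm x F"
proof (cases "c = 0")
  case False
  hence "ssupp (\<lambda>\<gamma>. c * F \<gamma>) x = ssupp F x" by (simp add: ssupp_def)
  thus ?thesis by (simp add: qnorm_def Real_Vector_Spaces.norm_mult L2_set_right_distrib)
qed (simp add: qnorm_def ssupp_def)

lemma qnorm_add:
  assumes "F \<in> fibre_finite" "H \<in> fibre_finite"
  shows "qnorm x (\<lambda>\<gamma>. F \<gamma> + H \<gamma>) \<le> qnorm x F + qnorm x H"
proof -
  let ?P = "ssupp F x \<union> ssupp H x"
  have P: "finite ?P" "\<And>\<gamma>. \<gamma> \<in> ?P \<Longrightarrow> \<gamma> \<in> arrows G \<and> src G \<gamma> = x"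
    using fibre_finiteD assms by (auto simp: ssupp_def)
  have "qnorm x (\<lambda>\<gamma>. F \<gamma> + H \<gamma>) = L2_set (\<lambda>\<gamma>. cmod (F \<gamma> + H \<gamma>)) ?P"
    by (rule qnorm_superset[OF P(1) _ P(2)]) (auto simp: ssupp_def)
  also have "\<dots> \<le> L2_set (\<lambda>\<gamma>. cmod (F \<gamma>) + cmod (H \<gamma>)) ?P"
    by (intro L2_set_mono norm_triangle_ineq) auto
  also have "\<dots> \<le> L2_set (\<lambda>\<gamma>. cmod (F \<gamma>)) ?P + L2_set (\<lambda>\<gamma>. cmod (H \<gamma>)) ?P" by (rule L2_set_triangle_ineq)
  also have "\<dots> = qnorm x F + qnorm x H" using qnorm_superset[OF P(1) _ P(2)] by simp
  finally show ?thesis .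
qed

lemma inner_self: "inner x F F = of_real ((qnorm x F)\<^sup>2)"
  unfolding inner_def qnorm_def L2_set_def
  by (simp add: sum_nonneg complex_norm_square[symmetric] del: of_real_power)

lemma inner_cauchy_schwarz:
  assumes "F \<in> fibre_finite" "H \<in> fibre_finite"
  shows "cmod (inner x F H) \<le> qnorm x F * qnorm x H"
proof -
  let ?P = "ssupp F x \<union> ssupp H x"
  have P: "finite ?P" "\<And>\<gamma>. \<gamma> \<in> ?P \<Longrightarrow> \<gamma> \<in> arrows G \<and> src G \<gamma> = x"
    using fibre_finiteD assms by (auto simp: ssupp_def)
  have "cmod (inner x F H) = cmod (\<Sum>\<gamma>\<in>?P. F \<gamma> * cnj (H \<gamma>))"
    using inner_superset[OF P(1) _ P(2)] by simp
  also have "\<dots> \<le> (\<Sum>\<gamma>\<in>?P. \<bar>cmod (F \<gamma>)\<bar> * \<bar>cmod (H \<gamma>)\<bar>)"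
    by (intro sum_norm_le) (simp add: Real_Vector_Spaces.norm_mult)
  also have "\<dots> \<le> L2_set (\<lambda>\<gamma>. cmod (F \<gamma>)) ?P * L2_set (\<lambda>\<gamma>. cmod (H \<gamma>)) ?P" by (rule L2_set_mult_ineq)
  also have "\<dots> = qnorm x F * qnorm x H" using qnorm_superset[OF P(1) _ P(2)] by simp
  finally show ?thesis .
qed

lemma value_le_qnorm_src:
  assumes "F \<in> fibre_finite" "\<gamma> \<in> arrows G" shows "cmod (F \<gamma>) \<le> qnorm (src G \<gamma>) F"
proof (cases "F \<gamma> = 0")
  case False
  hence "\<gamma> \<in> ssupp F (src G \<gamma>)" using assms by (auto simp: ssupp_def)
  thus ?thesis using member_le_L2_set[of "ssupp F (src G \<gamma>)" \<gamma> "\<lambda>\<gamma>. cmod (F \<gamma>)"] fibre_finiteD(3)[OF assms(1)]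
    by (simp add: qnorm_def)
qed simp

lemma value_le_qnorm: "\<lbrakk>F \<in> fibre_finite; x \<in> units G\<rbrakk> \<Longrightarrow> cmod (F x) \<le> qnorm x F"
  using value_le_qnorm_src[of F x] by (simp add: units_arrows src_of_unit)

text \<open>The scalar product in terms of the algebra. In particular \<open>(F\<^sup>*F)(x)\<close> is the square of the
  seminorm at \<open>x\<close>.\<close>

lemma tconv_tstar_unit:
  assumes F: "F \<in> fibre_finite" and H: "H \<in> fibre_finite" and x: "x \<in> units G"
  shows "tconv (tstar H) F x = inner x F H"
proof -
  have xa: "x \<in> arrows G" "rng G x = x" "src G x = x" using x units_arrows rng_of_unit src_of_unit by auto
  have "tconv (tstar H) F x = (\<Sum>\<alpha>\<in>rsupp (tstar H) x. cocycle \<alpha> (ginv G \<alpha>) * tstar H \<alpha> * F (ginv G \<alpha>))"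
    unfolding tconv_def using xa by (auto simp: rsupp_def intro!: sum.cong)
  also have "\<dots> = (\<Sum>\<gamma>\<in>ssupp F x. F \<gamma> * cnj (H \<gamma>))"
  proof (rule sum_reindex_support[where i="ginv G" and j="ginv G" and
        S'="{\<alpha>\<in>rsupp (tstar H) x. F (ginv G \<alpha>) = 0}" and T'="{\<gamma>\<in>ssupp F x. H \<gamma> = 0}"])
    fix \<alpha> assume a: "\<alpha> \<in> rsupp (tstar H) x - {\<alpha>\<in>rsupp (tstar H) x. F (ginv G \<alpha>) = 0}"
    hence \<alpha>: "\<alpha> \<in> arrows G" "rng G \<alpha> = x" by (auto simp: rsupp_def)
    show "ginv G (ginv G \<alpha>) = \<alpha>" using \<alpha> by simp
    show "ginv G \<alpha> \<in> ssupp F x - {\<gamma>\<in>ssupp F x. H \<gamma> = 0}"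
      using a \<alpha> by (auto simp: ssupp_def rsupp_def tstar_eq_0)
    have "cocycle \<alpha> (ginv G \<alpha>) * costar (ginv G \<alpha>) = 1" using cocycle_star[of "ginv G \<alpha>"] \<alpha> by simp
    thus "F (ginv G \<alpha>) * cnj (H (ginv G \<alpha>)) = cocycle \<alpha> (ginv G \<alpha>) * tstar H \<alpha> * F (ginv G \<alpha>)"
      using \<alpha> by (simp add: tstar_def mult.assoc[symmetric])
  next
    fix \<gamma> assume "\<gamma> \<in> ssupp F x - {\<gamma>\<in>ssupp F x. H \<gamma> = 0}"
    thus "ginv G (ginv G \<gamma>) = \<gamma>" "ginv G \<gamma> \<in> rsupp (tstar H) x - {\<alpha>\<in>rsupp (tstar H) x. F (ginv G \<alpha>) = 0}"
      by (auto simp: ssupp_def rsupp_def tstar_eq_0)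
  qed (use fibre_finiteD tstar_closed F H in auto)
  finally show ?thesis by (simp add: inner_def)
qed

lemma inner_adjoint:
  assumes "F \<in> fibre_finite" "H \<in> fibre_finite" "K \<in> fibre_finite" "x \<in> units G"
  shows "inner x (tconv F H) K = inner x H (tconv (tstar F) K)"
proof -
  have "inner x (tconv F H) K = tconv (tstar K) (tconv F H) x" using assms by (simp add: tconv_tstar_unit tconv_closed)
  also have "\<dots> = tconv (tstar (tconv (tstar F) K)) H x"
    using assms by (simp add: tstar_tconv tstar_closed tstar_tstar tconv_assoc)
  also have "\<dots> = inner x H (tconv (tstar F) K)"
    using assms by (simp add: tconv_tstar_unit tconv_closed tstar_closed)
  finally show ?thesis .
qed

lemma tconv_diag_left:
  assumes "\<And>\<gamma>. \<gamma> \<notin> units G \<Longrightarrow> F \<gamma> = 0"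
  shows "tconv F H \<gamma> = (if \<gamma> \<in> arrows G then F (rng G \<gamma>) * H \<gamma> else 0)"
proof (cases "\<gamma> \<in> arrows G")
  case True
  have "rsupp F (rng G \<gamma>) \<subseteq> {rng G \<gamma>}"
    using assms rng_of_unit unfolding rsupp_def by fastforce
  hence "tconv F H \<gamma> = (\<Sum>\<alpha>\<in>{rng G \<gamma>}. cocycle \<alpha> (gcomp G (ginv G \<alpha>) \<gamma>) * F \<alpha> * H (gcomp G (ginv G \<alpha>) \<gamma>))"
    using True by (intro tconv_superset) auto
  thus ?thesis using True by (simp add: inv_unit rng_unit)
qed (simp add: tconv_def)

lemma tconv_diag_right:
  assumes H: "H \<in> fibre_finite" and F: "\<And>\<gamma>. \<gamma> \<notin> units G \<Longrightarrow> F \<gamma> = 0"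
  shows "tconv H F \<gamma> = (if \<gamma> \<in> arrows G then H \<gamma> * F (src G \<gamma>) else 0)"
proof (cases "\<gamma> \<in> arrows G")
  case True
  have eq: "\<alpha> = \<gamma>" if a: "\<alpha> \<in> arrows G" "rng G \<alpha> = rng G \<gamma>" and "gcomp G (ginv G \<alpha>) \<gamma> \<in> units G" for \<alpha>
  proof -
    have "gcomp G (ginv G \<alpha>) \<gamma> = rng G (gcomp G (ginv G \<alpha>) \<gamma>)" using rng_of_unit that by simp
    hence "gcomp G (ginv G \<alpha>) \<gamma> = src G \<alpha>" using a True by simp
    thus ?thesis using gcomp_inv_cancel[OF a(1) True a(2)] a by simp
  qed
  have "tconv H F \<gamma> = (\<Sum>\<alpha>\<in>insert \<gamma> (rsupp H (rng G \<gamma>)). cocycle \<alpha> (gcomp G (ginv G \<alpha>) \<gamma>) * H \<alpha> * F (gcomp G (ginv G \<alpha>) \<gamma>))"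
    using True fibre_finiteD(2)[OF H] by (intro tconv_superset) (auto simp: rsupp_def)
  also have "\<dots> = (\<Sum>\<alpha>\<in>{\<gamma>}. cocycle \<alpha> (gcomp G (ginv G \<alpha>) \<gamma>) * H \<alpha> * F (gcomp G (ginv G \<alpha>) \<gamma>))"
    using eq F True fibre_finiteD(2)[OF H] by (intro sum.mono_neutral_right) (auto simp: rsupp_def)
  finally show ?thesis using True by (simp add: inv_comp)
qed (simp add: tconv_def)

text \<open>Right translation by \<open>\<gamma>\<close> is an isometry from the functions on the arrows with source \<open>rng G \<gamma>\<close> onto
  those on the arrows with source \<open>src G \<gamma>\<close>.\<close>

lemma qnorm_tconv_single:
  assumes F: "F \<in> fibre_finite" and H: "H \<in> fibre_finite" and \<gamma>: "\<gamma> \<in> arrows G"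
    and single: "\<And>\<beta>. \<beta> \<in> arrows G \<Longrightarrow> src G \<beta> = src G \<gamma> \<Longrightarrow> \<beta> \<noteq> \<gamma> \<Longrightarrow> H \<beta> = 0"
  shows "qnorm (src G \<gamma>) (tconv F H) = cmod (H \<gamma>) * qnorm (rng G \<gamma>) F"
proof (cases "H \<gamma> = 0")
  case True
  have "ssupp H (src G \<gamma>) = {}" using True single by (auto simp: ssupp_def)
  hence "ssupp (tconv F H) (src G \<gamma>) = {}" using tconv_support(2)[of F H "src G \<gamma>"] by simp
  thus ?thesis using True by (simp add: qnorm_def)
next
  case False
  have val: "cmod (tconv F H (gcomp G \<alpha> \<gamma>)) = cmod (H \<gamma>) * cmod (F \<alpha>)" if \<alpha>: "\<alpha> \<in> arrows G" "src G \<alpha> = rng G \<gamma>" for \<alpha>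
  proof -
    let ?\<delta> = "gcomp G \<alpha> \<gamma>"
    have "tconv F H ?\<delta> = (\<Sum>\<beta>\<in>insert \<alpha> (rsupp F (rng G ?\<delta>)). cocycle \<beta> (gcomp G (ginv G \<beta>) ?\<delta>) * F \<beta> * H (gcomp G (ginv G \<beta>) ?\<delta>))"
      using \<alpha> \<gamma> fibre_finiteD(2)[OF F] by (intro tconv_superset) (auto simp: rsupp_def)
    also have "\<dots> = (\<Sum>\<beta>\<in>{\<alpha>}. cocycle \<beta> (gcomp G (ginv G \<beta>) ?\<delta>) * F \<beta> * H (gcomp G (ginv G \<beta>) ?\<delta>))"
    proof (rule sum.mono_neutral_right)
      show "\<forall>\<beta>\<in>insert \<alpha> (rsupp F (rng G ?\<delta>)) - {\<alpha>}. cocycle \<beta> (gcomp G (ginv G \<beta>) ?\<delta>) * F \<beta> * H (gcomp G (ginv G \<beta>) ?\<delta>) = 0"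
      proof
        fix \<beta> assume "\<beta> \<in> insert \<alpha> (rsupp F (rng G ?\<delta>)) - {\<alpha>}"
        hence b: "\<beta> \<in> arrows G" "rng G \<beta> = rng G \<alpha>" "\<beta> \<noteq> \<alpha>" using \<alpha> \<gamma> by (auto simp: rsupp_def)
        have "gcomp G (ginv G \<beta>) ?\<delta> \<noteq> \<gamma>"
        proof
          assume e: "gcomp G (ginv G \<beta>) ?\<delta> = \<gamma>"
          hence "gcomp G \<beta> \<gamma> = gcomp G \<alpha> \<gamma>" using b \<alpha> \<gamma> gcomp_inv_cancel[of \<beta> ?\<delta>] by simp
          moreover have "src G \<beta> = rng G \<gamma>" using e b \<alpha> \<gamma> src_rng(8)[of "ginv G \<beta>" ?\<delta>] by simp
          ultimately have "gcomp G (gcomp G \<beta> \<gamma>) (ginv G \<gamma>) = gcomp G (gcomp G \<alpha> \<gamma>) (ginv G \<gamma>)" by simp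
          hence "\<beta> = \<alpha>" using \<open>src G \<beta> = rng G \<gamma>\<close> b \<alpha> \<gamma> by (simp add: gcomp_assoc comp_inv)
          thus False using b by simp
        qed
        thus "cocycle \<beta> (gcomp G (ginv G \<beta>) ?\<delta>) * F \<beta> * H (gcomp G (ginv G \<beta>) ?\<delta>) = 0"
          using single[of "gcomp G (ginv G \<beta>) ?\<delta>"] b \<alpha> \<gamma> by simp
      qed
    qed (use fibre_finiteD(2)[OF F] in auto)
    finally show ?thesis using \<alpha> \<gamma> cmod_cocycle[of \<alpha> \<gamma>] by (simp add: Real_Vector_Spaces.norm_mult)
  qed
  define P where "P = ssupp F (rng G \<gamma>)"
  have P: "finite P" "\<And>\<alpha>. \<alpha> \<in> P \<Longrightarrow> \<alpha> \<in> arrows G \<and> src G \<alpha> = rng G \<gamma>"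
    using fibre_finiteD(3)[OF F] by (auto simp: P_def ssupp_def)
  let ?j = "\<lambda>\<alpha>. gcomp G \<alpha> \<gamma>"
  have inj: "inj_on ?j P"
  proof (rule inj_on_inverseI[of _ "\<lambda>\<delta>. gcomp G \<delta> (ginv G \<gamma>)"])
    show "gcomp G (?j \<alpha>) (ginv G \<gamma>) = \<alpha>" if "\<alpha> \<in> P" for \<alpha>
      using P(2)[OF that] \<gamma> by (simp add: gcomp_assoc comp_inv)
  qed
  have "ssupp H (src G \<gamma>) \<subseteq> {\<gamma>}" using single by (auto simp: ssupp_def)
  hence "ssupp (tconv F H) (src G \<gamma>) \<subseteq> ?j ` P"
    using tconv_support(2)[of F H "src G \<gamma>"] unfolding P_def by blast
  hence "qnorm (src G \<gamma>) (tconv F H) = L2_set (\<lambda>\<delta>. cmod (tconv F H \<delta>)) (?j ` P)"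
    using P \<gamma> by (intro qnorm_superset) auto
  also have "\<dots> = L2_set (\<lambda>\<alpha>. cmod (tconv F H (?j \<alpha>))) P"
    unfolding L2_set_def using inj by (simp add: sum.reindex)
  also have "\<dots> = L2_set (\<lambda>\<alpha>. cmod (H \<gamma>) * cmod (F \<alpha>)) P"
    using P val by (intro L2_set_cong) auto
  also have "\<dots> = cmod (H \<gamma>) * qnorm (rng G \<gamma>) F"
    by (simp add: L2_set_right_distrib qnorm_def P_def)
  finally show ?thesis .
qed

section \<open>Sections in coordinates\<close>

definition cf :: "('g \<Rightarrow> 'l) \<Rightarrow> 'g \<Rightarrow> complex" where
  "cf f \<gamma> = (if \<gamma> \<in> arrows G then coord \<gamma> (f \<gamma>) else 0)"

definition sections :: "('g \<Rightarrow> 'l) set" where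
  "sections = {f. f \<in> extensional (arrows G) \<and> (\<forall>\<gamma>\<in>arrows G. f \<gamma> \<in> fibre L \<gamma>)}"

lemma section_eqI: "\<lbrakk>f \<in> sections; g \<in> sections; cf f = cf g\<rbrakk> \<Longrightarrow> f = g"
proof (rule extensionalityI[of _ "arrows G"])
  fix \<gamma> assume fg: "f \<in> sections" "g \<in> sections" and eq: "cf f = cf g" and \<gamma>: "\<gamma> \<in> arrows G"
  have "coord \<gamma> (f \<gamma>) = coord \<gamma> (g \<gamma>)" using fun_cong[OF eq, of \<gamma>] \<gamma> by (simp add: cf_def)
  thus "f \<gamma> = g \<gamma>" using fg \<gamma> coord_eqI[of "f \<gamma>" \<gamma> "g \<gamma>"] by (simp add: sections_def)
qed (auto simp: sections_def)

lemma convolution_coord: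
  assumes f: "f \<in> sections" "cf f \<in> fibre_finite" and \<gamma>: "\<gamma> \<in> arrows G"
    and g: "\<And>\<beta>. \<beta> \<in> arrows G \<Longrightarrow> src G \<beta> = src G \<gamma> \<Longrightarrow> g \<beta> \<in> fibre L \<beta> \<and> coord \<beta> (g \<beta>) = H \<beta>"
  shows "convolution G L f g \<gamma> \<in> fibre L \<gamma> \<and> coord \<gamma> (convolution G L f g \<gamma>) = tconv (cf f) H \<gamma>"
proof -
  \<comment> \<open>The pairs with nonzero product are parametrized by finitely many left factors, so that the finite
    product in the fibre group is not the default value for infinite index sets.\<close>
  define I where "I = {(\<alpha>, \<beta>). (\<alpha>, \<beta>) \<in> composable G \<and> gcomp G \<alpha> \<beta> = \<gamma> \<and> bmult L (f \<alpha>) (g \<beta>) \<noteq> bzero L \<gamma>}"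
  have ff: "f \<alpha> \<in> fibre L \<alpha>" if "\<alpha> \<in> arrows G" for \<alpha> using f that by (auto simp: sections_def)
  have tm: "bmult L (f \<alpha>) (g \<beta>) \<in> fibre L \<gamma>"
    "coord \<gamma> (bmult L (f \<alpha>) (g \<beta>)) = cocycle \<alpha> \<beta> * cf f \<alpha> * H \<beta>" "\<beta> = gcomp G (ginv G \<alpha>) \<gamma>"
    if "(\<alpha>, \<beta>) \<in> composable G" "gcomp G \<alpha> \<beta> = \<gamma>" for \<alpha> \<beta>
    using that \<gamma> g[of \<beta>] ff[of \<alpha>] coord_mult[of "f \<alpha>" \<alpha> "g \<beta>" \<beta>] bmult_closed[of "f \<alpha>" \<alpha> "g \<beta>" \<beta>]
    by (auto simp: composable_def cf_def)
  have nz: "bmult L (f \<alpha>) (g \<beta>) \<noteq> bzero L \<gamma> \<longleftrightarrow> cf f \<alpha> \<noteq> 0 \<and> H \<beta> \<noteq> 0"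
    if ab: "(\<alpha>, \<beta>) \<in> composable G" "gcomp G \<alpha> \<beta> = \<gamma>" for \<alpha> \<beta>
    using coord_eq_0[OF tm(1)[OF ab]] tm(2)[OF ab] cmod_cocycle[of \<alpha> \<beta>] ab
    by (auto simp: composable_def)
  have I_eq: "I = (\<lambda>\<alpha>. (\<alpha>, gcomp G (ginv G \<alpha>) \<gamma>)) ` {\<alpha> \<in> rsupp (cf f) (rng G \<gamma>). H (gcomp G (ginv G \<alpha>) \<gamma>) \<noteq> 0}"
    (is "I = ?j ` ?P")
  proof (intro equalityI subsetI)
    fix p assume "p \<in> I"
    then obtain \<alpha> \<beta> where p: "p = (\<alpha>, \<beta>)" "(\<alpha>, \<beta>) \<in> composable G" "gcomp G \<alpha> \<beta> = \<gamma>" "cf f \<alpha> \<noteq> 0" "H \<beta> \<noteq> 0"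
      using nz by (auto simp: I_def)
    moreover have "rng G \<alpha> = rng G \<gamma>" using src_rng(8)[of \<alpha> \<beta>] p(2,3) by (auto simp: composable_def)
    ultimately show "p \<in> ?j ` ?P" using tm(3)[OF p(2,3)] by (auto simp: rsupp_def composable_def)
  next
    fix p assume "p \<in> ?j ` ?P"
    then obtain \<alpha> where \<alpha>: "p = ?j \<alpha>" "\<alpha> \<in> arrows G" "rng G \<alpha> = rng G \<gamma>" "cf f \<alpha> \<noteq> 0" "H (gcomp G (ginv G \<alpha>) \<gamma>) \<noteq> 0"
      by (auto simp: rsupp_def)
    hence "(\<alpha>, gcomp G (ginv G \<alpha>) \<gamma>) \<in> composable G" "gcomp G \<alpha> (gcomp G (ginv G \<alpha>) \<gamma>) = \<gamma>"
      using \<gamma> by (auto simp: composable_def)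
    thus "p \<in> I" using nz \<alpha> by (auto simp: I_def)
  qed
  have finP: "finite ?P" using fibre_finiteD(2)[OF f(2)] by simp
  hence finI: "finite I" by (simp add: I_eq)
  have "coord \<gamma> (finprod (fibre_group L \<gamma>) (\<lambda>(\<alpha>, \<beta>). bmult L (f \<alpha>) (g \<beta>)) I) =
      (\<Sum>p\<in>I. coord \<gamma> (case p of (\<alpha>, \<beta>) \<Rightarrow> bmult L (f \<alpha>) (g \<beta>)))"
    "finprod (fibre_group L \<gamma>) (\<lambda>(\<alpha>, \<beta>). bmult L (f \<alpha>) (g \<beta>)) I \<in> fibre L \<gamma>"
    using coord_finprod[OF \<gamma> finI] tm(1) by (auto simp: I_def)
  moreover have "(\<Sum>p\<in>I. coord \<gamma> (case p of (\<alpha>, \<beta>) \<Rightarrow> bmult L (f \<alpha>) (g \<beta>))) =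
      (\<Sum>p\<in>I. case p of (\<alpha>, \<beta>) \<Rightarrow> cocycle \<alpha> \<beta> * cf f \<alpha> * H \<beta>)"
    using tm(2) by (intro sum.cong) (auto simp: I_def)
  moreover have "\<dots> = (\<Sum>\<alpha>\<in>?P. cocycle \<alpha> (gcomp G (ginv G \<alpha>) \<gamma>) * cf f \<alpha> * H (gcomp G (ginv G \<alpha>) \<gamma>))"
    unfolding I_eq by (subst sum.reindex) (auto intro: inj_onI)
  moreover have "\<dots> = tconv (cf f) H \<gamma>"
    using \<gamma> fibre_finiteD(2)[OF f(2)] by (auto simp: tconv_def intro!: sum.mono_neutral_left)
  ultimately show ?thesis by (simp add: convolution_def flip: I_def)
qed

end

section \<open>Topology of the arrow space\<close>

lemma continuous_map_nbhdI:
  assumes "\<And>x. x \<in> topspace X \<Longrightarrow> f x \<in> topspace Y"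
    and "\<And>x W. \<lbrakk>x \<in> topspace X; openin Y W; f x \<in> W\<rbrakk> \<Longrightarrow> \<exists>V. openin X V \<and> x \<in> V \<and> (\<forall>y\<in>V. f y \<in> W)"
  shows "continuous_map X Y f"
  unfolding continuous_map_eq_topcontinuous_at topcontinuous_at_def using assms by blast

context etale_groupoid
begin

abbreviation "T \<equiv> arrow_top G"

lemma topspace_T [simp]: "topspace T = arrows G"
  by (simp add: arrows_def)

lemma topspace_units [simp]: "topspace (unit_top G) = units G"
  using units_arrows by (auto simp: unit_top_def)

lemma etale_nbhd:
  assumes "\<gamma> \<in> arrows G"
  obtains U where "openin T U" "\<gamma> \<in> U" "openin (unit_top G) (rng G ` U)"
    "homeomorphic_map (subtopology T U) (subtopology (unit_top G) (rng G ` U)) (rng G)"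
  using etale assms unfolding local_homeomorphism_def by auto

lemma rng_continuous_units: "continuous_map T (unit_top G) (rng G)"
proof (rule continuous_map_nbhdI)
  fix \<gamma> W assume \<gamma>: "\<gamma> \<in> topspace T" and W: "openin (unit_top G) W" "rng G \<gamma> \<in> W"
  obtain U where U: "openin T U" "\<gamma> \<in> U"
    "homeomorphic_map (subtopology T U) (subtopology (unit_top G) (rng G ` U)) (rng G)"
    using etale_nbhd \<gamma> by auto
  have "continuous_map (subtopology T U) (unit_top G) (rng G)"
    using homeomorphic_imp_continuous_map[OF U(3)] continuous_map_in_subtopology by blast
  from openin_continuous_map_preimage[OF this W(1)]
  have "openin T {a \<in> topspace (subtopology T U). rng G a \<in> W}" using U(1) openin_open_subtopology by blast
  thus "\<exists>V. openin T V \<and> \<gamma> \<in> V \<and> (\<forall>y\<in>V. rng G y \<in> W)"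
    using U \<gamma> W by (intro exI[of _ "{a \<in> topspace (subtopology T U). rng G a \<in> W}"]) auto
qed (simp add: rng_unit)

lemma rng_open: "openin T W \<Longrightarrow> openin (unit_top G) (rng G ` W)"
proof (subst openin_subopen, intro ballI)
  fix x assume W: "openin T W" and "x \<in> rng G ` W"
  then obtain \<gamma> where \<gamma>: "\<gamma> \<in> W" "x = rng G \<gamma>" by blast
  hence "\<gamma> \<in> arrows G" using openin_subset[OF W] by auto
  then obtain U where U: "openin T U" "\<gamma> \<in> U" "openin (unit_top G) (rng G ` U)"
    "homeomorphic_map (subtopology T U) (subtopology (unit_top G) (rng G ` U)) (rng G)"
    by (rule etale_nbhd)
  have "openin (subtopology T U) (W \<inter> U)" using W by (simp add: openin_subtopology_Int)
  hence "openin (subtopology (unit_top G) (rng G ` U)) (rng G ` (W \<inter> U))"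
    using homeomorphic_imp_open_map[OF U(4)] by (simp add: open_map_def)
  hence "openin (unit_top G) (rng G ` (W \<inter> U))" using U(3) openin_open_subtopology by blast
  thus "\<exists>S. openin (unit_top G) S \<and> x \<in> S \<and> S \<subseteq> rng G ` W" using \<gamma> U(2) by blast
qed

text \<open>Near a unit \<open>x\<close> the range map is injective on some open \<open>U\<close>. An arrow \<open>\<gamma> \<in> U\<close> with \<open>rng G \<gamma> \<in> U\<close> has
  the same range as the unit \<open>rng G \<gamma>\<close>, hence is equal to it.\<close>

lemma units_open: "openin T (units G)"
proof (subst openin_subopen, intro ballI)
  fix x assume x: "x \<in> units G"
  obtain U where U: "openin T U" "x \<in> U"
    "homeomorphic_map (subtopology T U) (subtopology (unit_top G) (rng G ` U)) (rng G)"
    using etale_nbhd units_arrows[OF x] by blast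
  have inj: "inj_on (rng G) U"
    using homeomorphic_imp_injective_map[OF U(3)] openin_subset[OF U(1)] by (auto simp: inf_absorb2)
  have "continuous_map T T (rng G)"
    using rng_continuous_units by (auto simp: unit_top_def continuous_map_in_subtopology)
  from openin_Int[OF U(1) openin_continuous_map_preimage[OF this U(1)]]
  have "openin T (U \<inter> {\<gamma> \<in> arrows G. rng G \<gamma> \<in> U})" by simp
  moreover have "x \<in> U \<inter> {\<gamma> \<in> arrows G. rng G \<gamma> \<in> U}" using x U units_arrows rng_of_unit by auto
  moreover have "U \<inter> {\<gamma> \<in> arrows G. rng G \<gamma> \<in> U} \<subseteq> units G"
  proof
    fix \<gamma> assume \<gamma>: "\<gamma> \<in> U \<inter> {\<gamma> \<in> arrows G. rng G \<gamma> \<in> U}"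
    hence "rng G \<gamma> = \<gamma>" using inj_onD[OF inj, of "rng G \<gamma>" \<gamma>] by auto
    thus "\<gamma> \<in> units G" using rng_unit[of \<gamma>] \<gamma> by simp
  qed
  ultimately show "\<exists>S. openin T S \<and> x \<in> S \<and> S \<subseteq> units G" by blast
qed

lemma openin_units_iff: "openin (unit_top G) V \<longleftrightarrow> openin T V \<and> V \<subseteq> units G"
  unfolding unit_top_def by (rule openin_open_subtopology[OF units_open])

lemma rng_continuous: "continuous_map T T (rng G)"
  using rng_continuous_units by (auto simp: unit_top_def continuous_map_in_subtopology)

lemma src_continuous_units: "continuous_map T (unit_top G) (src G)"
  using continuous_map_compose[OF continuous_inv rng_continuous_units]
  by (rule continuous_map_eq) simp

lemma src_continuous: "continuous_map T T (src G)"
  using src_continuous_units by (auto simp: unit_top_def continuous_map_in_subtopology)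

lemma inv_image: "W \<subseteq> arrows G \<Longrightarrow> ginv G ` W = {\<gamma> \<in> arrows G. ginv G \<gamma> \<in> W}"
proof (intro equalityI subsetI)
  fix \<gamma> assume "W \<subseteq> arrows G" "\<gamma> \<in> {\<gamma> \<in> arrows G. ginv G \<gamma> \<in> W}"
  thus "\<gamma> \<in> ginv G ` W" using inv_inv[of \<gamma>] by (metis (no_types, lifting) imageI mem_Collect_eq)
qed auto

lemma inv_open: "openin T W \<Longrightarrow> openin T (ginv G ` W)"
  using openin_continuous_map_preimage[OF continuous_inv, of W] inv_image[of W] openin_subset[of T W]
  by simp

lemma src_open: "openin T W \<Longrightarrow> openin (unit_top G) (src G ` W)"
proof -
  assume W: "openin T W"
  have "src G ` W = rng G ` (ginv G ` W)"
    using openin_subset[OF W] by (force simp: image_image)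
  thus ?thesis using rng_open[OF inv_open[OF W]] by simp
qed

lemma bisection_arrows: "open_bisection G U \<Longrightarrow> U \<subseteq> arrows G"
  using openin_subset by (fastforce simp: open_bisection_def)

lemma bisection_eqI:
  "\<lbrakk>open_bisection G U; \<alpha> \<in> U; \<beta> \<in> U; src G \<alpha> = src G \<beta> \<or> rng G \<alpha> = rng G \<beta>\<rbrakk> \<Longrightarrow> \<alpha> = \<beta>"
  by (auto simp: open_bisection_def inj_on_def)

lemma units_bisection: "open_bisection G (units G)"
  using units_open rng_of_unit src_of_unit by (auto simp: open_bisection_def inj_on_def)

lemma bisection_inv: "open_bisection G U \<Longrightarrow> open_bisection G (ginv G ` U)"
  using bisection_arrows[of U] inv_open[of U]
  by (auto simp: open_bisection_def inj_on_def subset_iff)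

text \<open>The arrow of an open bisection with a given range, which depends continuously on the range
  because the range map is open.\<close>

definition with_range :: "'g set \<Rightarrow> 'g \<Rightarrow> 'g" where
  "with_range U = inv_into U (rng G)"

lemma with_range:
  "\<lbrakk>open_bisection G U; \<alpha> \<in> U; rng G \<alpha> = x\<rbrakk> \<Longrightarrow> with_range U x = \<alpha>"
  unfolding with_range_def open_bisection_def using inv_into_f_f by metis

lemma with_range_continuous:
  assumes U: "open_bisection G U"
  shows "continuous_map (subtopology T (rng G ` U)) T (with_range U)"
proof (rule continuous_map_nbhdI)
  have r: "rng G ` U \<subseteq> arrows G" using bisection_arrows[OF U] by auto
  show "with_range U x \<in> topspace T" if "x \<in> topspace (subtopology T (rng G ` U))" for x
    using that with_range[OF U] bisection_arrows[OF U] by auto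
  fix x W assume x: "x \<in> topspace (subtopology T (rng G ` U))" and W: "openin T W" "with_range U x \<in> W"
  have WU: "openin T (W \<inter> U)" using W U by (auto simp: open_bisection_def)
  have "openin T (rng G ` (W \<inter> U))" using rng_open[OF WU] openin_units_iff by blast
  hence "openin (subtopology T (rng G ` U)) (rng G ` (W \<inter> U))"
    by (metis Int_lower2 image_mono inf.orderE openin_subtopology)
  moreover have "x \<in> rng G ` (W \<inter> U)"
  proof -
    obtain \<alpha> where \<alpha>: "\<alpha> \<in> U" "x = rng G \<alpha>" using x by auto
    hence "\<alpha> \<in> W" using with_range[OF U] W(2) by simp
    thus ?thesis using \<alpha> by blast
  qed
  moreover have "\<forall>y\<in>rng G ` (W \<inter> U). with_range U y \<in> W" using with_range[OF U] by auto
  ultimately show "\<exists>V. openin (subtopology T (rng G ` U)) V \<and> x \<in> V \<and> (\<forall>y\<in>V. with_range U y \<in> W)"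
    by blast
qed

definition bprod :: "'g set \<Rightarrow> 'g set \<Rightarrow> 'g set" where
  "bprod U V = {gcomp G \<alpha> \<beta> |\<alpha> \<beta>. \<alpha> \<in> U \<and> \<beta> \<in> V \<and> src G \<alpha> = rng G \<beta>}"

definition left_factor :: "'g set \<Rightarrow> 'g \<Rightarrow> 'g" where
  "left_factor U \<gamma> = with_range U (rng G \<gamma>)"

definition right_factor :: "'g set \<Rightarrow> 'g \<Rightarrow> 'g" where
  "right_factor U \<gamma> = gcomp G (ginv G (left_factor U \<gamma>)) \<gamma>"

lemma factor_continuous:
  assumes U: "open_bisection G U"
  defines "D \<equiv> {\<gamma> \<in> arrows G. rng G \<gamma> \<in> rng G ` U}"
  shows "openin T D" "continuous_map (subtopology T D) T (left_factor U)"
    "continuous_map (subtopology T D) T (right_factor U)"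
proof -
  have "openin T (rng G ` U)" using rng_open openin_units_iff U by (auto simp: open_bisection_def)
  thus "openin T D" using openin_continuous_map_preimage[OF rng_continuous] by (simp add: D_def)
  have "continuous_map (subtopology T D) (subtopology T (rng G ` U)) (rng G)"
    using rng_continuous by (auto simp: continuous_map_in_subtopology D_def intro: continuous_map_from_subtopology)
  from continuous_map_compose[OF this with_range_continuous[OF U]]
  show lc: "continuous_map (subtopology T D) T (left_factor U)" by (simp add: left_factor_def[abs_def] comp_def)
  have l: "left_factor U \<gamma> \<in> arrows G" "rng G (left_factor U \<gamma>) = rng G \<gamma>" if "\<gamma> \<in> D" for \<gamma>
    using that with_range[OF U] bisection_arrows[OF U] by (auto simp: D_def left_factor_def)
  have "continuous_map (subtopology T D) (prod_topology T T) (\<lambda>\<gamma>. (ginv G (left_factor U \<gamma>), \<gamma>))"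
    using continuous_map_compose[OF lc continuous_inv]
    by (intro continuous_map_pairedI) (auto simp: comp_def)
  hence "continuous_map (subtopology T D) (subtopology (prod_topology T T) (composable G))
      (\<lambda>\<gamma>. (ginv G (left_factor U \<gamma>), \<gamma>))"
    using l by (auto simp: continuous_map_in_subtopology composable_def D_def)
  from continuous_map_compose[OF this continuous_comp]
  show "continuous_map (subtopology T D) T (right_factor U)"
    by (simp add: right_factor_def[abs_def] comp_def)
qed

lemma factors:
  assumes U: "open_bisection G U" and V: "open_bisection G V"
    and "\<alpha> \<in> U" "\<beta> \<in> V" "src G \<alpha> = rng G \<beta>"
  shows "left_factor U (gcomp G \<alpha> \<beta>) = \<alpha>" "right_factor U (gcomp G \<alpha> \<beta>) = \<beta>"
proof -
  have a: "\<alpha> \<in> arrows G" "\<beta> \<in> arrows G" using assms bisection_arrows by auto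
  thus 1: "left_factor U (gcomp G \<alpha> \<beta>) = \<alpha>"
    using with_range[OF U assms(3)] assms by (simp add: left_factor_def)
  show "right_factor U (gcomp G \<alpha> \<beta>) = \<beta>" using a assms by (simp add: right_factor_def 1)
qed

text \<open>This description of the product as a preimage shows that it is open.\<close>

lemma bprod_eq:
  assumes U: "open_bisection G U" and V: "open_bisection G V"
  shows "bprod U V = {\<gamma> \<in> topspace (subtopology T {\<gamma> \<in> arrows G. rng G \<gamma> \<in> rng G ` U}). right_factor U \<gamma> \<in> V}"
proof (intro equalityI subsetI)
  fix \<gamma> assume "\<gamma> \<in> bprod U V"
  then obtain \<alpha> \<beta> where g: "\<gamma> = gcomp G \<alpha> \<beta>" "\<alpha> \<in> U" "\<beta> \<in> V" "src G \<alpha> = rng G \<beta>" by (auto simp: bprod_def)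
  moreover have "\<alpha> \<in> arrows G" "\<beta> \<in> arrows G" using g bisection_arrows U V by auto
  ultimately show "\<gamma> \<in> {\<gamma> \<in> topspace (subtopology T {\<gamma> \<in> arrows G. rng G \<gamma> \<in> rng G ` U}). right_factor U \<gamma> \<in> V}"
    using factors[OF U V] by auto
next
  fix \<gamma> assume "\<gamma> \<in> {\<gamma> \<in> topspace (subtopology T {\<gamma> \<in> arrows G. rng G \<gamma> \<in> rng G ` U}). right_factor U \<gamma> \<in> V}"
  then obtain \<alpha> where g: "\<gamma> \<in> arrows G" "\<alpha> \<in> U" "rng G \<gamma> = rng G \<alpha>" "right_factor U \<gamma> \<in> V" by auto
  have a: "\<alpha> \<in> arrows G" using g bisection_arrows[OF U] by auto
  have l: "left_factor U \<gamma> = \<alpha>" using g with_range[OF U g(2)] by (simp add: left_factor_def)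
  hence "right_factor U \<gamma> = gcomp G (ginv G \<alpha>) \<gamma>" by (simp add: right_factor_def)
  hence "\<gamma> = gcomp G \<alpha> (right_factor U \<gamma>)" "src G \<alpha> = rng G (right_factor U \<gamma>)" using a g by auto
  thus "\<gamma> \<in> bprod U V" using g unfolding bprod_def by blast
qed

lemma bprod_bisection:
  assumes U: "open_bisection G U" and V: "open_bisection G V"
  shows "open_bisection G (bprod U V)"
proof -
  note ar = bisection_arrows[OF U] bisection_arrows[OF V]
  have "openin T (bprod U V)"
    unfolding bprod_eq[OF U V]
    using openin_continuous_map_preimage[OF factor_continuous(3)[OF U], of V] V factor_continuous(1)[OF U]
    by (metis (no_types, lifting) open_bisection_def openin_open_subtopology)
  moreover have "inj_on (rng G) (bprod U V)" "inj_on (src G) (bprod U V)"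
  proof -
    have *: "\<gamma> = \<gamma>'" if "\<gamma> \<in> bprod U V" "\<gamma>' \<in> bprod U V" "src G \<gamma> = src G \<gamma>' \<or> rng G \<gamma> = rng G \<gamma>'" for \<gamma> \<gamma>'
    proof -
      obtain \<alpha> \<beta> where g: "\<gamma> = gcomp G \<alpha> \<beta>" "\<alpha> \<in> U" "\<beta> \<in> V" "src G \<alpha> = rng G \<beta>" using \<open>\<gamma> \<in> bprod U V\<close> by (auto simp: bprod_def)
      obtain \<alpha>' \<beta>' where g': "\<gamma>' = gcomp G \<alpha>' \<beta>'" "\<alpha>' \<in> U" "\<beta>' \<in> V" "src G \<alpha>' = rng G \<beta>'" using \<open>\<gamma>' \<in> bprod U V\<close> by (auto simp: bprod_def)
      have a: "\<alpha> \<in> arrows G" "\<beta> \<in> arrows G" "\<alpha>' \<in> arrows G" "\<beta>' \<in> arrows G" using g g' ar by auto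
      from that(3) show ?thesis
      proof
        assume "src G \<gamma> = src G \<gamma>'"
        hence "\<beta> = \<beta>'" using bisection_eqI[OF V g(3) g'(3)] g g' a by auto
        moreover hence "\<alpha> = \<alpha>'" using bisection_eqI[OF U g(2) g'(2)] g g' by auto
        ultimately show ?thesis using g g' by simp
      next
        assume "rng G \<gamma> = rng G \<gamma>'"
        hence "\<alpha> = \<alpha>'" using bisection_eqI[OF U g(2) g'(2)] g g' a by auto
        moreover hence "\<beta> = \<beta>'" using bisection_eqI[OF V g(3) g'(3)] g g' by auto
        ultimately show ?thesis using g g' by simp
      qed
    qed
    thus "inj_on (rng G) (bprod U V)" "inj_on (src G) (bprod U V)" by (auto simp: inj_on_def)
  qed
  ultimately show ?thesis by (simp add: open_bisection_def)
qed

lemma compact_product: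
  assumes "compactin T K" "compactin T K'"
  shows "compactin T {gcomp G \<alpha> \<beta> |\<alpha> \<beta>. \<alpha> \<in> K \<and> \<beta> \<in> K' \<and> src G \<alpha> = rng G \<beta>}"
proof -
  let ?P = "prod_topology T T"
  have sub: "K \<subseteq> arrows G" "K' \<subseteq> arrows G" using assms compactin_subset_topspace by fastforce+
  have "closedin ?P {p \<in> topspace ?P. (src G \<circ> fst) p = (rng G \<circ> snd) p}"
    by (intro closedin_continuous_maps_eq[OF Hausdorff_units]
        continuous_map_compose[OF continuous_map_fst src_continuous_units]
        continuous_map_compose[OF continuous_map_snd rng_continuous_units])
  moreover have "{p \<in> topspace ?P. (src G \<circ> fst) p = (rng G \<circ> snd) p} = composable G"
    by (auto simp: composable_def)
  ultimately have "closedin ?P (composable G)" by simp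
  hence "compactin ?P (composable G \<inter> (K \<times> K'))"
    using assms by (intro closed_Int_compactin) (auto simp: compactin_Times)
  hence "compactin (subtopology ?P (composable G)) (composable G \<inter> (K \<times> K'))"
    by (simp add: compactin_subtopology)
  from image_compactin[OF this continuous_comp]
  have "compactin T ((\<lambda>(\<alpha>, \<beta>). gcomp G \<alpha> \<beta>) ` (composable G \<inter> (K \<times> K')))" .
  moreover have "(\<lambda>(\<alpha>, \<beta>). gcomp G \<alpha> \<beta>) ` (composable G \<inter> (K \<times> K')) =
      {gcomp G \<alpha> \<beta> |\<alpha> \<beta>. \<alpha> \<in> K \<and> \<beta> \<in> K' \<and> src G \<alpha> = rng G \<beta>}"
    using sub by (force simp: composable_def)
  ultimately show ?thesis by simp
qed

lemma compact_closed_in_bisection: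
  assumes U: "open_bisection G U" and K: "compactin T K" "K \<subseteq> U"
  shows "openin T (U - K)"
proof -
  have "closedin (unit_top G) (rng G ` K)"
    by (rule compactin_imp_closedin[OF Hausdorff_units image_compactin[OF K(1) rng_continuous_units]])
  hence "openin (unit_top G) (units G - rng G ` K)" by (metis openin_diff openin_topspace topspace_units)
  hence "openin T {\<gamma> \<in> arrows G. rng G \<gamma> \<in> units G - rng G ` K}"
    using openin_continuous_map_preimage[OF rng_continuous_units, of "units G - rng G ` K"]
    by (simp only: topspace_T)
  hence "openin T (U \<inter> {\<gamma> \<in> arrows G. rng G \<gamma> \<in> units G - rng G ` K})"
    using U by (auto simp: open_bisection_def)
  moreover have "U \<inter> {\<gamma> \<in> arrows G. rng G \<gamma> \<in> units G - rng G ` K} = U - K"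
    using bisection_arrows[OF U] rng_unit bisection_eqI[OF U] K(2) by (auto; metis subsetD)
  ultimately show ?thesis by simp
qed

lemma compactin_units: "compactin (unit_top G) K \<longleftrightarrow> compactin T K \<and> K \<subseteq> units G"
  by (simp add: unit_top_def compactin_subtopology conj_commute)

text \<open>A Urysohn function \<open>f\<close> that vanishes outside an open \<open>W\<close> need not have support inside \<open>W\<close>; cutting
  it off at height \<open>1/2\<close> leaves a function that vanishes outside the closed set where \<open>f \<ge> 1/2\<close>.\<close>

lemma bump_function:
  assumes K: "compactin T K" "K \<subseteq> V" and V: "openin (unit_top G) V"
  obtains \<phi> :: "'g \<Rightarrow> real" and K' where "continuous_map (unit_top G) euclideanreal \<phi>"
    "\<And>x. x \<in> units G \<Longrightarrow> 0 \<le> \<phi> x \<and> \<phi> x \<le> 1" "\<And>x. x \<in> K \<Longrightarrow> \<phi> x = 1"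
    "compactin T K'" "K' \<subseteq> V" "\<And>x. x \<in> units G - K' \<Longrightarrow> \<phi> x = 0"
proof -
  let ?X = "unit_top G"
  have V': "V \<subseteq> units G" using openin_subset[OF V] by simp
  have KX: "compactin ?X K" using K V' by (auto simp: compactin_units)
  obtain U0 L0 where U0: "openin ?X U0" "compactin ?X L0" "closedin ?X L0" "K \<subseteq> U0" "U0 \<subseteq> L0"
    using locally_compact_space_compact_closed_compact[of ?X] Hausdorff_units locally_compact_units KX by blast
  define W where "W = U0 \<inter> V"
  have W: "openin ?X W" "K \<subseteq> W" using U0 V K by (auto simp: W_def)
  have cr: "completely_regular_space ?X"
    using locally_compact_regular_imp_completely_regular_space locally_compact_units Hausdorff_units by blast
  obtain f where f: "continuous_map ?X (subtopology euclideanreal {0..1}) f" "f ` (topspace ?X - W) \<subseteq> {0}" "f ` K \<subseteq> {1}"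
  proof (rule Urysohn_completely_regular_compact_closed[of 0 1 ?X K "topspace ?X - W"])
    show "closedin ?X (topspace ?X - W)" using W(1) by blast
    show "disjnt K (topspace ?X - W)" using W(2) by (auto simp: disjnt_def)
  qed (use cr KX in auto)
  have fc: "continuous_map ?X euclideanreal f" and f01: "x \<in> units G \<Longrightarrow> f x \<in> {0..1}" for x
    using f(1) by (auto simp: continuous_map_in_subtopology)
  define \<phi> where "\<phi> = (\<lambda>x. max 0 (2 * f x - 1))"
  define K' where "K' = {x \<in> topspace ?X. f x \<in> {1/2..}}"
  have K'W: "K' \<subseteq> W" using f(2) by (force simp: K'_def)
  have "closedin ?X K'" unfolding K'_def
    by (rule closedin_continuous_map_preimage[OF fc]) auto
  hence "compactin ?X K'" using closed_compactin[OF U0(2)] K'W U0(5) by (auto simp: W_def)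
  show ?thesis
  proof (rule that)
    show "continuous_map ?X euclideanreal \<phi>" unfolding \<phi>_def by (intro continuous_intros fc) auto
    show "0 \<le> \<phi> x \<and> \<phi> x \<le> 1" if "x \<in> units G" for x using f01[OF that] by (auto simp: \<phi>_def)
    show "\<phi> x = 1" if "x \<in> K" for x using f(3) that by (auto simp: \<phi>_def)
    show "compactin T K'" using \<open>compactin ?X K'\<close> by (simp add: compactin_units)
    show "K' \<subseteq> V" using K'W by (auto simp: W_def)
    show "\<phi> x = 0" if "x \<in> units G - K'" for x using that by (auto simp: \<phi>_def K'_def)
  qed
qed

end

section \<open>Continuous sections\<close>

context fell_line_bundle
begin

abbreviation "E U \<equiv> subtopology (total_top L) {\<xi>. proj L \<xi> \<in> U}"

lemma bundle_axioms:
  assumes U: "open_bisection G U"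
  shows proj_continuous: "continuous_map (E U) (subtopology T U) (proj L)"
    and proj_open: "open_map (E U) (subtopology T U) (proj L)"
    and bnorm_continuous: "continuous_map (E U) euclideanreal (bnorm L)"
    and badd_continuous: "continuous_map (subtopology (prod_topology (E U) (E U)) {(\<xi>, \<eta>). proj L \<xi> = proj L \<eta>}) (E U)
         (\<lambda>(\<xi>, \<eta>). badd L \<xi> \<eta>)"
    and bscale_continuous: "continuous_map (E U) (E U) (bscale L c)"
    and small_open: "\<lbrakk>\<gamma> \<in> U; openin (E U) W; bzero L \<gamma> \<in> W\<rbrakk> \<Longrightarrow> \<exists>V \<epsilon>. openin T V \<and> \<gamma> \<in> V \<and> V \<subseteq> U \<and> \<epsilon> > 0 \<and>
             (\<forall>\<delta>\<in>V. \<forall>\<xi>\<in>fibre L \<delta>. bnorm L \<xi> < \<epsilon> \<longrightarrow> \<xi> \<in> W)"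
proof -
  note b = banach_bundle[OF U, unfolded continuous_banach_bundle_on_def Let_def]
  from b show "continuous_map (E U) (subtopology T U) (proj L)" "open_map (E U) (subtopology T U) (proj L)"
    "continuous_map (E U) euclideanreal (bnorm L)"
    "continuous_map (subtopology (prod_topology (E U) (E U)) {(\<xi>, \<eta>). proj L \<xi> = proj L \<eta>}) (E U)
         (\<lambda>(\<xi>, \<eta>). badd L \<xi> \<eta>)" "continuous_map (E U) (E U) (bscale L c)"
    by blast+
  have U': "openin T U" "topspace (subtopology T U) = U"
    using U bisection_arrows[OF U] by (auto simp: open_bisection_def)
  assume "\<gamma> \<in> U" "openin (E U) W" "bzero L \<gamma> \<in> W"
  then obtain V \<epsilon> where V: "openin (subtopology T U) V" "\<gamma> \<in> V" "\<epsilon> > 0"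
    "{\<xi> \<in> topspace (E U). proj L \<xi> \<in> V \<and> bnorm L \<xi> < \<epsilon>} \<subseteq> W"
    using b U'(2) by blast
  have VU: "openin T V" "V \<subseteq> U" using V(1) U'(1) openin_open_subtopology by blast+
  have "\<forall>\<delta>\<in>V. \<forall>\<xi>\<in>fibre L \<delta>. bnorm L \<xi> < \<epsilon> \<longrightarrow> \<xi> \<in> W" using V(4) VU by (auto simp: fibre_def)
  thus "\<exists>V \<epsilon>. openin T V \<and> \<gamma> \<in> V \<and> V \<subseteq> U \<and> \<epsilon> > 0 \<and>
             (\<forall>\<delta>\<in>V. \<forall>\<xi>\<in>fibre L \<delta>. bnorm L \<xi> < \<epsilon> \<longrightarrow> \<xi> \<in> W)" using V VU by blast
qed

lemma E_top: "\<xi> \<in> topspace (E U) \<longleftrightarrow> \<xi> \<in> fibre L (proj L \<xi>) \<and> proj L \<xi> \<in> U"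
  by (auto simp: fibre_def)

lemma fibre_E: "\<xi> \<in> fibre L \<gamma> \<Longrightarrow> \<gamma> \<in> U \<Longrightarrow> \<xi> \<in> topspace (E U)"
  by (auto simp: fibre_def)

definition csection :: "'g set \<Rightarrow> ('g \<Rightarrow> 'l) \<Rightarrow> bool" where
  "csection Y f \<longleftrightarrow> (\<forall>\<gamma>\<in>Y. f \<gamma> \<in> fibre L \<gamma>) \<and> continuous_map (subtopology T Y) (total_top L) f"

lemma csection_E: "\<lbrakk>csection Y f; Y \<subseteq> U\<rbrakk> \<Longrightarrow> continuous_map (subtopology T Y) (E U) f"
  by (auto simp: csection_def continuous_map_in_subtopology fibre_def)

lemma csection_subset: "\<lbrakk>csection Y f; Z \<subseteq> Y\<rbrakk> \<Longrightarrow> csection Z f"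
  by (auto simp: csection_def intro: continuous_map_from_subtopology_mono)

lemma csection_cong: "\<lbrakk>csection Y f; \<And>\<gamma>. \<gamma> \<in> Y \<Longrightarrow> f \<gamma> = g \<gamma>\<rbrakk> \<Longrightarrow> csection Y g"
  by (auto simp: csection_def intro: continuous_map_eq)

lemma csection_badd:
  assumes U: "open_bisection G U" and Y: "Y \<subseteq> U" and f: "csection Y f" and g: "csection Y g"
  shows "csection Y (\<lambda>\<gamma>. badd L (f \<gamma>) (g \<gamma>))"
proof -
  have "continuous_map (subtopology T Y) (prod_topology (E U) (E U)) (\<lambda>\<gamma>. (f \<gamma>, g \<gamma>))"
    using csection_E[OF f Y] csection_E[OF g Y] by (rule continuous_map_pairedI)
  hence "continuous_map (subtopology T Y) (subtopology (prod_topology (E U) (E U)) {(\<xi>, \<eta>). proj L \<xi> = proj L \<eta>}) (\<lambda>\<gamma>. (f \<gamma>, g \<gamma>))"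
    using f g by (auto simp: continuous_map_in_subtopology csection_def fibre_def)
  from continuous_map_compose[OF this badd_continuous[OF U]]
  have "continuous_map (subtopology T Y) (total_top L) (\<lambda>\<gamma>. badd L (f \<gamma>) (g \<gamma>))"
    by (simp add: comp_def continuous_map_in_subtopology)
  thus ?thesis using f g badd_closed by (simp add: csection_def)
qed

lemma csection_bscale:
  assumes U: "open_bisection G U" and Y: "Y \<subseteq> U" and f: "csection Y f"
  shows "csection Y (\<lambda>\<gamma>. bscale L c (f \<gamma>))"
  using continuous_map_compose[OF csection_E[OF f Y] bscale_continuous[OF U, of c]] f bscale_closed fibre_arrow
  by (auto simp: csection_def comp_def continuous_map_in_subtopology)

lemma csection_bnorm:
  assumes U: "open_bisection G U" and Y: "Y \<subseteq> U" and f: "csection Y f"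
  shows "continuous_map (subtopology T Y) euclideanreal (\<lambda>\<gamma>. bnorm L (f \<gamma>))"
  using continuous_map_compose[OF csection_E[OF f Y] bnorm_continuous[OF U]] by (simp add: comp_def)

lemma csection_zero:
  assumes U: "open_bisection G U"
  shows "csection U (bzero L)"
  unfolding csection_def
proof (intro conjI ballI continuous_map_nbhdI)
  note ar = bisection_arrows[OF U]
  show *: "bzero L \<gamma> \<in> fibre L \<gamma>" if "\<gamma> \<in> U" for \<gamma> using that ar bzero_closed by auto
  show "bzero L \<gamma> \<in> topspace (total_top L)" if "\<gamma> \<in> topspace (subtopology T U)" for \<gamma>
    using that * fibre_top by auto
  fix \<gamma> W assume \<gamma>: "\<gamma> \<in> topspace (subtopology T U)" and W: "openin (total_top L) W" "bzero L \<gamma> \<in> W"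
  have "openin (E U) (W \<inter> {\<xi>. proj L \<xi> \<in> U})" using W by (auto simp: openin_subtopology)
  moreover have "bzero L \<gamma> \<in> W \<inter> {\<xi>. proj L \<xi> \<in> U}" using W \<gamma> fibre_top(2)[OF *[of \<gamma>]] by auto
  ultimately obtain V \<epsilon> where V: "openin T V" "\<gamma> \<in> V" "V \<subseteq> U" "\<epsilon> > 0"
    "\<forall>\<delta>\<in>V. \<forall>\<xi>\<in>fibre L \<delta>. bnorm L \<xi> < \<epsilon> \<longrightarrow> \<xi> \<in> W \<inter> {\<xi>. proj L \<xi> \<in> U}"
    using small_open[OF U, of \<gamma>] \<gamma> by (metis (no_types, lifting) IntD2 topspace_subtopology)
  have "openin (subtopology T U) V" using V by (metis inf.orderE openin_subtopology)
  moreover have "\<forall>\<delta>\<in>V. bzero L \<delta> \<in> W" using V ar bnorm_bzero bzero_closed by (metis IntD1 subsetD)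
  ultimately show "\<exists>V. openin (subtopology T U) V \<and> \<gamma> \<in> V \<and> (\<forall>y\<in>V. bzero L y \<in> W)" using V by blast
qed

text \<open>Continuity of the addition at \<open>(\<omega>, 0)\<close> and the smallness axiom: an element near \<open>\<omega>\<close> may be
  changed by one of small norm.\<close>

lemma perturbation:
  assumes U: "open_bisection G U" and W: "openin (total_top L) W" "\<omega> \<in> W" "proj L \<omega> \<in> U"
  shows "\<exists>W1 \<epsilon>. openin (E U) W1 \<and> \<omega> \<in> W1 \<and> \<epsilon> > 0 \<and>
    (\<forall>\<xi>\<in>W1. \<forall>\<eta>\<in>fibre L (proj L \<xi>). bnorm L \<eta> < \<epsilon> \<longrightarrow> badd L \<xi> \<eta> \<in> W)"
proof -
  define \<gamma> where "\<gamma> = proj L \<omega>"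
  have \<omega>: "\<omega> \<in> fibre L \<gamma>" using W openin_subset by (force simp: fibre_def \<gamma>_def)
  have \<gamma>: "\<gamma> \<in> U" "\<gamma> \<in> arrows G" using W bisection_arrows[OF U] by (auto simp: \<gamma>_def)
  let ?P = "prod_topology (E U) (E U)" and ?D = "{(\<xi>, \<eta>). proj L \<xi> = proj L \<eta>}"
  have "openin (E U) (W \<inter> {\<xi>. proj L \<xi> \<in> U})" using W by (auto simp: openin_subtopology)
  from openin_continuous_map_preimage[OF badd_continuous[OF U] this]
  obtain R where R: "openin ?P R"
    "{p \<in> topspace (subtopology ?P ?D). (case p of (\<xi>, \<eta>) \<Rightarrow> badd L \<xi> \<eta>) \<in> W \<inter> {\<xi>. proj L \<xi> \<in> U}} = R \<inter> ?D"
    unfolding openin_subtopology by blast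
  have "badd L \<omega> (bzero L \<gamma>) = \<omega>"
    using badd_zero[OF \<omega>] comm_groupE(4)[OF fibre_comm_group[OF \<gamma>(2)], of \<omega> "bzero L \<gamma>"] \<omega> bzero_closed[OF \<gamma>(2)]
    by (simp add: fibre_group_def)
  moreover have "\<omega> \<in> topspace (E U)" "bzero L \<gamma> \<in> topspace (E U)"
    using fibre_E[OF \<omega> \<gamma>(1)] fibre_E[OF bzero_closed[OF \<gamma>(2)] \<gamma>(1)] by auto
  moreover have "proj L (bzero L \<gamma>) = \<gamma>" using bzero_closed[OF \<gamma>(2)] fibre_top by blast
  ultimately have "(\<omega>, bzero L \<gamma>) \<in> {p \<in> topspace (subtopology ?P ?D). (case p of (\<xi>, \<eta>) \<Rightarrow> badd L \<xi> \<eta>) \<in> W \<inter> {\<xi>. proj L \<xi> \<in> U}}"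
    using W by (simp add: \<gamma>_def)
  hence inR: "(\<omega>, bzero L \<gamma>) \<in> R" unfolding R(2) by blast
  obtain W1 W2 where W12: "openin (E U) W1" "openin (E U) W2" "\<omega> \<in> W1" "bzero L \<gamma> \<in> W2" "W1 \<times> W2 \<subseteq> R"
    using R(1)[unfolded openin_prod_topology_alt, rule_format, OF inR] by (elim exE conjE)
  obtain V \<epsilon> where V: "openin T V" "\<gamma> \<in> V" "V \<subseteq> U" "\<epsilon> > 0" "\<forall>\<delta>\<in>V. \<forall>\<xi>\<in>fibre L \<delta>. bnorm L \<xi> < \<epsilon> \<longrightarrow> \<xi> \<in> W2"
    using small_open[OF U \<gamma>(1) W12(2,4)] by blast
  have "openin (subtopology T U) V" using V by (metis inf.orderE openin_subtopology)
  from openin_Int[OF W12(1) openin_continuous_map_preimage[OF proj_continuous[OF U] this]]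
  have op: "openin (E U) (W1 \<inter> {\<xi> \<in> topspace (E U). proj L \<xi> \<in> V})" .
  show ?thesis
  proof (rule exI[of _ "W1 \<inter> {\<xi> \<in> topspace (E U). proj L \<xi> \<in> V}"], rule exI[of _ \<epsilon>], intro conjI ballI impI op V)
    show "\<omega> \<in> W1 \<inter> {\<xi> \<in> topspace (E U). proj L \<xi> \<in> V}"
      using W12(3) V(2) \<open>\<omega> \<in> topspace (E U)\<close> by (simp add: \<gamma>_def)
    fix \<xi> \<eta> assume \<xi>: "\<xi> \<in> W1 \<inter> {\<xi> \<in> topspace (E U). proj L \<xi> \<in> V}" and \<eta>: "\<eta> \<in> fibre L (proj L \<xi>)" "bnorm L \<eta> < \<epsilon>"
    have "\<eta> \<in> W2" using V(5) \<xi> \<eta> by blast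
    hence "(\<xi>, \<eta>) \<in> R \<inter> ?D" using \<xi> \<eta> W12(5) fibre_top(2)[OF \<eta>(1)] by auto
    thus "badd L \<xi> \<eta> \<in> W" unfolding R(2)[symmetric] by auto
  qed
qed

text \<open>Only the multiplication by a constant is continuous by assumption. Near \<open>\<gamma>\<close>, the element
  \<open>\<phi>(\<delta>) f(\<delta>)\<close> differs from \<open>\<phi>(\<gamma>) f(\<delta>)\<close> by one of small norm.\<close>

lemma csection_scalar:
  assumes U: "open_bisection G U" and Y: "Y \<subseteq> U" and f: "csection Y f"
    and \<phi>: "continuous_map (subtopology T Y) euclidean (\<phi> :: 'g \<Rightarrow> complex)"
  shows "csection Y (\<lambda>\<gamma>. bscale L (\<phi> \<gamma>) (f \<gamma>))"
  unfolding csection_def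
proof (intro conjI ballI continuous_map_nbhdI)
  note ar = bisection_arrows[OF U]
  have ff: "f \<gamma> \<in> fibre L \<gamma>" if "\<gamma> \<in> Y" for \<gamma> using f that by (auto simp: csection_def)
  show *: "bscale L (\<phi> \<gamma>) (f \<gamma>) \<in> fibre L \<gamma>" if "\<gamma> \<in> Y" for \<gamma>
    using that ff bscale_closed ar Y by blast
  show "bscale L (\<phi> \<gamma>) (f \<gamma>) \<in> topspace (total_top L)" if "\<gamma> \<in> topspace (subtopology T Y)" for \<gamma>
    using that * fibre_top by auto
  fix \<gamma> W assume \<gamma>: "\<gamma> \<in> topspace (subtopology T Y)" and W: "openin (total_top L) W" "bscale L (\<phi> \<gamma>) (f \<gamma>) \<in> W"
  have \<gamma>': "\<gamma> \<in> Y" "\<gamma> \<in> U" using \<gamma> Y by auto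
  obtain W1 \<epsilon> where W1: "openin (E U) W1" "bscale L (\<phi> \<gamma>) (f \<gamma>) \<in> W1" "\<epsilon> > 0"
    "\<And>\<xi> \<eta>. \<xi> \<in> W1 \<Longrightarrow> \<eta> \<in> fibre L (proj L \<xi>) \<Longrightarrow> bnorm L \<eta> < \<epsilon> \<Longrightarrow> badd L \<xi> \<eta> \<in> W"
    using perturbation[OF U W] *[OF \<gamma>'(1)] \<gamma>' fibre_top(2) by metis
  have c1: "continuous_map (subtopology T Y) (E U) (\<lambda>\<delta>. bscale L (\<phi> \<gamma>) (f \<delta>))"
    by (rule csection_E[OF csection_bscale[OF U Y f] Y])
  have c2: "continuous_map (subtopology T Y) euclideanreal (\<lambda>\<delta>. cmod (\<phi> \<delta> - \<phi> \<gamma>) * bnorm L (f \<delta>))"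
    by (intro continuous_map_real_mult continuous_map_norm continuous_map_diff \<phi> continuous_map_const[THEN iffD2]
        csection_bnorm[OF U Y f]) simp
  let ?V = "{\<delta> \<in> topspace (subtopology T Y). bscale L (\<phi> \<gamma>) (f \<delta>) \<in> W1} \<inter>
      {\<delta> \<in> topspace (subtopology T Y). cmod (\<phi> \<delta> - \<phi> \<gamma>) * bnorm L (f \<delta>) \<in> {..<\<epsilon>}}"
  have "openin (subtopology T Y) ?V"
    by (intro openin_Int openin_continuous_map_preimage[OF c1 W1(1)] openin_continuous_map_preimage[OF c2]) auto
  moreover have "\<gamma> \<in> ?V" using \<gamma> W1 by simp
  moreover have "bscale L (\<phi> \<delta>) (f \<delta>) \<in> W" if \<delta>: "\<delta> \<in> ?V" for \<delta>
  proof -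
    have \<delta>Y: "\<delta> \<in> Y" "\<delta> \<in> arrows G" using \<delta> by auto
    note fd = ff[OF \<delta>Y(1)]
    have "bscale L (\<phi> \<delta>) (f \<delta>) = badd L (bscale L (\<phi> \<gamma>) (f \<delta>)) (bscale L (\<phi> \<delta> - \<phi> \<gamma>) (f \<delta>))"
      using bscale_add_left[OF \<delta>Y(2) fd, of "\<phi> \<gamma>" "\<phi> \<delta> - \<phi> \<gamma>"] by simp
    moreover have "bscale L (\<phi> \<delta> - \<phi> \<gamma>) (f \<delta>) \<in> fibre L (proj L (bscale L (\<phi> \<gamma>) (f \<delta>)))"
      using bscale_closed[OF \<delta>Y(2) fd] fibre_top(2) by metis
    ultimately show ?thesis using W1(4) \<delta> bnorm_bscale[OF \<delta>Y(2) fd] by simp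
  qed
  ultimately show "\<exists>V. openin (subtopology T Y) V \<and> \<gamma> \<in> V \<and> (\<forall>\<delta>\<in>V. bscale L (\<phi> \<delta>) (f \<delta>) \<in> W)" by blast
qed

lemma continuous_square: "continuous_map (E (units G)) (E (units G)) (\<lambda>\<xi>. bmult L \<xi> \<xi>)"
proof -
  let ?E = "E (units G)"
  have *: "(\<xi>, \<xi>) \<in> bundle_composable G L" "bmult L \<xi> \<xi> \<in> fibre L (proj L \<xi>)" if "\<xi> \<in> topspace ?E" for \<xi>
  proof -
    have \<xi>: "\<xi> \<in> fibre L (proj L \<xi>)" "proj L \<xi> \<in> units G" using that by (auto simp: fibre_def)
    note u = units_arrows[OF \<xi>(2)] src_of_unit[OF \<xi>(2)] rng_of_unit[OF \<xi>(2)]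
    show "(\<xi>, \<xi>) \<in> bundle_composable G L" using bundle_composableI[OF \<xi>(1) \<xi>(1)] u by simp
    show "bmult L \<xi> \<xi> \<in> fibre L (proj L \<xi>)" using bmult_closed[OF \<xi>(1) \<xi>(1)] u by simp
  qed
  have id: "continuous_map ?E (total_top L) (\<lambda>\<xi>. \<xi>)"
    using continuous_map_from_subtopology[OF continuous_map_id, of "total_top L"] by (simp add: id_def)
  have "continuous_map ?E (prod_topology (total_top L) (total_top L)) (\<lambda>\<xi>. (\<xi>, \<xi>))"
    by (rule continuous_map_pairedI[OF id id])
  hence "continuous_map ?E (subtopology (prod_topology (total_top L) (total_top L)) (bundle_composable G L)) (\<lambda>\<xi>. (\<xi>, \<xi>))"
    using * by (auto simp: continuous_map_in_subtopology)
  from continuous_map_compose[OF this continuous_mult]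
  have "continuous_map ?E (total_top L) (\<lambda>\<xi>. bmult L \<xi> \<xi>)" by (simp add: comp_def)
  thus ?thesis using *(2) fibre_top(2) by (fastforce simp: continuous_map_in_subtopology)
qed

text \<open>As the projection is open, there are elements \<open>c\<cdot>1\<close> near a given unit element in all
  neighbouring fibres. By continuity of \<open>\<parallel>\<xi>\<xi> - \<xi>\<parallel>\<close> and \<open>\<parallel>\<xi>\<parallel>\<close> the scalar \<open>c\<close> is close to \<open>1\<close>.\<close>

lemma csection_one: "csection (units G) (fibre_one L)"
  unfolding csection_def
proof (intro conjI ballI continuous_map_nbhdI)
  let ?E = "E (units G)"
  note U = units_bisection
  show *: "fibre_one L x \<in> fibre L x" if "x \<in> units G" for x using fibre_one(1)[OF that] .
  show "fibre_one L x \<in> topspace (total_top L)" if "x \<in> topspace (subtopology T (units G))" for x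
    using that * fibre_top by auto
  fix x W assume "x \<in> topspace (subtopology T (units G))" and W: "openin (total_top L) W" "fibre_one L x \<in> W"
  hence x: "x \<in> units G" by auto
  obtain W1 \<epsilon> where W1: "openin ?E W1" "fibre_one L x \<in> W1" "\<epsilon> > 0"
    "\<And>\<xi> \<eta>. \<xi> \<in> W1 \<Longrightarrow> \<eta> \<in> fibre L (proj L \<xi>) \<Longrightarrow> bnorm L \<eta> < \<epsilon> \<Longrightarrow> badd L \<xi> \<eta> \<in> W"
    using perturbation[OF U W] *[OF x] x fibre_top(2) by metis
  have id: "continuous_map ?E ?E (\<lambda>\<xi>. \<xi>)" using continuous_map_id by (simp add: id_def)
  define n1 where "n1 = (\<lambda>\<xi>. bnorm L (badd L (bmult L \<xi> \<xi>) (bscale L (-1) \<xi>)))"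
  have coord1: "\<xi> = bscale L (coord y \<xi>) (fibre_one L y)" if "\<xi> \<in> fibre L y" "y \<in> units G" for \<xi> y
    using bscale_coord[OF that(1)] unit_vec_unit[OF that(2)] by simp
  have sq: "bmult L \<xi> \<xi> \<in> fibre L y" "coord y (bmult L \<xi> \<xi>) = coord y \<xi> * coord y \<xi>"
    if "\<xi> \<in> fibre L y" "y \<in> units G" for \<xi> y
    using bmult_closed[OF that(1,1)] coord_mult[OF that(1,1)] cocycle_unit_left[of y] that(2)
      units_arrows[of y] src_of_unit[of y] rng_of_unit[of y] by auto
  have n1: "n1 \<xi> = cmod (coord y \<xi>) * cmod (coord y \<xi> - 1)" if "\<xi> \<in> fibre L y" "y \<in> units G" for \<xi> y
  proof -
    note y = units_arrows[OF that(2)]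
    have m: "bscale L (-1) \<xi> \<in> fibre L y" using bscale_closed[OF y that(1)] .
    have "coord y (badd L (bmult L \<xi> \<xi>) (bscale L (-1) \<xi>)) = coord y \<xi> * (coord y \<xi> - 1)"
      using coord_add[OF sq(1)[OF that] m] sq(2)[OF that] coord_scale[OF that(1)] by (simp add: algebra_simps)
    thus ?thesis unfolding n1_def using bnorm_coord[OF badd_closed[OF sq(1)[OF that] m]]
      by (simp add: Real_Vector_Spaces.norm_mult)
  qed
  have pr: "proj L (bmult L \<xi> \<xi>) = proj L (bscale L (-1) \<xi>)" if "\<xi> \<in> topspace ?E" for \<xi>
    using that sq(1)[of \<xi> "proj L \<xi>"] bscale_closed[of "proj L \<xi>" \<xi>] units_arrows fibre_top(2)
    by (metis E_top)
  have "continuous_map ?E (prod_topology ?E ?E) (\<lambda>\<xi>. (bmult L \<xi> \<xi>, bscale L (-1) \<xi>))"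
    by (intro continuous_map_pairedI continuous_square bscale_continuous[OF U])
  hence "continuous_map ?E (subtopology (prod_topology ?E ?E) {(\<xi>, \<eta>). proj L \<xi> = proj L \<eta>}) (\<lambda>\<xi>. (bmult L \<xi> \<xi>, bscale L (-1) \<xi>))"
    using pr by (auto simp: continuous_map_in_subtopology)
  from continuous_map_compose[OF continuous_map_compose[OF this badd_continuous[OF U]] bnorm_continuous[OF U]]
  have c1: "continuous_map ?E euclideanreal n1" by (simp add: n1_def comp_def)
  define W2 where "W2 = W1 \<inter> {\<xi> \<in> topspace ?E. n1 \<xi> \<in> {..<\<epsilon>/2}} \<inter> {\<xi> \<in> topspace ?E. bnorm L \<xi> \<in> {1/2<..}}"
  have "openin ?E W2" unfolding W2_def
    by (intro openin_Int W1 openin_continuous_map_preimage[OF c1]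
        openin_continuous_map_preimage[OF bnorm_continuous[OF U]]) auto
  hence V: "openin (subtopology T (units G)) (proj L ` W2)"
    using proj_open[OF U] by (simp add: open_map_def)
  have "fibre_one L x \<in> W2"
    using W1(2,3) fibre_E[OF *[OF x] x] n1[OF *[OF x] x] coord_unit_vec[OF units_arrows[OF x]] fibre_one(2)[OF x]
    by (simp add: W2_def unit_vec_unit[OF x])
  hence xV: "x \<in> proj L ` W2" using fibre_top(2)[OF *[OF x]] by force
  moreover have "fibre_one L y \<in> W" if yV: "y \<in> proj L ` W2" for y
  proof -
    obtain \<xi> where \<xi>: "\<xi> \<in> W2" "y = proj L \<xi>" using yV by blast
    have \<xi>': "\<xi> \<in> fibre L y" "y \<in> units G" using \<xi> by (auto simp: W2_def fibre_def)
    define c where "c = coord y \<xi>"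
    have "cmod c > 1/2" "cmod c * cmod (c - 1) < \<epsilon> / 2"
      using \<xi> n1[OF \<xi>'] bnorm_coord[OF \<xi>'(1)] by (auto simp: W2_def c_def)
    hence "cmod (c - 1) * (1/2) \<le> cmod c * cmod (c - 1)" using mult_right_mono[of "1/2" "cmod c" "cmod (c - 1)"] by simp
    hence small: "cmod (1 - c) < \<epsilon>" using \<open>cmod c * cmod (c - 1) < \<epsilon> / 2\<close> by (simp add: norm_minus_commute)
    note y = units_arrows[OF \<xi>'(2)] and o = *[OF \<xi>'(2)]
    have "fibre_one L y = badd L \<xi> (bscale L (1 - c) (fibre_one L y))"
      using bscale_add_left[OF y o, of c "1 - c"] bscale_one[OF y o] coord1[OF \<xi>'] by (simp add: c_def)
    moreover have "bnorm L (bscale L (1 - c) (fibre_one L y)) < \<epsilon>"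
      using bnorm_bscale[OF y o] fibre_one(2)[OF \<xi>'(2)] small by simp
    moreover have "\<xi> \<in> W1" using \<xi> by (simp add: W2_def)
    ultimately show ?thesis using W1(4) bscale_closed[OF y o] \<xi>(2) by metis
  qed
  ultimately show "\<exists>V. openin (subtopology T (units G)) V \<and> x \<in> V \<and> (\<forall>y\<in>V. fibre_one L y \<in> W)" using V by blast
qed

text \<open>The distance of the coordinate to a constant \<open>c\<close> is the norm of the continuous section \<open>f - c\<cdot>1\<close>.\<close>

lemma csection_coord_continuous:
  assumes f: "csection (units G) f"
  shows "continuous_map (unit_top G) euclidean (\<lambda>x. coord x (f x))"
  unfolding unit_top_def
proof (rule continuous_map_nbhdI)
  note U = units_bisection
  fix x W assume "x \<in> topspace (subtopology T (units G))" and W: "openin euclidean W" "coord x (f x) \<in> W"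
  hence x: "x \<in> units G" by auto
  define c where "c = coord x (f x)"
  obtain \<epsilon> where e: "\<epsilon> > 0" "\<And>z. dist z c < \<epsilon> \<Longrightarrow> z \<in> W" using W by (auto simp: open_dist c_def)
  define g where "g = (\<lambda>y. badd L (f y) (bscale L (- c) (fibre_one L y)))"
  have "csection (units G) g"
    unfolding g_def by (intro csection_badd[OF U _ f] csection_bscale[OF U _ csection_one] order_refl)
  from csection_bnorm[OF U order_refl this]
  have "continuous_map (subtopology T (units G)) euclideanreal (\<lambda>y. bnorm L (g y))" .
  moreover have "bnorm L (g y) = cmod (coord y (f y) - c)" if y: "y \<in> units G" for y
  proof -
    note ya = units_arrows[OF y] and o = fibre_one(1)[OF y]
    have fy: "f y \<in> fibre L y" using f y by (auto simp: csection_def)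
    have s: "bscale L (- c) (fibre_one L y) \<in> fibre L y" using bscale_closed[OF ya o] .
    have "coord y (g y) = coord y (f y) - c"
      unfolding g_def coord_add[OF fy s] using coord_bscale[OF ya, of "- c"] unit_vec_unit[OF y] by simp
    thus ?thesis using bnorm_coord[OF badd_closed[OF fy s]] by (simp add: g_def)
  qed
  ultimately have "continuous_map (subtopology T (units G)) euclideanreal (\<lambda>y. cmod (coord y (f y) - c))"
    by (rule continuous_map_eq) auto
  from openin_continuous_map_preimage[OF this, of "{..<\<epsilon>}"]
  have "openin (subtopology T (units G)) {y \<in> topspace (subtopology T (units G)). cmod (coord y (f y) - c) \<in> {..<\<epsilon>}}" by simp
  moreover have "x \<in> {y \<in> topspace (subtopology T (units G)). cmod (coord y (f y) - c) \<in> {..<\<epsilon>}}"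
    using x units_arrows e by (auto simp: c_def)
  ultimately show "\<exists>V. openin (subtopology T (units G)) V \<and> x \<in> V \<and> (\<forall>y\<in>V. coord y (f y) \<in> W)"
    using e(2) by (intro exI[of _ "{y \<in> topspace (subtopology T (units G)). cmod (coord y (f y) - c) \<in> {..<\<epsilon>}}"])
      (auto simp: dist_norm)
qed simp

end

section \<open>The algebra of compactly supported sections\<close>

context fell_line_bundle
begin

abbreviation "SA \<equiv> section_algebra G L"

lemma section_fibre: "f \<in> sections \<Longrightarrow> \<gamma> \<in> arrows G \<Longrightarrow> f \<gamma> \<in> fibre L \<gamma>"
  by (simp add: sections_def)

lemma cf_eq_0: "f \<in> sections \<Longrightarrow> \<gamma> \<in> arrows G \<Longrightarrow> cf f \<gamma> = 0 \<longleftrightarrow> f \<gamma> = bzero L \<gamma>"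
  using coord_eq_0[OF section_fibre] by (simp add: cf_def)

lemma bnorm_cf: "f \<in> sections \<Longrightarrow> \<gamma> \<in> arrows G \<Longrightarrow> bnorm L (f \<gamma>) = cmod (cf f \<gamma>)"
  using bnorm_coord[OF section_fibre] by (simp add: cf_def)

lemma Cc_on_iff:
  "f \<in> Cc_on G L U \<longleftrightarrow> f \<in> sections \<and> continuous_map (subtopology T U) (total_top L) f \<and>
     (\<exists>K. compactin T K \<and> K \<subseteq> U \<and> (\<forall>\<gamma>\<in>arrows G - K. cf f \<gamma> = 0))"
  using cf_eq_0[of f] unfolding Cc_on_def sections_def by auto

lemma Cc_onD:
  assumes "f \<in> Cc_on G L U"
  shows "f \<in> sections" "U \<subseteq> arrows G \<Longrightarrow> csection U f"
  using assms section_fibre by (auto simp: Cc_on_iff csection_def)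

lemma Cc_on_compact:
  assumes "f \<in> Cc_on G L U"
  obtains K where "compactin T K" "K \<subseteq> U" "\<And>\<gamma>. cf f \<gamma> \<noteq> 0 \<Longrightarrow> \<gamma> \<in> K"
  using assms unfolding Cc_on_iff by (metis DiffI cf_def)

lemma Cc_onI:
  "\<lbrakk>f \<in> sections; csection U f; compactin T K; K \<subseteq> U; \<And>\<gamma>. cf f \<gamma> \<noteq> 0 \<Longrightarrow> \<gamma> \<in> K\<rbrakk> \<Longrightarrow> f \<in> Cc_on G L U"
  unfolding Cc_on_iff csection_def by blast

lemma Cc_on_support: "f \<in> Cc_on G L U \<Longrightarrow> cf f \<gamma> \<noteq> 0 \<Longrightarrow> \<gamma> \<in> U"
  using Cc_on_compact by blast

lemma section_ops:
  assumes f: "f \<in> sections"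
  shows "sa_zero SA \<in> sections" "cf (sa_zero SA) = (\<lambda>\<gamma>. 0)"
    and "sa_scale SA c f \<in> sections" "cf (sa_scale SA c f) = (\<lambda>\<gamma>. c * cf f \<gamma>)"
    and "sa_star SA f \<in> sections" "cf (sa_star SA f) = tstar (cf f)"
    and "g \<in> sections \<Longrightarrow> sa_add SA f g \<in> sections"
    and "g \<in> sections \<Longrightarrow> cf (sa_add SA f g) = (\<lambda>\<gamma>. cf f \<gamma> + cf g \<gamma>)"
    and "g \<in> sections \<Longrightarrow> cf f \<in> fibre_finite \<Longrightarrow> sa_mult SA f g \<in> sections"
    and "g \<in> sections \<Longrightarrow> cf f \<in> fibre_finite \<Longrightarrow> cf (sa_mult SA f g) = tconv (cf f) (cf g)"
proof -
  note ff = section_fibre[OF f]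
  show "sa_zero SA \<in> sections" "cf (sa_zero SA) = (\<lambda>\<gamma>. 0)"
    using bzero_closed coord_zero by (auto simp: section_algebra_def sections_def cf_def)
  show "sa_scale SA c f \<in> sections" "cf (sa_scale SA c f) = (\<lambda>\<gamma>. c * cf f \<gamma>)"
    using ff bscale_closed coord_scale by (auto simp: section_algebra_def sections_def cf_def fun_eq_iff)
  have st: "bstar L (f (ginv G \<gamma>)) \<in> fibre L \<gamma>" "coord \<gamma> (bstar L (f (ginv G \<gamma>))) = tstar (cf f) \<gamma>"
    if "\<gamma> \<in> arrows G" for \<gamma>
    using bstar_closed[OF ff[of "ginv G \<gamma>"]] coord_star[OF ff[of "ginv G \<gamma>"]] that
    by (auto simp: tstar_def cf_def)
  thus "sa_star SA f \<in> sections" "cf (sa_star SA f) = tstar (cf f)"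
    by (auto simp: section_algebra_def sections_def cf_def tstar_def fun_eq_iff)
  assume g: "g \<in> sections"
  show "sa_add SA f g \<in> sections" "cf (sa_add SA f g) = (\<lambda>\<gamma>. cf f \<gamma> + cf g \<gamma>)"
    using ff section_fibre[OF g] badd_closed coord_add
    by (auto simp: section_algebra_def sections_def cf_def fun_eq_iff)
  assume ffin: "cf f \<in> fibre_finite"
  have "convolution G L f g \<gamma> \<in> fibre L \<gamma> \<and> coord \<gamma> (convolution G L f g \<gamma>) = tconv (cf f) (cf g) \<gamma>"
    if "\<gamma> \<in> arrows G" for \<gamma>
    by (rule convolution_coord[OF f ffin that]) (use section_fibre[OF g] in \<open>simp add: cf_def\<close>)
  thus "sa_mult SA f g \<in> sections" "cf (sa_mult SA f g) = tconv (cf f) (cf g)"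
    by (auto simp: section_algebra_def sections_def cf_def tconv_def fun_eq_iff)
qed

lemma fibre_finite_bisection:
  assumes U: "open_bisection G U" and F: "\<And>\<gamma>. F \<gamma> \<noteq> 0 \<Longrightarrow> \<gamma> \<in> U"
  shows "F \<in> fibre_finite"
proof -
  have s: "rsupp F x \<subseteq> {inv_into U (rng G) x}" "ssupp F x \<subseteq> {inv_into U (src G) x}" for x
    using F U inv_into_f_f unfolding open_bisection_def by (fastforce simp: rsupp_def ssupp_def)+
  hence "finite (rsupp F x)" "finite (ssupp F x)" for x
    using finite_subset[OF s(1)] finite_subset[OF s(2)] by simp_all
  moreover have "F \<gamma> = 0" if "\<gamma> \<notin> arrows G" for \<gamma> using F bisection_arrows[OF U] that by blast
  ultimately show ?thesis by (simp add: fibre_finite_def)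
qed

lemma Cc_on_fibre_finite: "\<lbrakk>open_bisection G U; f \<in> Cc_on G L U\<rbrakk> \<Longrightarrow> cf f \<in> fibre_finite"
  using fibre_finite_bisection Cc_on_support by blast

lemma SA_ops:
  "sa_zero SA = (\<lambda>\<gamma>\<in>arrows G. bzero L \<gamma>)"
  "sa_add SA f g = (\<lambda>\<gamma>\<in>arrows G. badd L (f \<gamma>) (g \<gamma>))"
  "sa_scale SA c f = (\<lambda>\<gamma>\<in>arrows G. bscale L c (f \<gamma>))"
  by (simp_all add: section_algebra_def)

lemma Cc_ops:
  "sa_zero SA \<in> Cc G L"
  "\<lbrakk>f \<in> Cc G L; g \<in> Cc G L\<rbrakk> \<Longrightarrow> sa_add SA f g \<in> Cc G L"
  "f \<in> Cc G L \<Longrightarrow> sa_scale SA c f \<in> Cc G L"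
  using Cc.intros by (auto simp: section_algebra_def)

lemma Cc_induct [consumes 1, case_names base zero add scale]:
  assumes "f \<in> Cc G L"
    and "\<And>U f. \<lbrakk>open_bisection G U; f \<in> Cc_on G L U\<rbrakk> \<Longrightarrow> P f" "P (sa_zero SA)"
    and "\<And>f g. \<lbrakk>f \<in> Cc G L; P f; g \<in> Cc G L; P g\<rbrakk> \<Longrightarrow> P (sa_add SA f g)"
    and "\<And>f c. \<lbrakk>f \<in> Cc G L; P f\<rbrakk> \<Longrightarrow> P (sa_scale SA c f)"
  shows "P f"
  using assms(1)
proof (induction rule: Cc.induct)
  case (base U f)
  thus ?case by (rule assms(2))
next
  case zero
  show ?case using assms(3) by (simp only: SA_ops)
next
  case (add f g)
  thus ?case using assms(4)[of f g] by (simp only: SA_ops)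
next
  case (scale f c)
  thus ?case using assms(5)[of f c] by (simp only: SA_ops)
qed

lemma Cc_section: "f \<in> Cc G L \<Longrightarrow> f \<in> sections \<and> cf f \<in> fibre_finite"
proof (induction rule: Cc_induct)
  case (base U f)
  thus ?case using Cc_onD(1) Cc_on_fibre_finite by blast
next
  case zero
  have "(\<lambda>\<gamma>\<in>arrows G. bzero L \<gamma>) \<in> sections" using bzero_closed by (auto simp: sections_def)
  thus ?case using section_ops(1,2) by (auto simp: fibre_finite_def rsupp_def ssupp_def)
next
  case (add f g)
  thus ?case using section_ops(7,8)[of f g] fibre_finite_add by simp
next
  case (scale f c)
  thus ?case using section_ops(3,4)[of f c] fibre_finite_scale by simp
qed

lemmas Cc_sections = Cc_section[THEN conjunct1]
lemmas Cc_fibre_finite = Cc_section[THEN conjunct2]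

lemma Cc_cf:
  "cf (sa_zero SA) = (\<lambda>\<gamma>. 0)"
  "f \<in> Cc G L \<Longrightarrow> cf (sa_scale SA c f) = (\<lambda>\<gamma>. c * cf f \<gamma>)"
  "f \<in> Cc G L \<Longrightarrow> cf (sa_star SA f) = tstar (cf f)"
  "\<lbrakk>f \<in> Cc G L; g \<in> Cc G L\<rbrakk> \<Longrightarrow> cf (sa_add SA f g) = (\<lambda>\<gamma>. cf f \<gamma> + cf g \<gamma>)"
  "\<lbrakk>f \<in> Cc G L; g \<in> Cc G L\<rbrakk> \<Longrightarrow> cf (sa_mult SA f g) = tconv (cf f) (cf g)"
  using section_ops(2)[OF Cc_sections[OF Cc_ops(1)]]
  by (simp_all add: section_ops(4,6,8,10) Cc_sections Cc_fibre_finite)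

lemma tconv_bisection:
  assumes U: "open_bisection G U" and F: "\<And>\<gamma>. F \<gamma> \<noteq> 0 \<Longrightarrow> \<gamma> \<in> U"
    and a: "\<alpha> \<in> U" "\<beta> \<in> arrows G" "src G \<alpha> = rng G \<beta>"
  shows "tconv F H (gcomp G \<alpha> \<beta>) = cocycle \<alpha> \<beta> * F \<alpha> * H \<beta>"
proof -
  have \<alpha>: "\<alpha> \<in> arrows G" using a bisection_arrows[OF U] by auto
  have "rsupp F (rng G (gcomp G \<alpha> \<beta>)) \<subseteq> {\<alpha>}"
    using F bisection_eqI[OF U _ a(1)] \<alpha> a by (auto simp: rsupp_def)
  hence "tconv F H (gcomp G \<alpha> \<beta>) = (\<Sum>\<alpha>'\<in>{\<alpha>}. cocycle \<alpha>' (gcomp G (ginv G \<alpha>') (gcomp G \<alpha> \<beta>)) * F \<alpha>' * H (gcomp G (ginv G \<alpha>') (gcomp G \<alpha> \<beta>)))"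
    using \<alpha> a by (intro tconv_superset) auto
  thus ?thesis using \<alpha> a by simp
qed

text \<open>On the product of the bisections, a product of arrows determines its factors and they depend
  continuously on it, so that the convolution has a single term and is continuous.\<close>

lemma Cc_on_mult:
  assumes U: "open_bisection G U" and V: "open_bisection G V"
    and f: "f \<in> Cc_on G L U" and g: "g \<in> Cc_on G L V"
  shows "sa_mult SA f g \<in> Cc_on G L (bprod U V)"
proof -
  let ?h = "sa_mult SA f g" and ?P = "bprod U V"
  note fs = Cc_onD(1)[OF f] and gs = Cc_onD(1)[OF g] and ffin = Cc_on_fibre_finite[OF U f]
  note hs = section_ops(9,10)[OF fs gs ffin]
  obtain K where K: "compactin T K" "K \<subseteq> U" "\<And>\<gamma>. cf f \<gamma> \<noteq> 0 \<Longrightarrow> \<gamma> \<in> K" using Cc_on_compact[OF f] by blast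
  obtain K' where K': "compactin T K'" "K' \<subseteq> V" "\<And>\<gamma>. cf g \<gamma> \<noteq> 0 \<Longrightarrow> \<gamma> \<in> K'" using Cc_on_compact[OF g] by blast
  define D where "D = {\<gamma> \<in> arrows G. rng G \<gamma> \<in> rng G ` U}"
  note pb = bprod_bisection[OF U V]
  have P: "left_factor U \<gamma> \<in> U \<and> right_factor U \<gamma> \<in> V \<and> \<gamma> \<in> D \<and> src G (left_factor U \<gamma>) = rng G (right_factor U \<gamma>) \<and>
      \<gamma> = gcomp G (left_factor U \<gamma>) (right_factor U \<gamma>)" if \<gamma>: "\<gamma> \<in> ?P" for \<gamma>
  proof -
    obtain \<alpha> \<beta> where g: "\<gamma> = gcomp G \<alpha> \<beta>" "\<alpha> \<in> U" "\<beta> \<in> V" "src G \<alpha> = rng G \<beta>" using \<gamma> by (auto simp: bprod_def)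
    moreover have "\<alpha> \<in> arrows G" "\<beta> \<in> arrows G" using g bisection_arrows U V by auto
    ultimately show ?thesis using factors[OF U V g(2-4)] by (auto simp: D_def)
  qed
  have ha: "?h \<gamma> = bmult L (f (left_factor U \<gamma>)) (g (right_factor U \<gamma>))" if \<gamma>: "\<gamma> \<in> ?P" for \<gamma>
  proof -
    define \<alpha> \<beta> where "\<alpha> = left_factor U \<gamma>" and "\<beta> = right_factor U \<gamma>"
    have ab: "\<alpha> \<in> U" "\<beta> \<in> V" "src G \<alpha> = rng G \<beta>" "\<gamma> = gcomp G \<alpha> \<beta>" using P[OF \<gamma>] by (auto simp: \<alpha>_def \<beta>_def)
    have a: "\<alpha> \<in> arrows G" "\<beta> \<in> arrows G"
      using ab bisection_arrows[OF U] bisection_arrows[OF V] by auto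
    moreover from this have "\<gamma> \<in> arrows G" using ab by simp
    ultimately have a: "\<alpha> \<in> arrows G" "\<beta> \<in> arrows G" "\<gamma> \<in> arrows G" by auto
    note fa = section_fibre[OF fs a(1)] and gb = section_fibre[OF gs a(2)]
    have "coord \<gamma> (?h \<gamma>) = tconv (cf f) (cf g) \<gamma>" using hs(2) a(3) by (metis cf_def)
    also have "\<dots> = cocycle \<alpha> \<beta> * cf f \<alpha> * cf g \<beta>"
      unfolding ab(4) by (rule tconv_bisection[OF U Cc_on_support[OF f] ab(1) a(2) ab(3)])
    also have "\<dots> = coord \<gamma> (bmult L (f \<alpha>) (g \<beta>))"
      using coord_mult[OF fa gb ab(3)] a ab(4) by (simp add: cf_def)
    finally have e: "coord \<gamma> (?h \<gamma>) = coord \<gamma> (bmult L (f \<alpha>) (g \<beta>))" .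
    have "bmult L (f \<alpha>) (g \<beta>) \<in> fibre L \<gamma>" unfolding ab(4) by (rule bmult_closed[OF fa gb ab(3)])
    from coord_eqI[OF section_fibre[OF hs(1) a(3)] this e]
    show ?thesis by (simp only: \<alpha>_def \<beta>_def)
  qed
  have PD: "?P \<subseteq> D" using P by blast
  have lc: "continuous_map (subtopology T ?P) (subtopology T U) (left_factor U)"
    using P continuous_map_from_subtopology_mono[OF factor_continuous(2)[OF U] PD[unfolded D_def]]
    by (auto simp: continuous_map_in_subtopology)
  have rc: "continuous_map (subtopology T ?P) (subtopology T V) (right_factor U)"
    using P continuous_map_from_subtopology_mono[OF factor_continuous(3)[OF U] PD[unfolded D_def]]
    by (auto simp: continuous_map_in_subtopology)
  have "continuous_map (subtopology T ?P) (prod_topology (total_top L) (total_top L))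
      (\<lambda>\<gamma>. (f (left_factor U \<gamma>), g (right_factor U \<gamma>)))"
    using continuous_map_compose[OF lc, of "total_top L" f] continuous_map_compose[OF rc, of "total_top L" g] f g
    by (intro continuous_map_pairedI) (auto simp: Cc_on_iff comp_def)
  moreover have "(f (left_factor U \<gamma>), g (right_factor U \<gamma>)) \<in> bundle_composable G L" if "\<gamma> \<in> ?P" for \<gamma>
    using P[OF that] bundle_composableI section_fibre[OF fs] section_fibre[OF gs] bisection_arrows[OF U] bisection_arrows[OF V]
    by blast
  ultimately have "continuous_map (subtopology T ?P) (subtopology (prod_topology (total_top L) (total_top L)) (bundle_composable G L))
      (\<lambda>\<gamma>. (f (left_factor U \<gamma>), g (right_factor U \<gamma>)))"
    by (auto simp: continuous_map_in_subtopology)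
  from continuous_map_compose[OF this continuous_mult]
  have "continuous_map (subtopology T ?P) (total_top L) ?h"
    using ha by (auto simp: comp_def intro: continuous_map_eq)
  hence cs: "csection ?P ?h" using section_fibre[OF hs(1)] bisection_arrows[OF pb] by (auto simp: csection_def)
  show ?thesis
  proof (rule Cc_onI[OF hs(1) cs compact_product[OF K(1) K'(1)]])
    show "{gcomp G \<alpha> \<beta> |\<alpha> \<beta>. \<alpha> \<in> K \<and> \<beta> \<in> K' \<and> src G \<alpha> = rng G \<beta>} \<subseteq> ?P"
      using K(2) K'(2) unfolding bprod_def by blast
    fix \<gamma> assume "cf ?h \<gamma> \<noteq> 0"
    hence "tconv (cf f) (cf g) \<gamma> \<noteq> 0" using hs by simp
    then obtain \<alpha> where \<alpha>: "\<gamma> \<in> arrows G" "\<alpha> \<in> arrows G" "rng G \<alpha> = rng G \<gamma>" "cf f \<alpha> \<noteq> 0"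
      "cf g (gcomp G (ginv G \<alpha>) \<gamma>) \<noteq> 0" using tconv_nonzero by blast
    thus "\<gamma> \<in> {gcomp G \<alpha> \<beta> |\<alpha> \<beta>. \<alpha> \<in> K \<and> \<beta> \<in> K' \<and> src G \<alpha> = rng G \<beta>}"
      using K(3) K'(3) unfolding mem_Collect_eq
      by (intro exI[of _ \<alpha>] exI[of _ "gcomp G (ginv G \<alpha>) \<gamma>"]) simp
  qed
qed

lemma Cc_on_star:
  assumes U: "open_bisection G U" and f: "f \<in> Cc_on G L U"
  shows "sa_star SA f \<in> Cc_on G L (ginv G ` U)"
proof -
  note fs = Cc_onD(1)[OF f] and hs = section_ops(5,6)[OF Cc_onD(1)[OF f]]
  note ar = bisection_arrows[OF U]
  obtain K where K: "compactin T K" "K \<subseteq> U" "\<And>\<gamma>. cf f \<gamma> \<noteq> 0 \<Longrightarrow> \<gamma> \<in> K" using Cc_on_compact[OF f] by blast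
  have "ginv G \<in> ginv G ` U \<rightarrow> U" using ar by auto
  hence "continuous_map (subtopology T (ginv G ` U)) (subtopology T U) (ginv G)"
    using ar continuous_map_from_subtopology[OF continuous_inv] by (auto simp: continuous_map_in_subtopology)
  from continuous_map_compose[OF continuous_map_compose[OF this] continuous_star, of f] f
  have "continuous_map (subtopology T (ginv G ` U)) (total_top L) (\<lambda>\<gamma>. bstar L (f (ginv G \<gamma>)))"
    by (auto simp: Cc_on_iff comp_def)
  hence "continuous_map (subtopology T (ginv G ` U)) (total_top L) (sa_star SA f)"
    using ar by (auto simp: section_algebra_def intro: continuous_map_eq)
  hence cs: "csection (ginv G ` U) (sa_star SA f)"
    using section_fibre[OF hs(1)] ar by (auto simp: csection_def)
  show ?thesis
  proof (rule Cc_onI[OF hs(1) cs image_compactin[OF K(1) continuous_inv]])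
    fix \<gamma> assume "cf (sa_star SA f) \<gamma> \<noteq> 0"
    hence "\<gamma> \<in> arrows G" "ginv G \<gamma> \<in> K" using hs K(3) by (auto simp: tstar_def split: if_splits)
    thus "\<gamma> \<in> ginv G ` K" by (metis imageI inv_inv)
  qed (use K in auto)
qed

text \<open>Extension by zero: a compact subset of an open bisection is closed in it.\<close>

lemma Cc_on_mono:
  assumes W: "open_bisection G W" and V: "openin T V" "V \<subseteq> W" and f: "f \<in> Cc_on G L V"
  shows "f \<in> Cc_on G L W"
proof -
  note fs = Cc_onD(1)[OF f] and ar = bisection_arrows[OF W]
  obtain K where K: "compactin T K" "K \<subseteq> V" "\<And>\<gamma>. cf f \<gamma> \<noteq> 0 \<Longrightarrow> \<gamma> \<in> K" using Cc_on_compact[OF f] by blast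
  have fc: "continuous_map (subtopology T V) (total_top L) f" using f by (simp add: Cc_on_iff)
  have WK: "openin T (W - K)" using compact_closed_in_bisection[OF W K(1)] K V by blast
  have zc: "continuous_map (subtopology T W) (total_top L) (bzero L)"
    using csection_zero[OF W] by (simp add: csection_def)
  have opW: "openin T W" using W by (simp add: open_bisection_def)
  have "continuous_map (subtopology T W) (total_top L) f"
  proof (rule continuous_map_nbhdI)
    show "f \<gamma> \<in> topspace (total_top L)" if "\<gamma> \<in> topspace (subtopology T W)" for \<gamma>
      using section_fibre[OF fs] that fibre_top by auto
    fix \<gamma> Y assume \<gamma>: "\<gamma> \<in> topspace (subtopology T W)" and Y: "openin (total_top L) Y" "f \<gamma> \<in> Y"
    show "\<exists>Z. openin (subtopology T W) Z \<and> \<gamma> \<in> Z \<and> (\<forall>\<delta>\<in>Z. f \<delta> \<in> Y)"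
    proof (cases "\<gamma> \<in> V")
      case True
      let ?Z = "{\<delta> \<in> topspace (subtopology T V). f \<delta> \<in> Y}"
      have "openin T ?Z" using openin_continuous_map_preimage[OF fc Y(1)] V(1) openin_open_subtopology by blast
      hence "openin (subtopology T W) ?Z" using V(2) openin_open_subtopology[OF opW] by auto
      thus ?thesis using True \<gamma> Y by (intro exI[of _ ?Z]) auto
    next
      case False
      have z: "f \<delta> = bzero L \<delta>" if "\<delta> \<in> W - K" for \<delta> using that ar K(3) cf_eq_0[OF fs] by blast
      let ?Z = "{\<delta> \<in> topspace (subtopology T W). bzero L \<delta> \<in> Y} \<inter> (W - K)"
      have "openin (subtopology T W) (W - K)" using WK opW openin_open_subtopology by blast
      hence "openin (subtopology T W) ?Z" using openin_continuous_map_preimage[OF zc Y(1)] by blast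
      moreover have "\<gamma> \<in> W - K" using False \<gamma> K(2) by auto
      hence "\<gamma> \<in> ?Z" using \<gamma> Y(2) z[of \<gamma>] by auto
      ultimately show ?thesis using z by (intro exI[of _ ?Z]) auto
    qed
  qed
  hence "csection W f" using section_fibre[OF fs] ar by (auto simp: csection_def)
  thus ?thesis using Cc_onI[OF fs _ K(1) _ K(3)] K V by blast
qed

lemma Cc_on_shrink:
  assumes W: "open_bisection G W" and f: "f \<in> Cc_on G L W"
    and K: "compactin T K" "K \<subseteq> V" "\<And>\<gamma>. cf f \<gamma> \<noteq> 0 \<Longrightarrow> \<gamma> \<in> K" and V: "V \<subseteq> W"
  shows "f \<in> Cc_on G L V"
  using Cc_onI[OF Cc_onD(1)[OF f] csection_subset[OF Cc_onD(2)[OF f bisection_arrows[OF W]] V] K(1,2)] K(3)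
  by blast

lemmas SA_simps = Cc_sections Cc_fibre_finite Cc_ops Cc_cf section_ops(3,5,7,9)
  fibre_finite_add fibre_finite_scale

lemma Cc_mult: 
  assumes "f \<in> Cc G L" "g \<in> Cc G L" shows "sa_mult SA f g \<in> Cc G L"
  using assms(1)
proof (induction rule: Cc_induct)
  case (base U f)
  note b = base
  show ?case using assms(2)
  proof (induction rule: Cc_induct)
    case (base V g)
    show ?case using Cc.base[OF bprod_bisection Cc_on_mult] b base by blast
  next
    case zero
    have "sa_mult SA f (sa_zero SA) = sa_zero SA" using Cc.base[OF b]
      by (intro section_eqI) (simp_all add: SA_simps tconv_def fun_eq_iff)
    thus ?case by (simp add: Cc_ops)
  next
    case (add g h)
    have f: "f \<in> Cc G L" using b by (rule Cc.base)
    have "sa_mult SA f (sa_add SA g h) = sa_add SA (sa_mult SA f g) (sa_mult SA f h)" using f add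
      by (intro section_eqI) (simp_all add: SA_simps tconv_add_right)
    thus ?case using add by (simp add: Cc_ops)
  next
    case (scale g c)
    have f: "f \<in> Cc G L" using b by (rule Cc.base)
    have "sa_mult SA f (sa_scale SA c g) = sa_scale SA c (sa_mult SA f g)" using f scale
      by (intro section_eqI) (simp_all add: SA_simps tconv_scale_right)
    thus ?case using scale by (simp add: Cc_ops)
  qed
next
  case zero
  have "sa_mult SA (sa_zero SA) g = sa_zero SA" using assms(2)
    by (intro section_eqI) (simp_all add: SA_simps tconv_def fun_eq_iff fibre_finite_def rsupp_def ssupp_def)
  thus ?case by (simp add: Cc_ops)
next
  case (add f h)
  have "sa_mult SA (sa_add SA f h) g = sa_add SA (sa_mult SA f g) (sa_mult SA h g)" using assms(2) add
    by (intro section_eqI) (simp_all add: SA_simps tconv_add_left)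
  thus ?case using add by (simp add: Cc_ops)
next
  case (scale f c)
  have "sa_mult SA (sa_scale SA c f) g = sa_scale SA c (sa_mult SA f g)" using assms(2) scale
    by (intro section_eqI) (simp_all add: SA_simps tconv_scale_left)
  thus ?case using scale by (simp add: Cc_ops)
qed

lemma Cc_star: 
  assumes "f \<in> Cc G L" shows "sa_star SA f \<in> Cc G L"
  using assms
proof (induction rule: Cc_induct)
  case (base U f)
  thus ?case using Cc.base[OF bisection_inv Cc_on_star] by blast
next
  case zero
  have "sa_star SA (sa_zero SA) = sa_zero SA"
    by (intro section_eqI) (simp_all add: SA_simps tstar_def fun_eq_iff)
  thus ?case by (simp add: Cc_ops)
next
  case (add f g)
  have "sa_star SA (sa_add SA f g) = sa_add SA (sa_star SA f) (sa_star SA g)" using add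
    by (intro section_eqI) (simp_all add: SA_simps tstar_add)
  thus ?case using add by (simp add: Cc_ops)
next
  case (scale f c)
  have "sa_star SA (sa_scale SA c f) = sa_scale SA (cnj c) (sa_star SA f)" using scale
    by (intro section_eqI) (simp_all add: SA_simps tstar_scale)
  thus ?case using scale by (simp add: Cc_ops)
qed

lemma carrier_SA [simp]: "carrier SA = Cc G L"
  by (simp add: section_algebra_def)

lemma SA_star_alg: "star_alg SA"
proof -
  note c = Cc_ops Cc_mult Cc_star Cc_cf Cc_fibre_finite tstar_closed tconv_closed
  have eqI: "f = g" if "f \<in> Cc G L" "g \<in> Cc G L" "cf f = cf g" for f g
    using section_eqI Cc_sections that by blast
  show ?thesis
    by (unfold_locales; (rule eqI)?)
       (simp_all add: c tconv_assoc tconv_add_left tconv_add_right tconv_scale_left tconv_scale_right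
         tstar_add tstar_scale tstar_tconv tstar_tstar algebra_simps)
qed

sublocale SA: star_alg SA by (rule SA_star_alg)

section \<open>Functions on the unit space\<close>

definition sec :: "('g \<Rightarrow> complex) \<Rightarrow> 'g \<Rightarrow> 'l" where
  "sec \<phi> = (\<lambda>\<gamma>\<in>arrows G. if \<gamma> \<in> units G then bscale L (\<phi> \<gamma>) (fibre_one L \<gamma>) else bzero L \<gamma>)"

lemma sec_section: "sec \<phi> \<in> sections" and cf_sec: "cf (sec \<phi>) = (\<lambda>\<gamma>. if \<gamma> \<in> units G then \<phi> \<gamma> else 0)"
  using bscale_closed[OF units_arrows fibre_one(1)] bzero_closed coord_zero
    coord_bscale[OF units_arrows] unit_vec_unit units_arrows
  by (auto simp: sec_def sections_def cf_def fun_eq_iff)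

lemma sec_Cc_on:
  assumes "continuous_map (unit_top G) euclidean \<phi>" "compactin T K" "K \<subseteq> units G"
    and "\<And>x. x \<in> units G - K \<Longrightarrow> \<phi> x = 0"
  shows "sec \<phi> \<in> Cc_on G L (units G)"
proof (rule Cc_onI[OF sec_section _ assms(2,3)])
  have "csection (units G) (\<lambda>x. bscale L (\<phi> x) (fibre_one L x))"
    by (rule csection_scalar[OF units_bisection order_refl csection_one assms(1)[unfolded unit_top_def]])
  thus "csection (units G) (sec \<phi>)"
    by (rule csection_cong) (simp add: sec_def units_arrows)
  show "\<gamma> \<in> K" if "cf (sec \<phi>) \<gamma> \<noteq> 0" for \<gamma>
    using that assms(4) by (auto simp: cf_sec split: if_splits)
qed

lemma Cc_on_units_coord:
  assumes h: "h \<in> Cc_on G L (units G)"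
  shows "continuous_map (unit_top G) euclidean (cf h)" and "h = sec (cf h)"
proof -
  have "units G \<subseteq> arrows G" using units_arrows by blast
  from csection_coord_continuous[OF Cc_onD(2)[OF h this]]
  show "continuous_map (unit_top G) euclidean (cf h)"
    by (rule continuous_map_eq) (simp add: cf_def units_arrows)
  show "h = sec (cf h)"
    using Cc_onD(1)[OF h] Cc_on_support[OF h] by (intro section_eqI) (auto simp: sec_section cf_sec fun_eq_iff)
qed

text \<open>Over a single bisection \<open>f\<^sup>*f\<close> is a function on the unit space. This reduces questions about norms to
  the commutative case.\<close>

lemma Cc_on_star_mult:
  assumes U: "open_bisection G U" and f: "f \<in> Cc_on G L U"
  shows "sa_mult SA (sa_star SA f) f \<in> Cc_on G L (units G)"
    and "\<gamma> \<in> U \<Longrightarrow> cf (sa_mult SA (sa_star SA f) f) (src G \<gamma>) = of_real ((cmod (cf f \<gamma>))\<^sup>2)"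
    and "cf (sa_mult SA (sa_star SA f) f) x \<noteq> 0 \<Longrightarrow> x \<in> src G ` U"
proof -
  let ?V = "bprod (ginv G ` U) U"
  note ar = bisection_arrows[OF U] and Ui = bisection_inv[OF U]
  have V: "?V = src G ` U"
  proof (intro equalityI subsetI)
    fix \<gamma> assume "\<gamma> \<in> ?V"
    then obtain \<alpha> \<beta> where "\<alpha> \<in> U" "\<beta> \<in> U" "\<gamma> = gcomp G (ginv G \<alpha>) \<beta>" "src G (ginv G \<alpha>) = rng G \<beta>"
      by (auto simp: bprod_def)
    moreover from this have "\<alpha> = \<beta>" using ar by (intro bisection_eqI[OF U]) auto
    ultimately show "\<gamma> \<in> src G ` U" using ar inv_comp by auto
  next
    fix x assume "x \<in> src G ` U"
    then obtain \<gamma> where g: "\<gamma> \<in> U" "x = gcomp G (ginv G \<gamma>) \<gamma>" using ar inv_comp by force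
    moreover have "src G (ginv G \<gamma>) = rng G \<gamma>" using g ar by auto
    ultimately show "x \<in> ?V" unfolding bprod_def by blast
  qed
  have m: "sa_mult SA (sa_star SA f) f \<in> Cc_on G L ?V"
    by (rule Cc_on_mult[OF Ui U Cc_on_star[OF U f] f])
  have "openin T ?V" using bprod_bisection[OF Ui U] by (simp add: open_bisection_def)
  moreover have "?V \<subseteq> units G" unfolding V using ar src_unit by blast
  ultimately show "sa_mult SA (sa_star SA f) f \<in> Cc_on G L (units G)"
    using Cc_on_mono[OF units_bisection _ _ m] by blast
  show "x \<in> src G ` U" if "cf (sa_mult SA (sa_star SA f) f) x \<noteq> 0"
    using Cc_on_support[OF m that] V by simp
  assume \<gamma>: "\<gamma> \<in> U"
  have fC: "f \<in> Cc G L" by (rule Cc.base[OF U f])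
  note ff = Cc_fibre_finite[OF fC]
  have "cf (sa_mult SA (sa_star SA f) f) (src G \<gamma>) = inner (src G \<gamma>) (cf f) (cf f)"
    using fC \<gamma> ar src_unit by (simp add: Cc_cf Cc_star tconv_tstar_unit[OF ff ff] subset_iff)
  also have "\<dots> = (\<Sum>\<gamma>\<in>{\<gamma>}. cf f \<gamma> * cnj (cf f \<gamma>))"
    using Cc_on_support[OF f] bisection_eqI[OF U _ \<gamma>] \<gamma> ar
    by (intro inner_superset) (auto simp: ssupp_def)
  finally show "cf (sa_mult SA (sa_star SA f) f) (src G \<gamma>) = of_real ((cmod (cf f \<gamma>))\<^sup>2)"
    by (simp add: complex_norm_square del: of_real_power)
qed

lemma Cc_on_bounded:
  assumes U: "open_bisection G U" and f: "f \<in> Cc_on G L U"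
  shows "\<exists>C>0. \<forall>\<gamma>. cmod (cf f \<gamma>) \<le> C"
proof -
  obtain K where K: "compactin T K" "K \<subseteq> U" "\<And>\<gamma>. cf f \<gamma> \<noteq> 0 \<Longrightarrow> \<gamma> \<in> K" using Cc_on_compact[OF f] by blast
  have "continuous_map (subtopology T U) euclideanreal (\<lambda>\<gamma>. bnorm L (f \<gamma>))"
    by (rule csection_bnorm[OF U order_refl Cc_onD(2)[OF f bisection_arrows[OF U]]])
  moreover have "compactin (subtopology T U) K" using K by (simp add: compactin_subtopology)
  ultimately have "compactin euclideanreal ((\<lambda>\<gamma>. bnorm L (f \<gamma>)) ` K)" using image_compactin by blast
  hence "bounded ((\<lambda>\<gamma>. bnorm L (f \<gamma>)) ` K)" by (simp add: compact_imp_bounded)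
  then obtain C where C: "C > 0" "\<forall>y\<in>(\<lambda>\<gamma>. bnorm L (f \<gamma>)) ` K. norm y \<le> C" using bounded_pos by blast
  have "cmod (cf f \<gamma>) \<le> C" for \<gamma>
  proof (cases "cf f \<gamma> = 0")
    case False
    hence "\<gamma> \<in> K" "\<gamma> \<in> arrows G" using K by (auto simp: cf_def split: if_splits)
    thus ?thesis using C bnorm_cf[OF Cc_onD(1)[OF f]] by auto
  qed (use C in simp)
  thus ?thesis using C by blast
qed

end

section \<open>Bounds for C*-norms\<close>

context fell_line_bundle
begin

lemma sec_mult: "sec \<phi> \<in> Cc G L \<Longrightarrow> sec \<psi> \<in> Cc G L \<Longrightarrow> sa_mult SA (sec \<phi>) (sec \<psi>) = sec (\<lambda>x. \<phi> x * \<psi> x)"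
  by (rule section_eqI[OF Cc_sections[OF Cc_mult] sec_section])
     (auto simp: Cc_cf fun_eq_iff cf_sec rng_of_unit units_arrows tconv_diag_left)

lemma sec_star: "sec \<phi> \<in> Cc G L \<Longrightarrow> sa_star SA (sec \<phi>) = sec (\<lambda>x. cnj (\<phi> x))"
proof (intro section_eqI sec_section)
  assume s: "sec \<phi> \<in> Cc G L"
  show "sa_star SA (sec \<phi>) \<in> sections" using s Cc_star Cc_sections by blast
  show "cf (sa_star SA (sec \<phi>)) = cf (sec (\<lambda>x. cnj (\<phi> x)))"
  proof
    fix \<gamma>
    show "cf (sa_star SA (sec \<phi>)) \<gamma> = cf (sec (\<lambda>x. cnj (\<phi> x))) \<gamma>"
    proof (cases "\<gamma> \<in> units G")
      case True
      thus ?thesis using s inv_unit[OF True] units_arrows[OF True] by (simp add: Cc_cf cf_sec tstar_def)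
    next
      case False
      hence "ginv G \<gamma> \<notin> units G" if "\<gamma> \<in> arrows G" using inv_unit[of "ginv G \<gamma>"] inv_inv[OF that] by auto
      thus ?thesis using s False by (auto simp: Cc_cf cf_sec tstar_def)
    qed
  qed
qed

lemma sec_add_scale:
  assumes "sec \<phi> \<in> Cc G L" "sec \<psi> \<in> Cc G L"
  shows "sa_add SA (sec \<phi>) (sec \<psi>) = sec (\<lambda>x. \<phi> x + \<psi> x)" "sa_scale SA c (sec \<phi>) = sec (\<lambda>x. c * \<phi> x)"
  using assms by (intro section_eqI; simp add: sec_section section_ops(3,7); auto simp: Cc_cf cf_sec)+

lemma Cc_units: "f \<in> Cc_on G L (units G) \<Longrightarrow> f \<in> Cc G L"
  by (rule Cc.base[OF units_bisection])

text \<open>With \<open>h = \<phi>\<close> and \<open>u = \<phi>\<^sup>2 + \<i> \<phi> \<surd>(1 - \<phi>\<^sup>2)\<close> one has \<open>u\<^sup>*u = h\<^sup>*h\<close> and \<open>h\<^sup>2\<close> is the real part of \<open>u\<close>,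
  so that \<open>\<parallel>h\<parallel>\<^sup>2 = \<parallel>h\<^sup>2\<parallel> \<le> \<parallel>u\<parallel> = \<parallel>h\<parallel>\<close>. This holds for every C*-norm.\<close>

lemma cstar_norm_unit_interval:
  assumes N: "cstar_norm SA N"
    and \<phi>: "continuous_map (unit_top G) euclideanreal \<phi>" "\<And>x. x \<in> units G \<Longrightarrow> 0 \<le> \<phi> x \<and> \<phi> x \<le> 1"
    and K: "compactin T K" "K \<subseteq> units G" "\<And>x. x \<in> units G - K \<Longrightarrow> \<phi> x = 0"
  shows "N (sec (\<lambda>x. of_real (\<phi> x))) \<le> 1"
proof -
  interpret pre_cstar SA N using N SA_star_alg by (simp add: pre_cstar_def pre_cstar_axioms_def)
  have ofr: "continuous_map euclideanreal euclidean (of_real :: real \<Rightarrow> complex)"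
    by (simp add: continuous_on_of_real continuous_on_id)
  note cofr = continuous_map_compose[OF _ ofr, unfolded comp_def]
  define a where "a = (\<lambda>x. \<phi> x * \<phi> x)"
  define b where "b = (\<lambda>x. \<phi> x * sqrt (1 - \<phi> x * \<phi> x))"
  have sq: "continuous_map euclideanreal euclideanreal sqrt" by (simp add: continuous_on_real_sqrt continuous_on_id)
  have ca: "continuous_map (unit_top G) euclideanreal a" unfolding a_def by (intro continuous_map_real_mult \<phi>)
  have cb: "continuous_map (unit_top G) euclideanreal b" unfolding b_def
    using continuous_map_compose[OF _ sq, unfolded comp_def]
    by (intro continuous_map_real_mult \<phi>) (auto intro!: continuous_intros \<phi>)
  define h where "h = sec (\<lambda>x. of_real (\<phi> x))"
  define u where "u = sec (\<lambda>x. of_real (a x) + \<i> * of_real (b x))"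
  have hC: "h \<in> Cc G L" unfolding h_def using K
    by (intro Cc_units sec_Cc_on[OF cofr[OF \<phi>(1)]]) auto
  have cib: "continuous_map (unit_top G) euclidean (\<lambda>x. \<i> * complex_of_real (b x))"
    using continuous_map_compose[OF cofr[OF cb], of euclidean "\<lambda>z. \<i> * z"] by (simp add: comp_def continuous_on_mult_left continuous_on_id)
  have uC: "u \<in> Cc G L" unfolding u_def using K
    by (intro Cc_units sec_Cc_on[OF continuous_map_add[OF cofr[OF ca] cib]]) (auto simp: a_def b_def)
  have cuC: "sec (\<lambda>x. cnj (of_real (a x) + \<i> * of_real (b x))) \<in> Cc G L"
    using sec_star uC Cc_star unfolding u_def by metis
  have hs: "sa_star SA h = h" using sec_star hC by (simp add: h_def)
  have hh: "sa_mult SA h h = sec (\<lambda>x. of_real (a x))"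
    using sec_mult hC by (simp add: h_def a_def)
  have "sa_mult SA (sa_star SA u) u = sec (\<lambda>x. cnj (of_real (a x) + \<i> * of_real (b x)) * (of_real (a x) + \<i> * of_real (b x)))"
    using sec_mult[OF cuC] sec_star uC unfolding u_def by simp
  also have "\<dots> = sec (\<lambda>x. of_real (a x))"
  proof -
    have "cnj (of_real (a x) + \<i> * of_real (b x)) * (of_real (a x) + \<i> * of_real (b x)) = of_real (a x)"
      if x: "x \<in> units G" for x
    proof -
      have "\<phi> x * \<phi> x \<le> 1" using \<phi>(2)[OF x] by (simp add: mult_le_one)
      hence "sqrt (1 - \<phi> x * \<phi> x) * sqrt (1 - \<phi> x * \<phi> x) = 1 - \<phi> x * \<phi> x" by simp
      hence "b x * b x = a x * (1 - a x)" by (simp add: a_def b_def algebra_simps)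
      hence "a x * a x + b x * b x = a x" by (simp add: algebra_simps)
      thus ?thesis by (simp add: complex_eq_iff)
    qed
    thus ?thesis by (auto simp: sec_def fun_eq_iff)
  qed
  finally have "(N u)\<^sup>2 = (N h)\<^sup>2" using N_star_mult[of u] N_star_mult[of h] uC hC hs hh by simp
  hence Nuh: "N u = N h" using N_nonneg uC hC by (simp add: power2_eq_iff_nonneg)
  have "sa_mult SA h h = sa_scale SA (1/2) (sa_add SA u (sa_star SA u))"
  proof -
    have "sa_add SA u (sa_star SA u) = sec (\<lambda>x. of_real (2 * a x))"
      using sec_star uC cuC sec_add_scale(1) unfolding u_def by simp
    moreover from this have "sec (\<lambda>x. of_real (2 * a x)) \<in> Cc G L" using uC Cc_star Cc_ops(2) by metis
    ultimately show ?thesis using hh sec_add_scale(2)[where c="1/2"] by simp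
  qed
  hence "N (sa_mult SA h h) \<le> 1/2 * (N u + N u)"
    using uC N_scale[of "sa_add SA u (sa_star SA u)" "1/2"] N_add[of u "sa_star SA u"] Cc_star[OF uC]
      Cc_ops(2)[OF uC Cc_star[OF uC]] by (simp add: N_star)
  moreover have "N (sa_mult SA h h) = (N h)\<^sup>2" using N_star_mult[of h] hC hs by simp
  ultimately have "N h * N h \<le> N h * 1" using Nuh by (simp add: power2_eq_square)
  thus ?thesis using N_nonneg[of h] hC unfolding h_def[symmetric]
    by (metis carrier_SA dual_order.trans linorder_not_le mult_le_cancel_left_pos zero_le_one order_less_le)
qed

text \<open>By the C*-identity it suffices to estimate \<open>f\<^sup>*f\<close>, a function on the unit space with values between
  \<open>0\<close> and \<open>C\<^sup>2\<close>.\<close>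

lemma cstar_norm_le_sup:
  assumes N: "cstar_norm SA N" and U: "open_bisection G U" and f: "f \<in> Cc_on G L U"
    and C: "C > 0" "\<And>\<gamma>. cmod (cf f \<gamma>) \<le> C"
  shows "N f \<le> C"
proof -
  interpret pre_cstar SA N using N SA_star_alg by (simp add: pre_cstar_def pre_cstar_axioms_def)
  have fC: "f \<in> Cc G L" by (rule Cc.base[OF U f])
  define h where "h = sa_mult SA (sa_star SA f) f"
  have h: "h \<in> Cc_on G L (units G)" unfolding h_def by (rule Cc_on_star_mult(1)[OF U f])
  define \<phi> where "\<phi> = (\<lambda>x. Re (cf h x) / C\<^sup>2)"
  have hv: "cf h x = of_real (Re (cf h x)) \<and> 0 \<le> Re (cf h x) \<and> Re (cf h x) \<le> C\<^sup>2" for x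
  proof (cases "cf h x = 0")
    case False
    then obtain \<gamma> where g: "\<gamma> \<in> U" "x = src G \<gamma>" using Cc_on_star_mult(3)[OF U f] unfolding h_def by blast
    have e: "cf h x = of_real ((cmod (cf f \<gamma>))\<^sup>2)"
      unfolding h_def g(2) by (rule Cc_on_star_mult(2)[OF U f g(1)])
    have "(cmod (cf f \<gamma>))\<^sup>2 \<le> C\<^sup>2" using C by (simp add: power_mono)
    thus ?thesis unfolding e by simp
  qed (use C in simp)
  obtain K where K: "compactin T K" "K \<subseteq> units G" "\<And>\<gamma>. cf h \<gamma> \<noteq> 0 \<Longrightarrow> \<gamma> \<in> K" using Cc_on_compact[OF h] by blast
  have "continuous_map (unit_top G) euclideanreal (\<lambda>x. Re (cf h x))"
    using continuous_map_compose[OF Cc_on_units_coord(1)[OF h], of euclideanreal Re]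
    by (simp add: comp_def continuous_on_Re continuous_on_id)
  hence "continuous_map (unit_top G) euclideanreal \<phi>"
    unfolding \<phi>_def using C by (intro continuous_map_real_divide) auto
  hence le: "N (sec (\<lambda>x. of_real (\<phi> x))) \<le> 1"
  proof (rule cstar_norm_unit_interval[OF N _ _ K(1,2)])
    show "0 \<le> \<phi> x \<and> \<phi> x \<le> 1" for x using hv[of x] C by (simp add: \<phi>_def)
    show "\<phi> x = 0" if "x \<in> units G - K" for x
    proof -
      have "cf h x = 0" using K(3)[of x] that by blast
      thus ?thesis by (simp add: \<phi>_def)
    qed
  qed
  have "sec (\<lambda>x. of_real (\<phi> x)) = sa_scale SA (of_real (1 / C\<^sup>2)) h"
  proof -
    have "sa_scale SA (of_real (1 / C\<^sup>2)) h = sec (\<lambda>x. of_real (1 / C\<^sup>2) * cf h x)"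
      using sec_add_scale(2)[of "cf h" "cf h"] Cc_on_units_coord(2)[OF h] Cc_units[OF h] by metis
    also have "\<dots> = sec (\<lambda>x. of_real (\<phi> x))"
      using hv by (intro arg_cong[where f=sec] ext) (metis \<phi>_def divide_inverse inverse_eq_divide mult.commute mult_1 of_real_mult)
    finally show ?thesis by simp
  qed
  hence "N h / C\<^sup>2 \<le> 1" using le N_scale[of h "of_real (1 / C\<^sup>2)"] Cc_units[OF h] by (simp add: norm_divide norm_power)
  hence "N h \<le> C\<^sup>2" using C by (simp add: field_simps)
  moreover have "N h = (N f)\<^sup>2" unfolding h_def using N_star_mult fC by simp
  ultimately have "(N f)\<^sup>2 \<le> C\<^sup>2" by simp
  thus ?thesis using C power2_le_imp_le[of "N f" C] by simp
qed

text \<open>Hence the supremum defining the full norm is finite.\<close>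

lemma cstar_norms_bounded:
  assumes "f \<in> Cc G L"
  shows "\<exists>b. \<forall>N. cstar_norm SA N \<longrightarrow> N f \<le> b"
  using assms
proof (induction rule: Cc_induct)
  case (base U f)
  obtain C where "C > 0" "\<forall>\<gamma>. cmod (cf f \<gamma>) \<le> C" using Cc_on_bounded[OF base] by blast
  thus ?case using cstar_norm_le_sup[OF _ base] by blast
next
  case zero
  have "N (sa_zero SA) \<le> 0" if "cstar_norm SA N" for N
    using that Cc_ops(1) unfolding cstar_norm_def carrier_SA by (metis order_refl)
  thus ?case by blast
next
  case (add f g)
  then obtain b c where "\<forall>N. cstar_norm SA N \<longrightarrow> N f \<le> b" "\<forall>N. cstar_norm SA N \<longrightarrow> N g \<le> c" by blast
  moreover have "N (sa_add SA f g) \<le> N f + N g" if "cstar_norm SA N" for N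
    using that add.hyps unfolding cstar_norm_def carrier_SA by blast
  ultimately have "N (sa_add SA f g) \<le> b + c" if "cstar_norm SA N" for N
    using that by (meson add_mono order_trans)
  thus ?case by blast
next
  case (scale f c)
  then obtain b where b: "\<forall>N. cstar_norm SA N \<longrightarrow> N f \<le> b" by blast
  have "N (sa_scale SA c f) \<le> cmod c * b" if "cstar_norm SA N" for N
    using that b scale.hyps mult_left_mono[of "N f" b "cmod c"] unfolding cstar_norm_def carrier_SA by simp
  thus ?case by blast
qed

section \<open>The reduced norm\<close>

lemma qnorm_mono:
  assumes H: "H \<in> fibre_finite" and C: "C \<ge> 0" and le: "\<And>\<gamma>. cmod (F \<gamma>) \<le> C * cmod (H \<gamma>)"
  shows "qnorm x F \<le> C * qnorm x H"
proof -
  have "F \<gamma> = 0" if "H \<gamma> = 0" for \<gamma> using le[of \<gamma>] that by simp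
  hence "ssupp F x \<subseteq> ssupp H x" by (auto simp: ssupp_def)
  hence "qnorm x F = L2_set (\<lambda>\<gamma>. cmod (F \<gamma>)) (ssupp H x)"
    using fibre_finiteD(3)[OF H] by (intro qnorm_superset) (auto simp: ssupp_def)
  also have "\<dots> \<le> L2_set (\<lambda>\<gamma>. C * cmod (H \<gamma>)) (ssupp H x)" by (intro L2_set_mono le) auto
  also have "\<dots> = C * qnorm x H" using C by (simp add: L2_set_right_distrib qnorm_def)
  finally show ?thesis .
qed

definition op_bound :: "'g \<Rightarrow> ('g \<Rightarrow> complex) \<Rightarrow> real \<Rightarrow> bool" where
  "op_bound x F C \<longleftrightarrow> (\<forall>H\<in>fibre_finite. qnorm x (tconv F H) \<le> C * qnorm x H)"

text \<open>For \<open>f\<close> over a single bisection, \<open>\<parallel>f * H\<parallel>\<^sup>2 = \<langle>H, f\<^sup>*f * H\<rangle>\<close>, where \<open>f\<^sup>*f\<close> acts by multiplication with a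
  bounded function of the range.\<close>

lemma op_bound_exists:
  assumes "f \<in> Cc G L"
  shows "\<exists>C\<ge>0. \<forall>x\<in>units G. op_bound x (cf f) C"
  using assms
proof (induction rule: Cc_induct)
  case (base U f)
  obtain C where C: "C > 0" "\<And>\<gamma>. cmod (cf f \<gamma>) \<le> C" using Cc_on_bounded[OF base] by blast
  have fC: "f \<in> Cc G L" by (rule Cc.base[OF base])
  note F = Cc_fibre_finite[OF fC]
  let ?D = "tconv (tstar (cf f)) (cf f)"
  have D: "?D = cf (sa_mult SA (sa_star SA f) f)" using fC by (simp add: Cc_cf Cc_star)
  have D0: "?D \<gamma> = 0" if "\<gamma> \<notin> units G" for \<gamma>
    using Cc_on_star_mult(3)[OF base, of \<gamma>] that bisection_arrows[OF base(1)] src_unit unfolding D by blast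
  have DC: "cmod (?D x) \<le> C\<^sup>2" for x
  proof (cases "?D x = 0")
    case False
    then obtain \<gamma> where g: "\<gamma> \<in> U" "x = src G \<gamma>" using Cc_on_star_mult(3)[OF base] unfolding D by blast
    have "?D x = of_real ((cmod (cf f \<gamma>))\<^sup>2)"
      unfolding D g(2) by (rule Cc_on_star_mult(2)[OF base g(1)])
    thus ?thesis using C(2)[of \<gamma>] by (simp add: norm_power power_mono)
  qed (use C in simp)
  have "op_bound x (cf f) C" if x: "x \<in> units G" for x
    unfolding op_bound_def
  proof
    fix H assume H: "H \<in> fibre_finite"
    note FH = tconv_closed[OF F H]
    have m: "qnorm x (tconv ?D H) \<le> C\<^sup>2 * qnorm x H"
    proof (rule qnorm_mono[OF H])
      fix \<gamma>
      show "cmod (tconv ?D H \<gamma>) \<le> C\<^sup>2 * cmod (H \<gamma>)"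
      proof -
        have "tconv ?D H \<gamma> = (if \<gamma> \<in> arrows G then ?D (rng G \<gamma>) * H \<gamma> else 0)"
          by (rule tconv_diag_left) (rule D0)
        thus ?thesis using mult_right_mono[OF DC[of "rng G \<gamma>"], of "cmod (H \<gamma>)"]
          by (simp add: Real_Vector_Spaces.norm_mult)
      qed
    qed simp
    have "of_real ((qnorm x (tconv (cf f) H))\<^sup>2) = inner x H (tconv (tstar (cf f)) (tconv (cf f) H))"
      using inner_adjoint[OF F H FH x] by (simp add: inner_self)
    also have "\<dots> = inner x H (tconv ?D H)" using F by (simp add: tconv_assoc tstar_closed)
    finally have "(qnorm x (tconv (cf f) H))\<^sup>2 = cmod (inner x H (tconv ?D H))"
      by (metis abs_of_nonneg norm_of_real zero_le_power2)
    also have "\<dots> \<le> qnorm x H * qnorm x (tconv ?D H)"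
      using F H by (intro inner_cauchy_schwarz tconv_closed tstar_closed)
    also have "\<dots> \<le> qnorm x H * (C\<^sup>2 * qnorm x H)" using m by (intro mult_left_mono) auto
    finally have "(qnorm x (tconv (cf f) H))\<^sup>2 \<le> (C * qnorm x H)\<^sup>2"
      by (simp add: power2_eq_square algebra_simps)
    thus "qnorm x (tconv (cf f) H) \<le> C * qnorm x H" by (rule power2_le_imp_le) (use C in simp)
  qed
  thus ?case using C by (intro exI[of _ C]) auto
next
  case zero
  have "op_bound x (cf (sa_zero SA)) 0" for x
    by (auto simp: op_bound_def Cc_cf tconv_def rsupp_def qnorm_def ssupp_def)
  thus ?case by blast
next
  case (add f g)
  then obtain C D where CD: "C \<ge> 0" "D \<ge> 0" "\<forall>x\<in>units G. op_bound x (cf f) C" "\<forall>x\<in>units G. op_bound x (cf g) D" by blast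
  have "op_bound x (cf (sa_add SA f g)) (C + D)" if x: "x \<in> units G" for x
    unfolding op_bound_def
  proof
    fix H assume H: "H \<in> fibre_finite"
    note F = Cc_fibre_finite[OF add.hyps(1)] and K = Cc_fibre_finite[OF add.hyps(2)]
    have "qnorm x (tconv (cf (sa_add SA f g)) H) \<le> qnorm x (tconv (cf f) H) + qnorm x (tconv (cf g) H)"
      using F K H add.hyps by (simp add: Cc_cf tconv_add_left qnorm_add tconv_closed)
    also have "\<dots> \<le> C * qnorm x H + D * qnorm x H"
      using CD x H unfolding op_bound_def by (meson add_mono)
    finally show "qnorm x (tconv (cf (sa_add SA f g)) H) \<le> (C + D) * qnorm x H" by (simp add: algebra_simps)
  qed
  thus ?case using CD by (intro exI[of _ "C + D"]) auto
next
  case (scale f c)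
  then obtain C where C: "C \<ge> 0" "\<forall>x\<in>units G. op_bound x (cf f) C" by blast
  have "op_bound x (cf (sa_scale SA c f)) (cmod c * C)" if x: "x \<in> units G" for x
    using C x scale.hyps by (auto simp: op_bound_def Cc_cf tconv_scale_left qnorm_scale mult.assoc intro!: mult_left_mono)
  thus ?case using C by (intro exI[of _ "cmod c * C"]) auto
qed

lemma l2_norm_coord:
  assumes "\<And>\<gamma>. \<gamma> \<in> source_fibre G x \<Longrightarrow> \<xi> \<gamma> \<in> fibre L \<gamma> \<and> coord \<gamma> (\<xi> \<gamma>) = H \<gamma>"
  shows "l2_norm G L x \<xi> = sqrt (\<Sum>\<^sub>\<infinity>\<gamma>\<in>source_fibre G x. (cmod (H \<gamma>))\<^sup>2)"
  unfolding l2_norm_def using assms bnorm_coord by (intro arg_cong[where f=sqrt] infsum_cong) force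

lemma infsum_qnorm:
  assumes "H \<in> fibre_finite"
  shows "(\<lambda>\<gamma>. (cmod (H \<gamma>))\<^sup>2) summable_on source_fibre G x"
    and "sqrt (\<Sum>\<^sub>\<infinity>\<gamma>\<in>source_fibre G x. (cmod (H \<gamma>))\<^sup>2) = qnorm x H"
proof -
  have sub: "ssupp H x \<subseteq> source_fibre G x" by (auto simp: ssupp_def source_fibre_def)
  have z: "(cmod (H \<gamma>))\<^sup>2 = 0" if "\<gamma> \<in> source_fibre G x - ssupp H x" for \<gamma>
    using that by (auto simp: ssupp_def source_fibre_def)
  have fin: "finite (ssupp H x)" by (rule fibre_finiteD(3)[OF assms])
  have "(\<lambda>\<gamma>. (cmod (H \<gamma>))\<^sup>2) summable_on ssupp H x" using fin by simp
  thus "(\<lambda>\<gamma>. (cmod (H \<gamma>))\<^sup>2) summable_on source_fibre G x"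
    using summable_on_cong_neutral[of "ssupp H x" "source_fibre G x" "\<lambda>\<gamma>. (cmod (H \<gamma>))\<^sup>2" "\<lambda>\<gamma>. (cmod (H \<gamma>))\<^sup>2"] sub z
    by blast
  have "(\<Sum>\<^sub>\<infinity>\<gamma>\<in>source_fibre G x. (cmod (H \<gamma>))\<^sup>2) = (\<Sum>\<^sub>\<infinity>\<gamma>\<in>ssupp H x. (cmod (H \<gamma>))\<^sup>2)"
    using sub z by (intro infsum_cong_neutral) auto
  thus "sqrt (\<Sum>\<^sub>\<infinity>\<gamma>\<in>source_fibre G x. (cmod (H \<gamma>))\<^sup>2) = qnorm x H"
    using fin by (simp add: qnorm_def L2_set_def)
qed

lemma regular_rep_coord:
  assumes f: "f \<in> Cc G L" and \<gamma>: "\<gamma> \<in> source_fibre G x"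
    and \<xi>: "\<And>\<beta>. \<beta> \<in> source_fibre G x \<Longrightarrow> \<xi> \<beta> \<in> fibre L \<beta> \<and> coord \<beta> (\<xi> \<beta>) = H \<beta>"
  shows "regular_rep G L x f \<xi> \<gamma> \<in> fibre L \<gamma> \<and> coord \<gamma> (regular_rep G L x f \<xi> \<gamma>) = tconv (cf f) H \<gamma>"
  using convolution_coord[OF Cc_sections[OF f] Cc_fibre_finite[OF f], of \<gamma> \<xi> H] \<gamma> \<xi>
  by (simp add: regular_rep_def source_fibre_def)

text \<open>Every value of \<open>f * \<xi>\<close> involves finitely many values of \<open>\<xi>\<close>, so that a bound on the finitely
  supported vectors is a bound on all of the Hilbert space.\<close>

lemma l2_bound:
  assumes f: "f \<in> Cc G L" and C: "C \<ge> 0" "op_bound x (cf f) C"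
    and \<xi>: "\<xi> \<in> l2_sections G L x" "l2_norm G L x \<xi> \<le> 1"
  shows "l2_norm G L x (regular_rep G L x f \<xi>) \<le> C"
proof -
  let ?S = "source_fibre G x"
  define H where "H \<gamma> = (if \<gamma> \<in> ?S then coord \<gamma> (\<xi> \<gamma>) else 0)" for \<gamma>
  have H: "\<xi> \<gamma> \<in> fibre L \<gamma> \<and> coord \<gamma> (\<xi> \<gamma>) = H \<gamma>" if "\<gamma> \<in> ?S" for \<gamma>
    using \<xi> that by (auto simp: l2_sections_def H_def)
  have "(\<lambda>\<gamma>. (bnorm L (\<xi> \<gamma>))\<^sup>2) summable_on ?S" using \<xi> by (auto simp: l2_sections_def)
  hence sumH: "(\<lambda>\<gamma>. (cmod (H \<gamma>))\<^sup>2) summable_on ?S"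
    by (rule summable_on_cong[THEN iffD1, rotated]) (use H bnorm_coord in force)
  have H1: "(\<Sum>\<^sub>\<infinity>\<gamma>\<in>?S. (cmod (H \<gamma>))\<^sup>2) \<le> 1"
    using \<xi>(2) l2_norm_coord[of x \<xi> H] H by simp
  note F = Cc_fibre_finite[OF f]
  let ?g = "\<lambda>\<gamma>. (cmod (tconv (cf f) H \<gamma>))\<^sup>2"
  have fin: "sum ?g P \<le> C\<^sup>2" if P: "finite P" "P \<subseteq> ?S" for P
  proof -
    define B where "B = (\<Union>\<gamma>\<in>P. (\<lambda>\<alpha>. gcomp G (ginv G \<alpha>) \<gamma>) ` rsupp (cf f) (rng G \<gamma>))"
    have B: "finite B" using P fibre_finiteD(2)[OF F] by (auto simp: B_def)
    have BS: "B \<subseteq> ?S" using P by (auto simp: B_def rsupp_def source_fibre_def)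
    define HB where "HB = (\<lambda>\<gamma>. if \<gamma> \<in> B then H \<gamma> else 0)"
    have HBff: "HB \<in> fibre_finite"
    proof -
      have "rsupp HB y \<subseteq> B" "ssupp HB y \<subseteq> B" for y by (auto simp: HB_def rsupp_def ssupp_def)
      hence "finite (rsupp HB y)" "finite (ssupp HB y)" for y using B finite_subset by metis+
      moreover have "HB \<gamma> = 0" if "\<gamma> \<notin> arrows G" for \<gamma> using that BS by (auto simp: HB_def source_fibre_def)
      ultimately show ?thesis by (simp add: fibre_finite_def)
    qed
    have eq: "tconv (cf f) H \<gamma> = tconv (cf f) HB \<gamma>" if "\<gamma> \<in> P" for \<gamma>
    proof -
      have "gcomp G (ginv G \<alpha>) \<gamma> \<in> B" if "\<alpha> \<in> rsupp (cf f) (rng G \<gamma>)" for \<alpha>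
        using that \<open>\<gamma> \<in> P\<close> unfolding B_def by blast
      thus ?thesis by (auto simp: tconv_def HB_def intro!: sum.cong)
    qed
    have "sum ?g P = (\<Sum>\<gamma>\<in>P. (cmod (tconv (cf f) HB \<gamma>))\<^sup>2)" using eq by simp
    also have "\<dots> \<le> (\<Sum>\<gamma>\<in>P \<union> ssupp (tconv (cf f) HB) x. (cmod (tconv (cf f) HB \<gamma>))\<^sup>2)"
      using P fibre_finiteD(3)[OF tconv_closed[OF F HBff]] by (intro sum_mono2) auto
    also have "\<dots> = (qnorm x (tconv (cf f) HB))\<^sup>2"
      using P fibre_finiteD(3)[OF tconv_closed[OF F HBff]]
      by (subst qnorm_superset[of "P \<union> ssupp (tconv (cf f) HB) x"])
         (auto simp: L2_set_def sum_nonneg ssupp_def source_fibre_def)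
    also have "\<dots> \<le> (C * qnorm x HB)\<^sup>2"
      using C HBff by (intro power_mono) (auto simp: op_bound_def)
    also have "\<dots> = C\<^sup>2 * (\<Sum>\<gamma>\<in>B. (cmod (HB \<gamma>))\<^sup>2)"
      using B BS by (subst qnorm_superset[of B])
        (auto simp: L2_set_def sum_nonneg power_mult_distrib HB_def ssupp_def source_fibre_def)
    also have "(\<Sum>\<gamma>\<in>B. (cmod (HB \<gamma>))\<^sup>2) = (\<Sum>\<gamma>\<in>B. (cmod (H \<gamma>))\<^sup>2)" by (simp add: HB_def)
    also have "\<dots> \<le> (\<Sum>\<^sub>\<infinity>\<gamma>\<in>?S. (cmod (H \<gamma>))\<^sup>2)"
      using finite_sum_le_infsum[OF sumH B BS] by simp
    also have "\<dots> \<le> 1" by (rule H1)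
    finally show ?thesis using C by (simp add: mult_left_mono)
  qed
  have sm: "?g summable_on ?S"
    by (rule nonneg_bdd_above_summable_on) (use fin in \<open>auto intro!: bdd_aboveI[of _ "C\<^sup>2"]\<close>)
  have "(\<Sum>\<^sub>\<infinity>\<gamma>\<in>?S. ?g \<gamma>) \<le> C\<^sup>2" using infsum_le_finite_sums[OF sm] fin by blast
  moreover have "l2_norm G L x (regular_rep G L x f \<xi>) = sqrt (\<Sum>\<^sub>\<infinity>\<gamma>\<in>?S. ?g \<gamma>)"
    using regular_rep_coord[OF f _ H] by (intro l2_norm_coord) blast
  ultimately show ?thesis using C real_le_lsqrt[of C] by (simp add: real_le_lsqrt infsum_nonneg)
qed

abbreviation "rrn x f \<equiv> regular_rep_norm G L x f"

lemma zero_l2: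
  "(\<lambda>\<gamma>\<in>source_fibre G x. bzero L \<gamma>) \<in> l2_sections G L x"
  "l2_norm G L x (\<lambda>\<gamma>\<in>source_fibre G x. bzero L \<gamma>) \<le> 1"
proof -
  have b: "bnorm L (bzero L \<gamma>) = 0" "bzero L \<gamma> \<in> fibre L \<gamma>" if "\<gamma> \<in> source_fibre G x" for \<gamma>
    using that bnorm_bzero bzero_closed by (auto simp: source_fibre_def)
  have "(\<lambda>\<gamma>. (bnorm L ((\<lambda>\<gamma>\<in>source_fibre G x. bzero L \<gamma>) \<gamma>))\<^sup>2) summable_on source_fibre G x"
    by (subst summable_on_cong[where g="\<lambda>_. 0"]) (use b in auto)
  thus "(\<lambda>\<gamma>\<in>source_fibre G x. bzero L \<gamma>) \<in> l2_sections G L x"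
    using b by (auto simp: l2_sections_def)
  have "(\<Sum>\<^sub>\<infinity>\<gamma>\<in>source_fibre G x. (bnorm L ((\<lambda>\<gamma>\<in>source_fibre G x. bzero L \<gamma>) \<gamma>))\<^sup>2) = 0"
    by (rule infsum_0) (use b in auto)
  thus "l2_norm G L x (\<lambda>\<gamma>\<in>source_fibre G x. bzero L \<gamma>) \<le> 1" by (simp add: l2_norm_def)
qed

lemma rrn_le:
  assumes "f \<in> Cc G L" "C \<ge> 0" "op_bound x (cf f) C"
  shows "rrn x f \<le> C"
  unfolding regular_rep_norm_def
proof (rule cSup_least)
  show "{l2_norm G L x (regular_rep G L x f \<xi>) |\<xi>. \<xi> \<in> l2_sections G L x \<and> l2_norm G L x \<xi> \<le> 1} \<noteq> {}"
    using zero_l2 by blast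
qed (use l2_bound[OF assms] in auto)

lemma rrn_op_bound:
  assumes f: "f \<in> Cc G L" and x: "x \<in> units G"
  shows "op_bound x (cf f) (rrn x f)"
  unfolding op_bound_def
proof
  fix H assume H: "H \<in> fibre_finite"
  obtain C where C: "C \<ge> 0" "op_bound x (cf f) C" using op_bound_exists[OF f] x by blast
  show "qnorm x (tconv (cf f) H) \<le> rrn x f * qnorm x H"
  proof (cases "qnorm x H = 0")
    case True
    thus ?thesis using C H by (force simp: op_bound_def)
  next
    case False
    define q where "q = qnorm x H"
    have q: "q > 0" using False qnorm_nonneg[of x H] unfolding q_def by linarith
    define H' where "H' = (\<lambda>\<gamma>. of_real (1 / q) * H \<gamma>)"
    have H': "H' \<in> fibre_finite" unfolding H'_def using H by (rule fibre_finite_scale)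
    have qH': "qnorm x H' = 1" using q unfolding H'_def qnorm_scale by (simp add: q_def norm_divide)
    define \<xi> where "\<xi> = (\<lambda>\<gamma>\<in>source_fibre G x. bscale L (H' \<gamma>) (unit_vec \<gamma>))"
    have \<xi>: "\<xi> \<gamma> \<in> fibre L \<gamma> \<and> coord \<gamma> (\<xi> \<gamma>) = H' \<gamma>" if "\<gamma> \<in> source_fibre G x" for \<gamma>
      using that bscale_closed unit_vec_closed coord_bscale by (auto simp: \<xi>_def source_fibre_def)
    have n1: "l2_norm G L x \<xi> = 1" using l2_norm_coord[of x \<xi> H'] \<xi> infsum_qnorm(2)[OF H'] qH' by simp
    have "(\<lambda>\<gamma>. (bnorm L (\<xi> \<gamma>))\<^sup>2) summable_on source_fibre G x"
      by (rule summable_on_cong[THEN iffD2, OF _ infsum_qnorm(1)[OF H']]) (use \<xi> bnorm_coord in force)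
    hence l2: "\<xi> \<in> l2_sections G L x" using \<xi> by (auto simp: l2_sections_def \<xi>_def)
    have "l2_norm G L x (regular_rep G L x f \<xi>) = qnorm x (tconv (cf f) H')"
      using l2_norm_coord[of x "regular_rep G L x f \<xi>" "tconv (cf f) H'"] regular_rep_coord[OF f _ \<xi>]
        infsum_qnorm(2)[OF tconv_closed[OF Cc_fibre_finite[OF f] H']] by simp
    also have "\<dots> = qnorm x (tconv (cf f) H) / q"
      using q by (simp add: H'_def tconv_scale_right qnorm_scale norm_divide del: of_real_divide)
    finally have "qnorm x (tconv (cf f) H) / q = l2_norm G L x (regular_rep G L x f \<xi>)" by simp
    also have "\<dots> \<le> rrn x f"
      unfolding regular_rep_norm_def
    proof (rule cSup_upper)
      show "bdd_above {l2_norm G L x (regular_rep G L x f \<xi>) |\<xi>. \<xi> \<in> l2_sections G L x \<and> l2_norm G L x \<xi> \<le> 1}"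
        using l2_bound[OF f C] by (auto intro!: bdd_aboveI[of _ C])
    qed (use l2 n1 in auto)
    finally show ?thesis using q by (simp add: q_def field_simps)
  qed
qed

definition point_mass :: "'g \<Rightarrow> 'g \<Rightarrow> complex" where
  "point_mass x = (\<lambda>\<gamma>. if \<gamma> = x then 1 else 0)"

lemma point_mass:
  assumes "x \<in> units G"
  shows "point_mass x \<in> fibre_finite" "qnorm x (point_mass x) = 1"
    and "F \<in> fibre_finite \<Longrightarrow> qnorm x (tconv F (point_mass x)) = qnorm x F"
proof -
  have xa: "x \<in> arrows G" "src G x = x" using assms units_arrows src_of_unit by auto
  show ff: "point_mass x \<in> fibre_finite"
    by (rule fibre_finite_bisection[OF units_bisection]) (use assms in \<open>auto simp: point_mass_def split: if_splits\<close>)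
  have "ssupp (point_mass x) x = {x}" using xa by (auto simp: ssupp_def point_mass_def)
  thus "qnorm x (point_mass x) = 1" by (simp add: qnorm_def L2_set_def point_mass_def)
  assume F: "F \<in> fibre_finite"
  show "qnorm x (tconv F (point_mass x)) = qnorm x F"
  proof (rule qnorm_cong)
    fix \<gamma> assume \<gamma>: "\<gamma> \<in> arrows G" "src G \<gamma> = x"
    have "point_mass x \<delta> = 0" if "\<delta> \<notin> units G" for \<delta> using that assms by (auto simp: point_mass_def)
    from tconv_diag_right[OF F this] \<gamma>
    show "cmod (tconv F (point_mass x) \<gamma>) = cmod (F \<gamma>)" by (simp add: point_mass_def)
  qed
qed

abbreviation "red \<equiv> red_norm G L"
abbreviation "full \<equiv> full_norm G L"

lemma red_bdd:
  assumes f: "f \<in> Cc G L"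
  shows "bdd_above (insert 0 ((\<lambda>x. rrn x f) ` units G))"
proof -
  obtain C where "C \<ge> 0" "\<forall>x\<in>units G. op_bound x (cf f) C" using op_bound_exists[OF f] by blast
  thus ?thesis using rrn_le[OF f] by (auto intro!: bdd_aboveI[of _ C])
qed

lemma red_nonneg: "f \<in> Cc G L \<Longrightarrow> 0 \<le> red f"
  unfolding red_norm_def by (rule cSup_upper[OF _ red_bdd]) auto

lemma red_bound:
  assumes f: "f \<in> Cc G L" and x: "x \<in> units G" and H: "H \<in> fibre_finite"
  shows "qnorm x (tconv (cf f) H) \<le> red f * qnorm x H"
proof -
  have "rrn x f \<le> red f" unfolding red_norm_def by (rule cSup_upper[OF _ red_bdd[OF f]]) (use x in auto)
  thus ?thesis using rrn_op_bound[OF f x] H mult_right_mono[of "rrn x f" "red f" "qnorm x H"]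
    unfolding op_bound_def by fastforce
qed

lemma red_leI:
  assumes f: "f \<in> Cc G L" and C: "C \<ge> 0"
    and le: "\<And>x H. \<lbrakk>x \<in> units G; H \<in> fibre_finite\<rbrakk> \<Longrightarrow> qnorm x (tconv (cf f) H) \<le> C * qnorm x H"
  shows "red f \<le> C"
  unfolding red_norm_def using rrn_le[OF f C] le C
  by (intro cSup_least) (auto simp: op_bound_def)

lemma qnorm_le_red: "\<lbrakk>f \<in> Cc G L; x \<in> units G\<rbrakk> \<Longrightarrow> qnorm x (cf f) \<le> red f"
  using red_bound[of f x "point_mass x"] point_mass[of x] Cc_fibre_finite by simp

text \<open>The inequality \<open>\<parallel>f * H\<parallel>\<^sup>2 = \<langle>H, f\<^sup>*f * H\<rangle> \<le> \<parallel>f\<^sup>*f * H\<parallel> \<parallel>H\<parallel>\<close> in the Hilbert space of each regular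
  representation.\<close>

lemma red_star_mult:
  assumes f: "f \<in> Cc G L"
  shows "(red f)\<^sup>2 \<le> red (sa_mult SA (sa_star SA f) f)"
proof -
  let ?h = "sa_mult SA (sa_star SA f) f"
  have h: "?h \<in> Cc G L" using f Cc_mult Cc_star by blast
  note F = Cc_fibre_finite[OF f]
  have "red f \<le> sqrt (red ?h)"
  proof (rule red_leI[OF f])
    fix x H assume x: "x \<in> units G" and H: "H \<in> fibre_finite"
    note FH = tconv_closed[OF F H]
    have "of_real ((qnorm x (tconv (cf f) H))\<^sup>2) = inner x H (tconv (tstar (cf f)) (tconv (cf f) H))"
      using inner_adjoint[OF F H FH x] by (simp add: inner_self)
    also have "\<dots> = inner x H (tconv (cf ?h) H)" using F f by (simp add: tconv_assoc tstar_closed Cc_cf Cc_star)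
    finally have "(qnorm x (tconv (cf f) H))\<^sup>2 = cmod (inner x H (tconv (cf ?h) H))"
      by (metis abs_of_nonneg norm_of_real zero_le_power2)
    also have "\<dots> \<le> qnorm x H * qnorm x (tconv (cf ?h) H)"
      using h H by (intro inner_cauchy_schwarz tconv_closed Cc_fibre_finite)
    also have "\<dots> \<le> qnorm x H * (red ?h * qnorm x H)"
      using red_bound[OF h x H] by (intro mult_left_mono) auto
    also have "\<dots> = (sqrt (red ?h) * qnorm x H)\<^sup>2"
      using red_nonneg[OF h] by (simp add: power_mult_distrib power2_eq_square)
    finally have "(qnorm x (tconv (cf f) H))\<^sup>2 \<le> (sqrt (red ?h) * qnorm x H)\<^sup>2" .
    thus "qnorm x (tconv (cf f) H) \<le> sqrt (red ?h) * qnorm x H"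
      by (rule power2_le_imp_le) (use red_nonneg[OF h] in simp)
  qed (use red_nonneg[OF h] in simp)
  thus ?thesis using red_nonneg[OF f] red_nonneg[OF h] by (metis power_mono real_sqrt_pow2)
qed

lemma red_mult:
  assumes "f \<in> Cc G L" "g \<in> Cc G L"
  shows "red (sa_mult SA f g) \<le> red f * red g"
proof (rule red_leI)
  fix x H assume x: "x \<in> units G" and H: "H \<in> fibre_finite"
  have "qnorm x (tconv (cf (sa_mult SA f g)) H) = qnorm x (tconv (cf f) (tconv (cf g) H))"
    using assms Cc_fibre_finite by (simp add: Cc_cf tconv_assoc)
  also have "\<dots> \<le> red f * qnorm x (tconv (cf g) H)"
    using assms x H Cc_fibre_finite by (intro red_bound) auto
  also have "\<dots> \<le> red f * (red g * qnorm x H)"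
    using red_bound[OF assms(2) x H] red_nonneg[OF assms(1)] by (intro mult_left_mono) auto
  finally show "qnorm x (tconv (cf (sa_mult SA f g)) H) \<le> red f * red g * qnorm x H" by (simp add: mult.assoc)
qed (use assms Cc_mult red_nonneg in auto)

lemma red_star: "f \<in> Cc G L \<Longrightarrow> red (sa_star SA f) = red f"
proof -
  have le: "red f \<le> red (sa_star SA f)" if f: "f \<in> Cc G L" for f
  proof (cases "red f = 0")
    case False
    hence "red f > 0" using red_nonneg[OF f] by simp
    moreover have "red f * red f \<le> red (sa_star SA f) * red f"
      using red_star_mult[OF f] red_mult[OF Cc_star[OF f] f] by (simp add: power2_eq_square)
    ultimately show ?thesis by simp
  qed (use red_nonneg[OF Cc_star[OF f]] in simp)
  assume f: "f \<in> Cc G L"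
  show ?thesis using le[OF f] le[OF Cc_star[OF f]] f SA.star_star[of f] by simp
qed

lemma red_cstar: "cstar_norm SA red"
  unfolding cstar_norm_def carrier_SA
proof (intro conjI ballI allI)
  fix f assume f: "f \<in> Cc G L"
  note F = Cc_fibre_finite[OF f]
  show "0 \<le> red f" by (rule red_nonneg[OF f])
  show "red f = 0 \<longleftrightarrow> f = sa_zero SA"
  proof
    assume 0: "red f = 0"
    have "cf f \<gamma> = 0" for \<gamma>
    proof (cases "\<gamma> \<in> arrows G")
      case True
      hence "cmod (cf f \<gamma>) \<le> 0"
        using value_le_qnorm_src[OF F True] qnorm_le_red[OF f src_unit[OF True]] 0 by linarith
      thus ?thesis by simp
    qed (simp add: cf_def)
    thus "f = sa_zero SA" using Cc_sections[OF f] Cc_sections[OF Cc_ops(1)] by (intro section_eqI) (auto simp: Cc_cf)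
  next
    assume "f = sa_zero SA"
    hence "red f \<le> 0" using f
      by (intro red_leI) (auto simp: Cc_cf tconv_def rsupp_def qnorm_def ssupp_def)
    thus "red f = 0" using red_nonneg[OF f] by simp
  qed
  have sc: "red (sa_scale SA c f) \<le> cmod c * red f" if f: "f \<in> Cc G L" for c f
    using red_bound[OF f] red_nonneg[OF f] Cc_ops(3)[OF f] f
    by (intro red_leI) (auto simp: Cc_cf tconv_scale_left qnorm_scale mult.assoc intro!: mult_left_mono)
  show "red (sa_scale SA c f) = cmod c * red f" for c
  proof (cases "c = 0")
    case True
    thus ?thesis using sc[OF f, of c] red_nonneg[OF Cc_ops(3)[OF f], of c] by simp
  next
    case False
    have "f = sa_scale SA (1 / c) (sa_scale SA c f)" using f False by (simp add: SA.scale_scale SA.scale_one)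
    hence "red f \<le> cmod (1 / c) * red (sa_scale SA c f)" using sc[OF Cc_ops(3)[OF f], of "1 / c" c] by simp
    hence "cmod c * red f \<le> red (sa_scale SA c f)" using False by (simp add: norm_divide field_simps)
    thus ?thesis using sc[OF f, of c] by simp
  qed
  show "red (sa_mult SA (sa_star SA f) f) = (red f)\<^sup>2"
    using red_star_mult[OF f] red_mult[OF Cc_star[OF f] f] red_star[OF f] by (simp add: power2_eq_square)
  fix g assume g: "g \<in> Cc G L"
  show "red (sa_mult SA f g) \<le> red f * red g" by (rule red_mult[OF f g])
  show "red (sa_add SA f g) \<le> red f + red g"
  proof (rule red_leI)
    fix x H assume x: "x \<in> units G" and H: "H \<in> fibre_finite"
    have "qnorm x (tconv (cf (sa_add SA f g)) H) \<le> qnorm x (tconv (cf f) H) + qnorm x (tconv (cf g) H)"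
      using f g H Cc_fibre_finite by (simp add: Cc_cf tconv_add_left qnorm_add tconv_closed)
    also have "\<dots> \<le> red f * qnorm x H + red g * qnorm x H"
      using red_bound[OF f x H] red_bound[OF g x H] by simp
    finally show "qnorm x (tconv (cf (sa_add SA f g)) H) \<le> (red f + red g) * qnorm x H" by (simp add: algebra_simps)
  qed (use f g Cc_ops red_nonneg in auto)
qed

section \<open>The full norm\<close>

lemma full_upper:
  assumes "f \<in> Cc G L" "cstar_norm SA N" shows "N f \<le> full f"
proof -
  obtain b where "\<forall>N. cstar_norm SA N \<longrightarrow> N f \<le> b" using cstar_norms_bounded[OF assms(1)] by blast
  hence "bdd_above {N f |N. cstar_norm SA N}" by (auto intro!: bdd_aboveI[of _ b])
  thus ?thesis unfolding full_norm_def using assms(2) by (intro cSup_upper) auto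
qed

lemma full_least: "(\<And>N. cstar_norm SA N \<Longrightarrow> N f \<le> b) \<Longrightarrow> full f \<le> b"
  unfolding full_norm_def using red_cstar by (intro cSup_least) auto

lemma red_le_full: "f \<in> Cc G L \<Longrightarrow> red f \<le> full f"
  by (rule full_upper[OF _ red_cstar])

lemma full_cstar: "cstar_norm SA full"
  unfolding cstar_norm_def carrier_SA
proof (intro conjI ballI allI)
  fix f assume f: "f \<in> Cc G L"
  note cn = cstar_norm_def[of SA, unfolded carrier_SA]
  show nn: "0 \<le> full f" using red_le_full[OF f] red_nonneg[OF f] by simp
  show "full f = 0 \<longleftrightarrow> f = sa_zero SA"
  proof
    assume "full f = 0"
    hence "red f = 0" using red_le_full[OF f] red_nonneg[OF f] by simp
    thus "f = sa_zero SA" using red_cstar f unfolding cn by blast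
  next
    assume "f = sa_zero SA"
    hence "full f \<le> 0" using f by (intro full_least) (auto simp: cn)
    thus "full f = 0" using nn by simp
  qed
  have sc: "full (sa_scale SA c f) \<le> cmod c * full f" if f: "f \<in> Cc G L" for c f
  proof (rule full_least)
    fix N assume N: "cstar_norm SA N"
    have "N (sa_scale SA c f) = cmod c * N f" using N f unfolding cn by blast
    thus "N (sa_scale SA c f) \<le> cmod c * full f" using full_upper[OF f N] by (simp add: mult_left_mono)
  qed
  show "full (sa_scale SA c f) = cmod c * full f" for c
  proof (cases "c = 0")
    case True
    thus ?thesis using sc[OF f, of c] red_le_full[OF Cc_ops(3)[OF f], of c] red_nonneg[OF Cc_ops(3)[OF f], of c] by simp
  next
    case False
    have "f = sa_scale SA (1 / c) (sa_scale SA c f)" using f False by (simp add: SA.scale_scale SA.scale_one)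
    hence "full f \<le> cmod (1 / c) * full (sa_scale SA c f)" using sc[OF Cc_ops(3)[OF f], of "1 / c" c] by simp
    hence "cmod c * full f \<le> full (sa_scale SA c f)" using False by (simp add: norm_divide field_simps)
    thus ?thesis using sc[OF f, of c] by simp
  qed
  let ?h = "sa_mult SA (sa_star SA f) f"
  have h: "?h \<in> Cc G L" using f Cc_mult Cc_star by blast
  show "full ?h = (full f)\<^sup>2"
  proof (rule antisym)
    show "full ?h \<le> (full f)\<^sup>2"
    proof (rule full_least)
      fix N assume N: "cstar_norm SA N"
      have "N ?h = (N f)\<^sup>2" "0 \<le> N f" using N f unfolding cn by blast+
      thus "N ?h \<le> (full f)\<^sup>2" using full_upper[OF f N] by (simp add: power_mono)
    qed
    have "full f \<le> sqrt (full ?h)"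
    proof (rule full_least)
      fix N assume N: "cstar_norm SA N"
      have "N ?h = (N f)\<^sup>2" "0 \<le> N f" using N f unfolding cn by blast+
      thus "N f \<le> sqrt (full ?h)" using full_upper[OF h N] by (simp add: real_le_rsqrt)
    qed
    moreover have "0 \<le> full ?h" using red_le_full[OF h] red_nonneg[OF h] by simp
    ultimately show "(full f)\<^sup>2 \<le> full ?h" using nn by (metis power_mono real_sqrt_pow2)
  qed
  fix g assume g: "g \<in> Cc G L"
  have gn: "0 \<le> full g" using red_le_full[OF g] red_nonneg[OF g] by simp
  show "full (sa_add SA f g) \<le> full f + full g"
  proof (rule full_least)
    fix N assume N: "cstar_norm SA N"
    have "N (sa_add SA f g) \<le> N f + N g" using N f g unfolding cn by blast
    thus "N (sa_add SA f g) \<le> full f + full g" using full_upper[OF f N] full_upper[OF g N] by simp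
  qed
  show "full (sa_mult SA f g) \<le> full f * full g"
  proof (rule full_least)
    fix N assume N: "cstar_norm SA N"
    have "N (sa_mult SA f g) \<le> N f * N g" "0 \<le> N g" using N f g unfolding cn by blast+
    moreover have "N f * N g \<le> full f * full g"
      using full_upper[OF f N] full_upper[OF g N] nn \<open>0 \<le> N g\<close> by (intro mult_mono)
    ultimately show "N (sa_mult SA f g) \<le> full f * full g" by simp
  qed
qed

sublocale CN: two_cstar_norms SA full red
  by unfold_locales (use full_cstar red_cstar red_le_full in auto)

end

section \<open>Free points\<close>

text \<open>The arguments about states apply to every C*-norm that dominates the reduced norm; the two instances
  of interest are the reduced and the full norm.\<close>

locale dominating_norm = fell_line_bundle G L
  for G :: "'g groupoid" and L :: "('g, 'l) vector_bundle" +
  fixes N :: "('g \<Rightarrow> 'l) \<Rightarrow> real"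
  assumes N_cstar: "cstar_norm SA N" and red_le_N: "f \<in> Cc G L \<Longrightarrow> red f \<le> N f"
begin

sublocale PC: pre_cstar SA N
  by unfold_locales (rule N_cstar)

lemma bump_section:
  assumes K: "compactin T K" "K \<subseteq> V" and V: "openin (unit_top G) V"
  obtains \<phi> K' where "\<phi> \<in> Cc_on G L (units G)" "sa_star SA \<phi> = \<phi>" "N \<phi> \<le> 1" "\<And>y. cmod (cf \<phi> y) \<le> 1"
    "\<And>y. y \<in> K \<Longrightarrow> cf \<phi> y = 1" "compactin T K'" "K' \<subseteq> V" "\<And>y. cf \<phi> y \<noteq> 0 \<Longrightarrow> y \<in> K'"
proof -
  obtain \<phi> :: "'g \<Rightarrow> real" and K' where p: "continuous_map (unit_top G) euclideanreal \<phi>"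
    "\<And>x. x \<in> units G \<Longrightarrow> 0 \<le> \<phi> x \<and> \<phi> x \<le> 1" "\<And>x. x \<in> K \<Longrightarrow> \<phi> x = 1"
    "compactin T K'" "K' \<subseteq> V" "\<And>x. x \<in> units G - K' \<Longrightarrow> \<phi> x = 0"
    using bump_function[OF K V] by blast
  have V': "V \<subseteq> units G" using openin_subset[OF V] by simp
  have ofr: "continuous_map euclideanreal euclidean (of_real :: real \<Rightarrow> complex)"
    by (simp add: continuous_on_of_real continuous_on_id)
  let ?\<phi> = "sec (\<lambda>x. of_real (\<phi> x))"
  have c: "?\<phi> \<in> Cc_on G L (units G)"
    using continuous_map_compose[OF p(1) ofr] p(4-6) V'
    by (intro sec_Cc_on[of _ K']) (auto simp: comp_def)
  show ?thesis
  proof (rule that[OF c _ _ _ _ p(4,5)])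
    show "sa_star SA ?\<phi> = ?\<phi>" using sec_star[OF Cc_units[OF c]] by simp
    show "N ?\<phi> \<le> 1" using cstar_norm_unit_interval[OF N_cstar p(1,2,4)] p(5,6) V' by blast
    show "cmod (cf ?\<phi> y) \<le> 1" for y using p(2)[of y] by (simp add: cf_sec)
    show "cf ?\<phi> y = 1" if "y \<in> K" for y
    proof -
      have "y \<in> units G" using that K V' by blast
      thus ?thesis using p(3)[OF that] by (simp add: cf_sec)
    qed
    show "y \<in> K'" if "cf ?\<phi> y \<noteq> 0" for y using that p(6) by (auto simp: cf_sec split: if_splits)
  qed
qed

text \<open>The value at \<open>x\<close> is the vector state of the regular representation at the point mass at \<open>x\<close>; this
  gives an extension of the evaluation for every unit.\<close>

lemma evaluation_functional:
  assumes x: "x \<in> units G"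
  shows "PC.pos_functional (\<lambda>f. cf f x)"
  unfolding PC.pos_functional_def carrier_SA
proof (intro conjI ballI allI)
  fix f assume f: "f \<in> Cc G L"
  note F = Cc_fibre_finite[OF f]
  show "cf (sa_add SA f g) x = cf f x + cf g x" if "g \<in> Cc G L" for g using f that by (simp add: Cc_cf)
  show "cf (sa_scale SA c f) x = c * cf f x" for c using f by (simp add: Cc_cf)
  show "cf (sa_mult SA (sa_star SA f) f) x \<in> \<real>\<^sub>\<ge>\<^sub>0"
    using f x by (simp add: Cc_cf Cc_star tconv_tstar_unit[OF F F] inner_self del: of_real_power)
  show "cmod (cf f x) \<le> N f"
    using value_le_qnorm[OF F x] qnorm_le_red[OF f x] red_le_N[OF f] by linarith
qed

lemma unit_norm_section:
  assumes x: "x \<in> units G"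
  obtains e where "e \<in> Cc_on G L (units G)" "e \<in> Cc G L" "N e \<le> 1" "cf e x = 1"
proof -
  have "compactin T {x}" using x units_arrows by auto
  from bump_section[OF this, of "units G"] x obtain \<phi> where
    "\<phi> \<in> Cc_on G L (units G)" "N \<phi> \<le> 1" "cf \<phi> x = 1" using openin_topspace[of "unit_top G"] by force
  thus ?thesis using that Cc_units by blast
qed

lemma evaluation_extension_iff:
  assumes x: "x \<in> units G"
  shows "evaluation_extension G L N x \<psi> \<longleftrightarrow>
    (\<exists>\<tau>. PC.pos_functional \<tau> \<and> (\<forall>\<phi>\<in>Cc_on G L (units G). \<tau> \<phi> = cf \<phi> x) \<and> \<psi> = PC.extend_functional \<tau>)"
proof
  have fv: "fibre_value L x (\<phi> x) = cf \<phi> x" if "\<phi> \<in> Cc_on G L (units G)" for \<phi>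
    using fibre_value_coord[OF x section_fibre[OF Cc_onD(1)[OF that] units_arrows[OF x]]] units_arrows[OF x]
    by (simp add: cf_def)
  {
    assume "evaluation_extension G L N x \<psi>"
    hence \<psi>: "state PC.B \<psi>" "extends_evaluation G L N x \<psi>" by (auto simp: evaluation_extension_def)
    have "\<psi> (PC.emb \<phi>) = cf \<phi> x" if "\<phi> \<in> Cc_on G L (units G)" for \<phi>
    proof -
      have "(\<lambda>n. \<phi>) \<in> carrier PC.K" using PC.cauchy_const[of \<phi>] Cc_units[OF that] by simp
      from \<psi>(2)[unfolded extends_evaluation_def, rule_format, OF this that]
      have "(\<lambda>n::nat. fibre_value L x (\<phi> x)) \<longlonglongrightarrow> \<psi> (PC.emb \<phi>)"
        unfolding completion_embed_def .
      hence "\<psi> (PC.emb \<phi>) = fibre_value L x (\<phi> x)" using LIMSEQ_unique tendsto_const by blast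
      thus ?thesis using fv[OF that] by simp
    qed
    thus "\<exists>\<tau>. PC.pos_functional \<tau> \<and> (\<forall>\<phi>\<in>Cc_on G L (units G). \<tau> \<phi> = cf \<phi> x) \<and> \<psi> = PC.extend_functional \<tau>"
      using PC.state_restricts[OF \<psi>(1)] PC.state_eq_extend[OF \<psi>(1), of "\<lambda>a. \<psi> (PC.emb a)"] by blast
  }
  assume "\<exists>\<tau>. PC.pos_functional \<tau> \<and> (\<forall>\<phi>\<in>Cc_on G L (units G). \<tau> \<phi> = cf \<phi> x) \<and> \<psi> = PC.extend_functional \<tau>"
  then obtain \<tau> where t: "PC.pos_functional \<tau>" "\<And>\<phi>. \<phi> \<in> Cc_on G L (units G) \<Longrightarrow> \<tau> \<phi> = cf \<phi> x"
    "\<psi> = PC.extend_functional \<tau>" by blast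
  obtain e where e: "e \<in> Cc_on G L (units G)" "e \<in> Cc G L" "N e \<le> 1" "cf e x = 1" using unit_norm_section[OF x] by blast
  have "state PC.B \<psi>" unfolding t(3) using t(1,2) e by (intro PC.extend_functional_state[of \<tau> e]) auto
  moreover have "extends_evaluation G L N x \<psi>"
    unfolding extends_evaluation_def
  proof (intro ballI impI)
    fix u assume u: "u \<in> carrier PC.K" "\<forall>n. u n \<in> Cc_on G L (units G)"
    have "fibre_value L x (u n x) = \<tau> (u n)" for n using fv t(2) u(2) by simp
    thus "(\<lambda>n. fibre_value L x (u n x)) \<longlonglongrightarrow> \<psi> (PC.cls u)"
      using PC.extend_functional_lim[OF t(1) u(1)] t(3) by simp
  qed
  ultimately show "evaluation_extension G L N x \<psi>" by (simp add: evaluation_extension_def)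
qed

text \<open>As a line bundle has enough continuous sections, this amounts to triviality of the isotropy
  group; stating it in terms of sections avoids their construction.\<close>

definition invisible_isotropy :: "'g \<Rightarrow> bool" where
  "invisible_isotropy x \<longleftrightarrow> (\<forall>\<gamma>\<in>isotropy G x. \<gamma> \<noteq> x \<longrightarrow> (\<forall>f\<in>Cc G L. cf f \<gamma> = 0))"

text \<open>The difference \<open>b\<close> of the two functions satisfies \<open>\<tau>(b\<^sup>*b) = (b\<^sup>*b)(x) = 0\<close>, so that \<open>\<tau>\<close> vanishes on
  products with \<open>b\<close> by the Cauchy-Schwarz inequality.\<close>

lemma multiplicative_domain:
  assumes \<tau>: "PC.pos_functional \<tau>" "\<And>\<phi>. \<phi> \<in> Cc_on G L (units G) \<Longrightarrow> \<tau> \<phi> = cf \<phi> x" and x: "x \<in> units G"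
    and \<phi>: "\<phi> \<in> Cc_on G L (units G)" "sa_star SA \<phi> = \<phi>" and \<theta>: "\<theta> \<in> Cc_on G L (units G)" "sa_star SA \<theta> = \<theta>"
    and eq: "cf \<phi> x = cf \<theta> x" and f: "f \<in> Cc G L"
  shows "\<tau> (sa_mult SA \<phi> f) = \<tau> (sa_mult SA \<theta> f)" "\<tau> (sa_mult SA f \<phi>) = \<tau> (sa_mult SA f \<theta>)"
proof -
  define b where "b = sa_diff SA \<phi> \<theta>"
  note c = Cc_units[OF \<phi>(1)] Cc_units[OF \<theta>(1)]
  have bC: "b \<in> Cc G L" using c SA.diff_closed unfolding b_def by simp
  have cfb: "cf b = (\<lambda>y. cf \<phi> y - cf \<theta> y)" using c unfolding b_def sa_diff_def by (simp add: Cc_cf Cc_ops)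
  obtain K1 where K1: "compactin T K1" "K1 \<subseteq> units G" "\<And>y. cf \<phi> y \<noteq> 0 \<Longrightarrow> y \<in> K1" using Cc_on_compact[OF \<phi>(1)] by blast
  obtain K2 where K2: "compactin T K2" "K2 \<subseteq> units G" "\<And>y. cf \<theta> y \<noteq> 0 \<Longrightarrow> y \<in> K2" using Cc_on_compact[OF \<theta>(1)] by blast
  have sup: "y \<in> K1 \<union> K2" if "cf b y \<noteq> 0" for y using that K1(3)[of y] K2(3)[of y] unfolding cfb by (cases "cf \<phi> y = 0") auto
  have "continuous_map (unit_top G) euclidean (cf b)" unfolding cfb
    by (intro continuous_map_diff Cc_on_units_coord(1) \<phi> \<theta>)
  hence "sec (cf b) \<in> Cc_on G L (units G)"
    using sup K1 K2 by (intro sec_Cc_on[of _ "K1 \<union> K2"] compactin_Un) auto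
  moreover have "sec (cf b) = b"
  proof (rule section_eqI[OF sec_section Cc_sections[OF bC]])
    have "cf b y = 0" if "y \<notin> units G" for y using sup[of y] K1(2) K2(2) that by blast
    thus "cf (sec (cf b)) = cf b" by (auto simp: cf_sec)
  qed
  ultimately have b: "b \<in> Cc_on G L (units G)" by simp
  have "\<tau> (sa_mult SA (sa_star SA b) b) = cf (sa_mult SA (sa_star SA b) b) x"
    by (rule \<tau>(2)[OF Cc_on_star_mult(1)[OF units_bisection b]])
  also have "\<dots> = 0" using Cc_on_star_mult(2)[OF units_bisection b x] src_of_unit[OF x] eq by (simp add: cfb)
  finally have z: "\<tau> (sa_mult SA (sa_star SA b) b) = 0" .
  have bs: "sa_star SA b = b" using c \<phi>(2) \<theta>(2) SA.diff_star[of \<phi> \<theta>] unfolding b_def by simp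
  have "\<tau> (sa_mult SA b f) = 0" using PC.pos_functional_cauchy_schwarz(1)[OF \<tau>(1) _ _ z, of f] f bC bs by simp
  thus "\<tau> (sa_mult SA \<phi> f) = \<tau> (sa_mult SA \<theta> f)"
    using PC.pos_functional_diff[OF \<tau>(1), of "sa_mult SA \<phi> f" "sa_mult SA \<theta> f"] c f SA.mult_diff_left[of \<phi> \<theta> f]
    unfolding b_def by (simp add: Cc_mult)
  have "\<tau> (sa_mult SA f b) = 0"
    using PC.pos_functional_cauchy_schwarz(2)[OF \<tau>(1) _ _ z, of "sa_star SA f"] f bC SA.star_star[of f]
    by (simp add: Cc_star)
  thus "\<tau> (sa_mult SA f \<phi>) = \<tau> (sa_mult SA f \<theta>)"
    using PC.pos_functional_diff[OF \<tau>(1), of "sa_mult SA f \<phi>" "sa_mult SA f \<theta>"] c f SA.mult_diff_right[of \<phi> \<theta> f]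
    unfolding b_def by (simp add: Cc_mult)
qed

lemma bprod_units:
  assumes "open_bisection G U"
  shows "bprod (units G) U = U" "bprod U (units G) = U"
proof -
  note ar = bisection_arrows[OF assms]
  have "\<gamma> \<in> bprod (units G) U \<longleftrightarrow> \<gamma> \<in> U" "\<gamma> \<in> bprod U (units G) \<longleftrightarrow> \<gamma> \<in> U" for \<gamma>
  proof -
    show "\<gamma> \<in> bprod (units G) U \<longleftrightarrow> \<gamma> \<in> U"
    proof
      assume "\<gamma> \<in> U"
      hence "\<gamma> = gcomp G (rng G \<gamma>) \<gamma> \<and> rng G \<gamma> \<in> units G \<and> \<gamma> \<in> U \<and> src G (rng G \<gamma>) = rng G \<gamma>"
        using ar rng_unit by auto
      thus "\<gamma> \<in> bprod (units G) U" unfolding bprod_def by blast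
    qed (use ar src_of_unit in \<open>auto simp: bprod_def subset_iff\<close>)
    show "\<gamma> \<in> bprod U (units G) \<longleftrightarrow> \<gamma> \<in> U"
    proof
      assume "\<gamma> \<in> U"
      hence "\<gamma> = gcomp G \<gamma> (src G \<gamma>) \<and> src G \<gamma> \<in> units G \<and> \<gamma> \<in> U \<and> src G \<gamma> = rng G (src G \<gamma>)"
        using ar src_unit by auto
      thus "\<gamma> \<in> bprod U (units G)" unfolding bprod_def by blast
    qed (use ar rng_of_unit in \<open>auto simp: bprod_def subset_iff\<close>)
  qed
  thus "bprod (units G) U = U" "bprod U (units G) = U" by blast+
qed

lemma cut_down:
  assumes \<phi>: "\<phi> \<in> Cc_on G L (units G)" and U: "open_bisection G U" and f: "f \<in> Cc_on G L U"
  shows "sa_mult SA \<phi> (sa_mult SA f \<phi>) \<in> Cc_on G L U"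
    and "\<gamma> \<in> arrows G \<Longrightarrow> cf (sa_mult SA \<phi> (sa_mult SA f \<phi>)) \<gamma> = cf \<phi> (rng G \<gamma>) * cf f \<gamma> * cf \<phi> (src G \<gamma>)"
proof -
  have "sa_mult SA f \<phi> \<in> Cc_on G L U"
    using Cc_on_mult[OF U units_bisection f \<phi>] bprod_units[OF U] by simp
  from Cc_on_mult[OF units_bisection U \<phi> this]
  show "sa_mult SA \<phi> (sa_mult SA f \<phi>) \<in> Cc_on G L U" using bprod_units[OF U] by simp
  have c: "\<phi> \<in> Cc G L" "f \<in> Cc G L" using Cc_units[OF \<phi>] Cc.base[OF U f] by auto
  have z: "cf \<phi> \<delta> = 0" if "\<delta> \<notin> units G" for \<delta> using Cc_on_support[OF \<phi>] that by blast
  assume "\<gamma> \<in> arrows G"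
  thus "cf (sa_mult SA \<phi> (sa_mult SA f \<phi>)) \<gamma> = cf \<phi> (rng G \<gamma>) * cf f \<gamma> * cf \<phi> (src G \<gamma>)"
    using c tconv_diag_left[OF z] tconv_diag_right[OF Cc_fibre_finite[OF c(2)] z]
    by (simp add: Cc_cf Cc_mult)
qed

text \<open>If some arrow of \<open>U\<close> starts at \<open>x\<close>, then it is moved to a different range, away from which one
  can stay, or it is an isotropy arrow, where \<open>f\<close> vanishes and hence is small nearby. If there is no
  such arrow, then the sources of the support of \<open>f\<close> stay away from \<open>x\<close>.\<close>

lemma small_return:
  assumes x: "x \<in> units G" "invisible_isotropy x" and U: "open_bisection G U" "x \<notin> U" and f: "f \<in> Cc_on G L U" and e: "\<epsilon> > 0"
  shows "\<exists>V. openin (unit_top G) V \<and> x \<in> V \<and> (\<forall>\<gamma>\<in>U. rng G \<gamma> \<in> V \<longrightarrow> src G \<gamma> \<in> V \<longrightarrow> cmod (cf f \<gamma>) \<le> \<epsilon>)"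
proof (cases "\<exists>\<gamma>\<in>U. src G \<gamma> = x")
  case False
  obtain K where K: "compactin T K" "K \<subseteq> U" "\<And>\<gamma>. cf f \<gamma> \<noteq> 0 \<Longrightarrow> \<gamma> \<in> K" using Cc_on_compact[OF f] by blast
  have "closedin (unit_top G) (src G ` K)"
    by (rule compactin_imp_closedin[OF Hausdorff_units image_compactin[OF K(1) src_continuous_units]])
  hence "openin (unit_top G) (units G - src G ` K)" by (metis openin_diff openin_topspace topspace_units)
  moreover have "x \<in> units G - src G ` K" using False K x by auto
  moreover have "cmod (cf f \<gamma>) \<le> \<epsilon>" if "src G \<gamma> \<in> units G - src G ` K" for \<gamma>
  proof -
    have "cf f \<gamma> = 0" using K(3)[of \<gamma>] that by blast
    thus ?thesis using e by simp
  qed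
  ultimately show ?thesis by blast
next
  case True
  then obtain \<gamma>0 where g0: "\<gamma>0 \<in> U" "src G \<gamma>0 = x" by blast
  note ar = bisection_arrows[OF U(1)] and opU = U(1)[unfolded open_bisection_def, THEN conjunct1]
  have g0a: "\<gamma>0 \<in> arrows G" using g0 ar by blast
  show ?thesis
  proof (cases "rng G \<gamma>0 = x")
    case True
    hence "\<gamma>0 \<in> isotropy G x" "\<gamma>0 \<noteq> x" using g0 g0a U(2) by (auto simp: isotropy_def)
    hence z: "cf f \<gamma>0 = 0" using x(2) Cc.base[OF U(1) f] unfolding invisible_isotropy_def by blast
    let ?O = "{\<gamma> \<in> topspace (subtopology T U). bnorm L (f \<gamma>) \<in> {..<\<epsilon>}}"
    have "openin (subtopology T U) ?O"
      by (rule openin_continuous_map_preimage[OF csection_bnorm[OF U(1) order_refl Cc_onD(2)[OF f ar]]]) auto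
    hence O: "openin T ?O" using opU openin_open_subtopology by blast
    have bn: "bnorm L (f \<gamma>) = cmod (cf f \<gamma>)" if "\<gamma> \<in> U" for \<gamma>
      using bnorm_cf[OF Cc_onD(1)[OF f]] that ar by blast
    have "\<gamma>0 \<in> ?O" using g0 g0a z bn e by simp
    hence "x \<in> src G ` ?O" using g0 by blast
    moreover have "cmod (cf f \<gamma>) \<le> \<epsilon>" if \<gamma>: "\<gamma> \<in> U" "src G \<gamma> \<in> src G ` ?O" for \<gamma>
    proof -
      obtain \<delta> where \<delta>: "\<delta> \<in> ?O" "src G \<gamma> = src G \<delta>" using \<gamma>(2) by blast
      hence "\<gamma> = \<delta>" using bisection_eqI[OF U(1) \<gamma>(1)] by auto
      thus ?thesis using \<delta>(1) bn[OF \<gamma>(1)] by simp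
    qed
    ultimately show ?thesis using src_open[OF O] by blast
  next
    case False
    obtain V1 V2 where V: "openin (unit_top G) V1" "openin (unit_top G) V2" "x \<in> V1" "rng G \<gamma>0 \<in> V2" "disjnt V1 V2"
      using Hausdorff_units x(1) rng_unit[OF g0a] False unfolding Hausdorff_space_def topspace_units by metis
    let ?O = "U \<inter> {\<gamma> \<in> topspace T. rng G \<gamma> \<in> V2}"
    have O: "openin T ?O" using opU openin_continuous_map_preimage[OF rng_continuous_units V(2)] by blast
    have "x \<in> V1 \<inter> src G ` ?O" using V g0 g0a by auto
    moreover have "\<not> (rng G \<gamma> \<in> V1 \<inter> src G ` ?O \<and> src G \<gamma> \<in> V1 \<inter> src G ` ?O)" if \<gamma>: "\<gamma> \<in> U" for \<gamma>
    proof
      assume a: "rng G \<gamma> \<in> V1 \<inter> src G ` ?O \<and> src G \<gamma> \<in> V1 \<inter> src G ` ?O"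
      then obtain \<delta> where \<delta>: "\<delta> \<in> ?O" "src G \<gamma> = src G \<delta>" by blast
      hence "\<gamma> = \<delta>" using bisection_eqI[OF U(1) \<gamma>] by auto
      thus False using \<delta>(1) a V(5) by (auto simp: disjnt_def)
    qed
    moreover have "openin (unit_top G) (V1 \<inter> src G ` ?O)" using V(1) src_open[OF O] by blast
    ultimately show ?thesis by blast
  qed
qed

text \<open>A function \<open>\<theta>\<close> that is one on the ranges and sources of the support of \<open>f\<close> satisfies
  \<open>f = \<theta> f \<theta>\<close>. By the previous results \<open>\<theta>\<close> may be replaced by any bump function \<open>\<phi>\<close> with
  \<open>\<phi>(x) = 1\<close>, supported as close to \<open>x\<close> as desired.\<close>

lemma free_unique:
  assumes x: "x \<in> units G" "invisible_isotropy x"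
    and \<tau>: "PC.pos_functional \<tau>" "\<And>\<phi>. \<phi> \<in> Cc_on G L (units G) \<Longrightarrow> \<tau> \<phi> = cf \<phi> x"
    and "f \<in> Cc G L"
  shows "\<tau> f = cf f x"
  using assms(5)
proof (induction rule: Cc_induct)
  case (base U f)
  note U = base(1) and f = base(2) and ar = bisection_arrows[OF base(1)]
  have fC: "f \<in> Cc G L" by (rule Cc.base[OF base])
  obtain K where K: "compactin T K" "K \<subseteq> U" "\<And>\<gamma>. cf f \<gamma> \<noteq> 0 \<Longrightarrow> \<gamma> \<in> K" using Cc_on_compact[OF f] by blast
  have cx: "compactin T {x}" using x units_arrows by auto
  let ?K = "rng G ` K \<union> src G ` K \<union> {x}"
  have "compactin T ?K"
    using image_compactin[OF K(1) rng_continuous] image_compactin[OF K(1) src_continuous] cx by (intro compactin_Un)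
  moreover have "?K \<subseteq> units G" using K(2) ar rng_unit src_unit x(1) by blast
  moreover have "openin (unit_top G) (units G)" using openin_topspace[of "unit_top G"] by simp
  ultimately obtain \<theta> where \<theta>: "\<theta> \<in> Cc_on G L (units G)" "sa_star SA \<theta> = \<theta>" "\<And>y. y \<in> ?K \<Longrightarrow> cf \<theta> y = 1"
    using bump_section[of ?K "units G"] by metis
  have f_eq: "f = sa_mult SA \<theta> (sa_mult SA f \<theta>)"
  proof (rule section_eqI[OF Cc_onD(1)[OF f] Cc_onD(1)[OF cut_down(1)[OF \<theta>(1) U f]]], rule ext)
    fix \<gamma> show "cf f \<gamma> = cf (sa_mult SA \<theta> (sa_mult SA f \<theta>)) \<gamma>"
    proof (cases "\<gamma> \<in> arrows G")
      case True
      show ?thesis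
      proof (cases "cf f \<gamma> = 0")
        case False
        hence "cf \<theta> (rng G \<gamma>) = 1" "cf \<theta> (src G \<gamma>) = 1" using K(3) \<theta>(3) by blast+
        thus ?thesis using cut_down(2)[OF \<theta>(1) U f True] by simp
      qed (use cut_down(2)[OF \<theta>(1) U f True] in simp)
    qed (simp add: cf_def)
  qed
  have reduce: "\<tau> f = \<tau> (sa_mult SA \<phi> (sa_mult SA f \<phi>))"
    if \<phi>: "\<phi> \<in> Cc_on G L (units G)" "sa_star SA \<phi> = \<phi>" "cf \<phi> x = 1" for \<phi>
  proof -
    note c = Cc_units[OF \<phi>(1)] Cc_units[OF \<theta>(1)]
    have eq: "cf \<theta> x = cf \<phi> x" using \<theta>(3) \<phi>(3) by simp
    have "\<tau> f = \<tau> (sa_mult SA \<phi> (sa_mult SA f \<theta>))"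
      using multiplicative_domain(1)[OF \<tau> x(1) \<theta>(1,2) \<phi>(1,2) eq, of "sa_mult SA f \<theta>"] f_eq Cc_mult[OF fC c(2)] by simp
    also have "\<dots> = \<tau> (sa_mult SA (sa_mult SA \<phi> f) \<theta>)" using c fC by (simp add: SA.mult_assoc)
    also have "\<dots> = \<tau> (sa_mult SA (sa_mult SA \<phi> f) \<phi>)"
      using multiplicative_domain(2)[OF \<tau> x(1) \<theta>(1,2) \<phi>(1,2) eq, of "sa_mult SA \<phi> f"] Cc_mult[OF c(1) fC] by simp
    finally show ?thesis using c fC by (simp add: SA.mult_assoc)
  qed
  show ?case
  proof (cases "x \<in> U")
    case True
    have V: "openin (unit_top G) (U \<inter> units G)"
      using U units_open by (auto simp: openin_units_iff open_bisection_def)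
    obtain \<phi> K' where \<phi>: "\<phi> \<in> Cc_on G L (units G)" "sa_star SA \<phi> = \<phi>" "cf \<phi> x = 1"
      "compactin T K'" "K' \<subseteq> U \<inter> units G" "\<And>y. cf \<phi> y \<noteq> 0 \<Longrightarrow> y \<in> K'"
      using bump_section[OF cx _ V] True x(1) by (metis Int_iff empty_subsetI insert_subset singletonI)
    let ?g = "sa_mult SA \<phi> (sa_mult SA f \<phi>)"
    note g = cut_down[OF \<phi>(1) U f]
    have "\<gamma> \<in> K'" if nz: "cf ?g \<gamma> \<noteq> 0" for \<gamma>
    proof -
      have \<gamma>: "\<gamma> \<in> U" using Cc_on_support[OF g(1) nz] .
      hence "src G \<gamma> \<in> K'" using nz g(2)[of \<gamma>] \<phi>(6) ar by fastforce
      moreover have "src G \<gamma> = \<gamma>" using calculation \<phi>(5) \<gamma> ar by (intro bisection_eqI[OF U]) auto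
      ultimately show ?thesis by simp
    qed
    \<comment> \<open>An arrow of \<open>U\<close> whose source lies in \<open>U\<close> and is a unit is equal to its source.\<close>
    hence "?g \<in> Cc_on G L (U \<inter> units G)" using Cc_on_shrink[OF U g(1) \<phi>(4,5)] by blast
    hence "?g \<in> Cc_on G L (units G)" using Cc_on_mono[OF units_bisection _ _] V openin_units_iff by blast
    hence "\<tau> f = cf ?g x" using reduce[OF \<phi>(1-3)] \<tau>(2) by simp
    thus ?thesis using g(2)[OF units_arrows[OF x(1)]] \<phi>(3) rng_of_unit[OF x(1)] src_of_unit[OF x(1)] by simp
  next
    case False
    have "cmod (\<tau> f) \<le> 0"
    proof (rule field_le_epsilon)
      fix \<epsilon> :: real assume e: "\<epsilon> > 0"
      obtain V where V: "openin (unit_top G) V" "x \<in> V"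
        "\<And>\<gamma>. \<gamma> \<in> U \<Longrightarrow> rng G \<gamma> \<in> V \<Longrightarrow> src G \<gamma> \<in> V \<Longrightarrow> cmod (cf f \<gamma>) \<le> \<epsilon>"
        using small_return[OF x U False f e] by blast
      obtain \<phi> K' where \<phi>: "\<phi> \<in> Cc_on G L (units G)" "sa_star SA \<phi> = \<phi>" "\<And>y. cmod (cf \<phi> y) \<le> 1" "cf \<phi> x = 1"
        "K' \<subseteq> V" "\<And>y. cf \<phi> y \<noteq> 0 \<Longrightarrow> y \<in> K'"
        using bump_section[OF cx _ V(1)] V(2) by (metis empty_subsetI insert_subset singletonI)
      let ?g = "sa_mult SA \<phi> (sa_mult SA f \<phi>)"
      note g = cut_down[OF \<phi>(1) U f]
      have "cmod (cf ?g \<gamma>) \<le> \<epsilon>" for \<gamma>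
      proof (cases "cf ?g \<gamma> = 0")
        case False
        have \<gamma>: "\<gamma> \<in> U" using Cc_on_support[OF g(1) False] .
        hence e1: "cf ?g \<gamma> = cf \<phi> (rng G \<gamma>) * cf f \<gamma> * cf \<phi> (src G \<gamma>)" using g(2) ar by blast
        hence "rng G \<gamma> \<in> V" "src G \<gamma> \<in> V" using False \<phi>(5,6) by auto
        hence "cmod (cf f \<gamma>) \<le> \<epsilon>" using V(3) \<gamma> by blast
        moreover have "cmod (cf ?g \<gamma>) \<le> 1 * cmod (cf f \<gamma>) * 1"
          unfolding e1 Real_Vector_Spaces.norm_mult by (intro mult_mono \<phi>(3) order_refl) auto
        ultimately show ?thesis by simp
      qed (use e in simp)
      hence "N ?g \<le> \<epsilon>" using cstar_norm_le_sup[OF N_cstar U g(1) e] by blast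
      moreover have "cmod (\<tau> ?g) \<le> N ?g" using \<tau>(1) Cc.base[OF U g(1)] by (simp add: PC.pos_functional_def)
      ultimately show "cmod (\<tau> f) \<le> 0 + \<epsilon>" using reduce[OF \<phi>(1,2,4)] by simp
    qed
    moreover have "cf f x = 0" using False Cc_on_support[OF f] by blast
    ultimately show ?thesis by simp
  qed
next
  case zero
  have "\<tau> (sa_scale SA 0 (sa_zero SA)) = 0" using \<tau>(1) Cc_ops(1) by (simp add: PC.pos_functional_def)
  thus ?case using SA.scale_zero by (simp add: Cc_cf)
next
  case (add f g)
  thus ?case using \<tau>(1) by (simp add: PC.pos_functional_def Cc_cf)
next
  case (scale f c)
  thus ?case using \<tau>(1) by (simp add: PC.pos_functional_def Cc_cf)
qed

text \<open>The vector states of the regular representation at \<open>(\<delta>\<^sub>x + z \<delta>\<^sub>\<gamma>) / \<surd>2\<close>, for \<open>\<gamma>\<close> in the isotropy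
  group at \<open>x\<close> and \<open>\<bar>z\<bar> = 1\<close>, all extend the evaluation at \<open>x\<close>.\<close>

definition twist_functional :: "'g \<Rightarrow> 'g \<Rightarrow> complex \<Rightarrow> ('g \<Rightarrow> 'l) \<Rightarrow> complex" where
  "twist_functional x \<gamma> z f = cf f x + (z * cocycle (ginv G \<gamma>) \<gamma> * cf f (ginv G \<gamma>) + cnj z * cf f \<gamma>) / 2"

lemma tconv_point_mass:
  assumes F: "F \<in> fibre_finite" and a: "\<gamma> \<in> arrows G" "y \<in> arrows G" "src G y = src G \<gamma>"
  shows "tconv F (point_mass \<gamma>) y = cocycle (gcomp G y (ginv G \<gamma>)) \<gamma> * F (gcomp G y (ginv G \<gamma>))"
proof -
  define \<alpha> where "\<alpha> = gcomp G y (ginv G \<gamma>)"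
  have \<alpha>: "\<alpha> \<in> arrows G" "rng G \<alpha> = rng G y" "src G \<alpha> = rng G \<gamma>" "gcomp G \<alpha> \<gamma> = y"
    using a by (auto simp: \<alpha>_def gcomp_assoc inv_comp)
  have eq: "\<beta> = \<alpha>" if b: "\<beta> \<in> arrows G" "rng G \<beta> = rng G y" "gcomp G (ginv G \<beta>) y = \<gamma>" for \<beta>
  proof -
    have "gcomp G \<beta> \<gamma> = y" using gcomp_inv_cancel[OF b(1) a(2) b(2)] b(3) by simp
    moreover have "src G \<beta> = rng G \<gamma>" using b a src_rng(8)[of "ginv G \<beta>" y] by simp
    ultimately show ?thesis unfolding \<alpha>_def using a b by (metis gcomp_assoc gcomp_unit(1) comp_inv arrow_closed(3) src_rng(6))
  qed
  have "tconv F (point_mass \<gamma>) y = (\<Sum>\<beta>\<in>insert \<alpha> (rsupp F (rng G y)). cocycle \<beta> (gcomp G (ginv G \<beta>) y) * F \<beta> * point_mass \<gamma> (gcomp G (ginv G \<beta>) y))"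
    using \<alpha> a fibre_finiteD(2)[OF F] by (intro tconv_superset) (auto simp: rsupp_def)
  also have "\<dots> = (\<Sum>\<beta>\<in>{\<alpha>}. cocycle \<beta> (gcomp G (ginv G \<beta>) y) * F \<beta> * point_mass \<gamma> (gcomp G (ginv G \<beta>) y))"
  proof (rule sum.mono_neutral_right)
    show "\<forall>\<beta>\<in>insert \<alpha> (rsupp F (rng G y)) - {\<alpha>}.
        cocycle \<beta> (gcomp G (ginv G \<beta>) y) * F \<beta> * point_mass \<gamma> (gcomp G (ginv G \<beta>) y) = 0"
    proof
      fix \<beta> assume "\<beta> \<in> insert \<alpha> (rsupp F (rng G y)) - {\<alpha>}"
      hence "\<beta> \<in> arrows G" "rng G \<beta> = rng G y" "\<beta> \<noteq> \<alpha>" by (auto simp: rsupp_def)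
      hence "gcomp G (ginv G \<beta>) y \<noteq> \<gamma>" using eq by blast
      thus "cocycle \<beta> (gcomp G (ginv G \<beta>) y) * F \<beta> * point_mass \<gamma> (gcomp G (ginv G \<beta>) y) = 0"
        by (simp add: point_mass_def)
    qed
  qed (use fibre_finiteD(2)[OF F] in auto)
  also have "\<dots> = cocycle \<alpha> \<gamma> * F \<alpha>"
    using \<alpha> a inv_gcomp_cancel[of \<alpha> \<gamma>] by (simp add: point_mass_def)
  finally show ?thesis by (simp add: \<alpha>_def)
qed

lemma twist_functional:
  assumes x: "x \<in> units G" and \<gamma>: "\<gamma> \<in> isotropy G x" "\<gamma> \<noteq> x" and z: "cmod z = 1"
  shows "PC.pos_functional (twist_functional x \<gamma> z)"
    and "\<phi> \<in> Cc_on G L (units G) \<Longrightarrow> twist_functional x \<gamma> z \<phi> = cf \<phi> x"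
proof -
  have ga: "\<gamma> \<in> arrows G" "src G \<gamma> = x" "rng G \<gamma> = x" using \<gamma> by (auto simp: isotropy_def)
  note xa = units_arrows[OF x] src_of_unit[OF x] rng_of_unit[OF x]
  have nu: "\<gamma> \<notin> units G" "ginv G \<gamma> \<notin> units G"
    using \<gamma>(2) ga src_of_unit[of \<gamma>] src_of_unit[of "ginv G \<gamma>"] inv_inv[OF ga(1)] inv_unit[OF x] by auto
  show "twist_functional x \<gamma> z \<phi> = cf \<phi> x" if "\<phi> \<in> Cc_on G L (units G)"
  proof -
    have "cf \<phi> \<gamma> = 0" "cf \<phi> (ginv G \<gamma>) = 0" using Cc_on_support[OF that] nu by blast+
    thus ?thesis by (simp add: twist_functional_def)
  qed
  define H where "H = (\<lambda>\<delta>. point_mass x \<delta> + z * point_mass \<gamma> \<delta>)"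
  have zz: "cnj z * z = 1" using z complex_norm_square[of z] by (simp add: mult.commute)
  have pm: "point_mass \<gamma> \<in> fibre_finite"
  proof -
    have "rsupp (point_mass \<gamma>) y \<subseteq> {\<gamma>}" "ssupp (point_mass \<gamma>) y \<subseteq> {\<gamma>}" for y
      by (auto simp: rsupp_def ssupp_def point_mass_def)
    hence "finite (rsupp (point_mass \<gamma>) y)" "finite (ssupp (point_mass \<gamma>) y)" for y
      by (meson finite.emptyI finite.insertI finite_subset)+
    thus ?thesis using ga by (auto simp: fibre_finite_def point_mass_def)
  qed
  have H: "H \<in> fibre_finite" unfolding H_def by (intro fibre_finite_add fibre_finite_scale pm point_mass[OF x])
  have Hv: "H x = 1" "H \<gamma> = z" "\<And>\<delta>. \<delta> \<noteq> x \<Longrightarrow> \<delta> \<noteq> \<gamma> \<Longrightarrow> H \<delta> = 0" using \<gamma>(2) by (auto simp: H_def point_mass_def)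
  have ss: "ssupp H x = {x, \<gamma>}" using Hv z ga xa by (auto simp: ssupp_def)
  have qH: "(qnorm x H)\<^sup>2 = 2" using ss \<gamma>(2) Hv z by (simp add: qnorm_def L2_set_def)
  have ii: "inner x F H = F x + cnj z * F \<gamma>" if F: "F \<in> fibre_finite" for F
  proof -
    have "inner x F H = (\<Sum>\<delta>\<in>ssupp F x \<union> {x, \<gamma>}. F \<delta> * cnj (H \<delta>))"
      using fibre_finiteD(3)[OF F] ga xa by (intro inner_superset) (auto simp: ssupp_def)
    also have "\<dots> = (\<Sum>\<delta>\<in>{x, \<gamma>}. F \<delta> * cnj (H \<delta>))"
      using fibre_finiteD(3)[OF F] Hv(3) by (intro sum.mono_neutral_right) auto
    finally show ?thesis using \<gamma>(2) Hv by (simp add: mult.commute)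
  qed
  have tw: "twist_functional x \<gamma> z f = inner x (tconv (cf f) H) H / 2" if f: "f \<in> Cc G L" for f
  proof -
    note F = Cc_fibre_finite[OF f]
    have t: "tconv (cf f) H y = tconv (cf f) (point_mass x) y + z * tconv (cf f) (point_mass \<gamma>) y" for y
      unfolding H_def by (simp add: tconv_add_right tconv_scale_right)
    have "tconv (cf f) (point_mass x) y = cf f y" if "y \<in> arrows G" "src G y = x" for y
      using tconv_point_mass[OF F xa(1) that(1)] that xa inv_unit[OF x] cocycle_unit_right[of y] by simp
    moreover have "tconv (cf f) (point_mass \<gamma>) x = cocycle (ginv G \<gamma>) \<gamma> * cf f (ginv G \<gamma>)"
      using tconv_point_mass[OF F ga(1) xa(1)] xa ga by simp
    moreover have "tconv (cf f) (point_mass \<gamma>) \<gamma> = cf f x"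
      using tconv_point_mass[OF F ga(1) ga(1)] ga comp_inv[OF ga(1)] cocycle_unit_left[OF ga(1)] by simp
    ultimately have "inner x (tconv (cf f) H) H = cf f x + z * (cocycle (ginv G \<gamma>) \<gamma> * cf f (ginv G \<gamma>)) + cnj z * (cf f \<gamma> + z * cf f x)"
      using ii[OF tconv_closed[OF F H]] t xa ga by simp
    also have "\<dots> = cf f x + (cnj z * z) * cf f x + (z * cocycle (ginv G \<gamma>) \<gamma> * cf f (ginv G \<gamma>) + cnj z * cf f \<gamma>)"
      by (simp add: algebra_simps)
    finally show ?thesis by (simp add: zz twist_functional_def add_divide_distrib)
  qed
  show "PC.pos_functional (twist_functional x \<gamma> z)"
    unfolding PC.pos_functional_def carrier_SA
  proof (intro conjI ballI allI)
    fix f assume f: "f \<in> Cc G L"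
    note F = Cc_fibre_finite[OF f] and FH = tconv_closed[OF Cc_fibre_finite[OF f] H]
    show "twist_functional x \<gamma> z (sa_add SA f g) = twist_functional x \<gamma> z f + twist_functional x \<gamma> z g" if "g \<in> Cc G L" for g
      using f that by (simp add: Cc_cf twist_functional_def field_simps)
    show "twist_functional x \<gamma> z (sa_scale SA c f) = c * twist_functional x \<gamma> z f" for c
      using f by (simp add: Cc_cf twist_functional_def field_simps)
    let ?h = "sa_mult SA (sa_star SA f) f"
    have h: "?h \<in> Cc G L" using f Cc_mult Cc_star by blast
    have "inner x (tconv (cf ?h) H) H = inner x (tconv (tstar (cf f)) (tconv (cf f) H)) H"
      using f F by (simp add: Cc_cf Cc_star tconv_assoc tstar_closed)
    also have "\<dots> = inner x (tconv (cf f) H) (tconv (cf f) H)"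
      using inner_adjoint[OF tstar_closed[OF F] FH H x] F by (simp add: tstar_tstar)
    finally have "twist_functional x \<gamma> z ?h = of_real ((qnorm x (tconv (cf f) H))\<^sup>2 / 2)"
      unfolding tw[OF h] inner_self by simp
    thus "twist_functional x \<gamma> z ?h \<in> \<real>\<^sub>\<ge>\<^sub>0" by (simp del: of_real_divide of_real_power)
    have "cmod (inner x (tconv (cf f) H) H) \<le> qnorm x (tconv (cf f) H) * qnorm x H"
      by (rule inner_cauchy_schwarz[OF FH H])
    also have "\<dots> \<le> (red f * qnorm x H) * qnorm x H" using red_bound[OF f x H] by (intro mult_right_mono) auto
    also have "\<dots> = red f * 2" using qH by (simp add: power2_eq_square)
    finally have "cmod (twist_functional x \<gamma> z f) \<le> red f" unfolding tw[OF f] by (simp add: norm_divide)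
    thus "cmod (twist_functional x \<gamma> z f) \<le> N f" using red_le_N[OF f] by simp
  qed
qed

lemma free_point_iff: "free_point G L N x \<longleftrightarrow> x \<in> units G \<and> invisible_isotropy x"
  and free_state_eq: "\<lbrakk>x \<in> units G; invisible_isotropy x\<rbrakk> \<Longrightarrow> free_state G L N x = PC.extend_functional (\<lambda>f. cf f x)"
proof -
  have ev: "evaluation_extension G L N x (PC.extend_functional (\<lambda>f. cf f x))" if "x \<in> units G" for x
    unfolding evaluation_extension_iff[OF that] using evaluation_functional[OF that] by blast
  have un: "\<psi> = PC.extend_functional (\<lambda>f. cf f x)"
    if x: "x \<in> units G" "invisible_isotropy x" and ext: "evaluation_extension G L N x \<psi>" for x \<psi>
  proof -
    obtain \<tau> where t: "PC.pos_functional \<tau>" "\<forall>\<phi>\<in>Cc_on G L (units G). \<tau> \<phi> = cf \<phi> x" "\<psi> = PC.extend_functional \<tau>"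
      using ext unfolding evaluation_extension_iff[OF x(1)] by blast
    have "\<psi> (PC.emb f) = cf f x" if "f \<in> Cc G L" for f
      using free_unique[OF x t(1) _ that] t(2) PC.extend_functional_emb[OF t(1), of f] that t(3) by simp
    thus ?thesis using PC.state_eq_extend[of \<psi> "\<lambda>f. cf f x"] ext by (simp add: evaluation_extension_def)
  qed
  show "free_state G L N x = PC.extend_functional (\<lambda>f. cf f x)" if "x \<in> units G" "invisible_isotropy x"
    unfolding free_state_def using ev un that by (intro the_equality) auto
  show "free_point G L N x \<longleftrightarrow> x \<in> units G \<and> invisible_isotropy x"
  proof
    assume "x \<in> units G \<and> invisible_isotropy x"
    thus "free_point G L N x" unfolding free_point_def using ev un by blast
  next
    assume fp: "free_point G L N x"
    hence x: "x \<in> units G" by (simp add: free_point_def)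
    have "cf f \<gamma> = 0" if \<gamma>: "\<gamma> \<in> isotropy G x" "\<gamma> \<noteq> x" and f: "f \<in> Cc G L" for \<gamma> f
    proof -
      have "twist_functional x \<gamma> z f = cf f x" if z: "cmod z = 1" for z
      proof -
        note t = twist_functional[OF x \<gamma> z]
        have "evaluation_extension G L N x (PC.extend_functional (twist_functional x \<gamma> z))"
          unfolding evaluation_extension_iff[OF x] using t by blast
        hence "PC.extend_functional (twist_functional x \<gamma> z) = PC.extend_functional (\<lambda>f. cf f x)"
          using fp ev[OF x] unfolding free_point_def by blast
        thus ?thesis
          using PC.extend_functional_emb[OF t(1), of f] PC.extend_functional_emb[OF evaluation_functional[OF x], of f] f by simp
      qed
      from this[of 1] this[of \<i>] show ?thesis by (simp add: twist_functional_def field_simps)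
    qed
    thus "x \<in> units G \<and> invisible_isotropy x" using x by (simp add: invisible_isotropy_def)
  qed
qed

section \<open>The gray ideal\<close>

lemma qnorm_le_N: "\<lbrakk>f \<in> Cc G L; x \<in> units G\<rbrakk> \<Longrightarrow> qnorm x (cf f) \<le> N f"
  using qnorm_le_red red_le_N by fastforce

text \<open>The value of \<open>\<psi>\<^sub>x\<close> at \<open>b\<^sup>*b\<close> is the limit of \<open>(u\<^sub>n\<^sup>*u\<^sub>n)(x)\<close>, the square of the seminorm of
  \<open>u\<^sub>n\<close>.\<close>

lemma gray_iff:
  assumes u: "u \<in> carrier PC.K"
  shows "PC.cls u \<in> gray_ideal G L N \<longleftrightarrow> (\<forall>x\<in>units G. invisible_isotropy x \<longrightarrow> (\<lambda>n. qnorm x (cf (u n))) \<longlonglongrightarrow> 0)"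
proof -
  have uC: "u n \<in> Cc G L" for n using PC.cauchy_term[OF u] by simp
  have "free_state G L N x (sa_mult PC.B (sa_star PC.B (PC.cls u)) (PC.cls u)) = 0 \<longleftrightarrow> (\<lambda>n. qnorm x (cf (u n))) \<longlonglongrightarrow> 0"
    if x: "x \<in> units G" "invisible_isotropy x" for x
  proof -
    have "(\<lambda>n. cf (sa_mult SA (sa_star SA (u n)) (u n)) x) \<longlonglongrightarrow>
        free_state G L N x (sa_mult PC.B (sa_star PC.B (PC.cls u)) (PC.cls u))"
      using PC.extend_functional_lim[OF evaluation_functional[OF x(1)] PC.K_closed(4)[OF PC.K_closed(5)[OF u] u]]
      by (simp add: free_state_eq[OF x] PC.B_ops u PC.K_closed)
    moreover have "cf (sa_mult SA (sa_star SA (u n)) (u n)) x = of_real ((qnorm x (cf (u n)))\<^sup>2)" for n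
      using tconv_tstar_unit[OF Cc_fibre_finite[OF uC] Cc_fibre_finite[OF uC] x(1)] uC
      by (simp add: Cc_cf Cc_star inner_self)
    ultimately have lim: "(\<lambda>n. complex_of_real ((qnorm x (cf (u n)))\<^sup>2)) \<longlonglongrightarrow>
        free_state G L N x (sa_mult PC.B (sa_star PC.B (PC.cls u)) (PC.cls u))" (is "_ \<longlonglongrightarrow> ?l") by simp
    have eq: "(\<lambda>n. (qnorm x (cf (u n)))\<^sup>2) \<longlonglongrightarrow> 0 \<longleftrightarrow> (\<lambda>n. qnorm x (cf (u n))) \<longlonglongrightarrow> 0"
      using tendsto_power[of "\<lambda>n. qnorm x (cf (u n))" 0 sequentially 2] tendsto_real_sqrt[of "\<lambda>n. (qnorm x (cf (u n)))\<^sup>2" 0 sequentially]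
      by auto
    show ?thesis
    proof
      assume "?l = 0"
      hence "(\<lambda>n. complex_of_real ((qnorm x (cf (u n)))\<^sup>2)) \<longlonglongrightarrow> of_real 0" using lim by simp
      hence "(\<lambda>n. (qnorm x (cf (u n)))\<^sup>2) \<longlonglongrightarrow> 0" unfolding tendsto_of_real_iff .
      thus "(\<lambda>n. qnorm x (cf (u n))) \<longlonglongrightarrow> 0" using eq by simp
    next
      assume "(\<lambda>n. qnorm x (cf (u n))) \<longlonglongrightarrow> 0"
      hence "(\<lambda>n. complex_of_real ((qnorm x (cf (u n)))\<^sup>2)) \<longlonglongrightarrow> of_real 0"
        unfolding tendsto_of_real_iff eq .
      thus "?l = 0" using LIMSEQ_unique[OF lim] by simp
    qed
  qed
  thus ?thesis using u by (auto simp: gray_ideal_def Let_def free_point_iff)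
qed

text \<open>If \<open>f\<close> did not vanish at an isotropy arrow \<open>\<delta>\<close> at the range of \<open>\<gamma>\<close>, then \<open>g\<^sup>* f g\<close> would not
  vanish at the conjugate of \<open>\<delta>\<close> by \<open>\<gamma>\<close>, which is an isotropy arrow at the source of \<open>\<gamma>\<close>.\<close>

lemma invisible_isotropy_transport:
  assumes x: "invisible_isotropy (src G \<gamma>)" and g: "g \<in> Cc_on G L U" "open_bisection G U" "cf g \<gamma> \<noteq> 0"
  shows "invisible_isotropy (rng G \<gamma>)"
  unfolding invisible_isotropy_def
proof (intro ballI impI)
  note U = g(2)
  have \<gamma>: "\<gamma> \<in> U" "\<gamma> \<in> arrows G" using Cc_on_support[OF g(1,3)] bisection_arrows[OF U] by auto
  have gC: "g \<in> Cc G L" by (rule Cc.base[OF U g(1)])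
  fix \<delta> f assume \<delta>: "\<delta> \<in> isotropy G (rng G \<gamma>)" "\<delta> \<noteq> rng G \<gamma>" and f: "f \<in> Cc G L"
  have d: "\<delta> \<in> arrows G" "src G \<delta> = rng G \<gamma>" "rng G \<delta> = rng G \<gamma>" using \<delta> by (auto simp: isotropy_def)
  define \<epsilon> where "\<epsilon> = gcomp G \<delta> \<gamma>"
  define \<eta> where "\<eta> = gcomp G (ginv G \<gamma>) \<epsilon>"
  have e: "\<epsilon> \<in> arrows G" "rng G \<epsilon> = rng G \<gamma>" "src G \<epsilon> = src G \<gamma>" using d \<gamma> by (auto simp: \<epsilon>_def)
  have h: "\<eta> \<in> isotropy G (src G \<gamma>)" using e \<gamma> by (simp add: \<eta>_def isotropy_def)
  have "\<eta> \<noteq> src G \<gamma>"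
  proof
    assume "\<eta> = src G \<gamma>"
    hence "\<epsilon> = \<gamma>" using gcomp_inv_cancel[OF \<gamma>(2) e(1)] e \<gamma> by (simp add: \<eta>_def)
    hence "gcomp G (gcomp G \<delta> \<gamma>) (ginv G \<gamma>) = rng G \<gamma>" using comp_inv[OF \<gamma>(2)] by (simp add: \<epsilon>_def)
    thus False using d \<gamma> \<delta>(2) comp_inv[OF \<gamma>(2)] by (simp add: gcomp_assoc)
  qed
  let ?h = "sa_mult SA (sa_star SA g) (sa_mult SA f g)"
  have hC: "?h \<in> Cc G L" using f gC Cc_mult Cc_star by blast
  have "cf ?h \<eta> = 0" using x h \<open>\<eta> \<noteq> src G \<gamma>\<close> hC unfolding invisible_isotropy_def by blast
  moreover have "cf ?h \<eta> = tconv (tstar (cf g)) (tconv (cf f) (cf g)) (gcomp G (ginv G \<gamma>) \<epsilon>)"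
    using f gC by (simp add: Cc_cf Cc_mult Cc_star \<eta>_def)
  moreover have "\<dots> = cocycle (ginv G \<gamma>) \<epsilon> * tstar (cf g) (ginv G \<gamma>) * tconv (cf f) (cf g) \<epsilon>"
  proof (rule tconv_bisection[OF bisection_inv[OF U]])
    show "\<alpha> \<in> ginv G ` U" if "tstar (cf g) \<alpha> \<noteq> 0" for \<alpha>
      using Cc_on_support[OF Cc_on_star[OF U g(1)], of \<alpha>] that gC by (simp add: Cc_cf)
  qed (use e \<gamma> in auto)
  moreover have "cocycle (ginv G \<gamma>) \<epsilon> \<noteq> 0" using cmod_cocycle[of "ginv G \<gamma>" \<epsilon>] e \<gamma> by auto
  moreover have "tstar (cf g) (ginv G \<gamma>) \<noteq> 0" using tstar_eq_0[of "ginv G \<gamma>" "cf g"] \<gamma> g(3) by simp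
  ultimately have "tconv (cf f) (cf g) \<epsilon> = 0" by simp
  moreover have "cmod (tconv (cf f) (cf g) \<epsilon>) = cmod (cf g \<gamma>) * cmod (cf f \<delta>)"
  proof -
    have z: "tconv (cf f) (cf g) \<epsilon> = tconv (cf f) (\<lambda>\<beta>. cf g \<gamma> * point_mass \<gamma> \<beta>) \<epsilon>"
    proof -
      have "cf g \<beta> = cf g \<gamma> * point_mass \<gamma> \<beta>" if "\<beta> \<in> arrows G" "src G \<beta> = src G \<gamma>" for \<beta>
        using Cc_on_support[OF g(1), of \<beta>] bisection_eqI[OF U _ \<gamma>(1)] that by (auto simp: point_mass_def)
      thus ?thesis using e unfolding tconv_def by (auto simp: rsupp_def intro!: sum.cong)
    qed
    have "gcomp G \<epsilon> (ginv G \<gamma>) = \<delta>" using d \<gamma> comp_inv[OF \<gamma>(2)] by (simp add: \<epsilon>_def gcomp_assoc)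
    thus ?thesis
      unfolding z tconv_scale_right using tconv_point_mass[OF Cc_fibre_finite[OF f] \<gamma>(2) e(1,3)] d \<gamma> cmod_cocycle[of \<delta> \<gamma>]
      by (simp add: Real_Vector_Spaces.norm_mult)
  qed
  ultimately show "cf f \<delta> = 0" using g(3) by simp
qed

text \<open>For \<open>g\<close> over a single bisection, right multiplication by \<open>g\<close> is a multiple of the right translation by
  the arrow \<open>\<gamma>\<close> of the bisection with source \<open>x\<close>, and \<open>u\<close> tends to \<open>0\<close> at the range of \<open>\<gamma>\<close> too.\<close>

lemma qnorm_mult_right:
  assumes u: "\<And>n. u n \<in> Cc G L" "\<And>x. \<lbrakk>x \<in> units G; invisible_isotropy x\<rbrakk> \<Longrightarrow> (\<lambda>n. qnorm x (cf (u n))) \<longlonglongrightarrow> 0"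
    and g: "g \<in> Cc G L" and x: "x \<in> units G" "invisible_isotropy x"
  shows "(\<lambda>n. qnorm x (cf (sa_mult SA (u n) g))) \<longlonglongrightarrow> 0"
  using g
proof (induction rule: Cc_induct)
  case (base U g)
  note U = base(1)
  have gC: "g \<in> Cc G L" by (rule Cc.base[OF base])
  note gf = Cc_fibre_finite[OF gC]
  show ?case
  proof (cases "\<exists>\<gamma>\<in>U. src G \<gamma> = x \<and> cf g \<gamma> \<noteq> 0")
    case True
    then obtain \<gamma> where \<gamma>: "\<gamma> \<in> U" "src G \<gamma> = x" "cf g \<gamma> \<noteq> 0" by blast
    have ga: "\<gamma> \<in> arrows G" using \<gamma> bisection_arrows[OF U] by blast
    have "invisible_isotropy (rng G \<gamma>)" using invisible_isotropy_transport[OF _ base(2) U \<gamma>(3)] \<gamma>(2) x(2) by simp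
    hence "(\<lambda>n. cmod (cf g \<gamma>) * qnorm (rng G \<gamma>) (cf (u n))) \<longlonglongrightarrow> 0"
      using u(2)[OF rng_unit[OF ga]] by (intro tendsto_mult_right_zero)
    moreover have "qnorm x (cf (sa_mult SA (u n) g)) = cmod (cf g \<gamma>) * qnorm (rng G \<gamma>) (cf (u n))" for n
    proof -
      have "cf g \<beta> = 0" if "\<beta> \<in> arrows G" "src G \<beta> = src G \<gamma>" "\<beta> \<noteq> \<gamma>" for \<beta>
        using Cc_on_support[OF base(2), of \<beta>] bisection_eqI[OF U _ \<gamma>(1)] that by auto
      from qnorm_tconv_single[OF Cc_fibre_finite[OF u(1)] gf ga this]
      show ?thesis using u(1) gC \<gamma>(2) by (simp add: Cc_cf)
    qed
    ultimately show ?thesis by simp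
  next
    case False
    have "ssupp (cf g) x = {}" using False Cc_on_support[OF base(2)] by (auto simp: ssupp_def)
    hence "ssupp (tconv (cf (u n)) (cf g)) x = {}" for n
      using tconv_support(2)[of "cf (u n)" "cf g" x] by simp
    hence "qnorm x (cf (sa_mult SA (u n) g)) = 0" for n using u(1) gC by (simp add: Cc_cf qnorm_def)
    thus ?thesis by simp
  qed
next
  case zero
  have "sa_mult SA (u n) (sa_zero SA) = sa_zero SA" for n using SA.mult_zero_right u(1) by simp
  thus ?case by (simp add: Cc_cf qnorm_def ssupp_def)
next
  case (add f g)
  have "qnorm x (cf (sa_mult SA (u n) (sa_add SA f g))) \<le>
      qnorm x (cf (sa_mult SA (u n) f)) + qnorm x (cf (sa_mult SA (u n) g))" for n
    using u(1) add.hyps Cc_fibre_finite by (simp add: Cc_cf Cc_ops tconv_add_right qnorm_add tconv_closed)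
  thus ?case
    by (intro tendsto_sandwich[OF _ _ tendsto_const tendsto_add_zero[OF add.IH]]) auto
next
  case (scale f c)
  have "qnorm x (cf (sa_mult SA (u n) (sa_scale SA c f))) = cmod c * qnorm x (cf (sa_mult SA (u n) f))" for n
    using u(1) scale.hyps by (simp add: Cc_cf Cc_ops tconv_scale_right qnorm_scale)
  thus ?case using tendsto_mult_right_zero[OF scale.IH] by simp
qed

lemma qnorm_Cc_add:
  "\<lbrakk>f \<in> Cc G L; g \<in> Cc G L\<rbrakk> \<Longrightarrow> qnorm x (cf (sa_add SA f g)) \<le> qnorm x (cf f) + qnorm x (cf g)"
  using Cc_fibre_finite by (simp add: Cc_cf qnorm_add)

lemma qnorm_Cc_mult:
  "\<lbrakk>f \<in> Cc G L; g \<in> Cc G L; x \<in> units G\<rbrakk> \<Longrightarrow> qnorm x (cf (sa_mult SA f g)) \<le> N f * qnorm x (cf g)"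
  using red_bound[of f x "cf g"] Cc_fibre_finite[of g] red_le_N[of f] mult_right_mono[of "red f" "N f" "qnorm x (cf g)"]
  by (simp add: Cc_cf)

text \<open>Approximate \<open>w\<close> by one of its terms and use that \<open>u\<close> is bounded in norm.\<close>

lemma gray_mult_right:
  assumes u: "u \<in> carrier PC.K" "PC.cls u \<in> gray_ideal G L N" and w: "w \<in> carrier PC.K"
  shows "PC.cls (\<lambda>n. sa_mult SA (u n) (w n)) \<in> gray_ideal G L N"
  unfolding gray_iff[OF PC.K_closed(4)[OF u(1) w]]
proof (intro ballI impI)
  fix x assume x: "x \<in> units G" "invisible_isotropy x"
  have uC: "u n \<in> Cc G L" and wC: "w n \<in> Cc G L" for n using PC.cauchy_term u w by auto
  have u0: "(\<lambda>n. qnorm x (cf (u n))) \<longlonglongrightarrow> 0" if "x \<in> units G" "invisible_isotropy x" for x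
    using u(2) gray_iff[OF u(1)] that by blast
  obtain C where C: "C > 0" "\<And>n. N (u n) \<le> C" using PC.cauchy_bounded[OF u(1)] by blast
  show "(\<lambda>n. qnorm x (cf (sa_mult SA (u n) (w n)))) \<longlonglongrightarrow> 0"
  proof (rule LIMSEQ_I)
    fix e :: real assume e: "e > 0"
    hence "e / (2 * C) > 0" using C by simp
    then obtain M where M: "\<And>n. n \<ge> M \<Longrightarrow> N (sa_diff SA (w n) (w M)) < e / (2 * C)"
      using w unfolding PC.cauchy_iff by (meson order_refl)
    have "(\<lambda>n. qnorm x (cf (sa_mult SA (u n) (w M)))) \<longlonglongrightarrow> 0" by (rule qnorm_mult_right[OF uC u0 wC x])
    then obtain M' where M': "\<And>n. n \<ge> M' \<Longrightarrow> qnorm x (cf (sa_mult SA (u n) (w M))) < e / 2"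
      using e LIMSEQ_D[of _ 0 "e / 2"] by fastforce
    have "norm (qnorm x (cf (sa_mult SA (u n) (w n))) - 0) < e" if n: "n \<ge> max M M'" for n
    proof -
      let ?d = "sa_diff SA (w n) (w M)"
      have dC: "?d \<in> Cc G L" using wC SA.diff_closed by simp
      have "sa_mult SA (u n) (w n) = sa_add SA (sa_mult SA (u n) (w M)) (sa_mult SA (u n) ?d)"
        using uC wC dC SA.distrib_left[of "u n" "w M" ?d] SA.add_diff_cancel[of "w M" "w n"] by simp
      hence "qnorm x (cf (sa_mult SA (u n) (w n))) \<le>
          qnorm x (cf (sa_mult SA (u n) (w M))) + qnorm x (cf (sa_mult SA (u n) ?d))"
        using qnorm_Cc_add uC wC dC Cc_mult by simp
      also have "qnorm x (cf (sa_mult SA (u n) ?d)) \<le> N (u n) * N ?d"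
        using qnorm_le_N[OF Cc_mult[OF uC[of n] dC] x(1)] PC.N_mult[of "u n" ?d] uC[of n] dC by simp
      also have "N (u n) * N ?d \<le> C * N ?d"
        using C dC PC.N_nonneg[of ?d] by (intro mult_right_mono) auto
      also have "C * N ?d < e / 2" using M[of n] n C by (simp add: field_simps)
      finally show ?thesis using M'[of n] n by simp
    qed
    thus "\<exists>no. \<forall>n\<ge>no. norm (qnorm x (cf (sa_mult SA (u n) (w n))) - 0) < e" by blast
  qed
qed

lemma gray_mult_left:
  assumes u: "u \<in> carrier PC.K" "PC.cls u \<in> gray_ideal G L N" and w: "w \<in> carrier PC.K"
  shows "PC.cls (\<lambda>n. sa_mult SA (w n) (u n)) \<in> gray_ideal G L N"
  unfolding gray_iff[OF PC.K_closed(4)[OF w u(1)]]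
proof (intro ballI impI)
  fix x assume x: "x \<in> units G" "invisible_isotropy x"
  have uC: "u n \<in> Cc G L" and wC: "w n \<in> Cc G L" for n using PC.cauchy_term u w by auto
  have u0: "(\<lambda>n. qnorm x (cf (u n))) \<longlonglongrightarrow> 0" using u(2) gray_iff[OF u(1)] x by blast
  obtain C where C: "C > 0" "\<And>n. N (w n) \<le> C" using PC.cauchy_bounded[OF w] by blast
  have "qnorm x (cf (sa_mult SA (w n) (u n))) \<le> C * qnorm x (cf (u n))" for n
    using qnorm_Cc_mult[OF wC uC x(1)] mult_right_mono[OF C(2), of "qnorm x (cf (u n))" n]
    by (meson order_trans qnorm_nonneg)
  thus "(\<lambda>n. qnorm x (cf (sa_mult SA (w n) (u n)))) \<longlonglongrightarrow> 0"
    by (intro tendsto_sandwich[OF _ _ tendsto_const tendsto_mult_right_zero[OF u0, of C]]) auto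
qed

text \<open>If \<open>b\<close> belongs to the ideal, then so does \<open>b b\<^sup>*\<close>, and \<open>\<psi>\<^sub>x(b b\<^sup>*)\<close> is dominated by the seminorm of
  \<open>b b\<^sup>*\<close> that vanishes on the ideal.\<close>

lemma gray_star:
  assumes u: "u \<in> carrier PC.K" "PC.cls u \<in> gray_ideal G L N"
  shows "PC.cls (\<lambda>n. sa_star SA (u n)) \<in> gray_ideal G L N"
  unfolding gray_iff[OF PC.K_closed(5)[OF u(1)]]
proof (intro ballI impI)
  fix x assume x: "x \<in> units G" "invisible_isotropy x"
  have uC: "u n \<in> Cc G L" for n using PC.cauchy_term[OF u(1)] by simp
  note us = PC.K_closed(5)[OF u(1)]
  have lim: "(\<lambda>n. qnorm x (cf (sa_mult SA (u n) (sa_star SA (u n))))) \<longlonglongrightarrow> 0"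
    using gray_mult_right[OF u us] x unfolding gray_iff[OF PC.K_closed(4)[OF u(1) us]] by blast
  have le: "(qnorm x (cf (sa_star SA (u n))))\<^sup>2 \<le> qnorm x (cf (sa_mult SA (u n) (sa_star SA (u n))))" for n
  proof -
    note sC = Cc_star[OF uC[of n]]
    have "of_real ((qnorm x (cf (sa_star SA (u n))))\<^sup>2) = cf (sa_mult SA (u n) (sa_star SA (u n))) x"
      using tconv_tstar_unit[OF Cc_fibre_finite[OF sC] Cc_fibre_finite[OF sC] x(1)] sC uC[of n] Cc_fibre_finite[OF uC[of n]]
      by (simp add: Cc_cf inner_self tstar_tstar)
    hence "(qnorm x (cf (sa_star SA (u n))))\<^sup>2 = cmod (cf (sa_mult SA (u n) (sa_star SA (u n))) x)"
      by (metis abs_of_nonneg norm_of_real zero_le_power2)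
    also have "\<dots> \<le> qnorm x (cf (sa_mult SA (u n) (sa_star SA (u n))))"
      by (rule value_le_qnorm[OF Cc_fibre_finite[OF Cc_mult[OF uC sC]] x(1)])
    finally show ?thesis .
  qed
  have "(\<lambda>n. (qnorm x (cf (sa_star SA (u n))))\<^sup>2) \<longlonglongrightarrow> 0"
    using le by (intro tendsto_sandwich[OF _ _ tendsto_const lim]) auto
  thus "(\<lambda>n. qnorm x (cf (sa_star SA (u n)))) \<longlonglongrightarrow> 0"
    using tendsto_real_sqrt[of "\<lambda>n. (qnorm x (cf (sa_star SA (u n))))\<^sup>2" 0 sequentially] by simp
qed

lemma gray_star_ideal: "star_ideal PC.B (gray_ideal G L N)"
proof
  let ?I = "gray_ideal G L N"
  show sub: "?I \<subseteq> carrier PC.B" by (auto simp: gray_ideal_def Let_def)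
  have obt: "\<exists>u\<in>carrier PC.K. b = PC.cls u \<and> PC.cls u \<in> ?I" if b: "b \<in> ?I" for b
  proof -
    obtain u where "u \<in> carrier PC.K" "b = PC.cls u" using PC.carrier_cases[OF subsetD[OF sub b]] .
    thus ?thesis using b by auto
  qed
  have 0: "(\<lambda>n. qnorm x (cf (u n))) \<longlonglongrightarrow> 0" if "u \<in> carrier PC.K" "PC.cls u \<in> ?I" "x \<in> units G" "invisible_isotropy x" for u x
    using gray_iff[OF that(1)] that by blast
  show "sa_zero PC.B \<in> ?I"
    unfolding PC.B_ops(1) gray_iff[OF PC.K_closed(1)] by (simp add: Cc_cf qnorm_def ssupp_def)
  show "sa_add PC.B a b \<in> ?I" if ab: "a \<in> ?I" "b \<in> ?I" for a b
  proof -
    obtain u v where u: "u \<in> carrier PC.K" "a = PC.cls u" "PC.cls u \<in> ?I" and v: "v \<in> carrier PC.K" "b = PC.cls v" "PC.cls v \<in> ?I"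
      using obt[OF ab(1)] obt[OF ab(2)] by blast
    have C: "u n \<in> Cc G L" "v n \<in> Cc G L" for n using PC.cauchy_term u v by auto
    have "(\<lambda>n. qnorm x (cf (sa_add SA (u n) (v n)))) \<longlonglongrightarrow> 0" if x: "x \<in> units G" "invisible_isotropy x" for x
      by (rule tendsto_sandwich[OF _ _ tendsto_const tendsto_add_zero[OF 0[OF u(1,3) x] 0[OF v(1,3) x]]])
         (use qnorm_Cc_add[OF C] in auto)
    thus ?thesis using u v gray_iff[OF PC.K_closed(2)[OF u(1) v(1)]] by (simp add: PC.B_ops)
  qed
  show "sa_scale PC.B c a \<in> ?I" if a: "a \<in> ?I" for a c
  proof -
    obtain u where u: "u \<in> carrier PC.K" "a = PC.cls u" "PC.cls u \<in> ?I" using obt[OF a] by blast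
    have C: "u n \<in> Cc G L" for n using PC.cauchy_term u by auto
    have "(\<lambda>n. qnorm x (cf (sa_scale SA c (u n)))) \<longlonglongrightarrow> 0" if x: "x \<in> units G" "invisible_isotropy x" for x
      using tendsto_mult_right_zero[OF 0[OF u(1,3) x], of "cmod c"] C by (simp add: Cc_cf qnorm_scale)
    thus ?thesis using u gray_iff[OF PC.K_closed(3)[OF u(1)]] by (simp add: PC.B_ops)
  qed
  show "sa_mult PC.B b a \<in> ?I" "sa_mult PC.B a b \<in> ?I" if a: "a \<in> ?I" and b: "b \<in> carrier PC.B" for a b
  proof -
    obtain u where u: "u \<in> carrier PC.K" "a = PC.cls u" "PC.cls u \<in> ?I" using obt[OF a] by blast
    obtain w where w: "w \<in> carrier PC.K" "b = PC.cls w" using PC.carrier_cases[OF b] by blast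
    show "sa_mult PC.B b a \<in> ?I" "sa_mult PC.B a b \<in> ?I"
      using gray_mult_left[OF u(1,3) w(1)] gray_mult_right[OF u(1,3) w(1)] u w by (simp_all add: PC.B_ops)
  qed
  show "sa_star PC.B a \<in> ?I" if a: "a \<in> ?I" for a
  proof -
    obtain u where u: "u \<in> carrier PC.K" "a = PC.cls u" "PC.cls u \<in> ?I" using obt[OF a] by blast
    show ?thesis using gray_star[OF u(1,3)] u by (simp add: PC.B_ops)
  qed
qed

lemma gray_closed:
  assumes v: "\<And>k. v k \<in> gray_ideal G L N" and b: "b \<in> carrier PC.B"
    and lim: "(\<lambda>k. sa_norm PC.B (sa_diff PC.B (v k) b)) \<longlonglongrightarrow> 0"
  shows "b \<in> gray_ideal G L N"
proof -
  obtain u where u: "u \<in> carrier PC.K" "b = PC.cls u" using PC.carrier_cases[OF b] by blast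
  have uC: "u n \<in> Cc G L" for n using PC.cauchy_term[OF u(1)] by simp
  have "(\<lambda>n. qnorm x (cf (u n))) \<longlonglongrightarrow> 0" if x: "x \<in> units G" "invisible_isotropy x" for x
  proof (rule LIMSEQ_I)
    fix e :: real assume e: "e > 0"
    then obtain k where "norm (sa_norm PC.B (sa_diff PC.B (v k) b) - 0) < e / 2"
      using LIMSEQ_D[OF lim, of "e / 2"] by auto
    hence k: "sa_norm PC.B (sa_diff PC.B (v k) b) < e / 2" by simp
    have "v k \<in> carrier PC.B" using v by (auto simp: gray_ideal_def Let_def)
    then obtain w where w: "w \<in> carrier PC.K" "v k = PC.cls w" using PC.carrier_cases by blast
    have wC: "w n \<in> Cc G L" for n using PC.cauchy_term[OF w(1)] by simp
    have "(\<lambda>n. qnorm x (cf (w n))) \<longlonglongrightarrow> 0" using v[of k] gray_iff[OF w(1)] w(2) x by auto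
    then obtain M where M: "\<And>n. n \<ge> M \<Longrightarrow> qnorm x (cf (w n)) < e / 2"
      using e LIMSEQ_D[of _ 0 "e / 2"] by fastforce
    have "(\<lambda>n. N (sa_diff SA (w n) (u n))) \<longlonglongrightarrow> sa_norm PC.B (sa_diff PC.B (v k) b)"
      using PC.B_norm[OF PC.K_closed(6)[OF w(1) u(1)]] u w by (simp add: PC.B_ops)
    from order_tendstoD(2)[OF this k]
    obtain M' where M': "\<And>n. n \<ge> M' \<Longrightarrow> N (sa_diff SA (w n) (u n)) < e / 2"
      by (auto simp: eventually_sequentially)
    have "norm (qnorm x (cf (u n)) - 0) < e" if n: "n \<ge> max M M'" for n
    proof -
      have d: "sa_diff SA (u n) (w n) \<in> Cc G L" using uC wC SA.diff_closed by simp
      have "u n = sa_add SA (w n) (sa_diff SA (u n) (w n))" using SA.add_diff_cancel[of "w n" "u n"] uC wC by simp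
      hence "qnorm x (cf (u n)) \<le> qnorm x (cf (w n)) + qnorm x (cf (sa_diff SA (u n) (w n)))"
        using qnorm_Cc_add[OF wC[of n] d] by metis
      also have "qnorm x (cf (sa_diff SA (u n) (w n))) \<le> N (sa_diff SA (w n) (u n))"
        using qnorm_le_N[OF d x(1)] PC.N_diff_commute[of "u n" "w n"] uC wC by simp
      finally show ?thesis using M[of n] M'[of n] n by simp
    qed
    thus "\<exists>no. \<forall>n\<ge>no. norm (qnorm x (cf (u n)) - 0) < e" by blast
  qed
  thus ?thesis unfolding u(2) gray_iff[OF u(1)] by blast
qed

lemma gray_closed_ideal: "closed_two_sided_ideal PC.B (gray_ideal G L N)"
proof -
  interpret I: star_ideal PC.B "gray_ideal G L N" by (rule gray_star_ideal)
  show ?thesis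
    unfolding closed_two_sided_ideal_def
  proof (intro conjI ballI allI impI)
    show "b \<in> gray_ideal G L N" if "b \<in> carrier PC.B"
      "(\<forall>n. v n \<in> gray_ideal G L N) \<and> (\<lambda>n. sa_norm PC.B (sa_diff PC.B (v n) b)) \<longlonglongrightarrow> 0" for v b
      using gray_closed[of v b] that by blast
  qed (rule I.ideal_sub I.ideal_zero I.ideal_add I.ideal_scale I.ideal_mult_left I.ideal_mult_right; assumption)+
qed

end

section \<open>The isomorphism\<close>

theorem proposition18p5:
  fixes G :: "'g groupoid" and L :: "('g, 'l) vector_bundle"
  assumes "etale_groupoid G"
    and "fell_line_bundle G L"
    and "topologically_free G"
  shows "star_hom (groupoid_cstar G L) (groupoid_cstar_red G L) (left_regular G L) \<and>
    (\<forall>f\<in>Cc G L.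
       left_regular G L (completion_embed (section_algebra G L) (full_norm G L) f) =
       completion_embed (section_algebra G L) (red_norm G L) f) \<and>
    closed_two_sided_ideal (groupoid_cstar G L) (full_gray_ideal G L) \<and>
    closed_two_sided_ideal (groupoid_cstar_red G L) (red_gray_ideal G L) \<and>
    left_regular G L ` full_gray_ideal G L \<subseteq> red_gray_ideal G L \<and>
    (\<exists>\<Phi>. star_iso (groupoid_cstar_ess G L)
             (quotient_algebra (groupoid_cstar_red G L) (red_gray_ideal G L)) \<Phi> \<and>
          (\<forall>b\<in>carrier (groupoid_cstar G L).
             \<Phi> (sa_coset (groupoid_cstar G L) (full_gray_ideal G L) b) =
             sa_coset (groupoid_cstar_red G L) (red_gray_ideal G L) (left_regular G L b)))"
proof -
  interpret fell_line_bundle G L by fact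
  interpret F: dominating_norm G L full
    by unfold_locales (use full_cstar red_le_full in auto)
  interpret R: dominating_norm G L red
    by unfold_locales (use red_cstar in auto)
  have reg: "left_regular G L = CN.regular"
    by (rule ext) (simp add: left_regular_def CN.regular_def)
  have alg: "groupoid_cstar G L = CN.full.B" "groupoid_cstar_red G L = CN.red.B"
    by (simp_all add: groupoid_cstar_def groupoid_cstar_red_def)
  have pre: "b \<in> full_gray_ideal G L \<longleftrightarrow> CN.regular b \<in> red_gray_ideal G L" if b: "b \<in> carrier CN.full.B" for b
  proof -
    obtain u where u: "u \<in> carrier CN.full.K" "b = CN.full.cls u" using CN.full.carrier_cases[OF b] by blast
    show ?thesis
      unfolding full_gray_ideal_def red_gray_ideal_def u(2) CN.regular_cls[OF u(1)]
        F.gray_iff[OF u(1)] R.gray_iff[OF CN.full_cauchy_red[OF u(1)]] F.invisible_isotropy_def R.invisible_isotropy_def ..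
  qed
  have sub: "full_gray_ideal G L \<subseteq> carrier CN.full.B" by (auto simp: full_gray_ideal_def gray_ideal_def Let_def)
  show ?thesis
    unfolding reg groupoid_cstar_ess_def alg
  proof (intro conjI ballI)
    show "star_hom CN.full.B CN.red.B CN.regular" by (rule CN.regular_hom)
    show "CN.regular (CN.full.emb f) = CN.red.emb f" if "f \<in> Cc G L" for f
      using CN.regular_emb that by simp
    show "closed_two_sided_ideal CN.full.B (full_gray_ideal G L)"
      unfolding full_gray_ideal_def by (rule F.gray_closed_ideal)
    show "closed_two_sided_ideal CN.red.B (red_gray_ideal G L)"
      unfolding red_gray_ideal_def by (rule R.gray_closed_ideal)
    show "CN.regular ` full_gray_ideal G L \<subseteq> red_gray_ideal G L" using pre sub by blast
    show "\<exists>\<Phi>. star_iso (quotient_algebra CN.full.B (full_gray_ideal G L))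
             (quotient_algebra CN.red.B (red_gray_ideal G L)) \<Phi> \<and>
          (\<forall>b\<in>carrier CN.full.B.
             \<Phi> (sa_coset CN.full.B (full_gray_ideal G L) b) =
             sa_coset CN.red.B (red_gray_ideal G L) (CN.regular b))"
      by (rule quotient_isomorphism[OF F.gray_star_ideal[folded full_gray_ideal_def]
            R.gray_star_ideal[folded red_gray_ideal_def] CN.regular_hom CN.regular_onto pre])
  qed
qed

end
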